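(* Let $\Omega\subset\mathbb{R}^2$ be a convex compact set containing $0$ in its interior. For every point $g_\circ=(x_\circ,y_\circ)\in G$ and every number $A_\circ>0$ there exist two families $\Gamma_+(g_\circ,A_\circ)=\{\gamma_+^\alpha\}$ and $\Gamma_-(g_\circ,A_\circ)=\{\gamma_-^\alpha\}$, $\alpha\in[0,2S_{\Omega^\circ})$, of simple Lipschitz contours which are solutions of the isoperimetric problems $(\mathrm{GP}_+)$ and $(\mathrm{GP}_-)$ respectively (with data $g_\circ,A_\circ$). Conversely, every solution $\gamma_\pm$ of $(\mathrm{GP}_\pm)$ is a contour of the family $\Gamma_\pm(g_\circ,A_\circ)$. Each contour $\gamma_\pm^\alpha$ of the family $\Gamma_\pm(g_\circ,A_\circ)$ is the boundary of the polar $\Omega^\circ$, rotated by $\mp\frac{\pi}{2}$, dilated by the factor $|R_\pm|$ and translated by the vector $(c_{x\pm},c_{y\pm})$. The corresponding constants are uniquely determined by the system $$ \begin{cases} F_\pm(\lambda_\pm)=\pm A_\circ,\\ R_\pm(\alpha,y_\circ,A_\circ)=\dfrac{y_\circ}{\lambda_\pm-\cos_{\Omega^\circ}(\alpha)},\\ c_{x\pm}(\alpha,x_\circ,y_\circ,A_\circ)=x_\circ-R_\pm\sin_{\Omega^\circ}(\alpha),\\ c_{y\pm}(\alpha,y_\circ,A_\circ)=R_\pm\lambda_\pm, \end{cases} $$ where $\lambda_+\in(M_+^\circ,+\infty)$ and $\lambda_-\in(-\infty,-M_-^\circ)$. Conversely, every contour $\gamma\subset G$ which is the boundary of the polar $\Omega^\circ$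 rotated by $\mp\frac{\pi}{2}$, dilated by a factor $R>0$ and translated into the upper half-plane is an isoperimetric contour, i.e. it belongs to the family $\Gamma_\pm(g_\circ,A_\circ)$ for $g_\circ\in\gamma$ and $A_\circ=\mathrm{Area}(U_\gamma)$, where $U_\gamma$ is the region bounded by $\gamma$. The Lipschitz natural parametrization $(x_\pm(t),y_\pm(t))$ of the contour $\gamma_\pm^\alpha$, with positive orientation in the case of $\gamma_+^\alpha$ and negative orientation in the case of $\gamma_-^\alpha$, has the form $$ \begin{cases} x_\pm(t)=R_\pm\sin_{\Omega^\circ}(\theta_\pm^\circ(t))+c_{x\pm},\\ y_\pm(t)=-R_\pm\cos_{\Omega^\circ}(\theta_\pm^\circ(t))+c_{y\pm},\\ \dot\theta_\pm^\circ(t)=\lambda_\pm-\cos_{\Omega^\circ}(\theta_\pm^\circ(t)),\quad \theta_\pm^\circ(0)=\alpha,\\ 0\le t\le L_\pm(\lambda_\pm). \end{cases} $$ Throughout, upper signs correspond to upper signs and lower signs to lower signs.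
   Context: Geometry. $G=\{(x,y):x\in\mathbb{R},\,y>0\}$ is the Lie group with product $(x_1,y_1)\cdot(x_2,y_2)=(x_1+x_2y_1,\,y_1y_2)$, unit $e=(0,1)$, and Lie algebra $T_eG\cong\mathbb{R}^2\supset\Omega$. Let $\|\cdot\|_e$ be the Minkowski functional (gauge) of $\Omega$ (possibly non-symmetric). The left-invariant Finsler structure is $\|(\xi_1,\xi_2)\|_{(x,y)}=\frac1y\|(\xi_1,\xi_2)\|_e$. A Lipschitz curve $\gamma(t)$, $t\in[a,b]$, in $G$ has length $\int_a^b\|\dot\gamma(t)\|_{\gamma(t)}dt$; a parametrization is natural if $\|\dot\gamma(t)\|_{\gamma(t)}=1$ for a.e. $t$. A contour is the image of a closed curve (called its parametrization); it is simple if the closed curve has no self-intersections except that its initial and final points coincide, and Lipschitz if the closed curve is Lipschitz. For a simple Lipschitz contour $\gamma$, $\mathrm{Len}_+(\gamma)$ (resp. $\mathrm{Len}_-(\gamma)$) is the length of any Lipschitz parametrization of $\gamma$ (traversing it once) with positive, i.e. counterclockwise (resp. negative) orientation. The area of a region $U\subset G$ is $\mathrm{Area}(U)=\int_U\frac{1}{y^2}\,dx\wedge dy$. Problem $(\mathrm{GP}_\pm)$ with data $g_\circ\in G$, $A_\circ>0$: minimize $\mathrm{Len}_\pm(\gamma)$ over all simple Lipschitz contours $\gamma\subset G$ with $g_\circ\in\gamma$ and $\mathrm{Area}(U_\gamma)=A_\circ$, where $U_\gamma$ is the region bounded by $\gamma$. Convex trigonometry. $\Omega^\circ=\{(p,q):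 px+qy\le1\ \forall (x,y)\in\Omega\}$ is the polar of $\Omega$; $S_\Omega,S_{\Omega^\circ}$ are Euclidean areas. For a convex compact planar set $K$ with $0$ in its interior, $\cos_K,\sin_K$ are the Lipschitz $2S_K$-periodic functions such that $\theta\mapsto(\cos_K\theta,\sin_K\theta)$, $\theta\in[0,2S_K]$, parametrizes $\partial K$ once with positive orientation, $\sin_K(0)=0$, $\cos_K(0)>0$, and $\cos_K\sin_K'-\sin_K\cos_K'=1$ a.e. (so for $0\le\theta\le 2S_K$ the parameter $\theta$ is twice the Euclidean area of the sector of $K$ swept from the positive $x$-axis). Angles $\theta,\theta^\circ$ correspond to each other if $\cos_\Omega(\theta)\cos_{\Omega^\circ}(\theta^\circ)+\sin_\Omega(\theta)\sin_{\Omega^\circ}(\theta^\circ)=1$. For a.e. $\theta^\circ$ the corresponding $\theta$ is unique modulo $2S_\Omega$; $\theta(\theta^\circ)$ denotes a (monotone) selection of corresponding angles. Functions. $M_+^\circ=\max\cos_{\Omega^\circ}>0$, $-M_-^\circ=\min\cos_{\Omega^\circ}<0$, and $$L_+(\lambda)=\int_0^{2S_{\Omega^\circ}}\frac{d\theta^\circ}{\lambda-\cos_{\Omega^\circ}(\theta^\circ)},\quad F_+(\lambda)=\int_0^{2S_{\Omega^\circ}}\frac{\cos_\Omega(\theta(\theta^\circ))\,d\theta^\circ}{\lambda-\cos_{\Omega^\circ}(\theta^\circ)},\quad \lambda>M_+^\circ,$$ $$L_-(\lambda)=\int_0^{2S_{\Omega^\circ}}\frac{d\theta^\circ}{\cos_{\Omega^\circ}(\theta^\circ)-\lambda},\quad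 F_-(\lambda)=\int_0^{2S_{\Omega^\circ}}\frac{\cos_\Omega(\theta(\theta^\circ))\,d\theta^\circ}{\cos_{\Omega^\circ}(\theta^\circ)-\lambda},\quad \lambda<-M_-^\circ.$$ *)

theory Defs
  imports "HOL-Complex_Analysis.Complex_Analysis"
begin

text \<open>The plane is \<^typ>\<open>complex\<close>: the pair \<open>(x, y)\<close> is \<open>Complex x y\<close>.\<close>

text \<open>\<open>Plus\<close> selects the upper and \<open>Minus\<close> the lower sign in every double sign of the statement.\<close>

datatype sign = Plus | Minus

primrec sign_val :: "sign \<Rightarrow> real" where
  "sign_val Plus = 1"
| "sign_val Minus = -1"


section \<open>Geometry of the half-plane\<close>

definition G :: "complex set" where
  "G = {z. Im z > 0}"

definition minkowski :: "complex set \<Rightarrow> complex \<Rightarrow> real" where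
  "minkowski \<Omega> v = Inf {r. 0 < r \<and> v \<in> (\<lambda>w. r *\<^sub>R w) ` \<Omega>}"

definition finsler :: "complex set \<Rightarrow> complex \<Rightarrow> complex \<Rightarrow> real" where
  "finsler \<Omega> z v = minkowski \<Omega> v / Im z"

definition curve_length :: "complex set \<Rightarrow> real \<Rightarrow> real \<Rightarrow> (real \<Rightarrow> complex) \<Rightarrow> real" where
  "curve_length \<Omega> a b c = integral {a..b} (\<lambda>t. finsler \<Omega> (c t) (vector_derivative c (at t)))"

text \<open>Library paths live on \<open>[0, 1]\<close>; this transports a curve on \<open>[a, b]\<close> there.\<close>

definition unit_path :: "real \<Rightarrow> real \<Rightarrow> (real \<Rightarrow> complex) \<Rightarrow> real \<Rightarrow> complex" where
  "unit_path a b c = (\<lambda>u. c (a + (b - a) * u))"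

definition simple_lipschitz_param ::
    "complex set \<Rightarrow> real \<Rightarrow> real \<Rightarrow> (real \<Rightarrow> complex) \<Rightarrow> bool" where
  "simple_lipschitz_param \<gamma> a b c \<longleftrightarrow>
     a < b \<and> (\<exists>C. C-lipschitz_on {a..b} c) \<and> simple_path (unit_path a b c) \<and>
     c a = c b \<and> c ` {a..b} = \<gamma>"

definition simple_lipschitz_contour :: "complex set \<Rightarrow> bool" where
  "simple_lipschitz_contour \<gamma> \<longleftrightarrow> (\<exists>a b c. simple_lipschitz_param \<gamma> a b c)"

text \<open>Counterclockwise means winding number \<open>1\<close> about the enclosed points, clockwise \<open>-1\<close>.\<close>

definition oriented_param ::
    "sign \<Rightarrow> complex set \<Rightarrow> real \<Rightarrow> real \<Rightarrow> (real \<Rightarrow> complex) \<Rightarrow> bool" where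
  "oriented_param s \<gamma> a b c \<longleftrightarrow>
     simple_lipschitz_param \<gamma> a b c \<and>
     (\<forall>z\<in>inside \<gamma>. winding_number (unit_path a b c) z = of_real (sign_val s))"

definition natural_param ::
    "complex set \<Rightarrow> real \<Rightarrow> real \<Rightarrow> (real \<Rightarrow> complex) \<Rightarrow> bool" where
  "natural_param \<Omega> a b c \<longleftrightarrow>
     (AE t in lebesgue_on {a..b}.
        c differentiable (at t) \<and> finsler \<Omega> (c t) (vector_derivative c (at t)) = 1)"

definition Len :: "complex set \<Rightarrow> sign \<Rightarrow> complex set \<Rightarrow> real" where
  "Len \<Omega> s \<gamma> = (THE l. \<exists>a b c. oriented_param s \<gamma> a b c \<and> l = curve_length \<Omega> a b c)"

definition Area :: "complex set \<Rightarrow> real" where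
  "Area U = integral U (\<lambda>z. 1 / (Im z)\<^sup>2)"

definition GP_admissible :: "complex \<Rightarrow> real \<Rightarrow> complex set \<Rightarrow> bool" where
  "GP_admissible g A \<gamma> \<longleftrightarrow>
     simple_lipschitz_contour \<gamma> \<and> \<gamma> \<subseteq> G \<and> g \<in> \<gamma> \<and> Area (inside \<gamma>) = A"

definition GP_solution :: "complex set \<Rightarrow> sign \<Rightarrow> complex \<Rightarrow> real \<Rightarrow> complex set \<Rightarrow> bool" where
  "GP_solution \<Omega> s g A \<gamma> \<longleftrightarrow>
     GP_admissible g A \<gamma> \<and> (\<forall>\<gamma>'. GP_admissible g A \<gamma>' \<longrightarrow> Len \<Omega> s \<gamma> \<le> Len \<Omega> s \<gamma>')"


section \<open>Convex trigonometry\<close>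

definition polar :: "complex set \<Rightarrow> complex set" where
  "polar \<Omega> = {w. \<forall>z\<in>\<Omega>. Re w * Re z + Im w * Im z \<le> 1}"

definition S :: "complex set \<Rightarrow> real" where
  "S K = measure lebesgue K"

definition is_convex_trig :: "complex set \<Rightarrow> (real \<Rightarrow> real) \<Rightarrow> (real \<Rightarrow> real) \<Rightarrow> bool" where
  "is_convex_trig K c s \<longleftrightarrow>
     (\<exists>C. C-lipschitz_on UNIV c) \<and> (\<exists>C. C-lipschitz_on UNIV s) \<and>
     (\<forall>\<theta>. c (\<theta> + 2 * S K) = c \<theta>) \<and> (\<forall>\<theta>. s (\<theta> + 2 * S K) = s \<theta>) \<and>
     oriented_param Plus (frontier K) 0 (2 * S K) (\<lambda>\<theta>. Complex (c \<theta>) (s \<theta>)) \<and>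
     s 0 = 0 \<and> c 0 > 0 \<and>
     (AE \<theta> in lebesgue. c differentiable (at \<theta>) \<and> s differentiable (at \<theta>) \<and>
        c \<theta> * deriv s \<theta> - s \<theta> * deriv c \<theta> = 1)"

text \<open>For a convex compact \<open>K\<close> with \<open>0\<close> in its interior exactly one pair of functions
  satisfies \<^const>\<open>is_convex_trig\<close>, so the choice below is no choice.\<close>

definition convex_trig :: "complex set \<Rightarrow> (real \<Rightarrow> real) \<times> (real \<Rightarrow> real)" where
  "convex_trig K = (SOME p. is_convex_trig K (fst p) (snd p))"

definition cosK :: "complex set \<Rightarrow> real \<Rightarrow> real" where
  "cosK K = fst (convex_trig K)"

definition sinK :: "complex set \<Rightarrow> real \<Rightarrow> real" where
  "sinK K = snd (convex_trig K)"

text \<open>The first angle belongs to \<open>\<Omega>\<close>, the second to its polar.\<close>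

definition corresponding :: "complex set \<Rightarrow> real \<Rightarrow> real \<Rightarrow> bool" where
  "corresponding \<Omega> \<theta> \<phi> \<longleftrightarrow>
     cosK \<Omega> \<theta> * cosK (polar \<Omega>) \<phi> + sinK \<Omega> \<theta> * sinK (polar \<Omega>) \<phi> = 1"

text \<open>Corresponding angles are unique modulo the period for almost every \<open>\<phi>\<close>, so the
  integrals below do not depend on the selection.\<close>

definition corr_angle :: "complex set \<Rightarrow> real \<Rightarrow> real" where
  "corr_angle \<Omega> = (SOME f. mono f \<and> (\<forall>\<phi>. corresponding \<Omega> (f \<phi>) \<phi>))"


section \<open>The constants of the isoperimetric contours\<close>

definition M_plus :: "complex set \<Rightarrow> real" where
  "M_plus \<Omega> = (SUP \<phi>. cosK (polar \<Omega>) \<phi>)"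

definition M_minus :: "complex set \<Rightarrow> real" where
  "M_minus \<Omega> = - (INF \<phi>. cosK (polar \<Omega>) \<phi>)"

primrec lambda_range :: "complex set \<Rightarrow> sign \<Rightarrow> real set" where
  "lambda_range \<Omega> Plus = {M_plus \<Omega> <..}"
| "lambda_range \<Omega> Minus = {..< - M_minus \<Omega>}"

primrec L :: "complex set \<Rightarrow> sign \<Rightarrow> real \<Rightarrow> real" where
  "L \<Omega> Plus \<Lambda> =
     integral {0..2 * S (polar \<Omega>)} (\<lambda>\<phi>. 1 / (\<Lambda> - cosK (polar \<Omega>) \<phi>))"
| "L \<Omega> Minus \<Lambda> =
     integral {0..2 * S (polar \<Omega>)} (\<lambda>\<phi>. 1 / (cosK (polar \<Omega>) \<phi> - \<Lambda>))"

primrec F :: "complex set \<Rightarrow> sign \<Rightarrow> real \<Rightarrow> real" where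
  "F \<Omega> Plus \<Lambda> =
     integral {0..2 * S (polar \<Omega>)}
       (\<lambda>\<phi>. cosK \<Omega> (corr_angle \<Omega> \<phi>) / (\<Lambda> - cosK (polar \<Omega>) \<phi>))"
| "F \<Omega> Minus \<Lambda> =
     integral {0..2 * S (polar \<Omega>)}
       (\<lambda>\<phi>. cosK \<Omega> (corr_angle \<Omega> \<phi>) / (cosK (polar \<Omega>) \<phi> - \<Lambda>))"

definition GP_constants ::
    "complex set \<Rightarrow> sign \<Rightarrow> complex \<Rightarrow> real \<Rightarrow> real \<Rightarrow> real \<Rightarrow> real \<Rightarrow> real \<Rightarrow> real \<Rightarrow> bool" where
  "GP_constants \<Omega> s g A \<alpha> \<Lambda> R cx cy \<longleftrightarrow>
     \<Lambda> \<in> lambda_range \<Omega> s \<and>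
     F \<Omega> s \<Lambda> = sign_val s * A \<and>
     R = Im g / (\<Lambda> - cosK (polar \<Omega>) \<alpha>) \<and>
     cx = Re g - R * sinK (polar \<Omega>) \<alpha> \<and>
     cy = R * \<Lambda>"

text \<open>The boundary of the polar, rotated by \<open>-\<pi>/2\<close> (\<open>Plus\<close>) or \<open>\<pi>/2\<close> (\<open>Minus\<close>),
  dilated by \<open>r\<close> and translated by \<open>c\<close>.\<close>

definition polar_contour :: "complex set \<Rightarrow> sign \<Rightarrow> real \<Rightarrow> complex \<Rightarrow> complex set" where
  "polar_contour \<Omega> s r c =
     (\<lambda>w. c + r *\<^sub>R (cis (- sign_val s * (pi / 2)) * w)) ` frontier (polar \<Omega>)"

definition angle_solution ::
    "complex set \<Rightarrow> sign \<Rightarrow> real \<Rightarrow> real \<Rightarrow> (real \<Rightarrow> real) \<Rightarrow> bool" where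
  "angle_solution \<Omega> s \<alpha> \<Lambda> \<theta> \<longleftrightarrow>
     \<theta> 0 = \<alpha> \<and>
     (\<forall>t\<in>{0..L \<Omega> s \<Lambda>}.
        (\<theta> has_real_derivative (\<Lambda> - cosK (polar \<Omega>) (\<theta> t))) (at t within {0..L \<Omega> s \<Lambda>}))"

end

theory Submission
  imports Defs
begin

text \<open>Rotating the polar by \<open>\<mp>\<pi>/2\<close> gives a convex body \<open>Q\<close> whose support function \<open>supp Q v\<close>, the maximum
  of \<open>det2 z v\<close> over \<open>z \<in> Q\<close>, is the gauge of \<open>\<plusminus>v\<close>, so both problems ask for a closed curve
  traversed counterclockwise with least \<open>\<integral> supp Q c' / Im c\<close>. By a dilation and a horizontal
  translation a given curve is moved to a curve \<open>u + \<i> \<Lambda>\<close> such that \<open>u\<close> has the same lowest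
  and highest heights as \<open>Q\<close>. The points of \<open>\<partial>Q\<close> at the height of \<open>u\<close>, taken on the right
  arc while going up and on the left arc while coming down, are calibrating covectors:
  they bound the length below by \<open>\<Lambda> A + C(\<Lambda>)\<close>, where \<open>C(\<Lambda>) = \<integral>\<^sub>Q 1 / (\<Lambda> + y)\<close> is convex with
  \<open>C' = -F\<close>, \<open>F(\<Lambda>) = \<integral>\<^sub>Q 1 / (\<Lambda> + y)\<^sup>2\<close>. So the bound is least for the \<open>\<Lambda>\<close> with \<open>F(\<Lambda>) = A\<close>,
  where the translated dilated \<open>\<partial>Q\<close> attains it, and equality forces \<open>u\<close> to be a horizontal translate of \<open>\<partial>Q\<close>.
  Green's formula for Lipschitz curves identifies \<open>F\<close> with the integral of the theorem.\<close>

section \<open>Lipschitz functions of a real variable\<close>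

text \<open>The weights 1/y and 1/y^2 exclude the usual translation arguments, but horizontal
  translations and dilations preserve length and area. So the heights of a curve can be normalized
  to those of \<open>Q\<close>, and the ratio of its highest to its lowest point survives as the
  single parameter \<Lambda>. The calibration rests on the identity det2 (X + i y) (x' + i y') /
  (\<Lambda> + y) = - x' + \<Lambda> x' / (\<Lambda> + y) + X y' / (\<Lambda> + y): the first term
  closes up, the second gives \<Lambda> times the area, and the third, with X a function of the
  height, depends only on the heights passed, whether or not the curve is monotone. The obstacle is
  regularity. Competitors are merely Lipschitz, two parametrizations may differ by a change of
  parameter that is not Lipschitz, and \<open>Len\<close> is a definite description over all of
  them. Hence derivatives almost everywhere, independence of the parametrization, winding numbers
  and Green's formula are all established at that level.\<close>

text \<open>Henstock's lemma controls the error sum over any disjoint family of short intervals, and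
  the Vitali covering theorem turns this into a bound for the measure of the exceptional set.\<close>

lemma negligible_not_derivative_of_integral:
  fixes F g :: "real \<Rightarrow> real"
  assumes int: "\<And>u v. u \<le> v \<Longrightarrow> (g has_integral (F v - F u)) {u..v}"
  shows "negligible {x. \<not> (F has_real_derivative g x) (at x)}"
proof -
  \<comment> \<open>Bad points: arbitrarily short intervals around \<open>x\<close> on which the
    increment misses \<open>g x\<close> by more than the proportion \<open>e\<close>. Every point
    where the derivative fails lies in some \<open>B e m\<close> with \<open>e\<close> of the form
    1/(n+1).\<close>
  define B where "B e m = {x\<in>{-m<..<m}. \<forall>d>0. \<exists>u v. u \<le> x \<and> x \<le> v \<and> u < v \<and> v - u < d \<and>
      \<bar>F v - F u - g x * (v - u)\<bar> > e * (v - u)}" for e m :: real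
  have neg: "negligible (B e m)" if "e > 0" "m > 0" for e m
    unfolding negligible_outer_le
  proof (intro allI impI)
    fix \<eta> :: real assume "\<eta> > 0"
    have gint: "g integrable_on cbox (-m) m" using int[of "-m" m] that by auto
    have e0: "e * \<eta> > 0" using that \<open>\<eta> > 0\<close> by simp
    obtain \<gamma> where \<gamma>: "gauge \<gamma>"
      and H: "\<And>p. \<lbrakk>p tagged_partial_division_of (cbox (-m) m); \<gamma> fine p\<rbrakk> \<Longrightarrow>
             sum (\<lambda>(x,k). norm(Henstock_Kurzweil_Integration.content k *\<^sub>R g x - integral k g)) p < e * \<eta>"
      by (rule Henstock_lemma[OF gint e0]) (rule that)
    \<comment> \<open>The inclusion in the gauge makes every finite disjoint subfamily a fine tagged
      partial division, the input of Henstock's lemma.\<close>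
    define K where "K = {(x,u,v). u \<le> x \<and> x \<le> v \<and> u < v \<and> {u..v} \<subseteq> \<gamma> x \<and> {u..v} \<subseteq> {-m..m} \<and>
      \<bar>F v - F u - g x * (v - u)\<bar> > e * (v - u)}"
    define a where "a = (\<lambda>(x::real,u::real,v::real). (u+v)/2)"
    define r where "r = (\<lambda>(x::real,u::real,v::real). (v-u)/2)"
    have cb: "cball (a i) (r i) = {fst (snd i)..snd (snd i)}" for i
      by (auto simp: a_def r_def cball_eq_atLeastAtMost split: prod.splits) (auto simp: field_simps)
    have "\<exists>C. countable C \<and> C \<subseteq> K \<and> pairwise (\<lambda>i j. disjnt (cball (a i) (r i)) (cball (a j) (r j))) C
      \<and> negligible (B e m - (\<Union>i \<in> C. cball (a i) (r i)))"
    proof (rule Vitali_covering_theorem_cballs[of K r "B e m" a])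
      show "\<And>i. i \<in> K \<Longrightarrow> 0 < r i" by (auto simp: K_def r_def)
      fix x d :: real assume x: "x \<in> B e m" and "0 < d"
      then have xm: "-m < x" "x < m" by (auto simp: B_def)
      have "open (\<gamma> x)" "x \<in> \<gamma> x" using \<gamma> by (auto simp: gauge_def)
      then obtain \<delta> where \<delta>: "\<delta> > 0" "ball x \<delta> \<subseteq> \<gamma> x" by (meson openE)
      define d' where "d' = min (min \<delta> d) (min (x + m) (m - x))"
      have "d' > 0" using \<delta> \<open>0 < d\<close> xm by (auto simp: d'_def)
      with x obtain u v where uv: "u \<le> x" "x \<le> v" "u < v" "v - u < d'"
          "\<bar>F v - F u - g x * (v - u)\<bar> > e * (v - u)" by (auto simp: B_def)
      have "{u..v} \<subseteq> ball x \<delta>" using uv by (auto simp: dist_real_def d'_def)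
      moreover have "{u..v} \<subseteq> {-m..m}" using uv by (auto simp: d'_def)
      ultimately have "(x,u,v) \<in> K" using uv \<delta> by (auto simp: K_def)
      moreover have "x \<in> cball (a (x,u,v)) (r (x,u,v))" using cb uv by auto
      moreover have "r (x,u,v) < d" using uv by (auto simp: r_def d'_def)
      ultimately show "\<exists>i. i \<in> K \<and> x \<in> cball (a i) (r i) \<and> r i < d" by blast
    qed blast
    then obtain C where C: "countable C" "C \<subseteq> K"
      and pw: "pairwise (\<lambda>i j. disjnt (cball (a i) (r i)) (cball (a j) (r j))) C"
      and ng: "negligible (B e m - (\<Union>i \<in> C. cball (a i) (r i)))" by blast
    have bound: "measure lebesgue (\<Union>i\<in>I. cball (a i) (r i)) \<le> \<eta>" if I: "I \<subseteq> C" "finite I" for I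
    proof -
      define f where "f = (\<lambda>i::real\<times>real\<times>real. (fst i, {fst (snd i)..snd (snd i)}))"
      have IK: "I \<subseteq> K" using I C by blast
      have ne: "fst (snd i) < snd (snd i)" if "i \<in> I" for i using that IK by (auto simp: K_def)
      have inj: "inj_on f I"
        by (auto simp: inj_on_def f_def Icc_eq_Icc dest: ne)
      have tp: "f ` I tagged_partial_division_of cbox (-m) m"
        unfolding tagged_partial_division_of_def
      proof (intro conjI allI impI)
        show "finite (f ` I)" using I by auto
        fix x K' assume "(x,K') \<in> f ` I"
        then show "x \<in> K'" "K' \<subseteq> cbox (-m) m" "\<exists>a b. K' = cbox a b"
          using IK by (auto simp: f_def K_def subset_eq intro: cbox_interval[symmetric])
      next
        fix x1 K1 x2 K2
        assume *: "(x1, K1) \<in> f ` I \<and> (x2, K2) \<in> f ` I \<and> (x1, K1) \<noteq> (x2, K2)"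
        then obtain i j where ij: "i \<in> I" "j \<in> I" "f i = (x1,K1)" "f j = (x2,K2)"
          unfolding image_iff by metis
        then have "i \<noteq> j" using * by metis
        then have "disjnt (cball (a i) (r i)) (cball (a j) (r j))"
          using pw ij I by (auto simp: pairwise_def)
        then have "K1 \<inter> K2 = {}" using ij unfolding cb f_def by (auto simp: disjnt_def)
        then show "interior K1 \<inter> interior K2 = {}" using interior_subset by blast
      qed
      have fine: "\<gamma> fine f ` I" using IK by (force simp: fine_def f_def K_def)
      have "sum (\<lambda>(x,k). norm(Henstock_Kurzweil_Integration.content k *\<^sub>R g x - integral k g)) (f ` I) < e * \<eta>" by (rule H[OF tp fine])
      also have "sum (\<lambda>(x,k). norm(Henstock_Kurzweil_Integration.content k *\<^sub>R g x - integral k g)) (f ` I) =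
          (\<Sum>i\<in>I. \<bar>F (snd (snd i)) - F (fst (snd i)) - g (fst i) * (snd (snd i) - fst (snd i))\<bar>)"
        unfolding sum.reindex[OF inj] o_def
      proof (rule sum.cong[OF refl])
        fix i assume "i \<in> I"
        then show "(case f i of (x, k) \<Rightarrow> norm (Henstock_Kurzweil_Integration.content k *\<^sub>R g x - integral k g)) =
          \<bar>F (snd (snd i)) - F (fst (snd i)) - g (fst i) * (snd (snd i) - fst (snd i))\<bar>"
          using ne[of i] integral_unique[OF int[of "fst (snd i)" "snd (snd i)"]]
          by (auto simp: f_def abs_minus_commute mult.commute)
      qed
      finally have 1: "(\<Sum>i\<in>I. \<bar>F (snd (snd i)) - F (fst (snd i)) - g (fst i) * (snd (snd i) - fst (snd i))\<bar>) < e * \<eta>" .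
      have "(\<Sum>i\<in>I. e * (snd (snd i) - fst (snd i))) \<le> (\<Sum>i\<in>I. \<bar>F (snd (snd i)) - F (fst (snd i)) - g (fst i) * (snd (snd i) - fst (snd i))\<bar>)"
        using IK by (intro sum_mono) (auto simp: K_def)
      with 1 have "e * (\<Sum>i\<in>I. (snd (snd i) - fst (snd i))) \<le> e * \<eta>" by (simp add: sum_distrib_left)
      then have 2: "(\<Sum>i\<in>I. (snd (snd i) - fst (snd i))) \<le> \<eta>" using \<open>e > 0\<close> by simp
      have "measure lebesgue (\<Union>i\<in>I. cball (a i) (r i)) \<le> (\<Sum>i\<in>I. measure lebesgue (cball (a i) (r i)))"
        by (rule measure_UNION_le) (use I in auto)
      also have "\<dots> = (\<Sum>i\<in>I. (snd (snd i) - fst (snd i)))"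
      proof (rule sum.cong[OF refl])
        fix i assume "i \<in> I"
        then show "measure lebesgue (cball (a i) (r i)) = snd (snd i) - fst (snd i)"
          unfolding cb using ne[of i] by simp
      qed
      finally show ?thesis using 2 by simp
    qed
    have lm: "\<And>i. i \<in> C \<Longrightarrow> cball (a i) (r i) \<in> lmeasurable" by simp
    have fm: "(\<Union>i\<in>C. cball (a i) (r i)) \<in> lmeasurable" "measure lebesgue (\<Union>i\<in>C. cball (a i) (r i)) \<le> \<eta>"
      using fmeasurable_UN_bound[OF C(1) lm bound] measure_UN_bound[OF C(1) lm bound] by auto
    define T where "T = (\<Union>i\<in>C. cball (a i) (r i)) \<union> (B e m - (\<Union>i \<in> C. cball (a i) (r i)))"
    show "\<exists>T. B e m \<subseteq> T \<and> T \<in> lmeasurable \<and> measure lebesgue T \<le> \<eta>"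
    proof (intro exI conjI)
      show "B e m \<subseteq> T" by (auto simp: T_def)
      show "T \<in> lmeasurable" unfolding T_def
        by (intro fmeasurable.Un fm(1) negligible_imp_measurable ng)
      have "measure lebesgue T \<le> measure lebesgue (\<Union>i\<in>C. cball (a i) (r i)) +
          measure lebesgue (B e m - (\<Union>i \<in> C. cball (a i) (r i)))"
        unfolding T_def by (rule measure_Un_le) (use fm ng negligible_imp_sets in \<open>auto simp: fmeasurableD\<close>)
      then show "measure lebesgue T \<le> \<eta>" using fm ng by (simp add: negligible_imp_measure0)
    qed
  qed
  have "negligible (\<Union>n::nat. \<Union>m::nat. B (1 / (1 + real n)) (1 + real m))"
    by (intro negligible_countable_Union) (auto intro!: negligible_countable_Union neg)
  then show ?thesis
  proof (rule negligible_subset)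
    show "{x. \<not> (F has_real_derivative g x) (at x)} \<subseteq> (\<Union>n::nat. \<Union>m::nat. B (1 / (1 + real n)) (1 + real m))"
    proof (rule subsetI, rule ccontr)
      fix x assume "x \<in> {x. \<not> (F has_real_derivative g x) (at x)}"
        and *: "x \<notin> (\<Union>n::nat. \<Union>m::nat. B (1 / (1 + real n)) (1 + real m))"
      then have nd: "\<not> (F has_real_derivative g x) (at x)" by simp
      from * have nB: "\<And>n m::nat. x \<notin> B (1 / (1 + real n)) (1 + real m)" by simp
      obtain m :: nat where m: "\<bar>x\<bar> < real m" using reals_Archimedean2 by blast
      have "(F has_real_derivative g x) (at x)"
        unfolding has_field_derivative_def has_derivative_at_alt
      proof (intro conjI allI impI)
        show "bounded_linear ((*) (g x))" by (rule bounded_linear_mult_right)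
        fix e :: real assume "0 < e"
        from reals_Archimedean[OF this] obtain n :: nat where "inverse (real (Suc n)) < e" ..
        then have n: "1 / (1 + real n) < e" by (simp add: inverse_eq_divide)
        have "\<not> (\<forall>d>0. \<exists>u v. u \<le> x \<and> x \<le> v \<and> u < v \<and> v - u < d \<and>
            \<bar>F v - F u - g x * (v - u)\<bar> > 1 / (1 + real n) * (v - u))"
        proof
          assume "\<forall>d>0. \<exists>u v. u \<le> x \<and> x \<le> v \<and> u < v \<and> v - u < d \<and>
            \<bar>F v - F u - g x * (v - u)\<bar> > 1 / (1 + real n) * (v - u)"
          moreover have "x \<in> {-(1 + real m)<..<1 + real m}" using m by auto
          ultimately have "x \<in> B (1 / (1 + real n)) (1 + real m)"
            unfolding B_def by blast
          with nB show False by blast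
        qed
        then obtain d where d: "d > 0" and
          D: "\<And>u v. u \<le> x \<Longrightarrow> x \<le> v \<Longrightarrow> u < v \<Longrightarrow> v - u < d \<Longrightarrow>
             \<bar>F v - F u - g x * (v - u)\<bar> \<le> 1 / (1 + real n) * (v - u)"
          by (meson not_less)
        show "\<exists>d>0. \<forall>y. norm (y - x) < d \<longrightarrow> norm (F y - F x - g x * (y - x)) \<le> e * norm (y - x)"
        proof (intro exI[of _ d] conjI allI impI d)
          fix y assume y: "norm (y - x) < d"
          have le: "1 / (1 + real n) * t \<le> e * t" if "t \<ge> 0" for t
            using n that by (intro mult_right_mono) auto
          consider "y = x" | "y > x" | "y < x" by linarith
          then show "norm (F y - F x - g x * (y - x)) \<le> e * norm (y - x)"
          proof cases
            case 2 then show ?thesis using D[of x y] y le[of "y - x"] by auto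
          next
            case 3
            have "\<bar>F x - F y - g x * (x - y)\<bar> \<le> e * (x - y)"
              using 3 D[of y x] y le[of "x - y"] by auto
            moreover have "\<bar>F x - F y - g x * (x - y)\<bar> = \<bar>F y - F x - g x * (y - x)\<bar>"
              by (simp add: abs_if algebra_simps)
            ultimately show ?thesis using 3 by simp
          qed auto
        qed
      qed
      with nd show False by blast
    qed
  qed
qed

text \<open>Adding (K+1)x makes the function increase with slope at least 1, so it has a 1-Lipschitz
  inverse \<open>h\<close>. The image of Lebesgue measure under \<open>h\<close> gives an interval
  the increment of \<phi> as its mass, and it is absolutely continuous because the Lipschitz map
  \<phi> preserves null sets. Its Radon-Nikodym density minus K+1 is the required function.\<close>

lemma lipschitz_imp_density:
  fixes f :: "real \<Rightarrow> real"
  assumes "K-lipschitz_on UNIV f"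
  obtains g where "g \<in> borel_measurable borel" "\<And>u v. u \<le> v \<Longrightarrow> (g has_integral (f v - f u)) {u..v}"
proof -
  have K0: "K \<ge> 0" and lip: "\<And>x y. \<bar>f x - f y\<bar> \<le> K * \<bar>x - y\<bar>"
    using assms by (auto simp: lipschitz_on_def dist_real_def)
  define \<phi> where "\<phi> x = f x + (K + 1) * x" for x
  have exp: "\<phi> y - \<phi> x \<ge> y - x" if "x \<le> y" for x y
  proof -
    have "f y - f x \<ge> - K * (y - x)" using lip[of y x] that by auto
    then show ?thesis by (simp add: \<phi>_def algebra_simps)
  qed
  have mono: "\<phi> x < \<phi> y \<longleftrightarrow> x < y" for x y
    using exp[of x y] exp[of y x] by (cases "x < y") auto
  have monole: "\<phi> x \<le> \<phi> y \<longleftrightarrow> x \<le> y" for x y using mono[of y x] by auto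
  have contf: "continuous_on UNIV f" using assms lipschitz_on_continuous_on by blast
  have cont: "continuous_on UNIV \<phi>" unfolding \<phi>_def by (intro continuous_intros contf)
  have inj: "inj \<phi>" by (metis injI less_irrefl linorder_neqE mono)
  have surj: "surj \<phi>"
    unfolding surj_def
  proof
    fix y
    define M where "M = \<bar>y - \<phi> 0\<bar>"
    have "\<phi> (-M) \<le> y" "y \<le> \<phi> M" using exp[of 0 M] exp[of "-M" 0] by (auto simp: M_def)
    then show "\<exists>x. y = \<phi> x"
      using IVT'[of \<phi> "-M" y M] continuous_on_subset[OF cont] by (force simp: M_def)
  qed
  define h where "h = inv \<phi>"
  have h1: "\<phi> (h y) = y" and h2: "h (\<phi> x) = x" for x y
    using inj surj by (auto simp: h_def surj_f_inv_f)
  have "1-lipschitz_on UNIV h"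
  proof (rule lipschitz_onI)
    fix x y
    show "dist (h x) (h y) \<le> 1 * dist x y"
      using exp[of "h x" "h y"] exp[of "h y" "h x"] by (auto simp: h1 dist_real_def abs_if)
  qed auto
  then have hc: "continuous_on UNIV h" using lipschitz_on_continuous_on by blast
  then have hm: "h \<in> borel_measurable borel" by (rule borel_measurable_continuous_onI)
  define \<mu> where "\<mu> = distr lborel borel h"
  have vim: "h -` N = \<phi> ` N" for N
  proof
    show "h -` N \<subseteq> \<phi> ` N" using h1 by (metis image_iff subsetI vimageD)
    show "\<phi> ` N \<subseteq> h -` N" using h2 by auto
  qed
  have ac: "absolutely_continuous lborel \<mu>"
    unfolding absolutely_continuous_def
  proof
    fix N :: "real set" assume N: "N \<in> null_sets lborel"
    then have Nb: "N \<in> sets borel" by auto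
    have "negligible N" using N by (simp add: negligible_iff_null_sets null_sets_completionI)
    have "negligible (\<phi> ` N)"
    proof (rule negligible_locally_Lipschitz_image[OF _ \<open>negligible N\<close>])
      fix x assume "x \<in> N"
      have "norm (\<phi> y - \<phi> x) \<le> (2 * K + 1) * norm (y - x)" for y
      proof -
        have "\<phi> y - \<phi> x = (f y - f x) + (K + 1) * (y - x)" by (simp add: \<phi>_def algebra_simps)
        then have "\<bar>\<phi> y - \<phi> x\<bar> \<le> \<bar>f y - f x\<bar> + \<bar>(K + 1) * (y - x)\<bar>" by simp
        then have "\<bar>\<phi> y - \<phi> x\<bar> \<le> K * \<bar>y - x\<bar> + (K + 1) * \<bar>y - x\<bar>"
          using lip[of y x] K0 by (simp add: abs_mult)
        then show ?thesis by (simp add: algebra_simps)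
      qed
      then show "\<exists>T B. open T \<and> x \<in> T \<and> (\<forall>y \<in> N \<inter> T. norm (\<phi> y - \<phi> x) \<le> B * norm (y - x))"
        by (intro exI[of _ UNIV] exI[of _ "2*K+1"]) auto
    qed auto
    then have "h -` N \<in> null_sets lebesgue" by (simp add: vim negligible_iff_null_sets)
    moreover have hN: "h -` N \<in> sets borel" using hm Nb by (metis borel_measurable_vimage_borel measurable_sets_borel)
    ultimately have "emeasure lborel (h -` N) = 0"
      by (metis null_setsD1 null_sets_completion_iff sets_lborel)
    then show "N \<in> null_sets \<mu>"
      unfolding \<mu>_def using Nb hm by (intro null_setsI) (auto simp: emeasure_distr)
  qed
  obtain r where r: "r \<in> borel_measurable lborel" "density lborel r = \<mu>"
    using sigma_finite_measure.Radon_Nikodym[OF sigma_finite_lborel ac] by (auto simp: \<mu>_def)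
  have nn: "(\<integral>\<^sup>+x. r x * indicator {u..v} x \<partial>lborel) = ennreal (\<phi> v - \<phi> u)" if "u \<le> v" for u v
  proof -
    have "(\<integral>\<^sup>+x. r x * indicator {u..v} x \<partial>lborel) = emeasure \<mu> {u..v}"
      unfolding r(2)[symmetric] by (rule emeasure_density[symmetric]) (use r in auto)
    also have "\<dots> = emeasure lborel (h -` {u..v})"
      unfolding \<mu>_def using hm by (subst emeasure_distr) auto
    also have "h -` {u..v} = {\<phi> u..\<phi> v}"
    proof -
      have "u \<le> h y \<longleftrightarrow> \<phi> u \<le> y" "h y \<le> v \<longleftrightarrow> y \<le> \<phi> v" for y
        using monole[of u "h y"] monole[of "h y" v] by (auto simp: h1)
      then show ?thesis by auto
    qed
    finally show ?thesis using monole that by simp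
  qed
  define g where "g x = enn2real (r x) - (K + 1)" for x
  show ?thesis
  proof
    show "g \<in> borel_measurable borel" using r unfolding g_def by measurable
    fix u v :: real assume uv: "u \<le> v"
    have fin: "AE x in lborel. r x * indicator {u..v} x \<noteq> \<infinity>"
      by (rule nn_integral_noteq_infinite) (use r nn[OF uv] in auto)
    have "(\<integral>\<^sup>+x. ennreal (enn2real (r x) * indicator {u..v} x) \<partial>lborel) = ennreal (\<phi> v - \<phi> u)"
      unfolding nn[OF uv, symmetric]
    proof (rule nn_integral_cong_AE)
      show "AE x in lborel. ennreal (enn2real (r x) * indicator {u..v} x) = r x * indicator {u..v} x"
        using fin by eventually_elim (auto simp: indicator_def ennreal_enn2real_if)
    qed
    then have "((\<lambda>x. enn2real (r x) * indicator {u..v} x) has_integral (\<phi> v - \<phi> u)) UNIV"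
      using r uv monole by (intro nn_integral_has_integral) (auto simp: nn_integral_completion)
    then have "((\<lambda>x. if x \<in> {u..v} then enn2real (r x) else 0) has_integral (\<phi> v - \<phi> u)) UNIV"
      by (rule has_integral_eq[rotated]) auto
    then have 1: "((\<lambda>x. enn2real (r x)) has_integral (\<phi> v - \<phi> u)) {u..v}"
      by (simp only: has_integral_restrict_UNIV)
    have 2: "((\<lambda>x. K + 1) has_integral (K + 1) * (v - u)) {u..v}"
      using has_integral_const_real[of "K + 1" u v] uv by (simp add: mult.commute)
    have "\<phi> v - \<phi> u - (K + 1) * (v - u) = f v - f u" by (simp add: \<phi>_def algebra_simps)
    then show "(g has_integral (f v - f u)) {u..v}"
      using has_integral_diff[OF 1 2] unfolding g_def by simp
  qed
qed

lemma lipschitz_vector_derivative_le: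
  fixes c :: "real \<Rightarrow> 'a::real_normed_vector"
  assumes lip: "K-lipschitz_on T c" "t \<in> T" "open T" and d: "(c has_vector_derivative D) (at t)"
  shows "norm D \<le> K"
proof -
  obtain r where r: "r > 0" "ball t r \<subseteq> T" using lip(2,3) openE by blast
  show ?thesis
  proof (rule field_le_epsilon)
    fix e :: real assume "e > 0"
    then obtain d where d: "d > 0"
      "\<And>y. norm (y - t) < d \<Longrightarrow> norm (c y - c t - (y - t) *\<^sub>R D) \<le> e * norm (y - t)"
      using d unfolding has_vector_derivative_def has_derivative_at_alt by metis
    define y where "y = t + min d r / 2"
    have y: "norm (y - t) < d" "y \<in> T" "norm (y - t) > 0"
      using d r by (auto simp: y_def dist_real_def subset_eq)
    have "norm ((y - t) *\<^sub>R D) \<le> norm (c y - c t) + norm (c y - c t - (y - t) *\<^sub>R D)"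
      by (metis norm_minus_commute norm_triangle_sub)
    also have "\<dots> \<le> K * norm (y - t) + e * norm (y - t)"
      using d(2)[OF y(1)] lipschitz_onD[OF lip(1) y(2) lip(2)] by (simp add: dist_norm)
    finally have "norm (y - t) * norm D \<le> norm (y - t) * (K + e)"
      by (simp only: norm_scaleR real_norm_def distrib_left mult.commute[of _ "\<bar>y - t\<bar>"])
    then show "norm D \<le> K + e" using y(3) by simp
  qed
qed

lemma lipschitz_derivative:
  fixes c :: "real \<Rightarrow> 'a::euclidean_space"
  assumes lip: "K-lipschitz_on UNIV c"
  obtains D where "D \<in> borel_measurable borel" "\<And>t. norm (D t) \<le> K"
    "negligible {t. \<not> (c has_vector_derivative D t) (at t)}"
    "\<And>u v. u \<le> v \<Longrightarrow> (D has_integral (c v - c u)) {u..v}"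
proof -
  have "\<exists>g. g \<in> borel_measurable borel \<and> (\<forall>u v. u \<le> v \<longrightarrow> (g has_integral (c v \<bullet> b - c u \<bullet> b)) {u..v})"
    if "b \<in> Basis" for b
  proof -
    have "K-lipschitz_on UNIV (\<lambda>t. c t \<bullet> b)"
    proof (rule lipschitz_onI)
      show "0 \<le> K" using lip by (rule lipschitz_on_nonneg)
      fix x y
      have "\<bar>(c x - c y) \<bullet> b\<bar> \<le> norm (c x - c y)" by (rule Basis_le_norm[OF that])
      also have "\<dots> \<le> K * dist x y" using lipschitz_onD[OF lip] by (auto simp: dist_norm)
      finally show "dist (c x \<bullet> b) (c y \<bullet> b) \<le> K * dist x y"
        by (simp add: dist_real_def inner_diff_left)
    qed
    then show ?thesis using lipschitz_imp_density by metis
  qed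
  then obtain g where gm: "\<And>b. b \<in> Basis \<Longrightarrow> g b \<in> borel_measurable borel"
    and gi: "\<And>b u v. b \<in> Basis \<Longrightarrow> u \<le> v \<Longrightarrow> (g b has_integral (c v \<bullet> b - c u \<bullet> b)) {u..v}"
    by metis
  define E where "E t = (\<Sum>b\<in>Basis. g b t *\<^sub>R b)" for t
  have Eb: "E t \<bullet> b = g b t" if "b \<in> Basis" for b t
    using that by (simp add: E_def)
  have Em: "E \<in> borel_measurable borel" unfolding E_def
    by (intro borel_measurable_sum borel_measurable_scaleR gm) auto
  define N where "N = (\<Union>b\<in>Basis. {t. \<not> ((\<lambda>t. c t \<bullet> b) has_real_derivative g b t) (at t)})"
  have negN: "negligible N" unfolding N_def
    using negligible_not_derivative_of_integral[OF gi]
    by (intro negligible_countable_Union) (auto simp: image_iff intro!: countable_finite)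
  have Eder: "(c has_vector_derivative E t) (at t)" if "t \<notin> N" for t
    unfolding has_vector_derivative_def
  proof (subst has_derivative_componentwise_within, intro ballI)
    fix b :: 'a assume b: "b \<in> Basis"
    then have "((\<lambda>t. c t \<bullet> b) has_real_derivative g b t) (at t)" using that by (auto simp: N_def)
    then have "((\<lambda>t. c t \<bullet> b) has_derivative (\<lambda>x. x * g b t)) (at t)"
      by (simp add: has_field_derivative_def mult_commute_abs)
    then show "((\<lambda>x. c x \<bullet> b) has_derivative (\<lambda>x. (x *\<^sub>R E t) \<bullet> b)) (at t)"
      using Eb[OF b] by simp
  qed
  \<comment> \<open>Truncation makes the bound hold at every point, so later estimates of integrands
    need no exceptional set. Off \<open>N\<close> nothing changes, since a derivative of a
    \<open>K\<close>-Lipschitz map has norm at most \<open>K\<close>.\<close>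
  define D where "D t = (if norm (E t) \<le> K then E t else 0)" for t
  have DE: "D t = E t" if "t \<notin> N" for t
    using lipschitz_vector_derivative_le[OF lip _ open_UNIV Eder[OF that]] by (simp add: D_def)
  show ?thesis
  proof
    have "{t. norm (E t) \<le> K} \<in> sets borel"
      using Em borel_measurable_le[of "\<lambda>t. norm (E t)" borel "\<lambda>_. K"] by simp
    then show "D \<in> borel_measurable borel" unfolding D_def using Em by simp
    show "norm (D t) \<le> K" for t using lipschitz_on_nonneg[OF lip] by (simp add: D_def)
    show "negligible {t. \<not> (c has_vector_derivative D t) (at t)}"
      by (rule negligible_subset[OF negN]) (use Eder DE in force)
    fix u v :: real assume "u \<le> v"
    have "(E has_integral (c v - c u)) {u..v}"
      by (subst has_integral_componentwise_iff) (use gi \<open>u \<le> v\<close> in \<open>auto simp: Eb inner_diff_left\<close>)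
    then show "(D has_integral (c v - c u)) {u..v}"
      by (rule has_integral_spike[OF negN, rotated]) (use DE in auto)
  qed
qed

text \<open>Nearest point of the interval. Precomposition with it extends a Lipschitz curve to the
  whole line with the same constant, which is how statements on the line are applied on an
  interval.\<close>

definition clamp1 :: "real \<Rightarrow> real \<Rightarrow> real \<Rightarrow> real" where
  "clamp1 a b t = max a (min b t)"

lemma clamp1_eq [simp]: "t \<in> {a..b} \<Longrightarrow> clamp1 a b t = t"
  by (auto simp: clamp1_def)

lemma clamp1_mem: "a \<le> b \<Longrightarrow> clamp1 a b t \<in> {a..b}"
  by (auto simp: clamp1_def)

lemma lipschitz_clamp1:
  assumes "K-lipschitz_on {a..b} c" "a \<le> b"
  shows "K-lipschitz_on UNIV (\<lambda>t. c (clamp1 a b t))"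
proof (rule lipschitz_onI)
  show "0 \<le> K" using assms(1) by (rule lipschitz_on_nonneg)
  fix x y :: real
  have "dist (c (clamp1 a b x)) (c (clamp1 a b y)) \<le> K * dist (clamp1 a b x) (clamp1 a b y)"
    using lipschitz_onD[OF assms(1) clamp1_mem clamp1_mem] assms(2) by blast
  also have "\<dots> \<le> K * dist x y"
    by (intro mult_left_mono lipschitz_on_nonneg[OF assms(1)])
       (auto simp: clamp1_def dist_real_def max_def min_def)
  finally show "dist (c (clamp1 a b x)) (c (clamp1 a b y)) \<le> K * dist x y" .
qed

lemma has_vector_derivative_cong_open:
  assumes "open T" "t \<in> T" "\<And>s. s \<in> T \<Longrightarrow> f s = g s"
  shows "(f has_vector_derivative D) (at t) \<longleftrightarrow> (g has_vector_derivative D) (at t)"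
proof
  show "(f has_vector_derivative D) (at t) \<Longrightarrow> (g has_vector_derivative D) (at t)"
    by (erule has_vector_derivative_transform_within_open[OF _ assms(1,2)]) (rule assms(3))
  show "(g has_vector_derivative D) (at t) \<Longrightarrow> (f has_vector_derivative D) (at t)"
    by (erule has_vector_derivative_transform_within_open[OF _ assms(1,2)]) (rule assms(3)[symmetric])
qed

lemma lipschitz_derivative_on:
  fixes c :: "real \<Rightarrow> 'a::euclidean_space"
  assumes lip: "K-lipschitz_on {a..b} c"
  obtains D N where "D \<in> borel_measurable borel" "\<And>t. norm (D t) \<le> K" "negligible N"
    "\<And>t. t \<in> {a<..<b} \<Longrightarrow> t \<notin> N \<Longrightarrow> (c has_vector_derivative D t) (at t)"
    "\<And>u v. a \<le> u \<Longrightarrow> u \<le> v \<Longrightarrow> v \<le> b \<Longrightarrow> (D has_integral (c v - c u)) {u..v}"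
proof (cases "a \<le> b")
  case True
  obtain D where D: "D \<in> borel_measurable borel" "\<And>t. norm (D t) \<le> K"
    "negligible {t. \<not> ((\<lambda>t. c (clamp1 a b t)) has_vector_derivative D t) (at t)}"
    "\<And>u v. u \<le> v \<Longrightarrow> (D has_integral (c (clamp1 a b v) - c (clamp1 a b u))) {u..v}"
    by (rule lipschitz_derivative[OF lipschitz_clamp1[OF lip True]]) (rule that)
  show ?thesis
  proof (rule that[OF D(1,2,3)])
    fix t assume t: "t \<in> {a<..<b}" "t \<notin> {t. \<not> ((\<lambda>t. c (clamp1 a b t)) has_vector_derivative D t) (at t)}"
    have "((\<lambda>t. c (clamp1 a b t)) has_vector_derivative D t) (at t) \<longleftrightarrow> (c has_vector_derivative D t) (at t)"
      using t by (intro has_vector_derivative_cong_open[of "{a<..<b}"]) auto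
    then show "(c has_vector_derivative D t) (at t)" using t by blast
  next
    fix u v assume uv: "a \<le> u" "u \<le> v" "v \<le> b"
    then show "(D has_integral (c v - c u)) {u..v}" using D(4)[of u v] by simp
  qed
next
  case False
  show ?thesis by (rule that[of "\<lambda>_. 0" "{}"]) (use False lipschitz_on_nonneg[OF lip] in auto)
qed

text \<open>By uniqueness of derivatives, a derivative prescribed off any null set agrees almost
  everywhere with the density constructed above.\<close>

lemma lipschitz_fundamental_theorem:
  fixes c :: "real \<Rightarrow> 'a::euclidean_space"
  assumes lip: "K-lipschitz_on {a..b} c" and ab: "a \<le> b" and N: "negligible N"
    and d: "\<And>t. t \<in> {a<..<b} \<Longrightarrow> t \<notin> N \<Longrightarrow> (c has_vector_derivative c' t) (at t)"
  shows "(c' has_integral (c b - c a)) {a..b}"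
proof -
  obtain D M where "D \<in> borel_measurable borel" "\<And>t. norm (D t) \<le> K" and D: "negligible M"
    "\<And>t. t \<in> {a<..<b} \<Longrightarrow> t \<notin> M \<Longrightarrow> (c has_vector_derivative D t) (at t)"
    "\<And>u v. a \<le> u \<Longrightarrow> u \<le> v \<Longrightarrow> v \<le> b \<Longrightarrow> (D has_integral (c v - c u)) {u..v}"
    by (rule lipschitz_derivative_on[OF lip]) (rule that)
  have "negligible (N \<union> M \<union> {a,b})" using N D(1) by auto
  then show ?thesis
  proof (rule has_integral_spike[OF _ _ D(3)])
    fix t assume "t \<in> {a..b} - (N \<union> M \<union> {a,b})"
    then have "(c has_vector_derivative c' t) (at t)" "(c has_vector_derivative D t) (at t)"
      using d D(2) by auto
    then show "c' t = D t" by (rule vector_derivative_unique_at)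
  qed (use ab in auto)
qed

lemma lipschitz_zero_derivative:
  fixes c :: "real \<Rightarrow> 'a::euclidean_space"
  assumes lip: "K-lipschitz_on {a..b} c" and ab: "a \<le> b" and N: "negligible N"
    and d: "\<And>t. t \<in> {a<..<b} \<Longrightarrow> t \<notin> N \<Longrightarrow> (c has_vector_derivative 0) (at t)"
  shows "c b = c a"
  using lipschitz_fundamental_theorem[OF assms] by (metis eq_iff_diff_eq_0 has_integral_0 has_integral_unique)

section \<open>Convex bodies, support functions and polars\<close>

text \<open>The area form replaces the inner product because it absorbs the quarter turn of the
  theorem: \<open>det2 (- \<i> * w) v\<close> is the inner product of \<open>w\<close> and
  \<open>v\<close>.\<close>

definition det2 :: "complex \<Rightarrow> complex \<Rightarrow> real" where
  "det2 z v = Re z * Im v - Im z * Re v"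

lemma det2_simps:
  "det2 (z + w) v = det2 z v + det2 w v" "det2 z (u + v) = det2 z u + det2 z v"
  "det2 (z - w) v = det2 z v - det2 w v" "det2 z (u - v) = det2 z u - det2 z v"
  "det2 (r *\<^sub>R z) v = r * det2 z v" "det2 z (r *\<^sub>R v) = r * det2 z v"
  "det2 0 v = 0" "det2 z 0 = 0" "det2 (- z) v = - det2 z v" "det2 z (- v) = - det2 z v"
  by (simp_all add: det2_def algebra_simps)

lemma abs_det2_le: "\<bar>det2 z v\<bar> \<le> norm z * norm v"
proof -
  have "det2 z v = Im (cnj z * v)" by (simp add: det2_def)
  then show ?thesis using abs_Im_le_cmod[of "cnj z * v"] by (simp add: norm_mult)
qed

lemma continuous_on_det2 [continuous_intros]:
  "continuous_on T f \<Longrightarrow> continuous_on T g \<Longrightarrow> continuous_on T (\<lambda>t. det2 (f t) (g t))"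
  unfolding det2_def by (intro continuous_intros)

definition supp :: "complex set \<Rightarrow> complex \<Rightarrow> real" where
  "supp Q v = Sup ((\<lambda>z. det2 z v) ` Q)"

locale body =
  fixes Q :: "complex set"
  assumes convQ: "convex Q" and compQ: "compact Q" and zeroQ: "0 \<in> interior Q"
begin

lemma zero_in: "0 \<in> Q" using zeroQ interior_subset by blast

lemma supp_bdd: "bdd_above ((\<lambda>z. det2 z v) ` Q)"
  by (intro bounded_imp_bdd_above compact_imp_bounded compact_continuous_image compQ continuous_intros)

lemma supp_ge: "z \<in> Q \<Longrightarrow> det2 z v \<le> supp Q v"
  unfolding supp_def by (rule cSUP_upper[OF _ supp_bdd])

lemma supp_le: "(\<And>z. z \<in> Q \<Longrightarrow> det2 z v \<le> r) \<Longrightarrow> supp Q v \<le> r"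
  unfolding supp_def by (rule cSUP_least) (use zero_in in auto)

lemma supp_attained: obtains z where "z \<in> Q" "det2 z v = supp Q v"
proof -
  have "\<exists>z\<in>Q. \<forall>y\<in>Q. det2 y v \<le> det2 z v"
    by (rule continuous_attains_sup) (use zero_in compQ in \<open>auto intro!: continuous_intros\<close>)
  then obtain z where z: "z \<in> Q" "\<And>y. y \<in> Q \<Longrightarrow> det2 y v \<le> det2 z v" by blast
  have "det2 z v = supp Q v" by (rule antisym[OF supp_ge[OF z(1)] supp_le[OF z(2)]])
  with z that show ?thesis by blast
qed

lemma supp_nonneg: "0 \<le> supp Q v"
  using supp_ge[OF zero_in, of v] by (simp add: det2_simps)

lemma supp_zero [simp]: "supp Q 0 = 0"
  by (rule antisym[OF supp_le supp_nonneg]) (simp add: det2_simps)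

lemma supp_add: "supp Q (u + v) \<le> supp Q u + supp Q v"
  by (rule supp_le) (simp add: det2_simps add_mono supp_ge)

lemma supp_scaleR: "0 \<le> t \<Longrightarrow> supp Q (t *\<^sub>R v) = t * supp Q v"
proof (rule antisym)
  assume t: "0 \<le> t"
  show "supp Q (t *\<^sub>R v) \<le> t * supp Q v"
    by (rule supp_le) (simp add: det2_simps mult_left_mono supp_ge t)
  obtain z where z: "z \<in> Q" "det2 z v = supp Q v" by (rule supp_attained)
  show "t * supp Q v \<le> supp Q (t *\<^sub>R v)"
    using supp_ge[OF z(1), of "t *\<^sub>R v"] z(2) by (simp add: det2_simps)
qed

lemma supp_pos: assumes "v \<noteq> 0" shows "0 < supp Q v"
proof -
  obtain e where e: "e > 0" "ball 0 e \<subseteq> Q" using zeroQ by (meson mem_interior)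
  define z where "z = (e / (2 * norm v)) *\<^sub>R (- \<i> * v)"
  have "norm z = e / 2" using assms e(1) by (simp add: z_def norm_mult)
  then have "z \<in> Q" using e by auto
  have "Re v * Re v + Im v * Im v > 0"
    using assms by (metis cmod_power2 norm_eq_zero power2_eq_square zero_less_power2)
  then have "det2 (- \<i> * v) v > 0"
    by (simp add: det2_def)
  then have "det2 z v > 0" unfolding z_def det2_simps using e(1) assms by simp
  with supp_ge[OF \<open>z \<in> Q\<close>, of v] show ?thesis by linarith
qed

lemma supp_bound: obtains B where "B > 0" "\<And>v. supp Q v \<le> B * norm v"
proof -
  obtain B where B: "B > 0" "\<And>z. z \<in> Q \<Longrightarrow> norm z \<le> B"
    using compact_imp_bounded[OF compQ] by (meson bounded_pos)
  have "supp Q v \<le> B * norm v" for v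
  proof (rule supp_le)
    fix z assume "z \<in> Q"
    then have "norm z * norm v \<le> B * norm v" using B by (simp add: mult_right_mono)
    then show "det2 z v \<le> B * norm v" using abs_det2_le[of z v] by linarith
  qed
  with B(1) that show ?thesis by blast
qed

lemma supp_lipschitz: obtains B where "B-lipschitz_on UNIV (supp Q)"
proof -
  obtain B where B: "B > 0" "\<And>v. supp Q v \<le> B * norm v" by (rule supp_bound) (rule that)
  have "B-lipschitz_on UNIV (supp Q)"
  proof (rule lipschitz_onI)
    fix u v
    have "supp Q u \<le> supp Q v + B * norm (u - v)" "supp Q v \<le> supp Q u + B * norm (u - v)"
      using supp_add[of v "u - v"] supp_add[of u "v - u"] B(2)[of "u - v"] B(2)[of "v - u"]
      by (auto simp: norm_minus_commute)
    then show "dist (supp Q u) (supp Q v) \<le> B * dist u v" by (simp add: dist_real_def dist_norm)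
  qed (use B in auto)
  with that show ?thesis by blast
qed

lemma continuous_on_supp: "continuous_on UNIV (supp Q)"
  using supp_lipschitz lipschitz_on_continuous_on by metis

lemma borel_measurable_supp [measurable]: "supp Q \<in> borel_measurable borel"
  by (rule borel_measurable_continuous_onI[OF continuous_on_supp])

text \<open>A supporting line at a boundary point can be scaled to the value 1 there because 0 is
  interior, which makes \<open>supp Q\<close> positive on nonzero vectors.\<close>

lemma support_normal:
  assumes "z \<in> frontier Q"
  obtains v where "det2 z v = 1" "\<And>w. w \<in> Q \<Longrightarrow> det2 w v \<le> 1"
proof -
  have zQ: "z \<in> Q" using assms compQ by (meson compact_imp_closed frontier_subset_closed subset_iff)
  have "z \<notin> rel_interior Q"
    using assms zeroQ rel_interior_nonempty_interior[of Q] by (auto simp: frontier_def)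
  then obtain a where a: "a \<noteq> 0" "\<And>w. w \<in> Q \<Longrightarrow> a \<bullet> z \<le> a \<bullet> w"
    using supporting_hyperplane_rel_boundary[OF convQ zQ] by metis
  define v where "v = \<i> * (- a)"
  have det: "det2 w v = - (a \<bullet> w)" for w
    by (simp add: det2_def v_def inner_complex_def algebra_simps)
  have vmax: "det2 w v \<le> det2 z v" if "w \<in> Q" for w using a(2)[OF that] by (simp add: det)
  have "supp Q v = det2 z v" by (rule antisym[OF supp_le[OF vmax] supp_ge[OF zQ]])
  moreover have "v \<noteq> 0" using a by (simp add: v_def)
  ultimately have pos: "det2 z v > 0" using supp_pos by metis
  show ?thesis
  proof (rule that[of "(1 / det2 z v) *\<^sub>R v"])
    show "det2 z ((1 / det2 z v) *\<^sub>R v) = 1" using pos by (simp add: det2_simps)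
    fix w assume "w \<in> Q"
    then show "det2 w ((1 / det2 z v) *\<^sub>R v) \<le> 1" using vmax pos by (simp add: det2_simps)
  qed
qed

lemma maximizer_in_frontier:
  assumes "z \<in> Q" "v \<noteq> 0" "\<And>w. w \<in> Q \<Longrightarrow> det2 w v \<le> det2 z v"
  shows "z \<in> frontier Q"
proof -
  have "z \<notin> interior Q"
  proof
    assume "z \<in> interior Q"
    then obtain e where e: "e > 0" "ball z e \<subseteq> Q" by (meson mem_interior)
    define w where "w = z + (e / (2 * norm v)) *\<^sub>R (- \<i> * v)"
    have "norm (w - z) = e / 2" using assms(2) e(1) by (simp add: w_def norm_mult)
    then have "w \<in> Q" using e by (auto simp: dist_norm norm_minus_commute subset_eq)
    have "Re v * Re v + Im v * Im v > 0"
      using assms(2) by (metis cmod_power2 norm_eq_zero power2_eq_square zero_less_power2)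
    then have "det2 (- \<i> * v) v > 0" by (simp add: det2_def)
    then have "det2 w v > det2 z v" unfolding w_def det2_simps using e(1) assms(2) by simp
    with assms(3)[OF \<open>w \<in> Q\<close>] show False by simp
  qed
  then show ?thesis using assms(1) closure_subset by (auto simp: frontier_def)
qed

end

lemma det2_rotate: "norm u = 1 \<Longrightarrow> det2 (u * z) (u * v) = det2 z v"
proof -
  assume "norm u = 1"
  then have "Re u * Re u + Im u * Im u = 1" by (metis cmod_power2 one_power2 power2_eq_square)
  moreover have "det2 (u * z) (u * v) = (Re u * Re u + Im u * Im u) * det2 z v"
    by (simp add: det2_def algebra_simps)
  ultimately show ?thesis by simp
qed

lemma body_linear_image:
  assumes "body P" "linear f" "inj f"
  shows "body (f ` P)"
proof -
  interpret body P by fact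
  show ?thesis
  proof
    show "convex (f ` P)" by (rule convex_linear_image[OF assms(2) convQ])
    show "compact (f ` P)" using assms(2)
      by (intro compact_continuous_image compQ) (simp add: linear_continuous_on linear_linear)
    have "f 0 \<in> f ` interior P" using zeroQ by blast
    then show "0 \<in> interior (f ` P)"
      using interior_injective_linear_image[OF assms(2,3)] linear_0[OF assms(2)] by auto
  qed
qed

lemma linear_cmult: "linear ((*) (u::complex))"
  by (rule linearI) (auto simp: algebra_simps)

lemma body_rotate: "body P \<Longrightarrow> u \<noteq> 0 \<Longrightarrow> body ((\<lambda>w. u * w) ` P)"
  by (rule body_linear_image) (auto intro: linear_cmult simp: inj_on_def)

lemma frontier_linear_image:
  fixes f :: "complex \<Rightarrow> complex"
  assumes "linear f" "inj f"
  shows "frontier (f ` P) = f ` frontier P"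
  unfolding frontier_def interior_injective_linear_image[OF assms] closure_injective_linear_image[OF assms, symmetric]
  using assms(2) by (simp add: image_set_diff)

lemma affine_image_eq:
  "(\<lambda>w. c + r *\<^sub>R w) ` P = (+) c ` (\<lambda>w. r *\<^sub>R w) ` P"
  by (simp add: image_image)

lemma frontier_affine_image:
  fixes c :: complex
  assumes "r \<noteq> 0"
  shows "frontier ((\<lambda>w. c + r *\<^sub>R w) ` P) = (\<lambda>w. c + r *\<^sub>R w) ` frontier P"
  unfolding affine_image_eq frontier_translation
  by (subst frontier_linear_image) (use assms in \<open>auto simp: inj_on_def linear_scaleR\<close>)

section \<open>Polar bodies and the gauge\<close>

lemma polar_eq: "polar \<Omega> = {w. \<forall>z\<in>\<Omega>. w \<bullet> z \<le> 1}"
  by (simp add: polar_def inner_complex_def)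

lemma body_polar:
  assumes "body \<Omega>" shows "body (polar \<Omega>)"
proof -
  interpret body \<Omega> by fact
  have eq: "polar \<Omega> = (\<Inter>z\<in>\<Omega>. {w. z \<bullet> w \<le> 1})" by (auto simp: polar_eq inner_commute)
  show ?thesis
  proof
    show "convex (polar \<Omega>)" unfolding eq by (intro convex_INT convex_halfspace_le)
    have cl: "closed (polar \<Omega>)" unfolding eq by (intro closed_INT ballI closed_halfspace_le)
    obtain e where e: "e > 0" "ball 0 e \<subseteq> \<Omega>" using zeroQ by (meson mem_interior)
    have "norm w \<le> 2 / e" if "w \<in> polar \<Omega>" for w :: complex
    proof (cases "w = 0")
      case False
      define z where "z = (e / (2 * norm w)) *\<^sub>R w"
      have "norm z < e" using False e(1) by (simp add: z_def)
      then have "z \<in> \<Omega>" using e by auto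
      then have "w \<bullet> z \<le> 1" using that by (simp add: polar_eq)
      then have "e / 2 * norm w \<le> 1" using False by (simp add: z_def power2_norm_eq_inner[symmetric] power2_eq_square)
      then show ?thesis using e(1) by (simp add: field_simps)
    qed (use e in auto)
    then have "bounded (polar \<Omega>)" by (auto simp: bounded_iff)
    with cl show "compact (polar \<Omega>)" using compact_eq_bounded_closed by blast
    obtain B where B: "B > 0" "\<And>z. z \<in> \<Omega> \<Longrightarrow> norm z \<le> B"
      using compact_imp_bounded[OF compQ] by (meson bounded_pos)
    have "ball 0 (1 / B) \<subseteq> polar \<Omega>"
    proof
      fix w :: complex assume "w \<in> ball 0 (1 / B)"
      then have w: "norm w < 1 / B" by simp
      have "w \<bullet> z \<le> 1" if "z \<in> \<Omega>" for z
      proof -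
        have "w \<bullet> z \<le> norm w * norm z" by (rule norm_cauchy_schwarz)
        also have "\<dots> \<le> 1 / B * B" using w B(2)[OF that] B(1) by (intro mult_mono) auto
        finally show ?thesis using B(1) by simp
      qed
      then show "w \<in> polar \<Omega>" by (simp add: polar_eq)
    qed
    then show "0 \<in> interior (polar \<Omega>)" using B(1) by (meson divide_pos_pos mem_interior zero_less_one)
  qed
qed

text \<open>A point outside is strictly separated by some \<open>a\<close> and \<open>b\<close>.
  Since 0 lies in the body, \<open>b\<close> is negative, so a/b belongs to the polar and exceeds 1
  at the point.\<close>

lemma bipolar_mem:
  assumes "body \<Omega>" and "\<And>k. k \<in> polar \<Omega> \<Longrightarrow> k \<bullet> v \<le> 1"
  shows "v \<in> \<Omega>"
proof (rule ccontr)
  interpret body \<Omega> by fact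
  assume "v \<notin> \<Omega>"
  then obtain a b where ab: "a \<bullet> v < b" "\<And>x. x \<in> \<Omega> \<Longrightarrow> a \<bullet> x > b"
    using separating_hyperplane_closed_point[OF convQ compact_imp_closed[OF compQ]] by metis
  have b: "b < 0" using ab(2)[OF zero_in] by simp
  have "(1 / b) *\<^sub>R a \<in> polar \<Omega>"
    unfolding polar_eq using ab(2) b by (auto simp: field_simps intro: less_imp_le)
  from assms(2)[OF this] ab(1) b show False by (auto simp: field_simps)
qed

lemma polar_polar: assumes "body \<Omega>" shows "polar (polar \<Omega>) = \<Omega>"
proof
  show "polar (polar \<Omega>) \<subseteq> \<Omega>"
    using bipolar_mem[OF assms] by (auto simp: polar_eq inner_commute)
  show "\<Omega> \<subseteq> polar (polar \<Omega>)" by (auto simp: polar_eq inner_commute)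
qed

text \<open>By the bipolar theorem, \<open>v\<close> lies in r times the body exactly when every
  point of the polar has inner product at most r with \<open>v\<close>. This puts the turned polar
  in the place of the unit ball of covectors.\<close>

lemma minkowski_eq_supp:
  assumes "body \<Omega>"
  shows "minkowski \<Omega> v = supp ((\<lambda>w. - \<i> * w) ` polar \<Omega>) v"
proof -
  interpret P: body "polar \<Omega>" by (rule body_polar[OF assms])
  interpret Q: body "(\<lambda>w. - \<i> * w) ` polar \<Omega>" by (rule body_rotate[OF P.body_axioms]) auto
  let ?N = "supp ((\<lambda>w. - \<i> * w) ` polar \<Omega>) v"
  have det: "det2 (- \<i> * w) u = w \<bullet> u" for w u by (simp add: det2_def inner_complex_def)
  have "v \<in> (\<lambda>w. r *\<^sub>R w) ` \<Omega> \<longleftrightarrow> ?N \<le> r" if "r > 0" for r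
  proof
    assume "v \<in> (\<lambda>w. r *\<^sub>R w) ` \<Omega>"
    then obtain w where w: "w \<in> \<Omega>" "v = r *\<^sub>R w" by blast
    show "?N \<le> r"
    proof (rule Q.supp_le)
      fix z assume "z \<in> (\<lambda>w. - \<i> * w) ` polar \<Omega>"
      then obtain k where k: "k \<in> polar \<Omega>" "z = - \<i> * k" by blast
      have "k \<bullet> w \<le> 1" using k w by (simp add: polar_eq)
      then have "r * (k \<bullet> w) \<le> r * 1" using that by (intro mult_left_mono) auto
      then show "det2 z v \<le> r" unfolding k(2) det w(2) inner_scaleR_right by linarith
    qed
  next
    assume le: "?N \<le> r"
    have "(1 / r) *\<^sub>R v \<in> \<Omega>"
    proof (rule bipolar_mem[OF assms])
      fix k assume "k \<in> polar \<Omega>"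
      then have "k \<bullet> v \<le> r" using Q.supp_ge[of "- \<i> * k" v] le unfolding det by auto
      then show "k \<bullet> (1 / r) *\<^sub>R v \<le> 1" using that by simp
    qed
    moreover have "v = r *\<^sub>R ((1 / r) *\<^sub>R v)" using that by simp
    ultimately show "v \<in> (\<lambda>w. r *\<^sub>R w) ` \<Omega>" by blast
  qed
  then have eq: "{r. 0 < r \<and> v \<in> (\<lambda>w. r *\<^sub>R w) ` \<Omega>} = {r. 0 < r \<and> ?N \<le> r}" by blast
  have "Inf {r. 0 < r \<and> ?N \<le> r} = ?N"
  \<comment> \<open>The dilation factor 0 is excluded in \<open>minkowski\<close>, so for value 0
    the infimum is that of an open ray and is not attained.\<close>
  proof (cases "?N = 0")
    case True
    have "Inf {0<..} = (0::real)" by (simp add: cInf_greaterThan)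
    moreover have "{r. 0 < r \<and> ?N \<le> r} = {0<..}" using True by auto
    ultimately show ?thesis using True by simp
  next
    case False
    then have "{r. 0 < r \<and> ?N \<le> r} = {?N..}" using Q.supp_nonneg[of v] by auto
    then show ?thesis by simp
  qed
  then show ?thesis unfolding minkowski_def eq .
qed

lemma minkowski_uminus_eq_supp:
  assumes "body \<Omega>"
  shows "minkowski \<Omega> (- v) = supp ((\<lambda>w. \<i> * w) ` polar \<Omega>) v"
proof -
  have "supp ((\<lambda>w. - \<i> * w) ` polar \<Omega>) (- v) = supp ((\<lambda>w. \<i> * w) ` polar \<Omega>) v"
    unfolding supp_def image_image by (simp add: det2_simps)
  then show ?thesis by (simp add: minkowski_eq_supp[OF assms])
qed

lemma minkowski_le_1_iff:
  assumes "body K"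
  shows "minkowski K v \<le> 1 \<longleftrightarrow> v \<in> K"
proof -
  interpret P: body "polar K" by (rule body_polar[OF assms])
  interpret Q: body "(\<lambda>w. - \<i> * w) ` polar K" by (rule body_rotate[OF P.body_axioms]) auto
  have det: "det2 (- \<i> * w) u = w \<bullet> u" for w u by (simp add: det2_def inner_complex_def)
  show ?thesis
  proof
    assume le: "minkowski K v \<le> 1"
    show "v \<in> K"
    proof (rule bipolar_mem[OF assms])
      fix k assume "k \<in> polar K"
      then show "k \<bullet> v \<le> 1"
        using Q.supp_ge[of "- \<i> * k" v] le unfolding det minkowski_eq_supp[OF assms] by auto
    qed
  next
    assume "v \<in> K"
    then show "minkowski K v \<le> 1" unfolding minkowski_eq_supp[OF assms]
      using det by (intro Q.supp_le) (auto simp: polar_eq)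
  qed
qed

text \<open>Around an interior point a slightly larger multiple still lies in the body, so the gauge
  there is strictly below 1. Conversely, the set where it is below 1 is open.\<close>

lemma frontier_eq_minkowski:
  assumes "body K"
  shows "frontier K = {v. minkowski K v = 1}"
proof -
  interpret K: body K by (rule assms)
  interpret P: body "polar K" by (rule body_polar[OF assms])
  interpret Q: body "(\<lambda>w. - \<i> * w) ` polar K" by (rule body_rotate[OF P.body_axioms]) auto
  have meq: "minkowski K = supp ((\<lambda>w. - \<i> * w) ` polar K)" using minkowski_eq_supp[OF assms] by blast
  have cl: "closure K = K" by (simp add: K.compQ compact_imp_closed)
  have "interior K = {v. minkowski K v < 1}"
  proof
    have "open {v. minkowski K v < 1}"
      unfolding meq using open_Collect_less[OF Q.continuous_on_supp continuous_on_const] .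
    moreover have "{v. minkowski K v < 1} \<subseteq> K" using minkowski_le_1_iff[OF assms] by force
    ultimately show "{v. minkowski K v < 1} \<subseteq> interior K" by (rule interior_maximal[rotated])
    show "interior K \<subseteq> {v. minkowski K v < 1}"
    proof
      fix v assume v: "v \<in> interior K"
      then obtain e where e: "e > 0" "ball v e \<subseteq> K" by (meson mem_interior)
      \<comment> \<open>Chosen so that \<open>d * norm v\<close> is at most e/2; the added 1 covers
        v = 0.\<close>
      define d where "d = e / (2 * (norm v + 1))"
      have n1: "norm v + 1 > 0" by (smt (verit) norm_ge_zero)
      have d: "d > 0" using e n1 by (simp add: d_def)
      have "d * norm v \<le> d * (norm v + 1)" using d by (intro mult_left_mono) auto
      also have "\<dots> = e / 2" unfolding d_def using less_imp_neq[OF n1] by (simp add: divide_simps)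
      finally have "d * norm v < e" using e by simp
      then have "(1 + d) *\<^sub>R v \<in> ball v e" using d by (simp add: dist_norm scaleR_left_distrib)
      then have "minkowski K ((1 + d) *\<^sub>R v) \<le> 1" using e minkowski_le_1_iff[OF assms] by blast
      then have "(1 + d) * minkowski K v \<le> 1"
        unfolding meq using d Q.supp_scaleR[of "1 + d" v] by linarith
      then show "v \<in> {v. minkowski K v < 1}"
        using d Q.supp_nonneg[of v] unfolding meq by (auto simp: algebra_simps) (smt (verit) mult_pos_pos)
    qed
  qed
  then show ?thesis unfolding frontier_def cl using minkowski_le_1_iff[OF assms] by force
qed

section \<open>Lengths of Lipschitz curves\<close>

lemma bounded_borel_integrable:
  fixes f :: "real \<Rightarrow> real"
  assumes "f \<in> borel_measurable borel" "\<And>t. t \<in> {a..b} \<Longrightarrow> \<bar>f t\<bar> \<le> B"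
  shows "f integrable_on {a..b}"
proof (rule measurable_bounded_by_integrable_imp_integrable[where g = "\<lambda>_. B"])
  show "f \<in> borel_measurable (lebesgue_on {a..b})"
    using assms(1) by (simp add: borel_measurable_if_D measurable_completion measurable_restrict_space1)
qed (use assms in auto)

text \<open>The support function stands for the gauge so that one notion serves both signs: with the
  polar turned by -\<pi>/2 this is \<open>curve_length\<close>, with the opposite turn it is the
  \<open>curve_length\<close> of the reversed curve.\<close>

definition len :: "complex set \<Rightarrow> real \<Rightarrow> real \<Rightarrow> (real \<Rightarrow> complex) \<Rightarrow> real" where
  "len Q a b c = integral {a..b} (\<lambda>t. supp Q (vector_derivative c (at t)) / Im (c t))"

lemma curve_Im_bounds:
  fixes c :: "real \<Rightarrow> complex"
  assumes "continuous_on {a..b} c" "c ` {a..b} \<subseteq> G"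
  obtains m M where "0 < m" "\<And>t. t \<in> {a..b} \<Longrightarrow> m \<le> Im (c t)" "\<And>t. t \<in> {a..b} \<Longrightarrow> Im (c t) \<le> M"
proof (cases "a \<le> b")
  case True
  have c: "continuous_on {a..b} (\<lambda>t. Im (c t))" using assms(1) by (intro continuous_intros)
  have ne: "compact {a..b}" "{a..b} \<noteq> {}" using True by auto
  obtain s where s: "s \<in> {a..b}" "\<And>t. t \<in> {a..b} \<Longrightarrow> Im (c s) \<le> Im (c t)"
    using continuous_attains_inf[OF ne c] by blast
  obtain r where r: "r \<in> {a..b}" "\<And>t. t \<in> {a..b} \<Longrightarrow> Im (c t) \<le> Im (c r)"
    using continuous_attains_sup[OF ne c] by blast
  have "Im (c s) > 0" using s(1) assms(2) by (simp add: G_def image_subset_iff)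
  then show ?thesis using that[of "Im (c s)" "Im (c r)"] s r by blast
next
  case False
  show ?thesis by (rule that[of 1 1]) (use False in auto)
qed

context body
begin

lemma speed_integrable:
  assumes lip: "K-lipschitz_on {a..b} c" and sub: "c ` {a..b} \<subseteq> G"
  shows "(\<lambda>t. supp Q (vector_derivative c (at t)) / Im (c t)) integrable_on {a..b}"
proof (cases "a \<le> b")
  case True
  obtain D N where D: "D \<in> borel_measurable borel" "\<And>t. norm (D t) \<le> K" "negligible N"
    "\<And>t. t \<in> {a<..<b} \<Longrightarrow> t \<notin> N \<Longrightarrow> (c has_vector_derivative D t) (at t)"
    by (rule lipschitz_derivative_on[OF lip]) (rule that)
  obtain m M where m: "0 < m" "\<And>t. t \<in> {a..b} \<Longrightarrow> m \<le> Im (c t)"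
    by (rule curve_Im_bounds[OF lipschitz_on_continuous_on[OF lip] sub]) (rule that)
  obtain B where B: "B > 0" "\<And>v. supp Q v \<le> B * norm v" by (rule supp_bound) (rule that)
  define f where "f t = supp Q (D t) / Im (c (clamp1 a b t))" for t
  have "continuous_on UNIV (\<lambda>t. c (clamp1 a b t))"
    using lipschitz_on_continuous_on[OF lipschitz_clamp1[OF lip True]] .
  then have cm: "(\<lambda>t. c (clamp1 a b t)) \<in> borel_measurable borel"
    by (rule borel_measurable_continuous_onI)
  have "f integrable_on {a..b}"
  proof (rule bounded_borel_integrable)
    have "(\<lambda>t. supp Q (D t)) \<in> borel_measurable borel"
      using measurable_compose[OF D(1) borel_measurable_supp] .
    moreover have "(\<lambda>t. Im (c (clamp1 a b t))) \<in> borel_measurable borel" using cm by simp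
    ultimately show "f \<in> borel_measurable borel" unfolding f_def by (rule borel_measurable_divide)
    fix t assume t: "t \<in> {a..b}"
    have "supp Q (D t) \<le> B * K" using B(2)[of "D t"] D(2)[of t] B(1)
      by (meson mult_left_mono less_imp_le order_trans)
    then have "supp Q (D t) / Im (c t) \<le> B * K / m"
      using m(1) m(2)[OF t] supp_nonneg[of "D t"] by (intro frac_le) auto
    then show "\<bar>f t\<bar> \<le> B * K / m"
      using t m(1) m(2)[OF t] supp_nonneg[of "D t"] by (simp add: f_def)
  qed
  then show ?thesis
  proof (rule integrable_spike)
    show "negligible (N \<union> {a,b})" using D(3) by auto
    fix t assume t: "t \<in> {a..b} - (N \<union> {a,b})"
    then have "vector_derivative c (at t) = D t" using D(4)[of t] vector_derivative_at by auto
    then show "supp Q (vector_derivative c (at t)) / Im (c t) = f t" using t by (simp add: f_def)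
  qed
qed auto

lemma lipschitz_sub: "K-lipschitz_on {a..b} c \<Longrightarrow> a \<le> u \<Longrightarrow> v \<le> b \<Longrightarrow> K-lipschitz_on {u..v} (c :: real \<Rightarrow> complex)"
  by (rule lipschitz_on_subset) auto

lemma len_combine:
  assumes lip: "K-lipschitz_on {a..b} c" and sub: "c ` {a..b} \<subseteq> G" and "a \<le> u" "u \<le> v" "v \<le> b"
  shows "len Q a v c = len Q a u c + len Q u v c"
  unfolding len_def
proof (rule Henstock_Kurzweil_Integration.integral_combine[symmetric])
  show "(\<lambda>t. supp Q (vector_derivative c (at t)) / Im (c t)) integrable_on {a..v}"
    by (rule speed_integrable[OF lipschitz_sub[OF lip]]) (use assms in auto)
qed (use assms in auto)

text \<open>A point of \<open>Q\<close> that attains the support function on the chord is a linear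
  functional. It integrates along the curve exactly to the chord and is dominated pointwise by the
  speed times the height.\<close>

lemma supp_chord_le:
  assumes lip: "K-lipschitz_on {u..v} c" and sub: "c ` {u..v} \<subseteq> G" and uv: "u \<le> v"
    and M: "\<And>t. t \<in> {u..v} \<Longrightarrow> Im (c t) \<le> M"
  shows "supp Q (c v - c u) \<le> M * len Q u v c"
proof -
  obtain D N where D: "D \<in> borel_measurable borel" "\<And>t. norm (D t) \<le> K" "negligible N"
    "\<And>t. t \<in> {u<..<v} \<Longrightarrow> t \<notin> N \<Longrightarrow> (c has_vector_derivative D t) (at t)"
    "\<And>p q. u \<le> p \<Longrightarrow> p \<le> q \<Longrightarrow> q \<le> v \<Longrightarrow> (D has_integral (c q - c p)) {p..q}"
    by (rule lipschitz_derivative_on[OF lip]) (rule that)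
  obtain z where z: "z \<in> Q" "det2 z (c v - c u) = supp Q (c v - c u)" by (rule supp_attained)
  have "bounded_linear (\<lambda>w. det2 z w)"
    by (subst linear_conv_bounded_linear[symmetric]) (auto intro!: linearI simp: det2_simps)
  from has_integral_linear[OF D(5)[OF order_refl uv order_refl] this]
  have "((\<lambda>t. det2 z (D t)) has_integral supp Q (c v - c u)) {u..v}"
    unfolding o_def z(2) .
  then have 1: "((\<lambda>t. det2 z (vector_derivative c (at t))) has_integral supp Q (c v - c u)) {u..v}"
  proof (rule has_integral_spike[rotated 2])
    show "negligible (N \<union> {u,v})" using D(3) by auto
    fix t assume t: "t \<in> {u..v} - (N \<union> {u,v})"
    then show "det2 z (vector_derivative c (at t)) = det2 z (D t)"
      using vector_derivative_at[OF D(4)[of t]] by simp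
  qed
  have 2: "((\<lambda>t. M * (supp Q (vector_derivative c (at t)) / Im (c t))) has_integral M * len Q u v c) {u..v}"
    unfolding len_def
    by (intro has_integral_mult_right integrable_integral speed_integrable[OF lip sub])
  show ?thesis
  proof (rule has_integral_le[OF 1 2])
    fix t assume t: "t \<in> {u..v}"
    then have pos: "Im (c t) > 0" using sub by (simp add: G_def image_subset_iff)
    let ?v = "vector_derivative c (at t)"
    have "supp Q ?v * Im (c t) \<le> supp Q ?v * M" by (intro mult_left_mono M t supp_nonneg)
    then have "supp Q ?v \<le> M * (supp Q ?v / Im (c t))" using pos by (simp add: field_simps)
    then show "det2 z ?v \<le> M * (supp Q ?v / Im (c t))" using supp_ge[OF z(1), of ?v] by linarith
  qed
qed

text \<open>The length is the smallest additive function of intervals that dominates the chords; this is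
  what makes it independent of the parametrization, which need not be bi-Lipschitz.\<close>

lemma len_le_of_chords:
  assumes lip: "K-lipschitz_on {a..b} c" and sub: "c ` {a..b} \<subseteq> G" and ab: "a \<le> b"
    and mono: "\<And>u v. a \<le> u \<Longrightarrow> u \<le> v \<Longrightarrow> v \<le> b \<Longrightarrow> H u \<le> (H v :: real)"
    and chord: "\<And>u v M. a \<le> u \<Longrightarrow> u \<le> v \<Longrightarrow> v \<le> b \<Longrightarrow> (\<And>t. t \<in> {u..v} \<Longrightarrow> Im (c t) \<le> M)
      \<Longrightarrow> supp Q (c v - c u) \<le> M * (H v - H u)"
  shows "len Q a b c \<le> H b - H a"
proof -
  obtain D N where D: "D \<in> borel_measurable borel" "\<And>t. norm (D t) \<le> K" "negligible N"
    "\<And>t. t \<in> {a<..<b} \<Longrightarrow> t \<notin> N \<Longrightarrow> (c has_vector_derivative D t) (at t)"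
    by (rule lipschitz_derivative_on[OF lip]) (rule that)
  obtain m M0 where m: "0 < m" "\<And>t. t \<in> {a..b} \<Longrightarrow> m \<le> Im (c t)"
    by (rule curve_Im_bounds[OF lipschitz_on_continuous_on[OF lip] sub]) (rule that)
  obtain B where B: "B > 0" "\<And>v. supp Q v \<le> B * norm v" by (rule supp_bound) (rule that)
  define Z where "Z = N \<union> {a,b}"
  have negZ: "negligible Z" using D(3) by (auto simp: Z_def)
  \<comment> \<open>With value 0 on the null set \<open>Z\<close>, tags without a usable derivative
    contribute nothing to Riemann sums.\<close>
  define f where "f t = (if t \<in> Z then 0 else supp Q (D t) / Im (c t))" for t
  have fint: "(f has_integral len Q a b c) {a..b}"
    unfolding len_def
  proof (rule has_integral_spike[OF negZ _ integrable_integral[OF speed_integrable[OF lip sub]]])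
    fix t assume t: "t \<in> {a..b} - Z"
    then show "f t = supp Q (vector_derivative c (at t)) / Im (c t)"
      using vector_derivative_at[OF D(4)[of t]] by (simp add: f_def Z_def)
  qed
  define T where "T = H b - H a"
  have T0: "T \<ge> 0" using mono[of a b] ab by (simp add: T_def)
  have key: "len Q a b c \<le> \<eta> + (1 + \<eta> / m) * T + (B * \<eta> / m) * (b - a)" if \<eta>: "\<eta> > 0" for \<eta>
  proof -
    \<comment> \<open>At a point of differentiability the chord over a short interval is (v - u) D x
      up to an error of order \<eta> (v - u), and the height changes by less than \<eta>. The chord
      hypothesis then bounds the speed by the increment of \<open>H\<close>, up to a factor that
      tends to 1 with \<eta>.\<close>
    have "\<exists>d>0. \<forall>u v. a \<le> u \<longrightarrow> v \<le> b \<longrightarrow> u \<le> x \<longrightarrow> x \<le> v \<longrightarrow> {u..v} \<subseteq> ball x d \<longrightarrow>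
       f x * (v - u) \<le> (1 + \<eta> / m) * (H v - H u) + (B * \<eta> / m) * (v - u)" for x
    proof (cases "x \<in> {a..b} - Z")
      case False
      have "f x * (v - u) \<le> (1 + \<eta> / m) * (H v - H u) + (B * \<eta> / m) * (v - u)"
        if uv: "a \<le> u" "v \<le> b" "u \<le> x" "x \<le> v" for u v
      proof -
        have "x \<in> Z" using False uv by auto
        moreover have "0 \<le> (1 + \<eta> / m) * (H v - H u)" using mono[of u v] uv m \<open>\<eta> > 0\<close> by simp
        moreover have "0 \<le> (B * \<eta> / m) * (v - u)" using m uv \<open>\<eta> > 0\<close> B by simp
        ultimately show ?thesis by (simp add: f_def)
      qed
      then show ?thesis by (meson zero_less_one)
    next
      case True
      then have x: "x \<in> {a<..<b}" "x \<notin> N" by (auto simp: Z_def)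
      have der: "(c has_vector_derivative D x) (at x)" using D(4) x by blast
      obtain d1 where d1: "d1 > 0"
        "\<And>y. norm (y - x) < d1 \<Longrightarrow> norm (c y - c x - (y - x) *\<^sub>R D x) \<le> \<eta> * norm (y - x)"
        using der \<eta> unfolding has_vector_derivative_def has_derivative_at_alt by metis
      have "isCont (\<lambda>t. Im (c t)) x"
        by (rule continuous_Im[OF has_vector_derivative_continuous[OF der]])
      then obtain d2 where d2: "d2 > 0" "\<And>y. dist y x < d2 \<Longrightarrow> dist (Im (c y)) (Im (c x)) < \<eta>"
        using \<eta> unfolding continuous_at_eps_delta by metis
      show ?thesis
      proof (intro exI[of _ "min d1 d2"] conjI allI impI)
        show "min d1 d2 > 0" using d1 d2 by simp
        fix u v assume uv: "a \<le> u" "v \<le> b" "u \<le> x" "x \<le> v" "{u..v} \<subseteq> ball x (min d1 d2)"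
        let ?y = "Im (c x)"
        have y: "?y \<ge> m" using m(2)[of x] True by auto
        have nu: "norm (u - x) < d1" "norm (v - x) < d1"
          using subsetD[OF uv(5), of u] subsetD[OF uv(5), of v] uv(3,4)
          by (auto simp: dist_real_def abs_minus_commute)
        have "supp Q (c v - c u) \<le> (?y + \<eta>) * (H v - H u)"
        proof (rule chord)
          fix t assume "t \<in> {u..v}"
          then have "dist t x < d2" using uv(5) by (auto simp: subset_eq dist_commute)
          from d2(2)[OF this] show "Im (c t) \<le> ?y + \<eta>" by (simp add: dist_real_def)
        qed (use uv in auto)
        moreover have "supp Q (D x) * (v - u) \<le> supp Q (c v - c u) + B * \<eta> * (v - u)"
        proof -
          let ?e = "(v - u) *\<^sub>R D x - (c v - c u)"
          have "?e = (c u - c x - (u - x) *\<^sub>R D x) - (c v - c x - (v - x) *\<^sub>R D x)"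
            by (simp add: algebra_simps)
          then have "norm ?e \<le> norm (c u - c x - (u - x) *\<^sub>R D x) + norm (c v - c x - (v - x) *\<^sub>R D x)"
            by (simp only: norm_triangle_ineq4)
          then have "norm ?e \<le> \<eta> * norm (u - x) + \<eta> * norm (v - x)"
            using d1(2)[OF nu(1)] d1(2)[OF nu(2)] by linarith
          then have ne: "norm ?e \<le> \<eta> * (v - u)" using uv by (simp add: algebra_simps)
          have "supp Q (D x) * (v - u) = supp Q ((v - u) *\<^sub>R D x)"
            using supp_scaleR[of "v - u" "D x"] uv by (simp add: mult.commute)
          also have "\<dots> \<le> supp Q (c v - c u) + supp Q ?e"
            using supp_add[of "c v - c u" ?e] by simp
          also have "supp Q ?e \<le> B * (\<eta> * (v - u))"
            using B(2)[of ?e] mult_left_mono[OF ne] B(1) by (meson less_imp_le order_trans)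
          finally show ?thesis by (simp add: mult.assoc)
        qed
        ultimately have le: "supp Q (D x) * (v - u) \<le> (?y + \<eta>) * (H v - H u) + B * \<eta> * (v - u)"
          by linarith
        have "f x * (v - u) = (supp Q (D x) * (v - u)) / ?y" using True by (simp add: f_def)
        also have "\<dots> \<le> ((?y + \<eta>) * (H v - H u) + B * \<eta> * (v - u)) / ?y"
          using y m by (intro divide_right_mono le) auto
        also have "\<dots> = (1 + \<eta> / ?y) * (H v - H u) + (B * \<eta> / ?y) * (v - u)"
          using y m by (simp add: field_simps)
        also have "\<dots> \<le> (1 + \<eta> / m) * (H v - H u) + (B * \<eta> / m) * (v - u)"
          using mono[of u v] uv y m(1) \<eta> B(1)
          by (intro add_mono mult_right_mono divide_left_mono mult_pos_pos) auto
        finally show "f x * (v - u) \<le> (1 + \<eta> / m) * (H v - H u) + (B * \<eta> / m) * (v - u)" .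
      qed
    qed
    then obtain d where d: "\<And>x. d x > 0" "\<And>x u v. a \<le> u \<Longrightarrow> v \<le> b \<Longrightarrow> u \<le> x \<Longrightarrow> x \<le> v \<Longrightarrow>
       {u..v} \<subseteq> ball x (d x) \<Longrightarrow> f x * (v - u) \<le> (1 + \<eta> / m) * (H v - H u) + (B * \<eta> / m) * (v - u)"
      by metis
    \<comment> \<open>On a division fine for both gauges the Riemann sum approximates the length,
      while the increments of \<open>H\<close> telescope to \<open>T\<close>.\<close>
    have g1: "gauge (\<lambda>x. ball x (d x))" using d(1) by (rule gauge_ball_dependent[rule_format])
    obtain g2 where g2: "gauge g2" "\<And>p. p tagged_division_of {a..b} \<Longrightarrow> g2 fine p \<Longrightarrow>
        norm ((\<Sum>(x,k)\<in>p. Henstock_Kurzweil_Integration.content k *\<^sub>R f x) - len Q a b c) < \<eta>"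
      using fint \<eta> unfolding has_integral_real by metis
    obtain p where p: "p tagged_division_of {a..b}" "(\<lambda>x. ball x (d x) \<inter> g2 x) fine p"
      using fine_division_exists_real[OF gauge_Int[OF g1 g2(1)]] by blast
    have "len Q a b c < (\<Sum>(x,k)\<in>p. Henstock_Kurzweil_Integration.content k *\<^sub>R f x) + \<eta>"
      using g2(2)[OF p(1)] p(2) by (auto simp: fine_Int)
    also have "(\<Sum>(x,k)\<in>p. Henstock_Kurzweil_Integration.content k *\<^sub>R f x) \<le>
        (\<Sum>(x,k)\<in>p. (1 + \<eta> / m) * (H (Sup k) - H (Inf k)) + (B * \<eta> / m) * (Sup k - Inf k))"
    proof (rule sum_mono, clarify)
      fix x k assume xk: "(x,k) \<in> p"
      then obtain u v where uv: "k = {u..v}" "x \<in> {u..v}" "{u..v} \<subseteq> {a..b}"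
        using p(1) by (metis tagged_division_ofD(2,3,4) cbox_interval)
      then have "u \<le> v" by auto
      have "{u..v} \<subseteq> ball x (d x)" using p(2) xk uv by (auto simp: fine_def)
      then have "f x * (v - u) \<le> (1 + \<eta> / m) * (H v - H u) + (B * \<eta> / m) * (v - u)"
        using uv \<open>u \<le> v\<close> by (intro d(2)) auto
      then show "Henstock_Kurzweil_Integration.content k *\<^sub>R f x \<le>
          (1 + \<eta> / m) * (H (Sup k) - H (Inf k)) + (B * \<eta> / m) * (Sup k - Inf k)"
        using \<open>u \<le> v\<close> by (simp add: uv(1) mult.commute)
    qed
    also have "\<dots> = (1 + \<eta> / m) * T + (B * \<eta> / m) * (b - a)"
    proof -
      have "(\<Sum>(x,k)\<in>p. (1 + \<eta> / m) * (H (Sup k) - H (Inf k)) + (B * \<eta> / m) * (Sup k - Inf k))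
        = (1 + \<eta> / m) * (\<Sum>(x,k)\<in>p. H (Sup k) - H (Inf k)) + (B * \<eta> / m) * (\<Sum>(x,k)\<in>p. Sup k - Inf k)"
        by (simp add: sum.distrib sum_distrib_left case_prod_unfold)
      then show ?thesis
        using additive_tagged_division_1[OF ab p(1), of H] additive_tagged_division_1[OF ab p(1), of "\<lambda>x. x"]
        by (simp add: T_def)
    qed
    finally show ?thesis by simp
  qed
  have "((\<lambda>\<eta>. \<eta> + (1 + \<eta> / m) * T + (B * \<eta> / m) * (b - a)) \<longlongrightarrow> 0 + (1 + 0 / m) * T + (B * 0 / m) * (b - a)) (at_right 0)"
    using m by (intro tendsto_intros) auto
  then have "((\<lambda>\<eta>. \<eta> + (1 + \<eta> / m) * T + (B * \<eta> / m) * (b - a)) \<longlongrightarrow> T) (at_right 0)" by simp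
  moreover have "\<forall>\<^sub>F \<eta> in at_right 0. len Q a b c \<le> \<eta> + (1 + \<eta> / m) * T + (B * \<eta> / m) * (b - a)"
    using key eventually_at_right_less by (metis (mono_tags, lifting) eventually_mono)
  ultimately show ?thesis unfolding T_def
    by (rule tendsto_lowerbound) simp
qed

lemma len_mono:
  assumes lip: "K-lipschitz_on {a..b} c" and sub: "c ` {a..b} \<subseteq> G" and "a \<le> u" "u \<le> v" "v \<le> b"
  shows "len Q a u c \<le> len Q a v c"
proof -
  have "0 \<le> len Q u v c" unfolding len_def
  proof (rule Henstock_Kurzweil_Integration.integral_nonneg)
    show "(\<lambda>t. supp Q (vector_derivative c (at t)) / Im (c t)) integrable_on {u..v}"
      by (rule speed_integrable[OF lipschitz_sub[OF lip]]) (use assms in auto)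
    fix t assume "t \<in> {u..v}"
    then have "t \<in> {a..b}" using assms(3,5) by auto
    then have "Im (c t) > 0" using sub by (simp add: G_def image_subset_iff)
    then show "0 \<le> supp Q (vector_derivative c (at t)) / Im (c t)" using supp_nonneg by simp
  qed
  then show ?thesis using len_combine[OF assms] by simp
qed

text \<open>The change of parameter \<open>k\<close> is only monotone, so no chain rule applies.
  Instead, the accumulated length of \<open>c1\<close> composed with \<open>k\<close> is an additive
  function that dominates the chords of \<open>c2\<close>.\<close>

lemma len_reparam_le:
  assumes l1: "K1-lipschitz_on {a1..b1} c1" and l2: "K2-lipschitz_on {a2..b2} c2"
    and sub: "c1 ` {a1..b1} \<subseteq> G" and ab: "a2 \<le> b2"
    and k: "strict_mono_on {a2..b2} k" "k ` {a2..b2} = {a1..b1}"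
    and eq: "\<And>s. s \<in> {a2..b2} \<Longrightarrow> c2 s = c1 (k s)"
  shows "len Q a2 b2 c2 \<le> len Q a1 b1 c1"
proof -
  have kmem: "s \<in> {a2..b2} \<Longrightarrow> k s \<in> {a1..b1}" for s using k(2) by blast
  have kle: "k s \<le> k t \<longleftrightarrow> s \<le> t" if "s \<in> {a2..b2}" "t \<in> {a2..b2}" for s t
    using strict_mono_on_leD[OF k(1)] strict_mono_onD[OF k(1)] that by (metis linorder_not_less)
  have ends: "k a2 = a1" "k b2 = b1"
  proof -
    have "a1 \<le> b1" using kmem[of a2] ab by auto
    then obtain s t where st: "s \<in> {a2..b2}" "k s = a1" "t \<in> {a2..b2}" "k t = b1"
      using k(2) by (metis atLeastAtMost_iff imageE order_refl)
    then show "k a2 = a1" "k b2 = b1" using kle[of a2 s] kle[of t b2] kmem[of a2] kmem[of b2] ab by auto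
  qed
  have "len Q a2 b2 c2 \<le> len Q a1 (k b2) c1 - len Q a1 (k a2) c1"
  proof (rule len_le_of_chords[OF l2 _ ab])
    show "c2 ` {a2..b2} \<subseteq> G" using eq kmem sub by auto
    fix u v assume uv: "a2 \<le> u" "u \<le> v" "v \<le> b2"
    have kuv: "a1 \<le> k u" "k u \<le> k v" "k v \<le> b1" using uv kmem[of u] kmem[of v] kle[of u v] by auto
    show "len Q a1 (k u) c1 \<le> len Q a1 (k v) c1" by (rule len_mono[OF l1 sub kuv])
    fix M assume M: "\<And>t. t \<in> {u..v} \<Longrightarrow> Im (c2 t) \<le> M"
    have "supp Q (c1 (k v) - c1 (k u)) \<le> M * len Q (k u) (k v) c1"
    proof (rule supp_chord_le[OF lipschitz_sub[OF l1 kuv(1,3)] _ kuv(2)])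
      show "c1 ` {k u..k v} \<subseteq> G" using sub kuv by auto
      fix t assume t: "t \<in> {k u..k v}"
      then obtain s where s: "s \<in> {a2..b2}" "k s = t" using k(2) kuv
        by (metis atLeastAtMost_iff imageE order_trans)
      then have "s \<in> {u..v}" using t kle[of u s] kle[of s v] uv by auto
      then show "Im (c1 t) \<le> M" using M[of s] eq[OF s(1)] s by simp
    qed
    then show "supp Q (c2 v - c2 u) \<le> M * (len Q a1 (k v) c1 - len Q a1 (k u) c1)"
      using eq uv len_combine[OF l1 sub kuv] by simp
  qed
  then show ?thesis unfolding ends by (simp add: len_def)
qed

lemma len_reparam:
  assumes l1: "K1-lipschitz_on {a1..b1} c1" and l2: "K2-lipschitz_on {a2..b2} c2"
    and sub: "c1 ` {a1..b1} \<subseteq> G" and ab: "a2 \<le> b2"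
    and k: "strict_mono_on {a2..b2} k" "k ` {a2..b2} = {a1..b1}"
    and eq: "\<And>s. s \<in> {a2..b2} \<Longrightarrow> c2 s = c1 (k s)"
  shows "len Q a2 b2 c2 = len Q a1 b1 c1"
proof (rule antisym)
  show "len Q a2 b2 c2 \<le> len Q a1 b1 c1" by (rule len_reparam_le[OF assms])
  have inj: "inj_on k {a2..b2}" using k(1) strict_mono_on_imp_inj_on by blast
  define h where "h = inv_into {a2..b2} k"
  have hk: "h (k s) = s" if "s \<in> {a2..b2}" for s using that inj by (simp add: h_def)
  have kh: "k (h t) = t" "h t \<in> {a2..b2}" if "t \<in> {a1..b1}" for t
    using that k(2) f_inv_into_f[of t k "{a2..b2}"] inv_into_into[of t k "{a2..b2}"] by (simp_all add: h_def)
  have "k a2 \<in> {a1..b1}" using k(2) ab by auto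
  show "len Q a1 b1 c1 \<le> len Q a2 b2 c2"
  proof (rule len_reparam_le[OF l2 l1])
    show "c2 ` {a2..b2} \<subseteq> G" using eq k(2) sub by auto
    show "a1 \<le> b1" using \<open>k a2 \<in> {a1..b1}\<close> by auto
    show "strict_mono_on {a1..b1} h"
    proof (rule strict_mono_onI)
      fix r s assume rs: "r \<in> {a1..b1}" "s \<in> {a1..b1}" "r < s"
      show "h r < h s"
        using rs kh strict_mono_on_leD[OF k(1), of "h s" "h r"] by (metis linorder_not_less)
    qed
    show "h ` {a1..b1} = {a2..b2}"
      unfolding k(2)[symmetric] image_image using hk by simp
    show "c1 t = c2 (h t)" if "t \<in> {a1..b1}" for t using kh[OF that] eq by metis
  qed
qed

end

section \<open>Parametrizations of simple closed curves\<close>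

lemma unit_interval_affine_image:
  fixes a b :: real
  assumes "a < b" shows "(\<lambda>u. a + (b - a) * u) ` {0..1} = {a..b}"
proof -
  have "(\<lambda>u. a + (b - a) * u) = (\<lambda>u. (b - a) * u + a)" by (simp add: add.commute)
  then show ?thesis using assms by (simp only: image_affinity_atLeastAtMost) auto
qed

lemma unit_interval_affine_mem:
  fixes a b :: real
  assumes "a < b" "0 \<le> u" "u \<le> 1" shows "a + (b - a) * u \<in> {a..b}"
  using unit_interval_affine_image[OF assms(1)] assms(2,3) by (metis atLeastAtMost_iff imageI)

lemma unit_path_image: "a < b \<Longrightarrow> path_image (unit_path a b c) = c ` {a..b}"
  unfolding path_image_def unit_path_def using unit_interval_affine_image[of a b] by (metis image_image)

lemma unit_path_path:
  assumes "a < b" "continuous_on {a..b} c" shows "path (unit_path a b c)"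
  unfolding path_def unit_path_def
proof (rule continuous_on_compose2[OF assms(2)])
  show "(\<lambda>u. a + (b - a) * u) ` {0..1} \<subseteq> {a..b}" using unit_interval_affine_image[OF assms(1)] by blast
qed (intro continuous_intros)

lemma inside_not_mem: "z \<in> inside \<gamma> \<Longrightarrow> z \<notin> \<gamma>"
  using inside_no_overlap by blast

lemma simple_lipschitz_param_iff:
  "simple_lipschitz_param \<gamma> a b c \<longleftrightarrow> a < b \<and> (\<exists>C. C-lipschitz_on {a..b} c) \<and>
     (\<forall>s\<in>{a..b}. \<forall>t\<in>{a..b}. c s = c t \<longrightarrow> s = t \<or> s = a \<and> t = b \<or> s = b \<and> t = a) \<and>
     c a = c b \<and> c ` {a..b} = \<gamma>"
proof -
  have lf: "simple_path (unit_path a b c) \<longleftrightarrow>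
    (\<forall>s\<in>{a..b}. \<forall>t\<in>{a..b}. c s = c t \<longrightarrow> s = t \<or> s = a \<and> t = b \<or> s = b \<and> t = a)"
    if ab: "a < b" and lip: "C-lipschitz_on {a..b} c" for C
  proof -
    have p: "path (unit_path a b c)"
      by (rule unit_path_path[OF ab lipschitz_on_continuous_on[OF lip]])
    have im: "{a..b} = (\<lambda>u. a + (b - a) * u) ` {0..1}"
      by (rule unit_interval_affine_image[OF ab, symmetric])
    have eqs: "a + (b - a) * u = a + (b - a) * v \<longleftrightarrow> u = v"
      "a + (b - a) * u = a \<longleftrightarrow> u = 0" "a + (b - a) * u = b \<longleftrightarrow> u = 1" for u v
    proof -
      show "a + (b - a) * u = a + (b - a) * v \<longleftrightarrow> u = v" "a + (b - a) * u = a \<longleftrightarrow> u = 0" using ab by auto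
      have "a + (b - a) * u - b = (b - a) * (u - 1)" by (simp add: algebra_simps)
      then show "a + (b - a) * u = b \<longleftrightarrow> u = 1" using ab
        by (metis diff_gt_0_iff_gt less_irrefl mult_eq_0_iff right_minus_eq)
    qed
    show ?thesis
      unfolding simple_path_def loop_free_def im ball_simps eqs
      using p by (simp add: unit_path_def)
  qed
  show ?thesis unfolding simple_lipschitz_param_def using lf by blast
qed

section \<open>Continuous logarithms, winding numbers and changes of parameter\<close>

lemma continuous_log_on_interval:
  fixes c :: "real \<Rightarrow> complex"
  assumes "continuous_on {a..b::real} c" "z \<notin> c ` {a..b}"
  obtains q where "continuous_on {a..b} q" "\<And>t. t \<in> {a..b} \<Longrightarrow> c t = z + exp (q t)"
proof -
  have contr: "contractible {a..b}" by (simp add: convex_imp_contractible)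
  have cont: "continuous_on {a..b} (\<lambda>t. c t - z)" using assms(1) by (intro continuous_intros)
  have nz: "c t - z \<noteq> 0" if "t \<in> {a..b}" for t using that assms(2) by auto
  obtain q where "continuous_on {a..b} q" "\<And>t. t \<in> {a..b} \<Longrightarrow> c t - z = exp (q t)"
    by (rule continuous_logarithm_on_contractible[OF cont contr]) (erule nz, rule that)
  then show ?thesis using that by (metis add.commute diff_add_cancel)
qed

text \<open>Expressing the winding number by the increment of a logarithm makes its behaviour under
  continuous changes of parameter, reversal and linear maps immediate, with no derivative
  involved.\<close>

lemma winding_of_log:
  assumes ab: "a < b" and q: "continuous_on {a..b} q" and c: "\<And>t. t \<in> {a..b} \<Longrightarrow> c t = z + exp (q t)"
  shows "winding_number (unit_path a b c) z = (q b - q a) / (2 * of_real pi * \<i>)"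
proof -
  note mem = unit_interval_affine_mem[OF ab]
  have "winding_number (unit_path a b c) z = winding_number (\<lambda>w. unit_path a b c w - z) 0"
    by (rule winding_number_offset)
  also have "\<dots> = winding_number (exp \<circ> unit_path a b q) 0"
    by (rule winding_number_cong) (simp add: unit_path_def c[OF mem])
  also have "\<dots> = (pathfinish (unit_path a b q) - pathstart (unit_path a b q)) / (2 * of_real pi * \<i>)"
    by (rule winding_number_compose_exp[OF unit_path_path[OF ab q]])
  finally show ?thesis by (simp add: pathfinish_def pathstart_def unit_path_def)
qed

text \<open>Continued with slope 1 on both sides, the function is monotone and onto the line, so its
  range is open and it cannot jump.\<close>

lemma strict_mono_onto_continuous:
  fixes m :: "real \<Rightarrow> real"
  assumes m: "strict_mono_on {a..b} m" "m ` {a..b} = {c..d}" and ab: "a \<le> b"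
  shows "continuous_on {a..b} m"
proof -
  define M where "M s = (if s < a then m a + (s - a) else if b < s then m b + (s - b) else m s)" for s
  have mle: "m s \<le> m t" if "s \<in> {a..b}" "t \<in> {a..b}" "s \<le> t" for s t
    using strict_mono_on_leD[OF m(1)] that by blast
  have "surj M"
    unfolding surj_def
  proof
    fix y
    consider "y < m a" | "y > m b" | "y \<in> {m a..m b}" by fastforce
    then show "\<exists>x. y = M x"
    proof cases
      case 1 then have "y = M (a + y - m a)" by (simp add: M_def)
      then show ?thesis by blast
    next
      case 2 then have "y = M (b + y - m b)" using ab by (simp add: M_def)
      then show ?thesis by blast
    next
      case 3
      have "m a \<in> {c..d}" "m b \<in> {c..d}" using m(2) ab by auto
      then have "y \<in> m ` {a..b}" using 3 m(2) by auto
      then obtain x where "x \<in> {a..b}" "y = m x" by blast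
      then have "y = M x" by (simp add: M_def)
      then show ?thesis by blast
    qed
  qed
  have "continuous_on UNIV M"
  proof (rule continuous_onI_mono)
    show "open (range M)" using \<open>surj M\<close> by simp
    fix s t :: real assume "s \<le> t"
    then show "M s \<le> M t"
      using mle[of s t] mle[of a t] mle[of s b] mle[of a b] ab
      by (auto simp: M_def not_less)
  qed
  then have "continuous_on {a..b} M" using continuous_on_subset by blast
  then show ?thesis by (rule continuous_on_eq) (simp add: M_def)
qed

lemma inside_param_nonempty:
  assumes "simple_lipschitz_param \<gamma> a b c"
  shows "inside \<gamma> \<noteq> {}"
proof -
  have p: "simple_path (unit_path a b c)" "pathfinish (unit_path a b c) = pathstart (unit_path a b c)"
    "path_image (unit_path a b c) = \<gamma>"
    using assms unit_path_image[of a b c]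
    by (auto simp: simple_lipschitz_param_def pathfinish_def pathstart_def unit_path_def)
  show ?thesis using Jordan_inside_outside[OF p(1,2)] p(3) by simp
qed

text \<open>The map \<open>k\<close> is the inverse of \<open>c1\<close> composed with
  \<open>c2\<close>. On the open interval it is continuous and injective, hence strictly monotone,
  and equal orientation excludes the decreasing case.\<close>

lemma oriented_param_change:
  assumes o1: "oriented_param s \<gamma> a1 b1 c1" and o2: "oriented_param s \<gamma> a2 b2 c2" and base: "c1 a1 = c2 a2"
  obtains k where "strict_mono_on {a2..b2} k" "k ` {a2..b2} = {a1..b1}"
    "\<And>r. r \<in> {a2..b2} \<Longrightarrow> c2 r = c1 (k r)"
proof -
  have p1: "simple_lipschitz_param \<gamma> a1 b1 c1" and p2: "simple_lipschitz_param \<gamma> a2 b2 c2"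
    using o1 o2 by (auto simp: oriented_param_def)
  have ab1: "a1 < b1" and inj1: "\<And>r t. r \<in> {a1..b1} \<Longrightarrow> t \<in> {a1..b1} \<Longrightarrow> c1 r = c1 t \<Longrightarrow>
      r = t \<or> r = a1 \<and> t = b1 \<or> r = b1 \<and> t = a1" and e1: "c1 a1 = c1 b1" and im1: "c1 ` {a1..b1} = \<gamma>"
    using p1 unfolding simple_lipschitz_param_iff by blast+
  have ab2: "a2 < b2" and inj2: "\<And>r t. r \<in> {a2..b2} \<Longrightarrow> t \<in> {a2..b2} \<Longrightarrow> c2 r = c2 t \<Longrightarrow>
      r = t \<or> r = a2 \<and> t = b2 \<or> r = b2 \<and> t = a2" and e2: "c2 a2 = c2 b2" and im2: "c2 ` {a2..b2} = \<gamma>"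
    using p2 unfolding simple_lipschitz_param_iff by blast+
  have cont1: "continuous_on {a1..b1} c1" and cont2: "continuous_on {a2..b2} c2"
    using p1 p2 lipschitz_on_continuous_on unfolding simple_lipschitz_param_def by blast+
  \<comment> \<open>Only interior parameters are matched: at the base point \<open>c1\<close> has
    two preimages, so the values of \<open>k\<close> at the ends are assigned later.\<close>
  have "\<exists>t\<in>{a1<..<b1}. c1 t = c2 r" if r: "r \<in> {a2<..<b2}" for r
  proof -
    have "c2 r \<in> c1 ` {a1..b1}" using im1 im2 r by auto
    then obtain t where t: "t \<in> {a1..b1}" "c1 t = c2 r" by auto
    have "c2 r \<noteq> c2 a2" using inj2[of r a2] r ab2 by auto
    then have "t \<noteq> a1" "t \<noteq> b1" using t base e1 by auto
    with t show ?thesis by auto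
  qed
  then obtain k0 where k0: "\<And>r. r \<in> {a2<..<b2} \<Longrightarrow> k0 r \<in> {a1<..<b1}"
    "\<And>r. r \<in> {a2<..<b2} \<Longrightarrow> c1 (k0 r) = c2 r" by metis
  have k0uniq: "k0 r = t" if "r \<in> {a2<..<b2}" "t \<in> {a1..b1}" "c1 t = c2 r" for r t
    using inj1[of "k0 r" t] k0(1)[OF that(1)] k0(2)[OF that(1)] that by auto
  \<comment> \<open>A map into a compact interval is continuous if its graph is closed, and here the
    graph is the zero set of c2 r - c1 t.\<close>
  have contk: "continuous_on {a2<..<b2} k0"
  proof (subst continuous_closed_graph_eq[of "{a1..b1}"])
    show "compact {a1..b1}" by (rule compact_Icc)
    show "k0 \<in> {a2<..<b2} \<rightarrow> {a1..b1}" using k0(1) by force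
    let ?X = "{a2<..<b2} \<times> {a1..b1}"
    have "continuous_on ?X (\<lambda>x. c2 (fst x) - c1 (snd x))"
      by (intro continuous_on_diff continuous_on_compose2[OF cont2 continuous_on_fst[OF continuous_on_id]]
        continuous_on_compose2[OF cont1 continuous_on_snd[OF continuous_on_id]]) auto
    then have "closedin (top_of_set ?X) {x \<in> ?X. c2 (fst x) - c1 (snd x) = 0}"
      by (rule continuous_closedin_preimage_constant)
    moreover have "{x \<in> ?X. c2 (fst x) - c1 (snd x) = 0} = (\<lambda>r. (r, k0 r)) ` {a2<..<b2}"
    proof (rule set_eqI)
      fix x :: "real \<times> real"
      obtain r t where x: "x = (r,t)" by (cases x)
      show "x \<in> {x \<in> ?X. c2 (fst x) - c1 (snd x) = 0} \<longleftrightarrow> x \<in> (\<lambda>r. (r, k0 r)) ` {a2<..<b2}"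
        using k0uniq[of r t] k0[of r] by (auto simp: x)
    qed
    ultimately show "closedin (top_of_set ?X) ((\<lambda>r. (r, k0 r)) ` {a2<..<b2})" by simp
  qed
  have "inj_on k0 {a2<..<b2}"
  proof (rule inj_onI)
    fix r t assume rt: "r \<in> {a2<..<b2}" "t \<in> {a2<..<b2}" "k0 r = k0 t"
    then have "c2 r = c2 t" using k0(2) by metis
    then show "r = t" using inj2[of r t] rt by auto
  qed
  then consider "strict_mono_on {a2<..<b2} k0" | "strict_antimono_on {a2<..<b2} k0"
    using injective_eq_monotone_map[OF _ contk] is_interval_oo by blast
  then show ?thesis
  proof cases
    case 1
    define k where "k r = (if r = a2 then a1 else if r = b2 then b1 else k0 r)" for r
    have kk: "k r = k0 r" if "r \<in> {a2<..<b2}" for r using that by (auto simp: k_def)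
    have k_ends: "k a2 = a1" "k b2 = b1" using ab2 by (auto simp: k_def)
    show ?thesis
    proof
      show "strict_mono_on {a2..b2} k"
      proof (rule strict_mono_onI)
        fix r t assume rt: "r \<in> {a2..b2}" "t \<in> {a2..b2}" "r < t"
        show "k r < k t"
        proof (cases "r = a2")
          case True
          then show ?thesis using rt k0(1)[of t] ab1 by (cases "t = b2") (auto simp: k_def)
        next
          case False
          then show ?thesis using rt k0(1)[of r] strict_mono_onD[OF 1, of r t]
            by (cases "t = b2") (auto simp: k_def)
        qed
      qed
      show "c2 r = c1 (k r)" if "r \<in> {a2..b2}" for r
        using that k0(2)[of r] base e1 e2 by (auto simp: k_def)
      show "k ` {a2..b2} = {a1..b1}"
      proof
        show "k ` {a2..b2} \<subseteq> {a1..b1}"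
        proof
          fix y assume "y \<in> k ` {a2..b2}"
          then obtain r where "r \<in> {a2..b2}" "y = k r" by blast
          then show "y \<in> {a1..b1}" using k0(1)[of r] ab1 by (auto simp: k_def)
        qed
        show "{a1..b1} \<subseteq> k ` {a2..b2}"
        proof
          fix t assume t: "t \<in> {a1..b1}"
          show "t \<in> k ` {a2..b2}"
          proof (cases "t = a1 \<or> t = b1")
            case True
            then show ?thesis using k_ends ab2 by (metis atLeastAtMost_iff image_eqI less_imp_le order_refl)
          next
            case False
            have "c1 t \<in> c2 ` {a2..b2}" using t im1 im2 by auto
            then obtain r where r: "r \<in> {a2..b2}" "c1 t = c2 r" by auto
            have "c1 t \<noteq> c1 a1" using inj1[of t a1] t False ab1 by auto
            then have "r \<noteq> a2" "r \<noteq> b2" using r base e2 by auto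
            then have "r \<in> {a2<..<b2}" using r by auto
            then show ?thesis using k0uniq[of r t] t r kk[of r] by (metis image_eqI)
          qed
        qed
      qed
    qed
  next
    case 2
    \<comment> \<open>In the decreasing case \<open>c2\<close> runs through \<open>c1\<close>
      backwards. Composing a logarithm along \<open>c1\<close> with \<open>k\<close> negates its
      increment, so the two winding numbers would be opposite.\<close>
    have anti: "k0 t < k0 r" if "r \<in> {a2<..<b2}" "t \<in> {a2<..<b2}" "r < t" for r t
      using monotone_onD[OF 2] that by blast
    define k where "k r = (if r = a2 then b1 else if r = b2 then a1 else k0 r)" for r
    have k_ends: "k a2 = b1" "k b2 = a1" using ab2 by (auto simp: k_def)
    have kk: "k r = k0 r" if "r \<in> {a2<..<b2}" for r using that by (auto simp: k_def)
    have ck: "c2 r = c1 (k r)" if "r \<in> {a2..b2}" for r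
      using that k0(2)[of r] base e1 e2 by (auto simp: k_def)
    have kim: "k ` {a2..b2} = {a1..b1}"
    proof
      show "k ` {a2..b2} \<subseteq> {a1..b1}"
      proof
        fix y assume "y \<in> k ` {a2..b2}"
        then obtain r where "r \<in> {a2..b2}" "y = k r" by blast
        then show "y \<in> {a1..b1}" using k0(1)[of r] ab1 by (auto simp: k_def)
      qed
      show "{a1..b1} \<subseteq> k ` {a2..b2}"
      proof
        fix t assume t: "t \<in> {a1..b1}"
        show "t \<in> k ` {a2..b2}"
        proof (cases "t = a1 \<or> t = b1")
          case True
          then show ?thesis using k_ends ab2 by (metis atLeastAtMost_iff image_eqI less_imp_le order_refl)
        next
          case False
          have "c1 t \<in> c2 ` {a2..b2}" using t im1 im2 by auto
          then obtain r where r: "r \<in> {a2..b2}" "c1 t = c2 r" by auto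
          have "c1 t \<noteq> c1 a1" using inj1[of t a1] t False ab1 by auto
          then have "r \<noteq> a2" "r \<noteq> b2" using r base e2 by auto
          then have "r \<in> {a2<..<b2}" using r by auto
          then show ?thesis using k0uniq[of r t] t r kk[of r] by (metis image_eqI)
        qed
      qed
    qed
    have "strict_mono_on {a2..b2} (\<lambda>r. - k r)"
    proof (rule strict_mono_onI)
      fix r t assume rt: "r \<in> {a2..b2}" "t \<in> {a2..b2}" "r < t"
      show "- k r < - k t"
      proof (cases "r = a2")
        case True
        then show ?thesis using rt k0(1)[of t] ab1 by (cases "t = b2") (auto simp: k_def)
      next
        case False
        then show ?thesis using rt k0(1)[of r] anti[of r t]
          by (cases "t = b2") (auto simp: k_def)
      qed
    qed
    moreover have "(\<lambda>r. - k r) ` {a2..b2} = {-b1..-a1}"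
      using kim by (metis (no_types) image_image image_uminus_atLeastAtMost)
    ultimately have "continuous_on {a2..b2} (\<lambda>r. - k r)"
      using ab2 by (intro strict_mono_onto_continuous) auto
    then have kc: "continuous_on {a2..b2} k" using continuous_on_minus by fastforce
    obtain z where z: "z \<in> inside \<gamma>" using inside_param_nonempty[OF p1] by blast
    have zn: "z \<notin> c1 ` {a1..b1}" using z im1 inside_no_overlap by blast
    obtain q where q: "continuous_on {a1..b1} q" "\<And>t. t \<in> {a1..b1} \<Longrightarrow> c1 t = z + exp (q t)"
      by (rule continuous_log_on_interval[OF cont1 zn]) (rule that)
    have w1: "winding_number (unit_path a1 b1 c1) z = (q b1 - q a1) / (2 * of_real pi * \<i>)"
      by (rule winding_of_log[OF ab1 q])
    have "continuous_on {a2..b2} (\<lambda>r. q (k r))"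
      by (rule continuous_on_compose2[OF q(1) kc]) (use kim in auto)
    then have w2: "winding_number (unit_path a2 b2 c2) z = (q (k b2) - q (k a2)) / (2 * of_real pi * \<i>)"
      by (rule winding_of_log[OF ab2]) (use kim ck q(2) in \<open>metis image_eqI\<close>)
    have "winding_number (unit_path a2 b2 c2) z = - winding_number (unit_path a1 b1 c1) z"
      unfolding w1 w2 k_ends by (simp add: field_simps)
    moreover have "winding_number (unit_path a1 b1 c1) z = of_real (sign_val s)"
      "winding_number (unit_path a2 b2 c2) z = of_real (sign_val s)"
      using o1 o2 z by (auto simp: oriented_param_def)
    ultimately show ?thesis by (cases s) auto
  qed
qed

section \<open>Change of base point and of orientation\<close>

lemma has_vector_derivative_shift_arg:
  fixes c :: "real \<Rightarrow> complex"
  shows "((\<lambda>t. c (t + e)) has_vector_derivative v) (at y) \<longleftrightarrow> (c has_vector_derivative v) (at (y + e))"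
proof -
  have *: "((\<lambda>t. c (t + e)) has_vector_derivative v) (at y)" if "(c has_vector_derivative v) (at (y + e))"
    for c :: "real \<Rightarrow> complex" and e y
  proof -
    have "((\<lambda>t. t + e) has_vector_derivative 1) (at y)" by (auto intro!: derivative_eq_intros)
    from vector_diff_chain_at[OF this that] show ?thesis by (simp add: o_def)
  qed
  show ?thesis using *[of c y e] *[of "\<lambda>t. c (t + e)" "y + e" "- e"] by auto
qed

lemma has_vector_derivative_reflect_arg:
  fixes c :: "real \<Rightarrow> complex"
  shows "((\<lambda>t. c (- t)) has_vector_derivative v) (at y) \<longleftrightarrow> (c has_vector_derivative - v) (at (- y))"
proof -
  have *: "((\<lambda>t. c (- t)) has_vector_derivative - v) (at y)" if "(c has_vector_derivative v) (at (- y))"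
    for c :: "real \<Rightarrow> complex" and v y
  proof -
    have "((\<lambda>t. - t) has_vector_derivative - 1) (at y)" by (auto intro!: derivative_eq_intros)
    from vector_diff_chain_at[OF this that] show ?thesis by (simp add: o_def)
  qed
  show ?thesis using *[of c "-v" y] *[of "\<lambda>t. c (- t)" v "- y"] by auto
qed

lemma len_cong:
  assumes "\<And>t. t \<in> {a<..<b} \<Longrightarrow> c t = c' t"
  shows "len Q a b c = len Q a b c'"
  unfolding len_def
proof (rule integral_spike[of "{a,b}"])
  fix t assume t: "t \<in> {a..b} - {a,b}"
  have "vector_derivative c (at t) = vector_derivative c' (at t)"
    unfolding vector_derivative_def
    using has_vector_derivative_cong_open[of "{a<..<b}" t c c'] t assms by auto
  then show "supp Q (vector_derivative c' (at t)) / Im (c' t) = supp Q (vector_derivative c (at t)) / Im (c t)"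
    using assms[of t] t by auto
qed auto

lemma len_shift: "len Q (a - e) (b - e) (\<lambda>t. c (t + e)) = len Q a b c"
proof -
  have "vector_derivative (\<lambda>t. c (t + e)) (at t) = vector_derivative c (at (t + e))" for t
    unfolding vector_derivative_def has_vector_derivative_shift_arg ..
  then show ?thesis unfolding len_def
    using integral_shift_real_ivl[of a e b "\<lambda>t. supp Q (vector_derivative c (at t)) / Im (c t)"] by simp
qed

text \<open>Two parametrizations are comparable by \<open>oriented_param_change\<close> only from a
  common base point, and this provides it: the curve starts at \<tau> and wraps around at
  \<open>b\<close>.\<close>

lemma oriented_param_shift:
  assumes orient: "oriented_param s \<gamma> a b c" and \<tau>: "\<tau> \<in> {a..b}"
  defines "c' \<equiv> (\<lambda>t. if t \<le> b then c t else c (t - (b - a)))"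
  shows "oriented_param s \<gamma> \<tau> (\<tau> + (b - a)) c'"
proof -
  let ?p = "unit_path a b c" and ?u = "(\<tau> - a) / (b - a)" and ?p' = "unit_path \<tau> (\<tau> + (b - a)) c'"
  have p: "simple_lipschitz_param \<gamma> a b c" using orient by (auto simp: oriented_param_def)
  then obtain K where ab: "a < b" and lip: "K-lipschitz_on {a..b} c" and sp: "simple_path ?p"
    and e: "c a = c b" and im: "c ` {a..b} = \<gamma>"
    by (auto simp: simple_lipschitz_param_def)
  have u: "0 \<le> ?u" "?u \<le> 1" using ab \<tau> by auto
  have fs: "pathfinish ?p = pathstart ?p" using e by (simp add: pathfinish_def pathstart_def unit_path_def)
  have img: "path_image ?p = \<gamma>" using unit_path_image[OF ab] im by simp
  have eq: "?p' = shiftpath ?u ?p"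
  proof
    fix x
    have "?u + x \<le> 1 \<longleftrightarrow> (\<tau> - a) + x * (b - a) \<le> b - a"
      using ab by (simp add: field_simps)
    also have "\<dots> \<longleftrightarrow> \<tau> + (b - a) * x \<le> b" by (auto simp: algebra_simps)
    finally have 1: "?u + x \<le> 1 \<longleftrightarrow> \<tau> + (b - a) * x \<le> b" .
    have "(b - a) * ?u = \<tau> - a" using ab by simp
    then have 2: "(b - a) * (?u + x) = \<tau> - a + (b - a) * x"
      "(b - a) * (?u + x - 1) = \<tau> - a + (b - a) * x - (b - a)"
      by (auto simp: algebra_simps)
    show "?p' x = shiftpath ?u ?p x"
      unfolding shiftpath_def unit_path_def c'_def 1 2 by (auto simp: algebra_simps)
  qed
  have lip': "K-lipschitz_on {\<tau>..\<tau> + (b - a)} c'"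
    unfolding c'_def
  proof (rule lipschitz_on_concat)
    show "K-lipschitz_on {\<tau>..b} c" by (rule lipschitz_on_subset[OF lip]) (use \<tau> in auto)
    show "K-lipschitz_on {b..\<tau> + (b - a)} (\<lambda>t. c (t - (b - a)))"
    proof (rule lipschitz_onI)
      fix x y assume "x \<in> {b..\<tau> + (b - a)}" "y \<in> {b..\<tau> + (b - a)}"
      then show "dist (c (x - (b - a))) (c (y - (b - a))) \<le> K * dist x y"
        using lipschitz_onD[OF lip, of "x - (b - a)" "y - (b - a)"] \<tau> by (auto simp: dist_real_def)
    qed (rule lipschitz_on_nonneg[OF lip])
  qed (use e in simp)
  have img': "path_image ?p' = \<gamma>"
    unfolding eq by (subst path_image_shiftpath) (use u fs img in auto)
  have sp': "simple_path ?p'" unfolding eq by (rule simple_path_shiftpath[OF sp fs u])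
  have "simple_lipschitz_param \<gamma> \<tau> (\<tau> + (b - a)) c'"
    unfolding simple_lipschitz_param_def
  proof (intro conjI)
    show "c' \<tau> = c' (\<tau> + (b - a))" using \<tau> e ab by (auto simp: c'_def)
    show "c' ` {\<tau>..\<tau> + (b - a)} = \<gamma>"
      using img' unit_path_image[of \<tau> "\<tau> + (b - a)" c'] ab by simp
  qed (use ab lip' sp' in auto)
  moreover have "winding_number ?p' z = of_real (sign_val s)" if z: "z \<in> inside \<gamma>" for z
  proof -
    have "winding_number ?p' z = winding_number ?p z"
      unfolding eq
      by (rule winding_number_shiftpath)
         (use simple_path_imp_path[OF sp] img z inside_not_mem fs u in auto)
    then show ?thesis using orient z by (auto simp: oriented_param_def)
  qed
  ultimately show ?thesis by (simp add: oriented_param_def)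
qed

lemma oriented_param_reverse:
  assumes orient: "oriented_param s \<gamma> a b c" and s': "sign_val s' = - sign_val s"
  shows "oriented_param s' \<gamma> (- b) (- a) (\<lambda>t. c (- t))"
proof -
  let ?p = "unit_path a b c" and ?p' = "unit_path (- b) (- a) (\<lambda>t. c (- t))"
  obtain K where ab: "a < b" and lip: "K-lipschitz_on {a..b} c" and sp: "simple_path ?p"
    and e: "c a = c b" and im: "c ` {a..b} = \<gamma>"
    using orient by (auto simp: oriented_param_def simple_lipschitz_param_def)
  have eq: "?p' = reversepath ?p"
    by (auto simp: unit_path_def reversepath_def algebra_simps intro!: ext arg_cong[of _ _ c])
  have "uminus ` {-b..-a} = {a..b}" by simp
  then have im': "(\<lambda>t. c (- t)) ` {-b..-a} = \<gamma>" using im by (metis image_image)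
  have img: "path_image ?p = \<gamma>" using unit_path_image[OF ab] im by simp
  show ?thesis
    unfolding oriented_param_def simple_lipschitz_param_def
  proof (intro conjI ballI)
    have "K-lipschitz_on {-b..-a} (\<lambda>t. c (- t))"
    proof (rule lipschitz_onI)
      fix x y assume "x \<in> {-b..-a}" "y \<in> {-b..-a}"
      then show "dist (c (- x)) (c (- y)) \<le> K * dist x y"
        using lipschitz_onD[OF lip, of "- x" "- y"] by (auto simp: dist_real_def abs_minus_commute)
    qed (rule lipschitz_on_nonneg[OF lip])
    then show "\<exists>C. C-lipschitz_on {-b..-a} (\<lambda>t. c (- t))" by blast
    show "simple_path ?p'" unfolding eq using sp by (simp add: simple_path_reversepath)
    fix z assume z: "z \<in> inside \<gamma>"
    have "winding_number ?p' z = - winding_number ?p z"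
      unfolding eq by (rule winding_number_reversepath)
        (use simple_path_imp_path[OF sp] img z inside_not_mem in auto)
    then show "winding_number ?p' z = of_real (sign_val s')"
      using orient z s' by (auto simp: oriented_param_def)
  qed (use ab e im' in auto)
qed

lemma oriented_param_exists:
  assumes "simple_lipschitz_contour \<gamma>"
  obtains a b c where "oriented_param s \<gamma> a b c"
proof -
  obtain a b c where p: "simple_lipschitz_param \<gamma> a b c" using assms by (auto simp: simple_lipschitz_contour_def)
  then have ab: "a < b" and sp: "simple_path (unit_path a b c)" and im: "c ` {a..b} = \<gamma>"
    by (auto simp: simple_lipschitz_param_def)
  have img: "path_image (unit_path a b c) = \<gamma>" using unit_path_image[OF ab] im by simp
  have "oriented_param Plus \<gamma> a b c \<or> oriented_param Minus \<gamma> a b c"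
    by (rule simple_closed_path_winding_number_inside[OF sp]) (use p img in \<open>auto simp: oriented_param_def\<close>)
  then show ?thesis
    using that oriented_param_reverse[of Plus \<gamma> a b c Minus] oriented_param_reverse[of Minus \<gamma> a b c Plus]
    by (cases s) auto
qed

section \<open>The length of a contour is well defined\<close>

context body
begin

text \<open>Move the base point of the first curve to that of the second, compare by a monotone
  change of parameter, and reassemble the two pieces of the shifted curve. This is what makes the
  definite description in \<open>Len\<close> meaningful.\<close>

lemma len_unique:
  assumes o1: "oriented_param s \<gamma> a1 b1 c1" and o2: "oriented_param s \<gamma> a2 b2 c2" and sub: "\<gamma> \<subseteq> G"
  shows "len Q a1 b1 c1 = len Q a2 b2 c2"
proof -
  obtain K1 where ab1: "a1 < b1" and l1: "K1-lipschitz_on {a1..b1} c1" and im1: "c1 ` {a1..b1} = \<gamma>"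
    using o1 by (auto simp: oriented_param_def simple_lipschitz_param_def)
  obtain K2 where ab2: "a2 < b2" and l2: "K2-lipschitz_on {a2..b2} c2" and im2: "c2 ` {a2..b2} = \<gamma>"
    using o2 by (auto simp: oriented_param_def simple_lipschitz_param_def)
  have "c2 a2 \<in> c1 ` {a1..b1}" using im1 im2 ab2 by auto
  then obtain \<tau> where \<tau>: "\<tau> \<in> {a1..b1}" "c1 \<tau> = c2 a2" by auto
  define c' where "c' = (\<lambda>t. if t \<le> b1 then c1 t else c1 (t - (b1 - a1)))"
  let ?e = "\<tau> + (b1 - a1)"
  have o': "oriented_param s \<gamma> \<tau> ?e c'"
    unfolding c'_def by (rule oriented_param_shift[OF o1 \<tau>(1)])
  obtain K' where l': "K'-lipschitz_on {\<tau>..?e} c'" and im': "c' ` {\<tau>..?e} = \<gamma>"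
    using o' by (auto simp: oriented_param_def simple_lipschitz_param_def)
  have base: "c' \<tau> = c2 a2" using \<tau> by (auto simp: c'_def)
  obtain k where k: "strict_mono_on {a2..b2} k" "k ` {a2..b2} = {\<tau>..?e}"
    "\<And>r. r \<in> {a2..b2} \<Longrightarrow> c2 r = c' (k r)"
    by (rule oriented_param_change[OF o' o2 base]) (rule that)
  have "len Q a2 b2 c2 = len Q \<tau> ?e c'"
    by (rule len_reparam[OF l' l2 _ _ k]) (use sub im' ab2 in auto)
  also have "\<dots> = len Q \<tau> b1 c' + len Q b1 ?e c'"
    by (rule len_combine[OF l']) (use sub im' \<tau> in auto)
  also have "len Q \<tau> b1 c' = len Q \<tau> b1 c1" by (rule len_cong) (auto simp: c'_def)
  also have "len Q b1 ?e c' = len Q b1 ?e (\<lambda>t. c1 (t + (a1 - b1)))"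
    by (rule len_cong) (auto simp: c'_def algebra_simps)
  also have "\<dots> = len Q a1 \<tau> c1" using len_shift[of Q a1 "a1 - b1" \<tau> c1] by (simp add: algebra_simps)
  also have "len Q \<tau> b1 c1 + len Q a1 \<tau> c1 = len Q a1 b1 c1"
    using len_combine[OF l1 _ _ _ order_refl, of \<tau>] sub im1 \<tau> by auto
  finally show ?thesis by simp
qed

end

lemma curve_length_eq_len:
  assumes "body \<Omega>"
  shows "curve_length \<Omega> a b c = len ((\<lambda>w. - \<i> * w) ` polar \<Omega>) a b c"
  unfolding curve_length_def len_def finsler_def minkowski_eq_supp[OF assms] ..

lemma Len_eq:
  assumes \<Omega>: "body \<Omega>" and o: "oriented_param s \<gamma> a b c" and sub: "\<gamma> \<subseteq> G"
  shows "Len \<Omega> s \<gamma> = curve_length \<Omega> a b c"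
proof -
  interpret Q: body "(\<lambda>w. - \<i> * w) ` polar \<Omega>" by (rule body_rotate[OF body_polar[OF \<Omega>]]) auto
  show ?thesis unfolding Len_def
  proof (rule the_equality)
    show "\<exists>a' b' c'. oriented_param s \<gamma> a' b' c' \<and> curve_length \<Omega> a b c = curve_length \<Omega> a' b' c'"
      using o by blast
    fix l assume "\<exists>a b c. oriented_param s \<gamma> a b c \<and> l = curve_length \<Omega> a b c"
    then show "l = curve_length \<Omega> a b c"
      using Q.len_unique[OF o _ sub] unfolding curve_length_eq_len[OF \<Omega>] by metis
  qed
qed

text \<open>Reversal negates the velocity, and the gauge of -v is the support function of the polar
  turned the other way. So the clockwise problem becomes a counterclockwise one for a different
  body.\<close>

lemma Len_Minus_eq:
  assumes \<Omega>: "body \<Omega>" and o: "oriented_param Plus \<gamma> a b c" and sub: "\<gamma> \<subseteq> G"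
  shows "Len \<Omega> Minus \<gamma> = len ((\<lambda>w. \<i> * w) ` polar \<Omega>) a b c"
proof -
  obtain K where ab: "a < b" and lip: "K-lipschitz_on {a..b} c" and im: "c ` {a..b} = \<gamma>"
    using o by (auto simp: oriented_param_def simple_lipschitz_param_def)
  obtain D N where D: "D \<in> borel_measurable borel" "\<And>t. norm (D t) \<le> K" "negligible N"
    "\<And>t. t \<in> {a<..<b} \<Longrightarrow> t \<notin> N \<Longrightarrow> (c has_vector_derivative D t) (at t)"
    by (rule lipschitz_derivative_on[OF lip]) (rule that)
  have "oriented_param Minus \<gamma> (- b) (- a) (\<lambda>t. c (- t))"
    by (rule oriented_param_reverse[OF o]) simp
  then have "Len \<Omega> Minus \<gamma> = curve_length \<Omega> (- b) (- a) (\<lambda>t. c (- t))"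
    by (rule Len_eq[OF \<Omega> _ sub])
  also have "\<dots> = integral {-b..-a} (\<lambda>t. (\<lambda>r. supp ((\<lambda>w. \<i> * w) ` polar \<Omega>) (vector_derivative c (at r)) / Im (c r)) (- t))"
    unfolding curve_length_def
  proof (rule integral_spike)
    show "negligible (uminus ` N \<union> {-a,-b})"
      using D(3) by (intro negligible_Un negligible_differentiable_image_negligible) (auto intro!: derivative_intros)
    fix t assume t: "t \<in> {-b..-a} - (uminus ` N \<union> {-a,-b})"
    then have "- t \<in> {a<..<b}" "- t \<notin> N" by (force simp: image_iff)+
    then have d: "(c has_vector_derivative D (- t)) (at (- t))" by (rule D(4))
    have "((\<lambda>t. c (- t)) has_vector_derivative - D (- t)) (at t)"
      unfolding has_vector_derivative_reflect_arg using d by simp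
    then have v: "vector_derivative (\<lambda>t. c (- t)) (at t) = - D (- t)" "vector_derivative c (at (- t)) = D (- t)"
      using vector_derivative_at d by auto
    show "supp ((\<lambda>w. \<i> * w) ` polar \<Omega>) (vector_derivative c (at (- t))) / Im (c (- t)) =
      finsler \<Omega> (c (- t)) (vector_derivative (\<lambda>t. c (- t)) (at t))"
      unfolding finsler_def v minkowski_uminus_eq_supp[OF \<Omega>] ..
  qed
  also have "\<dots> = len ((\<lambda>w. \<i> * w) ` polar \<Omega>) a b c"
    unfolding len_def by (rule Henstock_Kurzweil_Integration.integral_reflect_real)
  finally show ?thesis .
qed

lemma AE_lebesgue_on_iff_negligible:
  assumes "T \<in> sets lebesgue"
  shows "(AE t in lebesgue_on T. R t) \<longleftrightarrow> negligible {t\<in>T. \<not> R t}"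
proof -
  have sp: "space (lebesgue_on T) = T" by simp
  show ?thesis
  proof
    assume "AE t in lebesgue_on T. R t"
    then obtain N where N: "N \<in> null_sets (lebesgue_on T)" "{t \<in> T. \<not> R t} \<subseteq> N"
      unfolding eventually_ae_filter sp by blast
    then have "N \<in> null_sets lebesgue" using assms by (simp add: null_sets_restrict_space)
    then show "negligible {t\<in>T. \<not> R t}" using N(2) negligible_subset negligible_iff_null_sets by blast
  next
    assume "negligible {t\<in>T. \<not> R t}"
    then have "{t\<in>T. \<not> R t} \<in> null_sets (lebesgue_on T)"
      using assms by (simp add: null_sets_restrict_space negligible_iff_null_sets)
    then show "AE t in lebesgue_on T. R t" unfolding eventually_ae_filter sp by blast
  qed
qed

text \<open>A natural parametrization has length t up to time t. Since a monotone change of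
  parameter preserves lengths, it must be the identity.\<close>

lemma natural_param_unique:
  assumes \<Omega>: "body \<Omega>" and o1: "oriented_param s \<gamma> 0 T1 c1" and o2: "oriented_param s \<gamma> 0 T2 c2"
    and n1: "natural_param \<Omega> 0 T1 c1" and n2: "natural_param \<Omega> 0 T2 c2"
    and base: "c1 0 = c2 0" and sub: "\<gamma> \<subseteq> G"
  shows "T1 = T2 \<and> (\<forall>t\<in>{0..T1}. c1 t = c2 t)"
proof -
  interpret Q: body "(\<lambda>w. - \<i> * w) ` polar \<Omega>" by (rule body_rotate[OF body_polar[OF \<Omega>]]) auto
  let ?Q = "(\<lambda>w. - \<i> * w) ` polar \<Omega>"
  obtain K1 where ab1: "0 < T1" and l1: "K1-lipschitz_on {0..T1} c1" and im1: "c1 ` {0..T1} = \<gamma>"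
    using o1 by (auto simp: oriented_param_def simple_lipschitz_param_def)
  obtain K2 where ab2: "0 < T2" and l2: "K2-lipschitz_on {0..T2} c2" and im2: "c2 ` {0..T2} = \<gamma>"
    using o2 by (auto simp: oriented_param_def simple_lipschitz_param_def)
  obtain k where k: "strict_mono_on {0..T2} k" "k ` {0..T2} = {0..T1}"
    "\<And>r. r \<in> {0..T2} \<Longrightarrow> c2 r = c1 (k r)"
    by (rule oriented_param_change[OF o1 o2 base]) (rule that)
  have nat: "len ?Q 0 t c = t" if n: "natural_param \<Omega> 0 T c" and t: "0 \<le> t" "t \<le> T" for t T c
  proof -
    have neg: "negligible {t\<in>{0..T}. \<not> (c differentiable (at t) \<and> finsler \<Omega> (c t) (vector_derivative c (at t)) = 1)}"
      using n unfolding natural_param_def by (subst (asm) AE_lebesgue_on_iff_negligible) auto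
    have "curve_length \<Omega> 0 t c = integral {0..t} (\<lambda>_. 1)"
      unfolding curve_length_def by (rule integral_spike[OF neg]) (use t in auto)
    then show ?thesis using t by (simp add: curve_length_eq_len[OF \<Omega>])
  qed
  have kmem: "r \<in> {0..T2} \<Longrightarrow> k r \<in> {0..T1}" for r using k(2) by blast
  have kle: "k r \<le> k t \<longleftrightarrow> r \<le> t" if "r \<in> {0..T2}" "t \<in> {0..T2}" for r t
    using strict_mono_on_leD[OF k(1)] strict_mono_onD[OF k(1)] that by (metis linorder_not_less)
  have k0: "k 0 = 0"
  proof -
    obtain r where r: "r \<in> {0..T2}" "k r = 0"
      using k(2) ab1 by (metis atLeastAtMost_iff imageE less_imp_le order_refl)
    then show ?thesis using kle[of 0 r] kmem[of 0] ab2 by auto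
  qed
  have kid: "k r = r" if r: "r \<in> {0..T2}" for r
  proof -
    have "len ?Q 0 r c2 = len ?Q 0 (k r) c1"
    proof (rule Q.len_reparam[where k = k])
      show "K1-lipschitz_on {0..k r} c1" "K2-lipschitz_on {0..r} c2"
        using kmem[OF r] r by (auto intro: lipschitz_on_subset[OF l1] lipschitz_on_subset[OF l2])
      show "c1 ` {0..k r} \<subseteq> G" using kmem[OF r] im1 sub by auto
      show "strict_mono_on {0..r} k" using r by (intro monotone_on_subset[OF k(1)]) auto
      show "k ` {0..r} = {0..k r}"
      proof
        show "k ` {0..r} \<subseteq> {0..k r}" using kmem kle r by auto
        show "{0..k r} \<subseteq> k ` {0..r}"
        proof
          fix t assume t: "t \<in> {0..k r}"
          then have "t \<in> {0..T1}" using kmem[OF r] by auto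
          then obtain r' where r': "r' \<in> {0..T2}" "k r' = t" using k(2) by (metis imageE)
          then have "r' \<le> r" using kle[of r' r] r t by auto
          then show "t \<in> k ` {0..r}" using r' by auto
        qed
      qed
    qed (use r k(3) in auto)
    then show ?thesis using nat[OF n2, of r] nat[OF n1, of "k r"] r kmem[OF r] by auto
  qed
  have "k ` {0..T2} = {0..T2}" using kid by auto
  then have "{0..T1} = {0..T2}" using k(2) by simp
  then have "T1 = T2" using ab1 ab2 by (simp add: Icc_eq_Icc)
  then show ?thesis using k(3) kid by auto
qed

section \<open>Green's formula for simple closed Lipschitz curves\<close>

lemma nn_integral_inv_sqrt_finite:
  assumes "0 \<le> M"
  shows "(\<integral>\<^sup>+u. indicator {-M..M} u * ennreal (\<bar>u\<bar> powr (-1/2)) \<partial>lborel) < \<infinity>"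
proof -
  let ?f = "\<lambda>u::real. \<bar>u\<bar> powr (-1/2)"
  have "((\<lambda>u. u powr (-1/2)) has_integral (M powr (-1/2 + 1) / (-1/2 + 1))) {0..M}"
    by (rule has_integral_powr_from_0) (use assms in auto)
  then have 1: "(?f has_integral (M powr (-1/2 + 1) / (-1/2 + 1))) {0..M}"
    by (rule has_integral_eq[rotated]) auto
  have "((\<lambda>u. ?f (- u)) has_integral (M powr (-1/2 + 1) / (-1/2 + 1))) {-M..-0}"
    by (rule has_integral_reflect_real[where f = ?f, THEN iffD2, OF 1])
  then have 2: "(?f has_integral (M powr (-1/2 + 1) / (-1/2 + 1))) {-M..0}" by simp
  obtain I where I: "(?f has_integral I) {-M..M}"
    using has_integral_combine[OF _ _ 2 1] assms by auto
  have "(\<integral>\<^sup>+u. ennreal (?f u) * indicator {-M..M} u \<partial>lborel) = ennreal I"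
    by (rule nn_integral_has_integral_lebesgue'[OF _ I]) simp
  then show ?thesis by (simp add: mult.commute)
qed

text \<open>Locally integrable. The value infinity at 0 lets \<open>kernel_bound\<close> hold at
  every point, including the singular lines.\<close>

definition inv_sqrt :: "real \<Rightarrow> ennreal" where
  "inv_sqrt u = (if u = 0 then \<infinity> else ennreal (\<bar>u\<bar> powr (-1/2)))"

lemma inv_sqrt_measurable [measurable]: "inv_sqrt \<in> borel_measurable borel"
  unfolding inv_sqrt_def by measurable

lemma nn_integral_inv_sqrt_shift_le:
  assumes "\<bar>x\<bar> + X \<le> M" "0 \<le> M" 
  shows "(\<integral>\<^sup>+u. indicator {-X..X} u * inv_sqrt (x - u) \<partial>lborel)
     \<le> (\<integral>\<^sup>+u. indicator {-M..M} u * ennreal (\<bar>u\<bar> powr (-1/2)) \<partial>lborel)"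
proof -
  have "(\<integral>\<^sup>+u. indicator {-X..X} u * inv_sqrt (x - u) \<partial>lborel)
     \<le> (\<integral>\<^sup>+u. (\<lambda>v. indicator {-M..M} v * inv_sqrt v) (x + (-1) * u) \<partial>lborel)"
    by (rule nn_integral_mono) (use assms in \<open>auto simp: indicator_def\<close>)
  also have "\<dots> = (\<integral>\<^sup>+v. indicator {-M..M} v * inv_sqrt v \<partial>lborel)"
    by (subst nn_integral_real_affine[where c = "-1" and t = x]) auto
  also have "\<dots> = (\<integral>\<^sup>+u. indicator {-M..M} u * ennreal (\<bar>u\<bar> powr (-1/2)) \<partial>lborel)"
  proof (rule nn_integral_cong_AE)
    have "AE u in lborel. u \<noteq> (0::real)" by (rule AE_lborel_singleton)
    then show "AE u in lborel. indicator {-M..M} u * inv_sqrt u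
        = indicator {-M..M} u * ennreal (\<bar>u\<bar> powr (-1/2))"
      by eventually_elim (simp add: inv_sqrt_def)
  qed
  finally show ?thesis .
qed

text \<open>The singular kernel is majorized by a product of functions of one variable: its size is
  at most K(|u| + |b|) / (u^2 + b^2), and 2 sqrt |u| sqrt |b| is at most |u| + |b|, whose square is
  at most 2(u^2 + b^2). Thus Fubini's theorem applies although the kernel is unbounded near the
  curve.\<close>

lemma kernel_bound:
  fixes p q u b K :: real
  assumes "\<bar>p\<bar> \<le> K" "\<bar>q\<bar> \<le> K"
  shows "ennreal \<bar>(q * u - p * b) / (u\<^sup>2 + b\<^sup>2)\<bar> \<le> ennreal (2 * K) * (inv_sqrt u * inv_sqrt b)"
proof (cases "K = 0 \<or> u = 0 \<or> b = 0")
  case True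
  show ?thesis
  proof (cases "K = 0")
    case True then show ?thesis using assms by simp
  next
    case False
    then have K: "K > 0" using assms by linarith
    have ub: "u = 0 \<or> b = 0" using True False by simp
    have pos: "inv_sqrt v \<noteq> 0" for v by (auto simp: inv_sqrt_def)
    have "inv_sqrt u * inv_sqrt b = \<infinity>"
      using ub pos[of u] pos[of b] by (auto simp: inv_sqrt_def ennreal_mult_eq_top_iff)
    then have "ennreal (2 * K) * (inv_sqrt u * inv_sqrt b) = \<infinity>"
      using K by (simp add: ennreal_mult_eq_top_iff)
    then show ?thesis by simp
  qed
next
  case False
  then have ub: "\<bar>u\<bar> > 0" "\<bar>b\<bar> > 0" and K: "K > 0" using assms by auto
  let ?s = "\<bar>u\<bar> powr (1/2)" and ?r = "\<bar>b\<bar> powr (1/2)"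
  have sr: "?s > 0" "?r > 0" using ub by auto
  have s2: "?s * ?s = \<bar>u\<bar>" "?r * ?r = \<bar>b\<bar>" using ub by (auto simp: powr_add[symmetric])
  have "(\<bar>u\<bar> - \<bar>b\<bar>)\<^sup>2 \<ge> 0" by simp
  have amgm: "2 * (?s * ?r) \<le> \<bar>u\<bar> + \<bar>b\<bar>"
    using zero_le_power2[of "?s - ?r"] s2 by (simp add: power2_eq_square algebra_simps)
  have "(\<bar>u\<bar> + \<bar>b\<bar>) * (\<bar>u\<bar> + \<bar>b\<bar>) \<le> 2 * (u\<^sup>2 + b\<^sup>2)"
    using \<open>(\<bar>u\<bar> - \<bar>b\<bar>)\<^sup>2 \<ge> 0\<close> by (simp add: power2_eq_square algebra_simps)
  moreover have "(\<bar>u\<bar> + \<bar>b\<bar>) * (2 * (?s * ?r)) \<le> (\<bar>u\<bar> + \<bar>b\<bar>) * (\<bar>u\<bar> + \<bar>b\<bar>)"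
    by (intro mult_left_mono amgm) auto
  ultimately have main: "(\<bar>u\<bar> + \<bar>b\<bar>) * (?s * ?r) \<le> u\<^sup>2 + b\<^sup>2" by simp
  have pos: "u\<^sup>2 + b\<^sup>2 > 0" using ub by (simp add: sum_power2_gt_zero_iff)
  have "\<bar>q * u - p * b\<bar> \<le> \<bar>q\<bar> * \<bar>u\<bar> + \<bar>p\<bar> * \<bar>b\<bar>" by (metis abs_mult abs_triangle_ineq4)
  also have "\<dots> \<le> K * \<bar>u\<bar> + K * \<bar>b\<bar>" using assms by (intro add_mono mult_right_mono) auto
  finally have "\<bar>q * u - p * b\<bar> \<le> K * (\<bar>u\<bar> + \<bar>b\<bar>)" by (simp add: distrib_left)
  then have "\<bar>q * u - p * b\<bar> * (?s * ?r) \<le> K * (\<bar>u\<bar> + \<bar>b\<bar>) * (?s * ?r)"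
    using sr by (intro mult_right_mono) auto
  also have "\<dots> = K * ((\<bar>u\<bar> + \<bar>b\<bar>) * (?s * ?r))" by (simp only: mult.assoc)
  also have "\<dots> \<le> K * (u\<^sup>2 + b\<^sup>2)" by (intro mult_left_mono main) (use K in auto)
  finally have "\<bar>q * u - p * b\<bar> * (?s * ?r) \<le> K * (u\<^sup>2 + b\<^sup>2)" .
  then have "\<bar>(q * u - p * b) / (u\<^sup>2 + b\<^sup>2)\<bar> \<le> K * ((1 / ?s) * (1 / ?r))"
    using pos sr by (simp add: field_simps abs_mult)
  also have "\<dots> \<le> 2 * K * ((1 / ?s) * (1 / ?r))" using sr K by (intro mult_right_mono) auto
  finally have "ennreal \<bar>(q * u - p * b) / (u\<^sup>2 + b\<^sup>2)\<bar> \<le> ennreal (2 * K * ((1 / ?s) * (1 / ?r)))"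
    by (rule ennreal_leI)
  also have "\<dots> = ennreal (2 * K) * (ennreal (1 / ?s) * ennreal (1 / ?r))"
  proof -
    have "ennreal (2 * K * (A * B)) = ennreal (2 * K) * (ennreal A * ennreal B)" if "0 \<le> A" "0 \<le> B" for A B
      using ennreal_mult[of "2*K" "A*B"] ennreal_mult[of A B] that K
      by (metis mult_nonneg_nonneg less_imp_le zero_le_numeral)
    then show ?thesis using sr by (metis less_imp_le zero_less_divide_1_iff)
  qed
  also have "ennreal (1 / ?s) = inv_sqrt u" using ub by (simp add: inv_sqrt_def powr_minus_divide)
  also have "ennreal (1 / ?r) = inv_sqrt b" using ub by (simp add: inv_sqrt_def powr_minus_divide)
  finally show ?thesis .
qed

text \<open>The primitive in \<xi> is a logarithm with factor q and an arctangent with factor p. On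
  widening intervals only the jump of the arctangent survives.\<close>

lemma kernel_integral:
  fixes x b p q X :: real
  assumes b: "b \<noteq> 0" and X: "0 \<le> X"
  shows "((\<lambda>\<xi>. (q * (x - \<xi>) - p * b) / ((x - \<xi>)\<^sup>2 + b\<^sup>2)) has_integral
    (q * (ln ((x + X)\<^sup>2 + b\<^sup>2) - ln ((x - X)\<^sup>2 + b\<^sup>2)) / 2
      - p * (arctan ((x + X) / b) - arctan ((x - X) / b)))) {-X..X}"
proof -
  define H where "H \<xi> = - q * ln ((x - \<xi>)\<^sup>2 + b\<^sup>2) / 2 + p * arctan ((x - \<xi>) / b)" for \<xi>
  have pos: "(x - \<xi>)\<^sup>2 + b\<^sup>2 > 0" for \<xi> using b by (simp add: add_nonneg_pos)
  have at: "inverse (1 + ((x - \<xi>) / b)\<^sup>2) = b\<^sup>2 / ((x - \<xi>)\<^sup>2 + b\<^sup>2)" for \<xi>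
    using b pos[of \<xi>] by (simp add: field_simps power_divide)
  have "((\<lambda>\<xi>. (q * (x - \<xi>) - p * b) / ((x - \<xi>)\<^sup>2 + b\<^sup>2)) has_integral (H X - H (-X))) {-X..X}"
  proof (rule fundamental_theorem_of_calculus)
    show "-X \<le> X" using X by simp
    fix \<xi> :: real
    have d1: "((\<lambda>\<xi>. ln ((x - \<xi>)\<^sup>2 + b\<^sup>2)) has_real_derivative - 2 * (x - \<xi>) / ((x - \<xi>)\<^sup>2 + b\<^sup>2)) (at \<xi> within {-X..X})"
      using pos[of \<xi>] by (auto intro!: derivative_eq_intros)
    have "((\<lambda>\<xi>. arctan ((x - \<xi>) / b)) has_real_derivative inverse (1 + ((x - \<xi>) / b)\<^sup>2) * (- 1 / b)) (at \<xi> within {-X..X})"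
      using b by (auto intro!: derivative_eq_intros)
    then have d2: "((\<lambda>\<xi>. arctan ((x - \<xi>) / b)) has_real_derivative - b / ((x - \<xi>)\<^sup>2 + b\<^sup>2)) (at \<xi> within {-X..X})"
      unfolding at using b by (simp add: power2_eq_square)
    have "((\<lambda>\<xi>. - q / 2 * ln ((x - \<xi>)\<^sup>2 + b\<^sup>2) + p * arctan ((x - \<xi>) / b)) has_real_derivative
        - q / 2 * (- 2 * (x - \<xi>) / ((x - \<xi>)\<^sup>2 + b\<^sup>2)) + p * (- b / ((x - \<xi>)\<^sup>2 + b\<^sup>2))) (at \<xi> within {-X..X})"
      by (intro DERIV_add DERIV_cmult d1 d2)
    moreover have "- q / 2 * (- 2 * (x - \<xi>) / ((x - \<xi>)\<^sup>2 + b\<^sup>2)) + p * (- b / ((x - \<xi>)\<^sup>2 + b\<^sup>2)) =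
        (q * (x - \<xi>) - p * b) / ((x - \<xi>)\<^sup>2 + b\<^sup>2)"
    proof -
      have "- q / 2 * (- 2 * u / N) + p * (- b / N) = (q * u - p * b) / N" for u N :: real
        by (simp add: diff_divide_distrib)
      then show ?thesis .
    qed
    ultimately have "(H has_real_derivative (q * (x - \<xi>) - p * b) / ((x - \<xi>)\<^sup>2 + b\<^sup>2)) (at \<xi> within {-X..X})"
      unfolding H_def by simp
    then show "(H has_vector_derivative (q * (x - \<xi>) - p * b) / ((x - \<xi>)\<^sup>2 + b\<^sup>2)) (at \<xi> within {-X..X})"
      by (simp add: has_real_derivative_iff_has_vector_derivative)
  qed
  moreover have "H X - H (-X) = q * (ln ((x + X)\<^sup>2 + b\<^sup>2) - ln ((x - X)\<^sup>2 + b\<^sup>2)) / 2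
      - p * (arctan ((x + X) / b) - arctan ((x - X) / b))"
    by (simp add: H_def algebra_simps diff_divide_distrib add_divide_distrib)
  ultimately show ?thesis by simp
qed

text \<open>The two arguments differ by 4 x X, at most 4 R0 X in size, and each is at least X^2/4.
  Together with ln s \<le> s - 1 this gives the quotient 16 R0 / X.\<close>

lemma ln_diff_bound:
  fixes x b X R0 :: real
  assumes "\<bar>x\<bar> \<le> R0" "2 * R0 + 1 \<le> X"
  shows "\<bar>ln ((x + X)\<^sup>2 + b\<^sup>2) - ln ((x - X)\<^sup>2 + b\<^sup>2)\<bar> \<le> 16 * R0 / X"
proof -
  have X: "X > 0" using assms by linarith
  let ?p = "(x + X)\<^sup>2 + b\<^sup>2" and ?q = "(x - X)\<^sup>2 + b\<^sup>2"
  have "X / 2 \<le> x + X" "X / 2 \<le> X - x" using assms by auto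
  then have "(X/2)\<^sup>2 \<le> (x + X)\<^sup>2" "(X/2)\<^sup>2 \<le> (X - x)\<^sup>2" using X by (auto intro!: power_mono)
  then have pq: "X\<^sup>2 / 4 \<le> ?p" "X\<^sup>2 / 4 \<le> ?q"
    by (auto simp: power_divide power2_commute[of X x] intro: order_trans)
  have pos: "X\<^sup>2 / 4 > 0" using X by simp
  have diff: "?p - ?q = 4 * x * X" by (simp add: power2_eq_square algebra_simps)
  have lnle: "ln s - ln r \<le> 16 * R0 / X" if sr: "X\<^sup>2 / 4 \<le> r" "r > 0" "s > 0" "s - r \<le> 4 * R0 * X" for s r
  proof -
    have "ln s - ln r = ln (s / r)" using sr by (simp add: ln_div)
    also have "\<dots> \<le> s / r - 1" using sr by (intro ln_le_minus_one) simp
    also have "\<dots> = (s - r) / r" using sr by (simp add: diff_divide_distrib)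
    also have "\<dots> \<le> 4 * R0 * X / r" using sr by (intro divide_right_mono) auto
    also have "\<dots> \<le> 4 * R0 * X / (X\<^sup>2 / 4)"
    proof (rule divide_left_mono)
      show "0 \<le> 4 * R0 * X" using assms X by simp
      show "0 < r * (X\<^sup>2 / 4)" using sr(2) pos by (rule mult_pos_pos)
    qed (rule sr(1))
    also have "\<dots> = 16 * R0 / X" using X by (simp add: power2_eq_square field_simps)
    finally show ?thesis .
  qed
  have "\<bar>x * X\<bar> \<le> R0 * X" using assms X by (simp add: abs_mult mult_right_mono)
  then have "?p - ?q \<le> 4 * R0 * X" "?q - ?p \<le> 4 * R0 * X" using diff by auto
  then show ?thesis using lnle[of ?q ?p] lnle[of ?p ?q] pq pos by auto
qed

lemma arctan_diff_limit:
  fixes x b :: real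
  assumes "b \<noteq> 0"
  shows "(\<lambda>n. arctan ((x + real n) / b) - arctan ((x - real n) / b)) \<longlonglongrightarrow> pi * sgn b"
proof -
  have n: "filterlim (\<lambda>n. x + real n) at_top sequentially" "filterlim (\<lambda>n. x - real n) at_bot sequentially"
  proof -
    show "filterlim (\<lambda>n. x + real n) at_top sequentially"
      by (rule filterlim_tendsto_add_at_top[OF tendsto_const filterlim_real_sequentially])
    have "filterlim (\<lambda>n. - x + real n) at_top sequentially"
      by (rule filterlim_tendsto_add_at_top[OF tendsto_const filterlim_real_sequentially])
    then show "filterlim (\<lambda>n. x - real n) at_bot sequentially"
      unfolding filterlim_uminus_at_top by simp
  qed
  consider "b > 0" | "b < 0" using assms by linarith
  then show ?thesis
  proof cases
    case 1
    have "filterlim (\<lambda>n. (x + real n) * (1 / b)) at_top sequentially"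
      by (rule filterlim_at_top_mult_tendsto_pos[OF tendsto_const _ n(1)]) (use 1 in auto)
    moreover have "filterlim (\<lambda>n. (1 / b) * (x - real n)) at_bot sequentially"
      by (rule filterlim_tendsto_pos_mult_at_bot[OF tendsto_const _ n(2)]) (use 1 in auto)
    ultimately have "(\<lambda>n. arctan ((x + real n) * (1 / b)) - arctan ((1 / b) * (x - real n))) \<longlonglongrightarrow> pi / 2 - - (pi / 2)"
      by (intro tendsto_diff filterlim_compose[OF tendsto_arctan_at_top] filterlim_compose[OF tendsto_arctan_at_bot])
    then show ?thesis using 1 by simp
  next
    case 2
    have "filterlim (\<lambda>n. (x + real n) * (1 / (- b))) at_top sequentially"
      by (rule filterlim_at_top_mult_tendsto_pos[OF tendsto_const _ n(1)]) (use 2 in auto)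
    moreover have "filterlim (\<lambda>n. (1 / (- b)) * (x - real n)) at_bot sequentially"
      by (rule filterlim_tendsto_pos_mult_at_bot[OF tendsto_const _ n(2)]) (use 2 in auto)
    ultimately have "(\<lambda>n. - (arctan ((x + real n) * (1 / (- b))) - arctan ((1 / (- b)) * (x - real n)))) \<longlonglongrightarrow> - (pi / 2 - - (pi / 2))"
      by (intro tendsto_minus tendsto_diff filterlim_compose[OF tendsto_arctan_at_top] filterlim_compose[OF tendsto_arctan_at_bot])
    then show ?thesis using 2 by (simp add: arctan_minus)
  qed
qed

section \<open>Fubini's theorem for the winding kernel\<close>

locale green_setup =
  fixes a b :: real and x y p q g :: "real \<Rightarrow> real" and R0 Y0 Y1 K B :: real
  assumes meas [measurable]: "x \<in> borel_measurable borel" "y \<in> borel_measurable borel"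
      "p \<in> borel_measurable borel" "q \<in> borel_measurable borel" "g \<in> borel_measurable borel"
    and xb: "\<And>t. \<bar>x t\<bar> \<le> R0" and yb: "\<And>t. Y0 \<le> y t \<and> y t \<le> Y1"
    and pb: "\<And>t. \<bar>p t\<bar> \<le> K" and qb: "\<And>t. \<bar>q t\<bar> \<le> K" and gb: "\<And>s. \<bar>g s\<bar> \<le> B"
begin

text \<open>With \<open>c = x + \<i> y\<close> and \<open>c' = p + \<i> q\<close> the kernel is \<open>Im (c' / (c - z))\<close> at \<open>z = \<xi> + \<i> Y\<close>; its
  integral along a closed curve is \<open>2 \<pi>\<close> times the winding number about \<open>z\<close>, which is the indicator
  function of the inside. Green's formula results from integrating the kernel over large rectangles
  first, by Fubini's theorem.\<close>

definition ker :: "real \<Rightarrow> real \<Rightarrow> real \<Rightarrow> real" where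
  "ker t Y \<xi> = (q t * (x t - \<xi>) - p t * (y t - Y)) / ((x t - \<xi>)\<^sup>2 + (y t - Y)\<^sup>2)"

definition \<phi> :: "real \<Rightarrow> real \<Rightarrow> real \<times> real \<Rightarrow> real" where
  "\<phi> X t w = indicator {a..b} t * (indicator {Y0..Y1} (fst w) * g (fst w) * (indicator {-X..X} (snd w) * ker t (fst w) (snd w)))"

definition om :: "real \<Rightarrow> real \<Rightarrow> real" where
  "om Y \<xi> = (\<integral>t. indicator {a..b} t * ker t Y \<xi> \<partial>lborel)"

lemma Kpos: "0 \<le> K" "0 \<le> B" "0 \<le> R0" "Y0 \<le> Y1"
  using pb[of 0] gb[of 0] xb[of 0] yb[of 0] by linarith+

lemma \<phi>_measurable: "case_prod (\<phi> X) \<in> borel_measurable (lborel \<Otimes>\<^sub>M lborel)"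
proof -
  have 1: "(\<lambda>(t, Y, \<xi>). indicator {a..b} t * (indicator {Y0..Y1} Y * g Y * (indicator {-X..X} \<xi> * ker t Y \<xi>)))
      \<in> borel_measurable (borel \<Otimes>\<^sub>M (borel \<Otimes>\<^sub>M borel))"
    unfolding ker_def by measurable
  have 2: "case_prod (\<phi> X) = (\<lambda>(t, Y, \<xi>). indicator {a..b} t * (indicator {Y0..Y1} Y * g Y * (indicator {-X..X} \<xi> * ker t Y \<xi>)))"
    by (auto simp: \<phi>_def)
  have 3: "sets (lborel \<Otimes>\<^sub>M (lborel :: (real \<times> real) measure)) = sets (borel \<Otimes>\<^sub>M (borel \<Otimes>\<^sub>M borel))"
    by (intro sets_pair_measure_cong) (simp_all only: sets_lborel borel_prod)
  show ?thesis unfolding 2 measurable_cong_sets[OF 3 refl] by (rule 1)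
qed

lemma \<phi>_integrable:
  assumes X: "0 \<le> X"
  shows "integrable (lborel \<Otimes>\<^sub>M lborel) (case_prod (\<phi> X))"
proof (rule integrableI_bounded[OF \<phi>_measurable])
  \<comment> \<open>Large enough for both variables: |x - \<xi>| is at most R0 + X, and |y - Y| is
    at most twice |Y0| + |Y1|.\<close>
  define M where "M = R0 + X + (\<bar>Y0\<bar> + \<bar>Y1\<bar>) * 2"
  have M: "0 \<le> M" using Kpos X by (simp add: M_def)
  define C where "C = (\<integral>\<^sup>+u. indicator {-M..M} u * ennreal (\<bar>u\<bar> powr (-1/2)) \<partial>lborel)"
  have Cfin: "C < \<infinity>" unfolding C_def by (rule nn_integral_inv_sqrt_finite[OF M])
  have inner: "(\<integral>\<^sup>+w. ennreal (norm (\<phi> X t w)) \<partial>lborel) \<le> indicator {a..b} t * (ennreal (B * (2 * K)) * (C * C))" for t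
  proof -
    have m: "(\<lambda>w. (indicator {Y0..Y1} (fst w) * inv_sqrt (y t - fst w)) * (indicator {-X..X} (snd w) * inv_sqrt (x t - snd w)))
        \<in> borel_measurable (lborel :: (real \<times> real) measure)"
      unfolding lborel_prod[symmetric] by measurable
    have "(\<integral>\<^sup>+w. ennreal (norm (\<phi> X t w)) \<partial>lborel)
       \<le> (\<integral>\<^sup>+w. indicator {a..b} t * (ennreal (B * (2 * K)) * ((indicator {Y0..Y1} (fst w) * inv_sqrt (y t - fst w)) * (indicator {-X..X} (snd w) * inv_sqrt (x t - snd w)))) \<partial>lborel)"
    proof (rule nn_integral_mono)
      fix w :: "real \<times> real"
      obtain Y \<xi> where w: "w = (Y, \<xi>)" by (cases w)
      have "ennreal (norm (g Y * ker t Y \<xi>)) \<le> ennreal (B * (2 * K)) * (inv_sqrt (y t - Y) * inv_sqrt (x t - \<xi>))"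
      proof -
        have "ennreal (norm (g Y * ker t Y \<xi>)) = ennreal \<bar>g Y\<bar> * ennreal \<bar>ker t Y \<xi>\<bar>"
          by (simp add: abs_mult ennreal_mult)
        also have "\<dots> \<le> ennreal B * (ennreal (2 * K) * (inv_sqrt (x t - \<xi>) * inv_sqrt (y t - Y)))"
          unfolding ker_def using gb pb qb by (intro mult_mono ennreal_leI kernel_bound) auto
        also have "\<dots> = ennreal (B * (2 * K)) * (inv_sqrt (y t - Y) * inv_sqrt (x t - \<xi>))"
          using Kpos by (simp add: ennreal_mult mult_ac)
        finally show ?thesis .
      qed
      then show "ennreal (norm (\<phi> X t w)) \<le> indicator {a..b} t * (ennreal (B * (2 * K)) * ((indicator {Y0..Y1} (fst w) * inv_sqrt (y t - fst w)) * (indicator {-X..X} (snd w) * inv_sqrt (x t - snd w))))"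
        by (auto simp: \<phi>_def w indicator_def)
    qed
    also have "\<dots> = indicator {a..b} t * (ennreal (B * (2 * K)) * (\<integral>\<^sup>+w. (indicator {Y0..Y1} (fst w) * inv_sqrt (y t - fst w)) * (indicator {-X..X} (snd w) * inv_sqrt (x t - snd w)) \<partial>lborel))"
      using m by (simp only: nn_integral_cmult borel_measurable_times_ennreal borel_measurable_const)
    also have "(\<integral>\<^sup>+w. (indicator {Y0..Y1} (fst w) * inv_sqrt (y t - fst w)) * (indicator {-X..X} (snd w) * inv_sqrt (x t - snd w)) \<partial>lborel)
      = (\<integral>\<^sup>+Y. \<integral>\<^sup>+\<xi>. (indicator {Y0..Y1} Y * inv_sqrt (y t - Y)) * (indicator {-X..X} \<xi> * inv_sqrt (x t - \<xi>)) \<partial>lborel \<partial>lborel)"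
      using lborel.nn_integral_fst[OF m[folded lborel_prod]] by (simp add: lborel_prod)
    also have "\<dots> = (\<integral>\<^sup>+Y. (indicator {Y0..Y1} Y * inv_sqrt (y t - Y)) * (\<integral>\<^sup>+\<xi>. indicator {-X..X} \<xi> * inv_sqrt (x t - \<xi>) \<partial>lborel) \<partial>lborel)"
      by (subst nn_integral_cmult) auto
    also have "\<dots> = (\<integral>\<^sup>+Y. indicator {Y0..Y1} Y * inv_sqrt (y t - Y) \<partial>lborel) * (\<integral>\<^sup>+\<xi>. indicator {-X..X} \<xi> * inv_sqrt (x t - \<xi>) \<partial>lborel)"
      by (subst nn_integral_multc) auto
    also have "\<dots> \<le> C * C"
    proof (rule mult_mono)
      show "(\<integral>\<^sup>+\<xi>. indicator {-X..X} \<xi> * inv_sqrt (x t - \<xi>) \<partial>lborel) \<le> C"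
        unfolding C_def using xb[of t] X by (intro nn_integral_inv_sqrt_shift_le) (auto simp: M_def)
      have "(\<integral>\<^sup>+Y. indicator {Y0..Y1} Y * inv_sqrt (y t - Y) \<partial>lborel) \<le> (\<integral>\<^sup>+Y. indicator {-(\<bar>Y0\<bar> + \<bar>Y1\<bar>)..\<bar>Y0\<bar> + \<bar>Y1\<bar>} Y * inv_sqrt (y t - Y) \<partial>lborel)"
        by (rule nn_integral_mono) (auto simp: indicator_def)
      also have "\<dots> \<le> C"
        unfolding C_def using yb[of t] X Kpos by (intro nn_integral_inv_sqrt_shift_le) (auto simp: M_def)
      finally show "(\<integral>\<^sup>+Y. indicator {Y0..Y1} Y * inv_sqrt (y t - Y) \<partial>lborel) \<le> C" .
    qed auto
    finally show ?thesis by (simp add: mult_left_mono)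
  qed
  have "(\<integral>\<^sup>+z. ennreal (norm (case_prod (\<phi> X) z)) \<partial>(lborel \<Otimes>\<^sub>M lborel)) = (\<integral>\<^sup>+t. \<integral>\<^sup>+w. ennreal (norm (\<phi> X t w)) \<partial>lborel \<partial>lborel)"
    using lborel.nn_integral_fst[of "\<lambda>z. ennreal (norm (case_prod (\<phi> X) z))" lborel] \<phi>_measurable[of X] by simp
  also have "\<dots> \<le> (\<integral>\<^sup>+t. indicator {a..b} t * (ennreal (B * (2 * K)) * (C * C)) \<partial>lborel)"
    by (intro nn_integral_mono inner)
  also have "\<dots> = emeasure lborel {a..b} * (ennreal (B * (2 * K)) * (C * C))"
    by (subst nn_integral_multc) auto
  also have "\<dots> < \<infinity>" using Cfin by (simp add: ennreal_mult_less_top emeasure_lborel_Icc_eq)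
  finally show "(\<integral>\<^sup>+z. ennreal (norm (case_prod (\<phi> X) z)) \<partial>(lborel \<Otimes>\<^sub>M lborel)) < \<infinity>" .
qed

lemma \<phi>_swap:
  assumes X: "0 \<le> X"
  shows "(\<integral>w. indicator {Y0..Y1} (fst w) * g (fst w) * (indicator {-X..X} (snd w) * om (fst w) (snd w)) \<partial>lborel)
    = (\<integral>t. (\<integral>w. \<phi> X t w \<partial>lborel) \<partial>lborel)"
proof -
  have "(\<integral>w. (\<integral>t. \<phi> X t w \<partial>lborel) \<partial>lborel) = (\<integral>t. (\<integral>w. \<phi> X t w \<partial>lborel) \<partial>lborel)"
    by (rule lborel_pair.Fubini_integral[OF \<phi>_integrable[OF X]])
  moreover have "(\<integral>t. \<phi> X t w \<partial>lborel) = indicator {Y0..Y1} (fst w) * g (fst w) * (indicator {-X..X} (snd w) * om (fst w) (snd w))" for w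
  proof -
    have "(\<integral>t. \<phi> X t w \<partial>lborel) = (\<integral>t. (indicator {Y0..Y1} (fst w) * g (fst w) * indicator {-X..X} (snd w)) * (indicator {a..b} t * ker t (fst w) (snd w)) \<partial>lborel)"
      by (rule Bochner_Integration.integral_cong) (auto simp: \<phi>_def mult_ac)
    then show ?thesis by (simp only: om_def mult.assoc integral_mult_right_zero)
  qed
  ultimately show ?thesis by simp
qed

text \<open>Closed form of the horizontal integral of \<phi>, by \<open>kernel_integral\<close>;
  \<open>\<psi>lim\<close> is its limit as the rectangle becomes infinitely wide.\<close>

definition \<psi> :: "real \<Rightarrow> real \<Rightarrow> real \<Rightarrow> real" where
  "\<psi> X t Y = indicator {a..b} t * (indicator {Y0..Y1} Y * g Y *
     (q t * (ln ((x t + X)\<^sup>2 + (y t - Y)\<^sup>2) - ln ((x t - X)\<^sup>2 + (y t - Y)\<^sup>2)) / 2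
      - p t * (arctan ((x t + X) / (y t - Y)) - arctan ((x t - X) / (y t - Y)))))"

definition \<psi>lim :: "real \<Rightarrow> real \<Rightarrow> real" where
  "\<psi>lim t Y = indicator {a..b} t * (indicator {Y0..Y1} Y * g Y * (- p t * (pi * sgn (y t - Y))))"

lemma \<phi>_inner:
  assumes X: "0 \<le> X"
  shows "AE t in lborel. (\<integral>w. \<phi> X t w \<partial>lborel) = (\<integral>Y. \<psi> X t Y \<partial>lborel)"
proof -
  have "AE t in lborel. integrable lborel (\<lambda>w. case_prod (\<phi> X) (t, w))"
    by (rule lborel_pair.AE_integrable_fst'[OF \<phi>_integrable[OF X]])
  then show ?thesis
  proof eventually_elim
    fix t assume "integrable lborel (\<lambda>w. case_prod (\<phi> X) (t, w))"
    then have int: "integrable (lborel \<Otimes>\<^sub>M lborel) (\<phi> X t)" by (simp add: lborel_prod)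
    have "(\<integral>w. \<phi> X t w \<partial>lborel) = (\<integral>Y. (\<integral>\<xi>. \<phi> X t (Y, \<xi>) \<partial>lborel) \<partial>lborel)"
      using lborel_pair.integral_fst'[OF int] by (simp add: lborel_prod)
    also have "\<dots> = (\<integral>Y. \<psi> X t Y \<partial>lborel)"
    proof (rule integral_cong_AE)
      have 1: "AE Y in lborel. Y \<noteq> y t" by (rule AE_lborel_singleton)
      have 2: "AE Y in lborel. integrable lborel (\<lambda>\<xi>. \<phi> X t (Y, \<xi>))"
        by (rule lborel_pair.AE_integrable_fst'[OF int])
      show "AE Y in lborel. (\<integral>\<xi>. \<phi> X t (Y, \<xi>) \<partial>lborel) = \<psi> X t Y"
        using 1 2
      proof eventually_elim
        fix Y assume Y: "Y \<noteq> y t" and i: "integrable lborel (\<lambda>\<xi>. \<phi> X t (Y, \<xi>))"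
        have "((\<lambda>\<xi>. \<phi> X t (Y, \<xi>)) has_integral (\<integral>\<xi>. \<phi> X t (Y, \<xi>) \<partial>lborel)) UNIV"
          by (rule has_integral_integral_lborel[OF i])
        moreover have "((\<lambda>\<xi>. \<phi> X t (Y, \<xi>)) has_integral \<psi> X t Y) UNIV"
        proof -
          have "((\<lambda>\<xi>. if \<xi> \<in> {-X..X} then ker t Y \<xi> else 0) has_integral
            (q t * (ln ((x t + X)\<^sup>2 + (y t - Y)\<^sup>2) - ln ((x t - X)\<^sup>2 + (y t - Y)\<^sup>2)) / 2
              - p t * (arctan ((x t + X) / (y t - Y)) - arctan ((x t - X) / (y t - Y))))) UNIV"
            unfolding has_integral_restrict_UNIV ker_def
            by (rule kernel_integral) (use Y X in auto)
          from has_integral_mult_right[OF this, of "indicator {a..b} t * (indicator {Y0..Y1} Y * g Y)"]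
          show ?thesis unfolding \<psi>_def
            by (rule has_integral_eq_rhs[OF has_integral_eq[rotated]]) (auto simp: \<phi>_def indicator_def)
        qed
        ultimately show "(\<integral>\<xi>. \<phi> X t (Y, \<xi>) \<partial>lborel) = \<psi> X t Y" by (rule has_integral_unique)
      qed
      show "(\<lambda>Y. \<integral>\<xi>. \<phi> X t (Y, \<xi>) \<partial>lborel) \<in> borel_measurable lborel"
        using lborel_pair.integrable_fst'[OF int] by (rule borel_measurable_integrable)
      show "\<psi> X t \<in> borel_measurable lborel" unfolding \<psi>_def by measurable
    qed
    finally show "(\<integral>w. \<phi> X t w \<partial>lborel) = (\<integral>Y. \<psi> X t Y \<partial>lborel)" .
  qed
qed

lemma \<psi>_measurable [measurable]: "case_prod (\<psi> X) \<in> borel_measurable (lborel \<Otimes>\<^sub>M lborel)"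
proof -
  have [measurable]: "fst \<in> borel_measurable (lborel \<Otimes>\<^sub>M lborel)" "snd \<in> borel_measurable (lborel \<Otimes>\<^sub>M lborel)"
    by (auto intro: measurable_fst'' measurable_snd'')
  have [measurable]: "(\<lambda>w. x (fst w)) \<in> borel_measurable (lborel \<Otimes>\<^sub>M lborel)"
    "(\<lambda>w. y (fst w)) \<in> borel_measurable (lborel \<Otimes>\<^sub>M lborel)"
    "(\<lambda>w. p (fst w)) \<in> borel_measurable (lborel \<Otimes>\<^sub>M lborel)"
    "(\<lambda>w. q (fst w)) \<in> borel_measurable (lborel \<Otimes>\<^sub>M lborel)"
    "(\<lambda>w. g (snd w)) \<in> borel_measurable (lborel \<Otimes>\<^sub>M lborel)"
    by measurable
  show ?thesis
    unfolding case_prod_unfold \<psi>_def by measurable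
qed

lemma \<psi>lim_measurable [measurable]: "case_prod \<psi>lim \<in> borel_measurable (lborel \<Otimes>\<^sub>M lborel)"
  unfolding \<psi>lim_def by measurable

definition dom :: "real \<times> real \<Rightarrow> real" where
  "dom w = indicator ({a..b} \<times> {Y0..Y1}) w * (B * (K * (8 * R0) + K * (2 * pi)))"

lemma dom_integrable: "integrable (lborel \<Otimes>\<^sub>M lborel) dom"
proof -
  have "emeasure (lborel \<Otimes>\<^sub>M lborel) ({a..b} \<times> {Y0..Y1}) < \<infinity>"
    by (subst lborel.emeasure_pair_measure_Times) (auto simp: ennreal_mult_less_top emeasure_lborel_Icc_eq)
  then show ?thesis unfolding dom_def
    by (intro integrable_mult_left integrable_real_indicator) auto
qed

lemma abs_arctan_diff_le: "\<bar>arctan r - arctan s\<bar> \<le> 2 * pi"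
  using arctan_bounded[of r] arctan_bounded[of s] by linarith

lemma \<psi>_bound:
  assumes X: "2 * R0 + 1 \<le> X"
  shows "\<bar>\<psi> X t Y\<bar> \<le> dom (t, Y)"
proof (cases "t \<in> {a..b} \<and> Y \<in> {Y0..Y1}")
  case True
  let ?l = "ln ((x t + X)\<^sup>2 + (y t - Y)\<^sup>2) - ln ((x t - X)\<^sup>2 + (y t - Y)\<^sup>2)"
  let ?a = "arctan ((x t + X) / (y t - Y)) - arctan ((x t - X) / (y t - Y))"
  have "\<bar>?l\<bar> \<le> 16 * R0 / X" by (rule ln_diff_bound[OF xb X])
  also have "\<dots> \<le> 16 * R0 / 1" using X Kpos by (intro divide_left_mono) auto
  finally have "\<bar>q t\<bar> * (\<bar>?l\<bar> / 2) \<le> K * (8 * R0)"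
    using qb[of t] Kpos by (intro mult_mono) auto
  moreover have "\<bar>p t\<bar> * \<bar>?a\<bar> \<le> K * (2 * pi)"
    using pb[of t] Kpos abs_arctan_diff_le by (intro mult_mono) auto
  ultimately have "\<bar>q t * ?l / 2 - p t * ?a\<bar> \<le> K * (8 * R0) + K * (2 * pi)"
    using abs_triangle_ineq4[of "q t * ?l / 2" "p t * ?a"] by (simp add: abs_mult)
  then have "\<bar>g Y\<bar> * \<bar>q t * ?l / 2 - p t * ?a\<bar> \<le> B * (K * (8 * R0) + K * (2 * pi))"
    using gb[of Y] Kpos by (intro mult_mono) auto
  then show ?thesis using True by (simp add: \<psi>_def dom_def abs_mult)
qed (auto simp: \<psi>_def dom_def indicator_def)

text \<open>The left side no longer changes once the rectangle is wide enough, so it equals the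
  limit of the right side: the logarithms vanish, the arctangents become \<pi> times a sign, and
  \<open>dom\<close> allows dominated convergence.\<close>

theorem limit_formula:
  assumes V: "\<And>n. N \<le> n \<Longrightarrow> (\<integral>w. indicator {Y0..Y1} (fst w) * g (fst w) *
      (indicator {- real n..real n} (snd w) * om (fst w) (snd w)) \<partial>lborel) = V"
  shows "V = (\<integral>t. (\<integral>Y. \<psi>lim t Y \<partial>lborel) \<partial>lborel)"
proof -
  obtain N1 :: nat where N1: "2 * R0 + 1 \<le> real N1" using real_arch_simple by blast
  define N2 where "N2 = max N N1"
  have big: "2 * R0 + 1 \<le> real (n + N2)" for n using N1 by (simp add: N2_def)
  have pint: "integrable (lborel \<Otimes>\<^sub>M lborel) (case_prod (\<psi> (real (n + N2))))" for n
    by (rule Bochner_Integration.integrable_bound[OF dom_integrable])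
       (use \<psi>_bound[OF big] in \<open>auto intro!: AE_I2 order_trans[OF _ abs_ge_self]\<close>)
  have Vn: "V = integral\<^sup>L (lborel \<Otimes>\<^sub>M lborel) (case_prod (\<psi> (real (n + N2))))" for n
  proof -
    have X: "0 \<le> real (n + N2)" by simp
    have "V = (\<integral>t. (\<integral>w. \<phi> (real (n + N2)) t w \<partial>lborel) \<partial>lborel)"
      using V[of "n + N2"] \<phi>_swap[OF X] by (simp add: N2_def)
    also have "\<dots> = (\<integral>t. (\<integral>Y. \<psi> (real (n + N2)) t Y \<partial>lborel) \<partial>lborel)"
    proof (rule integral_cong_AE)
      show "(\<lambda>t. \<integral>w. \<phi> (real (n + N2)) t w \<partial>lborel) \<in> borel_measurable lborel"
        using borel_measurable_integrable[OF lborel_pair.integrable_fst'[OF \<phi>_integrable[OF X]]] by simp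
      show "(\<lambda>t. \<integral>Y. \<psi> (real (n + N2)) t Y \<partial>lborel) \<in> borel_measurable lborel"
        using borel_measurable_integrable[OF lborel_pair.integrable_fst'[OF pint[of n]]] by simp
    qed (rule \<phi>_inner[OF X])
    also have "\<dots> = integral\<^sup>L (lborel \<Otimes>\<^sub>M lborel) (case_prod (\<psi> (real (n + N2))))"
      using lborel_pair.integral_fst'[OF pint[of n]] by simp
    finally show ?thesis .
  qed
  have lim: "(\<lambda>n. \<psi> (real (n + N2)) t Y) \<longlonglongrightarrow> \<psi>lim t Y" if "Y \<noteq> y t" for t Y
  proof -
    let ?l = "\<lambda>n. ln ((x t + real n)\<^sup>2 + (y t - Y)\<^sup>2) - ln ((x t - real n)\<^sup>2 + (y t - Y)\<^sup>2)"
    have "?l \<longlonglongrightarrow> 0"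
    proof (rule Lim_null_comparison)
      show "\<forall>\<^sub>F n in sequentially. norm (?l n) \<le> 16 * R0 / real n"
        using eventually_ge_at_top[of N1]
      proof eventually_elim
        case (elim n)
        then have "2 * R0 + 1 \<le> real n" using N1 by linarith
        from ln_diff_bound[OF xb this] show ?case by simp
      qed
      show "(\<lambda>n. 16 * R0 / real n) \<longlonglongrightarrow> 0" by (rule lim_const_over_n)
    qed
    then have l: "(\<lambda>n. ?l (n + N2)) \<longlonglongrightarrow> 0" by (rule LIMSEQ_ignore_initial_segment)
    have "(\<lambda>n. arctan ((x t + real n) / (y t - Y)) - arctan ((x t - real n) / (y t - Y))) \<longlonglongrightarrow> pi * sgn (y t - Y)"
      by (rule arctan_diff_limit) (use that in simp)
    then have a: "(\<lambda>n. arctan ((x t + real (n + N2)) / (y t - Y)) - arctan ((x t - real (n + N2)) / (y t - Y))) \<longlonglongrightarrow> pi * sgn (y t - Y)"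
      by (rule LIMSEQ_ignore_initial_segment)
    have "(\<lambda>n. \<psi> (real (n + N2)) t Y) \<longlonglongrightarrow> indicator {a..b} t * (indicator {Y0..Y1} Y * g Y * (q t * 0 / 2 - p t * (pi * sgn (y t - Y))))"
      unfolding \<psi>_def by (intro tendsto_intros l a) auto
    then show ?thesis by (simp add: \<psi>lim_def)
  qed
  have ne: "AE w in lborel \<Otimes>\<^sub>M lborel. snd w \<noteq> y (fst w)"
  proof -
    have "AE t in lborel. AE Y in lborel. Y \<noteq> y t" by (intro AE_I2 AE_lborel_singleton)
    moreover have "{w \<in> space (lborel \<Otimes>\<^sub>M lborel). snd w \<noteq> y (fst w)} \<in> sets (lborel \<Otimes>\<^sub>M lborel)"
      by measurable
    ultimately show ?thesis using lborel_pair.AE_pair_iff by fastforce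
  qed
  have lim2: "(\<lambda>n. integral\<^sup>L (lborel \<Otimes>\<^sub>M lborel) (case_prod (\<psi> (real (n + N2))))) \<longlonglongrightarrow> integral\<^sup>L (lborel \<Otimes>\<^sub>M lborel) (case_prod \<psi>lim)"
    and lint: "integrable (lborel \<Otimes>\<^sub>M lborel) (case_prod \<psi>lim)"
  proof -
    have 1: "AE w in lborel \<Otimes>\<^sub>M lborel. (\<lambda>n. case_prod (\<psi> (real (n + N2))) w) \<longlonglongrightarrow> case_prod \<psi>lim w"
      using ne by eventually_elim (use lim in \<open>simp add: case_prod_unfold del: of_nat_add\<close>)
    have 2: "AE w in lborel \<Otimes>\<^sub>M lborel. norm (case_prod (\<psi> (real (n + N2))) w) \<le> dom w" for n
      using \<psi>_bound[OF big] by (auto intro!: AE_I2)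
    show "(\<lambda>n. integral\<^sup>L (lborel \<Otimes>\<^sub>M lborel) (case_prod (\<psi> (real (n + N2))))) \<longlonglongrightarrow> integral\<^sup>L (lborel \<Otimes>\<^sub>M lborel) (case_prod \<psi>lim)"
      by (rule integral_dominated_convergence[OF \<psi>lim_measurable \<psi>_measurable dom_integrable 1 2])
    show "integrable (lborel \<Otimes>\<^sub>M lborel) (case_prod \<psi>lim)"
      by (rule integrable_dominated_convergence[OF \<psi>lim_measurable \<psi>_measurable dom_integrable 1 2])
  qed
  have "V = integral\<^sup>L (lborel \<Otimes>\<^sub>M lborel) (case_prod \<psi>lim)"
    using lim2 unfolding Vn[symmetric] by (simp add: LIMSEQ_const_iff)
  also have "\<dots> = (\<integral>t. (\<integral>Y. \<psi>lim t Y \<partial>lborel) \<partial>lborel)"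
    using lborel_pair.integral_fst'[OF lint] by simp
  finally show ?thesis .
qed

end

section \<open>Winding numbers of Lipschitz curves\<close>

lemma negligible_not_derivative_of_integral_on:
  fixes H g :: "real \<Rightarrow> real"
  assumes int: "\<And>u v. a \<le> u \<Longrightarrow> u \<le> v \<Longrightarrow> v \<le> b \<Longrightarrow> (g has_integral (H v - H u)) {u..v}"
  shows "negligible {x\<in>{a<..<b}. \<not> (H has_real_derivative g x) (at x)}"
proof (cases "a \<le> b")
  case True
  define H' where "H' t = H (clamp1 a b t)" for t
  define g' where "g' t = (if t \<in> {a..b} then g t else 0)" for t
  have "(g' has_integral (H' v - H' u)) {u..v}" if "u \<le> v" for u v
  proof (cases "max u a \<le> min v b")
    case True
    have "(g has_integral (H (min v b) - H (max u a))) {max u a..min v b}"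
      by (rule int) (use True that in auto)
    moreover have "clamp1 a b v = min v b" "clamp1 a b u = max u a"
      using True that \<open>a \<le> b\<close> unfolding clamp1_def by linarith+
    then have "H (min v b) = H' v" "H (max u a) = H' u" by (simp_all add: H'_def)
    moreover have "{max u a..min v b} = {a..b} \<inter> {u..v}" by auto
    ultimately have "(g has_integral (H' v - H' u)) ({a..b} \<inter> {u..v})" by simp
    then show ?thesis unfolding g'_def has_integral_restrict_Int .
  next
    case False
    then have "clamp1 a b u = clamp1 a b v" using that \<open>a \<le> b\<close> unfolding clamp1_def by linarith
    moreover have "(g' has_integral 0) {u..v}"
    proof (rule has_integral_eq[where f = "\<lambda>_. 0"])
      fix t assume "t \<in> {u..v}"
      then have "t \<notin> {a..b}"
        using False by (metis atLeastAtMost_iff max.bounded_iff min.bounded_iff order_trans)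
      then show "0 = g' t" by (simp only: g'_def if_False)
    qed simp
    ultimately show ?thesis by (simp add: H'_def)
  qed
  then have "negligible {x. \<not> (H' has_real_derivative g' x) (at x)}"
    by (rule negligible_not_derivative_of_integral)
  then show ?thesis
  proof (rule negligible_subset)
    show "{x\<in>{a<..<b}. \<not> (H has_real_derivative g x) (at x)} \<subseteq> {x. \<not> (H' has_real_derivative g' x) (at x)}"
    proof clarify
      fix x assume x: "x \<in> {a<..<b}" "\<not> (H has_real_derivative g x) (at x)" "(H' has_real_derivative g' x) (at x)"
      then have "(H' has_real_derivative g x) (at x)" by (simp add: g'_def)
      then have "(H has_real_derivative g x) (at x)"
        by (rule has_field_derivative_transform_within_open[of _ _ _ "{a<..<b}"]) (use x in \<open>auto simp: H'_def\<close>)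
      with x show False by blast
    qed
  qed
qed auto

lemma negligible_not_vector_derivative_of_integral_on:
  fixes H g :: "real \<Rightarrow> complex"
  assumes int: "\<And>u v. a \<le> u \<Longrightarrow> u \<le> v \<Longrightarrow> v \<le> b \<Longrightarrow> (g has_integral (H v - H u)) {u..v}"
  shows "negligible {x\<in>{a<..<b}. \<not> (H has_vector_derivative g x) (at x)}"
proof -
  have 1: "((\<lambda>t. Re (g t)) has_integral (Re (H v) - Re (H u))) {u..v}"
    "((\<lambda>t. Im (g t)) has_integral (Im (H v) - Im (H u))) {u..v}"
    if "a \<le> u" "u \<le> v" "v \<le> b" for u v
    using has_integral_linear[OF int[OF that] bounded_linear_Re] has_integral_linear[OF int[OF that] bounded_linear_Im]
    by (simp_all add: o_def)
  let ?A = "{x\<in>{a<..<b}. \<not> ((\<lambda>t. Re (H t)) has_real_derivative Re (g x)) (at x)}"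
  let ?B = "{x\<in>{a<..<b}. \<not> ((\<lambda>t. Im (H t)) has_real_derivative Im (g x)) (at x)}"
  have "negligible (?A \<union> ?B)"
    by (intro negligible_Un negligible_not_derivative_of_integral_on 1)
  then show ?thesis
  proof (rule negligible_subset)
    show "{x\<in>{a<..<b}. \<not> (H has_vector_derivative g x) (at x)} \<subseteq> ?A \<union> ?B"
    proof (rule subsetI, rule ccontr)
      fix x assume x: "x \<in> {x\<in>{a<..<b}. \<not> (H has_vector_derivative g x) (at x)}" "x \<notin> ?A \<union> ?B"
      then have d: "((\<lambda>t. Re (H t)) has_real_derivative Re (g x)) (at x)" "((\<lambda>t. Im (H t)) has_real_derivative Im (g x)) (at x)"
        by auto
      have "((\<lambda>t. complex_of_real (Re (H t))) has_vector_derivative of_real (Re (g x))) (at x)"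
        "((\<lambda>t. complex_of_real (Im (H t))) has_vector_derivative of_real (Im (g x))) (at x)"
        using d has_vector_derivative_of_real by (auto simp: has_real_derivative_iff_has_vector_derivative)
      then have "((\<lambda>t. of_real (Re (H t)) + \<i> * of_real (Im (H t))) has_vector_derivative
          of_real (Re (g x)) + \<i> * of_real (Im (g x))) (at x)"
        by (intro has_vector_derivative_add has_vector_derivative_mult_right)
      then have "(H has_vector_derivative g x) (at x)" by (simp add: complex_eq[symmetric])
      then show False using x by blast
    qed
  qed
qed

lemma lipschitz_on_times:
  fixes f h :: "real \<Rightarrow> 'a::real_normed_algebra"
  assumes f: "K1-lipschitz_on {a..b} f" and h: "K2-lipschitz_on {a..b} h"
  shows "\<exists>K. K-lipschitz_on {a..b} (\<lambda>t. f t * h t)"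
proof -
  have "bounded (f ` {a..b})" "bounded (h ` {a..b})"
    by (auto intro!: compact_imp_bounded compact_continuous_image lipschitz_on_continuous_on[OF f] lipschitz_on_continuous_on[OF h])
  then obtain A B where "A > 0" "\<forall>x\<in>f ` {a..b}. norm x \<le> A" "B > 0" "\<forall>x\<in>h ` {a..b}. norm x \<le> B"
    unfolding bounded_pos by blast
  then have A: "A > 0" "\<And>t. t \<in> {a..b} \<Longrightarrow> norm (f t) \<le> A"
    and B: "B > 0" "\<And>t. t \<in> {a..b} \<Longrightarrow> norm (h t) \<le> B"
    by auto
  have "(K1 * B + A * K2)-lipschitz_on {a..b} (\<lambda>t. f t * h t)"
  proof (rule lipschitz_onI)
    show "0 \<le> K1 * B + A * K2" using A B lipschitz_on_nonneg[OF f] lipschitz_on_nonneg[OF h] by simp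
    fix s t assume st: "s \<in> {a..b}" "t \<in> {a..b}"
    have "f s * h s - f t * h t = (f s - f t) * h s + f t * (h s - h t)" by (simp add: algebra_simps)
    then have "norm (f s * h s - f t * h t) \<le> norm ((f s - f t) * h s) + norm (f t * (h s - h t))"
      by (simp only: norm_triangle_ineq)
    also have "\<dots> \<le> norm (f s - f t) * norm (h s) + norm (f t) * norm (h s - h t)"
      by (intro add_mono norm_mult_ineq)
    also have "\<dots> \<le> (K1 * dist s t) * B + A * (K2 * dist s t)"
      using lipschitz_onD[OF f st] lipschitz_onD[OF h st] A(1) A(2)[OF st(2)] B(1) B(2)[OF st(1)]
        lipschitz_on_nonneg[OF f]
      by (intro add_mono mult_mono) (auto simp: dist_norm)
    finally show "dist (f s * h s) (f t * h t) \<le> (K1 * B + A * K2) * dist s t"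
      by (simp add: dist_norm algebra_simps)
  qed
  then show ?thesis by blast
qed

lemma lipschitz_on_compose_differentiable:
  fixes f :: "real \<Rightarrow> 'a::real_normed_field"
  assumes f: "K-lipschitz_on T f" and im: "f ` T \<subseteq> C" and C: "convex C"
    and d: "\<And>z. z \<in> C \<Longrightarrow> (h has_field_derivative h' z) (at z within C)"
    and b: "\<And>z. z \<in> C \<Longrightarrow> norm (h' z) \<le> B" and B: "0 \<le> B"
  shows "(B * K)-lipschitz_on T (\<lambda>t. h (f t))"
proof (rule lipschitz_onI)
  show "0 \<le> B * K" using B lipschitz_on_nonneg[OF f] by simp
  fix s t assume st: "s \<in> T" "t \<in> T"
  have "norm (h (f s) - h (f t)) \<le> B * norm (f s - f t)"
    by (rule field_differentiable_bound[OF C d b]) (use st im in auto)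
  also have "\<dots> \<le> B * (K * dist s t)"
    using lipschitz_onD[OF f st] B by (intro mult_left_mono) (auto simp: dist_norm)
  finally show "dist (h (f s)) (h (f t)) \<le> B * K * dist s t" by (simp add: dist_norm)
qed

lemma bounded_borel_integrable_complex:
  fixes f :: "real \<Rightarrow> complex"
  assumes "f \<in> borel_measurable borel" "\<And>t. t \<in> {a..b} \<Longrightarrow> norm (f t) \<le> B"
  shows "f integrable_on {a..b}"
proof (rule measurable_bounded_by_integrable_imp_integrable[where g = "\<lambda>_. B"])
  show "f \<in> borel_measurable (lebesgue_on {a..b})"
    using assms(1) by (simp add: borel_measurable_if_D measurable_completion measurable_restrict_space1)
qed (use assms in auto)

text \<open>A logarithm from topology alone carries no derivative. Here it is built as the integral
  Q of c' / (c - z); the Lipschitz function (c - z) exp (- Q) has derivative 0 almost everywhere and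
  is therefore constant.\<close>

lemma lipschitz_log:
  fixes c :: "real \<Rightarrow> complex"
  assumes lip: "K-lipschitz_on {a..b} c" and ab: "a < b" and z: "z \<notin> c ` {a..b}"
  obtains q M where "M-lipschitz_on {a..b} q" "\<And>t. t \<in> {a..b} \<Longrightarrow> c t = z + exp (q t)"
    "\<And>t. t \<in> {a..b} \<Longrightarrow> ((\<lambda>t. vector_derivative c (at t) / (c t - z)) has_integral (q t - q a)) {a..t}"
proof -
  obtain D N where D: "D \<in> borel_measurable borel" "\<And>t. norm (D t) \<le> K" "negligible N"
    "\<And>t. t \<in> {a<..<b} \<Longrightarrow> t \<notin> N \<Longrightarrow> (c has_vector_derivative D t) (at t)"
    by (rule lipschitz_derivative_on[OF lip]) (rule that)
  have cont: "continuous_on {a..b} c" by (rule lipschitz_on_continuous_on[OF lip])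
  have "closed (c ` {a..b})" by (intro compact_imp_closed compact_continuous_image cont) simp
  then obtain d0 where d0: "d0 > 0" "\<And>w. w \<in> c ` {a..b} \<Longrightarrow> d0 \<le> dist z w"
    using separate_point_closed[OF _ z] by blast
  have away: "d0 \<le> norm (c t - z)" if "t \<in> {a..b}" for t
    using d0(2)[of "c t"] that by (auto simp: dist_norm norm_minus_commute)
  define g where "g t = D t / (c (clamp1 a b t) - z)" for t
  have "continuous_on UNIV (\<lambda>t. c (clamp1 a b t))"
    using lipschitz_on_continuous_on[OF lipschitz_clamp1[OF lip less_imp_le[OF ab]]] .
  then have cm: "(\<lambda>t. c (clamp1 a b t)) \<in> borel_measurable borel" by (rule borel_measurable_continuous_onI)
  have gm: "g \<in> borel_measurable borel" unfolding g_def using cm D(1) by measurable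
  have K0: "0 \<le> K" using lip by (rule lipschitz_on_nonneg)
  have gb: "norm (g t) \<le> K / d0" if "t \<in> {a..b}" for t
    using D(2)[of t] away[OF that] d0(1) K0 that by (auto simp: g_def norm_divide intro!: frac_le)
  have gint: "g integrable_on {u..v}" if "a \<le> u" "v \<le> b" for u v
    by (rule bounded_borel_integrable_complex[OF gm gb]) (use that in auto)
  define Q where "Q t = integral {a..t} g" for t
  have Qint: "(g has_integral (Q v - Q u)) {u..v}" if "a \<le> u" "u \<le> v" "v \<le> b" for u v
  proof -
    have "Q u + integral {u..v} g = Q v"
      unfolding Q_def by (rule Henstock_Kurzweil_Integration.integral_combine) (use that gint in auto)
    then have "Q v - Q u = integral {u..v} g" by (simp add: algebra_simps)
    then show ?thesis using gint that by (simp add: integrable_integral)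
  qed
  have Qlip: "(K / d0)-lipschitz_on {a..b} Q"
  proof (rule lipschitz_on_leI)
    show "0 \<le> K / d0" using K0 d0 by simp
    fix u v assume uv: "u \<in> {a..b}" "v \<in> {a..b}" "u \<le> v"
    have "norm (Q v - Q u) \<le> K / d0 * Henstock_Kurzweil_Integration.content (cbox u v)"
      by (rule has_integral_bound[of _ g]) (use uv Qint[of u v] gb K0 d0 in auto)
    then show "dist (Q u) (Q v) \<le> K / d0 * dist u v"
      using uv by (simp add: dist_norm norm_minus_commute)
  qed
  have Qder: "negligible {x\<in>{a<..<b}. \<not> (Q has_vector_derivative g x) (at x)}"
    by (rule negligible_not_vector_derivative_of_integral_on[OF Qint])
  have "bounded (Q ` {a..b})"
    by (auto intro!: compact_imp_bounded compact_continuous_image lipschitz_on_continuous_on[OF Qlip])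
  then obtain A where A: "\<And>t. t \<in> {a..b} \<Longrightarrow> norm (Q t) \<le> A" by (meson bounded_iff image_eqI)
  have "(exp A * (K / d0))-lipschitz_on {a..b} (\<lambda>t. exp (- Q t))"
  proof (rule lipschitz_on_compose_differentiable[where f = "\<lambda>t. - Q t" and h = exp and C = "cball 0 A" and h' = exp])
    show "(K / d0)-lipschitz_on {a..b} (\<lambda>t. - Q t)"
      using Qlip by (simp add: lipschitz_on_def dist_minus)
    show "norm (exp z) \<le> exp A" if "z \<in> cball 0 A" for z :: complex
      using that abs_Re_le_cmod[of z] by (auto simp: norm_exp_eq_Re)
  qed (use A in \<open>auto intro!: derivative_eq_intros\<close>)
  moreover have "K-lipschitz_on {a..b} (\<lambda>t. c t - z)" using lip by (simp add: lipschitz_on_def dist_norm)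
  ultimately obtain M where M: "M-lipschitz_on {a..b} (\<lambda>t. (c t - z) * exp (- Q t))"
    using lipschitz_on_times by blast
  let ?N = "N \<union> {x\<in>{a<..<b}. \<not> (Q has_vector_derivative g x) (at x)}"
  have zero: "(c t - z) * exp (- Q t) = (c a - z) * exp (- Q a)" if t: "t \<in> {a..b}" for t
  proof (rule lipschitz_zero_derivative)
    show "M-lipschitz_on {a..t} (\<lambda>t. (c t - z) * exp (- Q t))"
      by (rule lipschitz_on_subset[OF M]) (use t in auto)
    show "negligible ?N" using D(3) Qder by (rule negligible_Un)
    fix s assume s: "s \<in> {a<..<t}" "s \<notin> ?N"
    then have s': "s \<in> {a<..<b}" "s \<in> {a..b}" using t by auto
    then have dc: "(c has_vector_derivative D s) (at s)" and dQ: "(Q has_vector_derivative g s) (at s)"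
      using s D(4) by auto
    have "((\<lambda>t. exp (- Q t)) has_vector_derivative (- g s) * exp (- Q s)) (at s)"
      using field_vector_diff_chain_at[of "\<lambda>t. - Q t" "- g s" s exp "exp (- Q s)"] dQ
      by (auto simp: o_def has_vector_derivative_minus intro: DERIV_exp)
    then have "((\<lambda>t. (c t - z) * exp (- Q t)) has_vector_derivative (c s - z) * ((- g s) * exp (- Q s)) + (D s) * exp (- Q s)) (at s)"
      using dc by (intro has_vector_derivative_mult) (auto intro!: derivative_eq_intros)
    moreover have "(c s - z) * ((- g s) * exp (- Q s)) + (D s) * exp (- Q s) = 0"
      using s' away[of s] d0(1) by (auto simp: g_def)
    ultimately show "((\<lambda>t. (c t - z) * exp (- Q t)) has_vector_derivative 0) (at s)" by simp
  qed (use t in auto)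
  have Qa: "Q a = 0" by (simp add: Q_def)
  have nz: "c a - z \<noteq> 0" using z ab by auto
  define q where "q t = Ln (c a - z) + Q t" for t
  show ?thesis
  proof
    show "(K / d0)-lipschitz_on {a..b} q" using Qlip by (simp add: q_def lipschitz_on_def)
    show "c t = z + exp (q t)" if "t \<in> {a..b}" for t
    proof -
      have "c t - z = (c t - z) * exp (- Q t) * exp (Q t)" by (simp add: mult_exp_exp mult.assoc)
      also have "\<dots> = exp (q t)" using zero[OF that] nz by (simp add: Qa q_def exp_add)
      finally show ?thesis by (simp add: algebra_simps)
    qed
    show "((\<lambda>t. vector_derivative c (at t) / (c t - z)) has_integral (q t - q a)) {a..t}" if t: "t \<in> {a..b}" for t
    proof -
      have "(g has_integral (q t - q a)) {a..t}" using Qint[of a t] t by (simp add: q_def Qa)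
      then show ?thesis
      proof (rule has_integral_spike[rotated 2])
        show "negligible (N \<union> {a,b})" using D(3) by auto
        fix s assume s: "s \<in> {a..t} - (N \<union> {a,b})"
        then have "s \<in> {a<..<b}" using t by auto
        then show "vector_derivative c (at s) / (c s - z) = g s"
          using vector_derivative_at[OF D(4)] s by (simp add: g_def)
      qed
    qed
  qed
qed

lemma Re_winding_lipschitz:
  fixes c :: "real \<Rightarrow> complex"
  assumes lip: "K-lipschitz_on {a..b} c" and ab: "a < b" and z: "z \<notin> c ` {a..b}"
  shows "((\<lambda>t. Im (vector_derivative c (at t) / (c t - z))) has_integral
    (2 * pi * Re (winding_number (unit_path a b c) z))) {a..b}"
proof -
  obtain q M where q: "M-lipschitz_on {a..b} q" "\<And>t. t \<in> {a..b} \<Longrightarrow> c t = z + exp (q t)"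
    "\<And>t. t \<in> {a..b} \<Longrightarrow> ((\<lambda>t. vector_derivative c (at t) / (c t - z)) has_integral (q t - q a)) {a..t}"
    by (rule lipschitz_log[OF assms]) (rule that)
  have "winding_number (unit_path a b c) z = (q b - q a) / (2 * of_real pi * \<i>)"
    by (rule winding_of_log[OF ab lipschitz_on_continuous_on[OF q(1)] q(2)])
  then have "q b - q a = (2 * of_real pi * \<i>) * winding_number (unit_path a b c) z" by simp
  then have "2 * pi * Re (winding_number (unit_path a b c) z) = Im (q b - q a)" by simp
  then show ?thesis
    using has_integral_linear[OF q(3)[of b] bounded_linear_Im] ab by (simp add: o_def)
qed

text \<open>The parameter interval is placed on the real axis of the plane, a null set; a Lipschitz
  map between sets of the same dimension keeps it null.\<close>

lemma negligible_lipschitz_curve: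
  fixes c :: "real \<Rightarrow> complex"
  assumes lip: "K-lipschitz_on {a..b} c"
  shows "negligible (c ` {a..b})"
proof -
  let ?T = "of_real ` {a..b} :: complex set"
  have "negligible {z. \<i> \<bullet> z = (0::real)}" by (rule negligible_hyperplane) auto
  then have "negligible ?T" by (rule negligible_subset) (auto simp: inner_complex_def)
  then have "negligible ((\<lambda>z. c (Re z)) ` ?T)"
  proof (rule negligible_locally_Lipschitz_image[rotated])
    fix z assume z: "z \<in> ?T"
    show "\<exists>T B. open T \<and> z \<in> T \<and> (\<forall>y \<in> ?T \<inter> T. norm (c (Re y) - c (Re z)) \<le> B * norm (y - z))"
    proof (intro exI[of _ UNIV] exI[of _ K] conjI ballI)
      fix y assume "y \<in> ?T \<inter> UNIV"
      then have "norm (c (Re y) - c (Re z)) \<le> K * \<bar>Re y - Re z\<bar>"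
        using lipschitz_onD[OF lip, of "Re y" "Re z"] z by (auto simp: dist_norm)
      also have "\<dots> \<le> K * norm (y - z)"
        using abs_Re_le_cmod[of "y - z"] lipschitz_on_nonneg[OF lip] by (intro mult_left_mono) auto
      finally show "norm (c (Re y) - c (Re z)) \<le> K * norm (y - z)" .
    qed auto
  qed auto
  then show ?thesis by (simp add: image_image)
qed

text \<open>Transfers Fubini's theorem for pairs to the complex plane, with the height as first
  coordinate because all weights depend on the height.\<close>

lemma lborel_complex_eq_distr: "distr lborel borel (\<lambda>w. Complex (snd w) (fst w)) = lborel"
proof (rule lborel_eqI[symmetric])
  have m: "(\<lambda>w. Complex (snd w) (fst w)) \<in> borel_measurable (lborel :: (real \<times> real) measure)"
  proof -
    have "continuous_on UNIV (\<lambda>w :: real \<times> real. Complex (snd w) (fst w))"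
      unfolding Complex_eq by (intro continuous_intros)
    then show ?thesis using borel_measurable_continuous_onI by simp
  qed
  fix l u :: complex
  assume lu: "\<And>b. b \<in> Basis \<Longrightarrow> l \<bullet> b \<le> u \<bullet> b"
  have le: "Re l \<le> Re u" "Im l \<le> Im u" using lu[of 1] lu[of \<i>] by (auto simp: Basis_complex_def inner_complex_def)
  have "emeasure (distr lborel borel (\<lambda>w. Complex (snd w) (fst w))) (box l u)
     = emeasure lborel ((\<lambda>w. Complex (snd w) (fst w)) -` box l u)"
    using m by (simp add: emeasure_distr)
  also have "(\<lambda>w. Complex (snd w) (fst w)) -` box l u = {Im l<..<Im u} \<times> {Re l<..<Re u}"
    by (auto simp: in_box_complex_iff)
  also have "emeasure lborel ({Im l<..<Im u} \<times> {Re l<..<Re u}) = emeasure lborel {Im l<..<Im u} * emeasure lborel {Re l<..<Re u}"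
    unfolding lborel_prod[symmetric] by (rule lborel.emeasure_pair_measure_Times) auto
  also have "\<dots> = ennreal ((Re u - Re l) * (Im u - Im l))"
    using le by (simp add: ennreal_mult mult.commute)
  also have "(Re u - Re l) * (Im u - Im l) = (\<Prod>b\<in>Basis. (u - l) \<bullet> b)"
    by (simp add: Basis_complex_def inner_complex_def)
  finally show "emeasure (distr lborel borel (\<lambda>w. Complex (snd w) (fst w))) (box l u) = (\<Prod>b\<in>Basis. (u - l) \<bullet> b)" .
qed simp

lemma lborel_integral_indicator_Icc:
  fixes f :: "real \<Rightarrow> real"
  assumes "f \<in> borel_measurable borel" "\<And>t. t \<in> {a..b} \<Longrightarrow> \<bar>f t\<bar> \<le> B"
  shows "(\<integral>t. indicator {a..b} t * f t \<partial>lborel) = integral {a..b} f"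
proof -
  have i: "integrable lborel (\<lambda>t. indicator {a..b} t * f t)"
  proof (rule Bochner_Integration.integrable_bound)
    show "integrable lborel (\<lambda>t. indicator {a..b} t * B)"
      by (intro integrable_mult_left integrable_real_indicator) (auto simp: emeasure_lborel_Icc_eq)
    show "(\<lambda>t. indicator {a..b} t * f t) \<in> borel_measurable lborel" using assms(1) by simp
    show "AE t in lborel. norm (indicator {a..b} t * f t) \<le> norm (indicator {a..b} t * B)"
      using assms(2) by (auto intro!: AE_I2 simp: indicator_def intro: order_trans[OF _ abs_ge_self])
  qed
  have "((\<lambda>t. indicator {a..b} t * f t) has_integral (\<integral>t. indicator {a..b} t * f t \<partial>lborel)) UNIV"
    by (rule has_integral_integral_lborel[OF i])
  then have "((\<lambda>t. if t \<in> {a..b} then f t else 0) has_integral (\<integral>t. indicator {a..b} t * f t \<partial>lborel)) UNIV"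
    by (rule has_integral_eq[rotated]) (auto simp: indicator_def)
  then show ?thesis unfolding has_integral_restrict_UNIV by (simp add: integral_unique)
qed

text \<open>In the limit of wide rectangles the factor of Re c' is the integral of g(Y) sgn (y - Y)
  over the strip, which is 2 G0(y) - G0(Y0) - G0(Y1). The two constants drop out because Re c'
  integrates to 0 along a closed curve.\<close>

theorem green_formula:
  fixes c :: "real \<Rightarrow> complex" and g G0 :: "real \<Rightarrow> real"
  assumes orient: "oriented_param Plus \<gamma> a b c"
    and cg: "continuous_on {Y0..Y1} g"
    and strip: "\<And>t. t \<in> {a..b} \<Longrightarrow> Y0 < Im (c t) \<and> Im (c t) < Y1"
    and G0: "\<And>s. s \<in> {Y0..Y1} \<Longrightarrow> (G0 has_real_derivative g s) (at s within {Y0..Y1})"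
  shows "((\<lambda>z. g (Im z)) has_integral (- integral {a..b} (\<lambda>t. G0 (Im (c t)) * Re (vector_derivative c (at t))))) (inside \<gamma>)"
proof -
  obtain K where ab: "a < b" and lip: "K-lipschitz_on {a..b} c" and im: "c ` {a..b} = \<gamma>" and loop: "c a = c b"
    and sp: "simple_path (unit_path a b c)"
    using orient by (auto simp: oriented_param_def simple_lipschitz_param_def)
  have wn: "z \<in> inside \<gamma> \<Longrightarrow> winding_number (unit_path a b c) z = 1" for z
    using orient by (auto simp: oriented_param_def)
  obtain D N where D: "D \<in> borel_measurable borel" "\<And>t. norm (D t) \<le> K" "negligible N"
    "\<And>t. t \<in> {a<..<b} \<Longrightarrow> t \<notin> N \<Longrightarrow> (c has_vector_derivative D t) (at t)"
    "\<And>u v. a \<le> u \<Longrightarrow> u \<le> v \<Longrightarrow> v \<le> b \<Longrightarrow> (D has_integral (c v - c u)) {u..v}"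
    by (rule lipschitz_derivative_on[OF lip]) (rule that)
  define cc where "cc t = c (clamp1 a b t)" for t
  have ccont: "continuous_on UNIV cc"
    unfolding cc_def using lipschitz_on_continuous_on[OF lipschitz_clamp1[OF lip less_imp_le[OF ab]]] .
  have ccm: "cc \<in> borel_measurable borel" by (rule borel_measurable_continuous_onI[OF ccont])
  have cceq: "cc t = c t" if "t \<in> {a..b}" for t using that by (simp add: cc_def)
  have ccmem: "cc t \<in> \<gamma>" for t using im clamp1_mem[of a b t] ab by (auto simp: cc_def)
  have cpt: "compact \<gamma>" unfolding im[symmetric]
    by (intro compact_continuous_image lipschitz_on_continuous_on[OF lip]) simp
  then obtain R0 where R0: "R0 > 0" "\<And>z. z \<in> \<gamma> \<Longrightarrow> norm z \<le> R0"
    using compact_imp_bounded bounded_pos by metis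
  have strip': "Y0 < Im z" "Im z < Y1" if "z \<in> \<gamma>" for z using that strip im by auto
  have Y01: "Y0 < Y1" using strip[of a] ab by force
  define gg where "gg s = g (clamp1 Y0 Y1 s)" for s
  define GG where "GG s = G0 (clamp1 Y0 Y1 s)" for s
  have clc: "continuous_on UNIV (clamp1 u v)" for u v unfolding clamp1_def by (intro continuous_intros)
  have clim: "range (clamp1 Y0 Y1) \<subseteq> {Y0..Y1}" using clamp1_mem[of Y0 Y1] Y01 by auto
  have G0c: "continuous_on {Y0..Y1} G0" using G0 by (rule DERIV_continuous_on)
  have ggc: "continuous_on UNIV gg" and GGc: "continuous_on UNIV GG"
    unfolding gg_def GG_def using continuous_on_compose2[OF cg clc clim] continuous_on_compose2[OF G0c clc clim] by auto
  have ggm: "gg \<in> borel_measurable borel" and GGm: "GG \<in> borel_measurable borel"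
    by (auto intro: borel_measurable_continuous_onI ggc GGc)
  have "bounded (g ` {Y0..Y1})" "bounded (G0 ` {Y0..Y1})"
    by (auto intro!: compact_imp_bounded compact_continuous_image cg G0c)
  then obtain B B' where "\<And>s. s \<in> {Y0..Y1} \<Longrightarrow> norm (g s) \<le> B" "\<And>s. s \<in> {Y0..Y1} \<Longrightarrow> norm (G0 s) \<le> B'"
    by (meson bounded_iff image_eqI)
  then have B: "\<bar>gg s\<bar> \<le> B" and B': "\<bar>GG s\<bar> \<le> B'" for s
    using clamp1_mem[of Y0 Y1 s] Y01 by (auto simp: gg_def GG_def)
  define x y p q where "x t = Re (cc t)" and "y t = Im (cc t)" and "p t = Re (D t)" and "q t = Im (D t)" for t
  have pK: "\<bar>p t\<bar> \<le> K" "\<bar>q t\<bar> \<le> K" for t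
    using D(2)[of t] abs_Re_le_cmod[of "D t"] abs_Im_le_cmod[of "D t"] by (auto simp: p_def q_def)
  interpret gs: green_setup a b x y p q gg R0 Y0 Y1 K B
  proof
    show "x \<in> borel_measurable borel" "y \<in> borel_measurable borel" unfolding x_def y_def using ccm by auto
    show "p \<in> borel_measurable borel" "q \<in> borel_measurable borel" unfolding p_def q_def using D(1) by auto
    show "\<bar>x t\<bar> \<le> R0" for t using R0(2)[OF ccmem[of t]] abs_Re_le_cmod[of "cc t"] by (simp add: x_def)
    show "Y0 \<le> y t \<and> y t \<le> Y1" for t using strip'[OF ccmem[of t]] by (simp add: y_def)
  qed (use ggm pK B in auto)
  have om: "gs.om Y \<xi> = 2 * pi * indicator (inside \<gamma>) (Complex \<xi> Y)" if zn: "Complex \<xi> Y \<notin> \<gamma>" for Y \<xi>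
  proof -
    let ?z = "Complex \<xi> Y"
    have "closed \<gamma>" using cpt by (rule compact_imp_closed)
    then obtain d0 where d0: "d0 > 0" "\<And>w. w \<in> \<gamma> \<Longrightarrow> d0 \<le> dist ?z w"
      using separate_point_closed[OF _ zn] by blast
    have k: "gs.ker t Y \<xi> = Im (D t / (cc t - ?z))" for t
      by (simp add: gs.ker_def x_def y_def p_def q_def Im_divide)
    have "gs.om Y \<xi> = integral {a..b} (\<lambda>t. gs.ker t Y \<xi>)"
      unfolding gs.om_def
    proof (rule lborel_integral_indicator_Icc[where B = "K / d0"])
      show "(\<lambda>t. gs.ker t Y \<xi>) \<in> borel_measurable borel" unfolding gs.ker_def by measurable
      fix t
      have "d0 \<le> norm (cc t - ?z)" using d0(2)[OF ccmem[of t]] by (simp add: dist_norm norm_minus_commute)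
      then have "norm (D t / (cc t - ?z)) \<le> K / d0"
        using D(2)[of t] d0(1) by (auto simp: norm_divide intro!: frac_le order_trans[OF norm_ge_zero])
      then show "\<bar>gs.ker t Y \<xi>\<bar> \<le> K / d0" unfolding k using abs_Im_le_cmod order_trans by blast
    qed
    also have "\<dots> = 2 * pi * Re (winding_number (unit_path a b c) ?z)"
    proof (rule integral_unique, rule has_integral_spike[rotated 2])
      show "((\<lambda>t. Im (vector_derivative c (at t) / (c t - ?z))) has_integral
          2 * pi * Re (winding_number (unit_path a b c) ?z)) {a..b}"
        by (rule Re_winding_lipschitz[OF lip ab]) (use zn im in auto)
      show "negligible (N \<union> {a,b})" using D(3) by auto
      fix t assume t: "t \<in> {a..b} - (N \<union> {a,b})"
      then have "vector_derivative c (at t) = D t" by (intro vector_derivative_at D(4)) auto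
      then show "gs.ker t Y \<xi> = Im (vector_derivative c (at t) / (c t - ?z))" using t by (simp add: k cceq)
    qed
    also have "\<dots> = 2 * pi * indicator (inside \<gamma>) ?z"
    proof (cases "?z \<in> inside \<gamma>")
      case False
      then have "?z \<in> outside \<gamma>" using zn inside_Un_outside[of \<gamma>] by blast
      then have "winding_number (unit_path a b c) ?z = 0"
        using unit_path_image[OF ab, of c] im loop
        by (intro winding_number_zero_in_outside simple_path_imp_path[OF sp])
           (auto simp: pathfinish_def pathstart_def unit_path_def)
      then show ?thesis using False by simp
    qed (use wn in simp)
    finally show ?thesis .
  qed
  define h where "h z = indicator (inside \<gamma>) z * gg (Im z)" for z
  have opn: "open (inside \<gamma>)" using cpt compact_imp_closed open_inside by blast
  have hm: "h \<in> borel_measurable borel"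
    unfolding h_def using opn ggc
    by (intro borel_measurable_times borel_measurable_indicator borel_open)
       (auto intro!: borel_measurable_continuous_onI continuous_on_compose2[OF ggc] continuous_intros)
  have inbox: "\<bar>Re z\<bar> \<le> R0" "Im z \<in> {Y0..Y1}" if "z \<in> inside \<gamma>" for z
  proof -
    have 1: "inside \<gamma> \<subseteq> T" if "convex T" "\<gamma> \<subseteq> T" for T
      using outside_subset_convex[OF that] inside_Int_outside[of \<gamma>] by blast
    have "inside \<gamma> \<subseteq> cball 0 R0" by (rule 1) (use R0 in auto)
    then show "\<bar>Re z\<bar> \<le> R0" using that abs_Re_le_cmod[of z] by auto
    have "convex {z. \<i> \<bullet> z \<ge> Y0}" "convex {z. \<i> \<bullet> z \<le> Y1}"
      by (rule convex_halfspace_ge, rule convex_halfspace_le)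
    then have "convex ({z. \<i> \<bullet> z \<ge> Y0} \<inter> {z. \<i> \<bullet> z \<le> Y1})" by (rule convex_Int)
    then have "inside \<gamma> \<subseteq> {z. \<i> \<bullet> z \<ge> Y0} \<inter> {z. \<i> \<bullet> z \<le> Y1}"
      by (rule 1) (use strip' in \<open>auto simp: inner_complex_def intro: less_imp_le\<close>)
    then show "Im z \<in> {Y0..Y1}" using that by (auto simp: inner_complex_def)
  qed
  let ?T = "\<lambda>w::real\<times>real. Complex (snd w) (fst w)"
  have Tm: "?T \<in> borel_measurable lborel"
  proof -
    have "continuous_on UNIV ?T" unfolding Complex_eq by (intro continuous_intros)
    then show ?thesis using borel_measurable_continuous_onI by simp
  qed
  have aeT: "AE w in lborel. ?T w \<notin> \<gamma>"
  proof -
    have "\<gamma> \<in> null_sets lebesgue" using negligible_lipschitz_curve[OF lip] im by (simp add: negligible_iff_null_sets)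
    moreover have gb: "\<gamma> \<in> sets borel" using cpt by (simp add: borel_compact)
    ultimately have "\<gamma> \<in> null_sets lborel" by (simp add: null_sets_completion_iff)
    then have "AE z in lborel. z \<notin> \<gamma>" by (rule AE_not_in)
    then have "AE z in distr lborel borel ?T. z \<notin> \<gamma>" unfolding lborel_complex_eq_distr .
    moreover have "{z \<in> space borel. z \<notin> \<gamma>} \<in> sets borel"
    proof -
      have "{z \<in> space borel. z \<notin> \<gamma>} = - \<gamma>" by auto
      then show ?thesis using gb by simp
    qed
    ultimately show ?thesis using Tm by (subst (asm) AE_distr_iff) auto
  qed
  \<comment> \<open>From \<open>N0\<close> on the rectangle contains the whole inside, so the
    truncated integrals are independent of \<open>n\<close>, as \<open>limit_formula\<close>
    demands.\<close>
  obtain N0 :: nat where N0: "R0 \<le> real N0" using real_arch_simple by blast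
  have V: "(\<integral>w. indicator {Y0..Y1} (fst w) * gg (fst w) *
      (indicator {- real n..real n} (snd w) * gs.om (fst w) (snd w)) \<partial>lborel) = 2 * pi * (\<integral>z. h z \<partial>lborel)"
    if n: "N0 \<le> n" for n
  proof -
    have "(\<integral>w. indicator {Y0..Y1} (fst w) * gg (fst w) *
      (indicator {- real n..real n} (snd w) * gs.om (fst w) (snd w)) \<partial>lborel) = (\<integral>w. 2 * pi * h (?T w) \<partial>lborel)"
    proof (rule integral_cong_AE)
      show "(\<lambda>w. 2 * pi * h (?T w)) \<in> borel_measurable lborel"
        using measurable_compose[OF Tm hm] by simp
      show "AE w in lborel. indicator {Y0..Y1} (fst w) * gg (fst w) *
        (indicator {- real n..real n} (snd w) * gs.om (fst w) (snd w)) = 2 * pi * h (?T w)"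
        using aeT
      proof eventually_elim
        fix w :: "real \<times> real" assume w: "?T w \<notin> \<gamma>"
        show "indicator {Y0..Y1} (fst w) * gg (fst w) *
          (indicator {- real n..real n} (snd w) * gs.om (fst w) (snd w)) = 2 * pi * h (?T w)"
          using inbox[of "?T w"] n N0 unfolding om[OF w] h_def
          by (auto simp: indicator_def)
      qed
      have "(\<lambda>w. \<integral>t. gs.\<phi> (real n) t w \<partial>lborel) \<in> borel_measurable lborel"
        using lborel_pair.integrable_snd[OF gs.\<phi>_integrable[of "real n"]] by (simp add: borel_measurable_integrable)
      moreover have "(\<integral>t. gs.\<phi> (real n) t w \<partial>lborel) = indicator {Y0..Y1} (fst w) * gg (fst w) *
        (indicator {- real n..real n} (snd w) * gs.om (fst w) (snd w))" for w
      proof -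
        have "(\<integral>t. gs.\<phi> (real n) t w \<partial>lborel) = (\<integral>t. (indicator {Y0..Y1} (fst w) * gg (fst w) * indicator {-real n..real n} (snd w)) * (indicator {a..b} t * gs.ker t (fst w) (snd w)) \<partial>lborel)"
          by (rule Bochner_Integration.integral_cong) (auto simp: gs.\<phi>_def mult_ac)
        then show ?thesis by (simp only: gs.om_def mult.assoc integral_mult_right_zero)
      qed
      ultimately show "(\<lambda>w. indicator {Y0..Y1} (fst w) * gg (fst w) *
        (indicator {- real n..real n} (snd w) * gs.om (fst w) (snd w))) \<in> borel_measurable lborel" by simp
    qed
    also have "\<dots> = 2 * pi * (\<integral>w. h (?T w) \<partial>lborel)" by simp
    also have "(\<integral>w. h (?T w) \<partial>lborel) = (\<integral>z. h z \<partial>distr lborel borel ?T)"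
      by (rule integral_distr[symmetric]) (use Tm hm in auto)
    finally show ?thesis unfolding lborel_complex_eq_distr .
  qed
  have inner: "(\<integral>Y. gs.\<psi>lim t Y \<partial>lborel) = indicator {a..b} t * (- pi * (p t * (2 * GG (y t) - G0 Y0 - G0 Y1)))" for t
  proof -
    have yt: "Y0 \<le> y t" "y t \<le> Y1" using strip'[OF ccmem[of t]] by (auto simp: y_def)
    have ftc: "(g has_integral (G0 v - G0 u)) {u..v}" if "Y0 \<le> u" "u \<le> v" "v \<le> Y1" for u v
    proof (rule fundamental_theorem_of_calculus[OF that(2)])
      fix s assume "s \<in> {u..v}"
      then have "(G0 has_real_derivative g s) (at s within {u..v})"
        using that by (intro DERIV_subset[OF G0]) auto
      then show "(G0 has_vector_derivative g s) (at s within {u..v})"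
        by (simp add: has_real_derivative_iff_has_vector_derivative)
    qed
    have 1: "((\<lambda>Y. gg Y * sgn (y t - Y)) has_integral (G0 (y t) - G0 Y0)) {Y0..y t}"
      by (rule has_integral_spike[OF _ _ ftc[OF order_refl yt], of "{y t}"]) (use yt in \<open>auto simp: gg_def\<close>)
    have "((\<lambda>Y. - g Y) has_integral - (G0 Y1 - G0 (y t))) {y t..Y1}"
      by (intro has_integral_neg ftc) (use yt in auto)
    then have 2: "((\<lambda>Y. gg Y * sgn (y t - Y)) has_integral - (G0 Y1 - G0 (y t))) {y t..Y1}"
      by (rule has_integral_spike[rotated 2, of _ _ _ "{y t}"]) (use yt in \<open>auto simp: gg_def\<close>)
    have 3: "integral {Y0..Y1} (\<lambda>Y. gg Y * sgn (y t - Y)) = (G0 (y t) - G0 Y0) + - (G0 Y1 - G0 (y t))"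
      by (rule integral_unique[OF has_integral_combine[OF yt 1 2]])
    have "(\<integral>Y. gs.\<psi>lim t Y \<partial>lborel) = (\<integral>Y. (indicator {a..b} t * (- pi * p t)) * (indicator {Y0..Y1} Y * (gg Y * sgn (y t - Y))) \<partial>lborel)"
      by (rule Bochner_Integration.integral_cong) (auto simp: gs.\<psi>lim_def)
    also have "\<dots> = (indicator {a..b} t * (- pi * p t)) * (\<integral>Y. indicator {Y0..Y1} Y * (gg Y * sgn (y t - Y)) \<partial>lborel)"
      by (rule integral_mult_right_zero)
    also have "(\<integral>Y. indicator {Y0..Y1} Y * (gg Y * sgn (y t - Y)) \<partial>lborel) = integral {Y0..Y1} (\<lambda>Y. gg Y * sgn (y t - Y))"
    proof (rule lborel_integral_indicator_Icc[where B = B])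
      show "(\<lambda>Y. gg Y * sgn (y t - Y)) \<in> borel_measurable borel" using ggm by measurable
      show "\<bar>gg Y * sgn (y t - Y)\<bar> \<le> B" for Y
        using B[of Y] by (auto simp: abs_mult sgn_if)
    qed
    finally show ?thesis unfolding 3 using yt by (simp add: GG_def algebra_simps)
  qed
  have "2 * pi * (\<integral>z. h z \<partial>lborel) = (\<integral>t. (\<integral>Y. gs.\<psi>lim t Y \<partial>lborel) \<partial>lborel)"
    by (rule gs.limit_formula[OF V])
  also have "\<dots> = (\<integral>t. indicator {a..b} t * (- pi * (p t * (2 * GG (y t) - G0 Y0 - G0 Y1))) \<partial>lborel)"
    unfolding inner ..
  also have "\<dots> = integral {a..b} (\<lambda>t. - pi * (p t * (2 * GG (y t) - G0 Y0 - G0 Y1)))"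
  proof (rule lborel_integral_indicator_Icc[where B = "pi * (K * (2 * B' + \<bar>G0 Y0\<bar> + \<bar>G0 Y1\<bar>))"])
    show "(\<lambda>t. - pi * (p t * (2 * GG (y t) - G0 Y0 - G0 Y1))) \<in> borel_measurable borel"
      using gs.meas(2,3) GGm by measurable
    fix t
    have "\<bar>p t\<bar> * \<bar>2 * GG (y t) - G0 Y0 - G0 Y1\<bar> \<le> K * (2 * B' + \<bar>G0 Y0\<bar> + \<bar>G0 Y1\<bar>)"
      using pK(1)[of t] B'[of "y t"] by (intro mult_mono) auto
    then show "\<bar>- pi * (p t * (2 * GG (y t) - G0 Y0 - G0 Y1))\<bar> \<le> pi * (K * (2 * B' + \<bar>G0 Y0\<bar> + \<bar>G0 Y1\<bar>))"
      by (simp add: abs_mult)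
  qed
  also have "\<dots> = 2 * pi * (- integral {a..b} (\<lambda>t. G0 (Im (c t)) * Re (vector_derivative c (at t))))"
  proof -
    have pint: "(p has_integral 0) {a..b}"
      using has_integral_linear[OF D(5)[of a b] bounded_linear_Re] ab loop by (simp add: o_def p_def[abs_def])
    have "(\<lambda>t. GG (y t) * p t) integrable_on {a..b}"
    proof (rule bounded_borel_integrable)
      show "(\<lambda>t. GG (y t) * p t) \<in> borel_measurable borel" using gs.meas(2,3) GGm by measurable
      show "\<bar>GG (y t) * p t\<bar> \<le> B' * K" for t
        using pK(1)[of t] B'[of "y t"] by (auto simp: abs_mult intro!: mult_mono)
    qed
    then have gi: "((\<lambda>t. GG (y t) * p t) has_integral integral {a..b} (\<lambda>t. GG (y t) * p t)) {a..b}"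
      by (rule integrable_integral)
    have "((\<lambda>t. (- 2 * pi) * (GG (y t) * p t) + pi * (G0 Y0 + G0 Y1) * p t) has_integral
       (- 2 * pi) * integral {a..b} (\<lambda>t. GG (y t) * p t) + pi * (G0 Y0 + G0 Y1) * 0) {a..b}"
      by (intro has_integral_add has_integral_mult_right gi pint)
    then have "integral {a..b} (\<lambda>t. - pi * (p t * (2 * GG (y t) - G0 Y0 - G0 Y1))) = (- 2 * pi) * integral {a..b} (\<lambda>t. GG (y t) * p t)"
      by (intro integral_unique) (simp add: algebra_simps)
    moreover have "integral {a..b} (\<lambda>t. GG (y t) * p t) = integral {a..b} (\<lambda>t. G0 (Im (c t)) * Re (vector_derivative c (at t)))"
    proof (rule integral_spike)
      show "negligible (N \<union> {a,b})" using D(3) by auto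
      fix t assume t: "t \<in> {a..b} - (N \<union> {a,b})"
      then have "vector_derivative c (at t) = D t" by (intro vector_derivative_at D(4)) auto
      then show "G0 (Im (c t)) * Re (vector_derivative c (at t)) = GG (y t) * p t"
        using t strip[of t] by (simp add: GG_def y_def p_def cceq)
    qed
    ultimately show ?thesis by simp
  qed
  finally have hval: "(\<integral>z. h z \<partial>lborel) = - integral {a..b} (\<lambda>t. G0 (Im (c t)) * Re (vector_derivative c (at t)))"
    by (subst (asm) mult_left_cancel) auto
  have hint: "integrable lborel h"
  proof (rule Bochner_Integration.integrable_bound)
    have "bounded (inside \<gamma>)" using cpt compact_imp_bounded bounded_inside by blast
    then have "emeasure lborel (inside \<gamma>) < \<infinity>" by (rule emeasure_bounded_finite)
    then show "integrable lborel (\<lambda>z. indicator (inside \<gamma>) z * B)"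
      using opn by (intro integrable_mult_left integrable_real_indicator) auto
    show "AE z in lborel. norm (h z) \<le> norm (indicator (inside \<gamma>) z * B)"
      using B by (auto intro!: AE_I2 simp: h_def indicator_def intro: order_trans[OF _ abs_ge_self])
  qed (use hm in simp)
  have "(h has_integral - integral {a..b} (\<lambda>t. G0 (Im (c t)) * Re (vector_derivative c (at t)))) UNIV"
    using has_integral_integral_lborel[OF hint] unfolding hval .
  then have "((\<lambda>z. if z \<in> inside \<gamma> then g (Im z) else 0) has_integral
      - integral {a..b} (\<lambda>t. G0 (Im (c t)) * Re (vector_derivative c (at t)))) UNIV"
    by (rule has_integral_eq[rotated]) (use inbox in \<open>auto simp: h_def gg_def\<close>)
  then show ?thesis by (simp only: has_integral_restrict_UNIV)
qed

lemma Area_eq_contour_integral: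
  assumes o: "oriented_param Plus \<gamma> a b c" and sub: "\<gamma> \<subseteq> G"
  shows "Area (inside \<gamma>) = integral {a..b} (\<lambda>t. Re (vector_derivative c (at t)) / Im (c t))"
proof -
  obtain K where ab: "a < b" and lip: "K-lipschitz_on {a..b} c" and im: "c ` {a..b} = \<gamma>"
    using o by (auto simp: oriented_param_def simple_lipschitz_param_def)
  obtain m M where m: "0 < m" "\<And>t. t \<in> {a..b} \<Longrightarrow> m \<le> Im (c t)" "\<And>t. t \<in> {a..b} \<Longrightarrow> Im (c t) \<le> M"
    by (rule curve_Im_bounds[OF lipschitz_on_continuous_on[OF lip]]) (use im sub that in auto)
  have "((\<lambda>z. 1 / (Im z)\<^sup>2) has_integral (- integral {a..b} (\<lambda>t. - (1 / Im (c t)) * Re (vector_derivative c (at t))))) (inside \<gamma>)"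
  \<comment> \<open>Green's formula wants the curve strictly inside the strip; the lower end m/2
    leaves room and keeps 1/s^2 regular.\<close>
  proof (rule green_formula[OF o, where ?Y0.0 = "m / 2" and ?Y1.0 = "M + 1" and ?G0.0 = "\<lambda>s. - (1 / s)" and g = "\<lambda>s. 1 / s\<^sup>2"])
    show "continuous_on {m / 2..M + 1} (\<lambda>s. 1 / s\<^sup>2)" by (intro continuous_intros) (use m in auto)
    show "m / 2 < Im (c t) \<and> Im (c t) < M + 1" if "t \<in> {a..b}" for t
      using m(2)[OF that] m(3)[OF that] m(1) by auto
    show "((\<lambda>s. - (1 / s)) has_real_derivative 1 / s\<^sup>2) (at s within {m / 2..M + 1})" if "s \<in> {m / 2..M + 1}" for s
      using that m(1) by (auto intro!: derivative_eq_intros simp: power2_eq_square)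
  qed
  then show ?thesis unfolding Area_def by (simp add: integral_unique)
qed

section \<open>Horizontal slices of a convex body\<close>

lemma derivative_zero_by_comparison:
  fixes h y :: "real \<Rightarrow> real"
  assumes y: "(y has_real_derivative 0) (at t)" and U: "open U" "t \<in> U"
    and le: "\<And>s. s \<in> U \<Longrightarrow> \<bar>h s - h t\<bar> \<le> B * \<bar>y s - y t\<bar>"
  shows "(h has_real_derivative 0) (at t)"
  unfolding has_field_derivative_iff
proof (rule Lim_null_comparison)
  have "((\<lambda>s. (y s - y t) / (s - t)) \<longlongrightarrow> 0) (at t)" using y by (simp add: has_field_derivative_iff)
  then have "((\<lambda>s. B * \<bar>(y s - y t) / (s - t)\<bar>) \<longlongrightarrow> B * \<bar>0\<bar>) (at t)" by (intro tendsto_intros)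
  then show "((\<lambda>s. B * \<bar>(y s - y t) / (s - t)\<bar>) \<longlongrightarrow> 0) (at t)" by simp
  have "\<forall>\<^sub>F s in at t. s \<in> U" using U eventually_at_in_open' by blast
  then show "\<forall>\<^sub>F s in at t. norm ((h s - h t) / (s - t)) \<le> B * \<bar>(y s - y t) / (s - t)\<bar>"
  proof eventually_elim
    case (elim s)
    show ?case using divide_right_mono[OF le[OF elim], of "\<bar>s - t\<bar>"] by (simp add: abs_divide)
  qed
qed

lemma bounded_continuous_Ioo_integrable:
  fixes f :: "real \<Rightarrow> real"
  assumes "continuous_on {a<..<b} f" "\<And>s. s \<in> {a..b} \<Longrightarrow> \<bar>f s\<bar> \<le> B"
  shows "f integrable_on {a..b}"
proof -
  have "f integrable_on {a<..<b}"
  proof (rule measurable_bounded_by_integrable_imp_integrable[where g = "\<lambda>_. B"])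
    show "f \<in> borel_measurable (lebesgue_on {a<..<b})"
      by (rule continuous_imp_measurable_on_sets_lebesgue[OF assms(1)]) simp
    show "(\<lambda>_. B) integrable_on {a<..<b}"
      using integrable_on_Icc_iff_Ioo[of "\<lambda>_. B" a b] integrable_const_ivl[of B a b] by blast
  qed (use assms in auto)
  then show ?thesis by (simp add: integrable_on_Icc_iff_Ioo)
qed

lemma derivative_zero_at_bounds:
  fixes y :: "real \<Rightarrow> real"
  assumes yt: "(y has_real_derivative d) (at t)" and t: "t \<in> {a<..<b}"
    and rng: "\<And>t. t \<in> {a..b} \<Longrightarrow> y t \<in> {m..M}" and out: "y t \<notin> {m<..<M}"
  shows "d = 0"
proof -
  have rt: "y t \<in> {m..M}" using rng t by auto
  have pos: "0 < min (t - a) (b - t)" using t by simp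
  show ?thesis
  proof (cases "y t = m")
    case True
    then have "\<forall>s. \<bar>t - s\<bar> < min (t - a) (b - t) \<longrightarrow> y t \<le> y s"
      using rng by (auto simp: abs_if split: if_splits)
    then show ?thesis by (rule DERIV_local_min[OF yt pos])
  next
    case False
    then have "y t = M" using out rt by auto
    then have "\<forall>s. \<bar>t - s\<bar> < min (t - a) (b - t) \<longrightarrow> y s \<le> y t"
      using rng by (auto simp: abs_if split: if_splits)
    then show ?thesis by (rule DERIV_local_max[OF yt pos])
  qed
qed

text \<open>The value depends only on the heights at the two ends, not on how \<open>y\<close> moves
  between them. Continuity of \<phi> is available only inside the range; where \<open>y\<close>
  touches an extreme value its derivative vanishes, and so does that of the composed
  primitive.\<close>

lemma chain_integral:
  fixes \<phi> y y' :: "real \<Rightarrow> real"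
  assumes \<phi>b: "\<And>s. s \<in> {m..M} \<Longrightarrow> \<bar>\<phi> s\<bar> \<le> B" and \<phi>c: "continuous_on {m<..<M} \<phi>"
    and lip: "K-lipschitz_on {a..b} y" and ab: "a \<le> b" and rng: "\<And>t. t \<in> {a..b} \<Longrightarrow> y t \<in> {m..M}"
    and N: "negligible N" and yd: "\<And>t. t \<in> {a<..<b} \<Longrightarrow> t \<notin> N \<Longrightarrow> (y has_real_derivative y' t) (at t)"
  shows "((\<lambda>t. \<phi> (y t) * y' t) has_integral (integral {m..y b} \<phi> - integral {m..y a} \<phi>)) {a..b}"
proof -
  have \<phi>i: "\<phi> integrable_on {m..M}" by (rule bounded_continuous_Ioo_integrable[OF \<phi>c \<phi>b])
  have B0: "0 \<le> B" using \<phi>b[of "y a"] rng[of a] ab by force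
  define H where "H s = integral {m..s} \<phi>" for s
  have Hdiff: "\<bar>H s - H r\<bar> \<le> B * \<bar>s - r\<bar>" if "r \<in> {m..M}" "s \<in> {m..M}" for r s
  proof -
    have le: "\<bar>H s - H r\<bar> \<le> B * (s - r)" if "m \<le> r" "r \<le> s" "s \<le> M" for r s
    proof -
      have i: "\<phi> integrable_on {m..s}" "\<phi> integrable_on {r..s}"
        by (rule integrable_on_subinterval[OF \<phi>i]; use that in auto)+
      have "H r + integral {r..s} \<phi> = H s"
        unfolding H_def by (rule Henstock_Kurzweil_Integration.integral_combine) (use that i in auto)
      moreover have "norm (integral {r..s} \<phi>) \<le> B * Henstock_Kurzweil_Integration.content (cbox r s)"
        by (rule has_integral_bound[OF B0]) (use i(2) \<phi>b that in \<open>auto simp: integrable_integral\<close>)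
      ultimately show ?thesis using that by auto
    qed
    show ?thesis using le[of r s] le[of s r] that by (cases "r \<le> s") (auto simp: abs_minus_commute)
  qed
  have Hder: "(H has_real_derivative \<phi> s) (at s)" if s: "s \<in> {m<..<M}" for s
  proof -
    have "continuous (at s within ({m..M} - {})) \<phi>"
      using \<phi>c s by (simp add: continuous_on_eq_continuous_at continuous_at_imp_continuous_at_within)
    then have "((\<lambda>u. integral {m..u} \<phi>) has_vector_derivative \<phi> s) (at s within ({m..M} - {}))"
      by (intro integral_has_vector_derivative_continuous_at[OF \<phi>i]) (use s in auto)
    moreover have "at s within {m..M} = at s" by (rule at_within_interior) (use s in auto)
    ultimately show ?thesis by (simp add: H_def[abs_def] has_real_derivative_iff_has_vector_derivative)
  qed
  have "(B * K)-lipschitz_on {a..b} (\<lambda>t. H (y t))"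
  proof (rule lipschitz_onI)
    show "0 \<le> B * K" using B0 lipschitz_on_nonneg[OF lip] by simp
    fix s t assume st: "s \<in> {a..b}" "t \<in> {a..b}"
    have "\<bar>H (y s) - H (y t)\<bar> \<le> B * \<bar>y s - y t\<bar>" by (rule Hdiff[OF rng[OF st(2)] rng[OF st(1)]])
    also have "\<dots> \<le> B * (K * dist s t)"
      using lipschitz_onD[OF lip st] B0 by (intro mult_left_mono) (auto simp: dist_real_def)
    finally show "dist (H (y s)) (H (y t)) \<le> B * K * dist s t" by (simp add: dist_real_def)
  qed
  then have "((\<lambda>t. \<phi> (y t) * y' t) has_integral (H (y b) - H (y a))) {a..b}"
  proof (rule lipschitz_fundamental_theorem[OF _ ab N])
    fix t assume t: "t \<in> {a<..<b}" "t \<notin> N"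
    have yt: "(y has_real_derivative y' t) (at t)" using yd t by blast
    have "((\<lambda>t. H (y t)) has_real_derivative \<phi> (y t) * y' t) (at t)"
    proof (cases "y t \<in> {m<..<M}")
      case True
      from DERIV_chain2[OF Hder[OF True] yt] show ?thesis .
    next
      case False
      have y0: "y' t = 0" by (rule derivative_zero_at_bounds[OF yt t(1) rng False])
      have "((\<lambda>t. H (y t)) has_real_derivative 0) (at t)"
      proof (rule derivative_zero_by_comparison)
        show "(y has_real_derivative 0) (at t)" using yt y0 by simp
        show "open {a<..<b}" "t \<in> {a<..<b}" using t by auto
        show "\<bar>H (y s) - H (y t)\<bar> \<le> B * \<bar>y s - y t\<bar>" if "s \<in> {a<..<b}" for s
          by (rule Hdiff) (use that t rng in auto)
      qed
      then show ?thesis using y0 by simp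
    qed
    then show "((\<lambda>t. H (y t)) has_vector_derivative \<phi> (y t) * y' t) (at t)"
      by (simp add: has_real_derivative_iff_has_vector_derivative)
  qed
  then show ?thesis by (simp add: H_def)
qed

lemma nonneg_has_integral_zero_negligible:
  fixes f :: "real \<Rightarrow> real"
  assumes i: "(f has_integral 0) {a..b}" and f: "\<And>t. t \<in> {a..b} \<Longrightarrow> 0 \<le> f t"
  shows "negligible {t\<in>{a..b}. f t \<noteq> 0}"
proof -
  have "f absolutely_integrable_on {a..b}"
    by (rule nonnegative_absolutely_integrable_1) (use i f in auto)
  then have int: "integrable lebesgue (\<lambda>t. indicator {a..b} t *\<^sub>R f t)"
    by (simp add: set_integrable_def)
  have "((\<lambda>t. indicator {a..b} t *\<^sub>R f t) has_integral integral\<^sup>L lebesgue (\<lambda>t. indicator {a..b} t *\<^sub>R f t)) UNIV"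
    by (rule has_integral_integral_lebesgue[OF int])
  then have "((\<lambda>t. if t \<in> {a..b} then f t else 0) has_integral integral\<^sup>L lebesgue (\<lambda>t. indicator {a..b} t *\<^sub>R f t)) UNIV"
    by (rule has_integral_eq[rotated]) (auto simp: indicator_def)
  then have "integral\<^sup>L lebesgue (\<lambda>t. indicator {a..b} t *\<^sub>R f t) = 0"
    unfolding has_integral_restrict_UNIV using i by (rule has_integral_unique)
  then have "AE t in lebesgue. indicator {a..b} t *\<^sub>R f t = 0"
    by (subst (asm) integral_nonneg_eq_0_iff_AE[OF int]) (use f in \<open>auto intro!: AE_I2 simp: indicator_def\<close>)
  then obtain N where N: "N \<in> null_sets lebesgue" "{t. indicator {a..b} t *\<^sub>R f t \<noteq> 0} \<subseteq> N"
    unfolding eventually_ae_filter by auto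
  then have "negligible N" by (simp add: negligible_iff_null_sets)
  then show ?thesis by (rule negligible_subset) (use N(2) in \<open>auto simp: indicator_def\<close>)
qed

context body
begin

definition ylo :: real where "ylo = Inf (Im ` Q)"
definition yhi :: real where "yhi = Sup (Im ` Q)"
text \<open>At each height of its range \<open>Q\<close> is the segment from \<open>xl\<close> to
  \<open>xr\<close>, so the two functions trace the left and right arcs of its boundary.\<close>

definition xr :: "real \<Rightarrow> real" where "xr Y = Sup {x. Complex x Y \<in> Q}"
definition xl :: "real \<Rightarrow> real" where "xl Y = Inf {x. Complex x Y \<in> Q}"

lemma Im_range: "z \<in> Q \<Longrightarrow> Im z \<in> {ylo..yhi}"
proof -
  have "compact (Im ` Q)" by (intro compact_continuous_image compQ continuous_intros)
  then have "bdd_above (Im ` Q)" "bdd_below (Im ` Q)"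
    by (auto intro: bounded_imp_bdd_above bounded_imp_bdd_below compact_imp_bounded)
  then show "z \<in> Q \<Longrightarrow> Im z \<in> {ylo..yhi}"
    by (auto simp: ylo_def yhi_def intro!: cInf_lower cSup_upper)
qed

lemma ylo_attained: obtains z where "z \<in> Q" "Im z = ylo"
proof -
  have "compact (Im ` Q)" "Im ` Q \<noteq> {}" using zero_in by (auto intro!: compact_continuous_image compQ continuous_intros)
  then have "Inf (Im ` Q) \<in> Im ` Q"
    by (intro closed_contains_Inf bounded_imp_bdd_below compact_imp_bounded compact_imp_closed)
  then show ?thesis using that by (auto simp: ylo_def)
qed

lemma yhi_attained: obtains z where "z \<in> Q" "Im z = yhi"
proof -
  have "compact (Im ` Q)" "Im ` Q \<noteq> {}" using zero_in by (auto intro!: compact_continuous_image compQ continuous_intros)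
  then have "Sup (Im ` Q) \<in> Im ` Q"
    by (intro closed_contains_Sup bounded_imp_bdd_above compact_imp_bounded compact_imp_closed)
  then show ?thesis using that by (auto simp: yhi_def)
qed

lemma ylo_yhi: "ylo < 0" "0 < yhi"
proof -
  obtain e where e: "e > 0" "ball 0 e \<subseteq> Q" using zeroQ by (meson mem_interior)
  then have "Complex 0 (e / 2) \<in> Q" "Complex 0 (- e / 2) \<in> Q" by (auto simp: subset_eq cmod_def)
  from Im_range[OF this(1)] Im_range[OF this(2)] e(1) show "ylo < 0" "0 < yhi" by auto
qed

lemma slice_ne: assumes "Y \<in> {ylo..yhi}" shows "\<exists>x. Complex x Y \<in> Q"
proof -
  obtain z w where zw: "z \<in> Q" "Im z = ylo" "w \<in> Q" "Im w = yhi" using ylo_attained yhi_attained by metis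
  define t where "t = (Y - ylo) / (yhi - ylo)"
  have t: "0 \<le> t" "t \<le> 1" using assms ylo_yhi by (auto simp: t_def divide_le_eq)
  have "(1 - t) *\<^sub>R z + t *\<^sub>R w \<in> Q" using convexD_alt[OF convQ zw(1,3)] t by simp
  moreover have "t * (yhi - ylo) = Y - ylo" using ylo_yhi by (simp add: t_def)
  then have "Im ((1 - t) *\<^sub>R z + t *\<^sub>R w) = Y" using zw by (simp add: algebra_simps)
  ultimately show ?thesis by (metis complex.collapse)
qed

lemma slice_compact: "compact {x. Complex x Y \<in> Q}"
proof -
  obtain B where B: "\<And>z. z \<in> Q \<Longrightarrow> norm z \<le> B" using compact_imp_bounded[OF compQ] by (auto simp: bounded_iff)
  have "continuous_on UNIV (\<lambda>x. Complex x Y)" unfolding Complex_eq by (intro continuous_intros)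
  then have "closed ((\<lambda>x. Complex x Y) -` Q)" by (intro closed_vimage compact_imp_closed compQ)
  moreover have "bounded {x. Complex x Y \<in> Q}"
    unfolding bounded_iff using B abs_Re_le_cmod by (metis complex.sel(1) mem_Collect_eq order_trans real_norm_def)
  ultimately show ?thesis by (simp add: compact_eq_bounded_closed vimage_def)
qed

lemma xr_mem: "Y \<in> {ylo..yhi} \<Longrightarrow> Complex (xr Y) Y \<in> Q"
  and xl_mem: "Y \<in> {ylo..yhi} \<Longrightarrow> Complex (xl Y) Y \<in> Q"
proof -
  assume "Y \<in> {ylo..yhi}"
  then have ne: "{x. Complex x Y \<in> Q} \<noteq> {}" using slice_ne by auto
  have "xr Y \<in> {x. Complex x Y \<in> Q}" unfolding xr_def
    by (intro closed_contains_Sup ne bounded_imp_bdd_above compact_imp_bounded compact_imp_closed slice_compact)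
  then show "Complex (xr Y) Y \<in> Q" by simp
  have "xl Y \<in> {x. Complex x Y \<in> Q}" unfolding xl_def
    by (intro closed_contains_Inf ne bounded_imp_bdd_below compact_imp_bounded compact_imp_closed slice_compact)
  then show "Complex (xl Y) Y \<in> Q" by simp
qed

lemma slice_bounds: "Complex x Y \<in> Q \<Longrightarrow> xl Y \<le> x \<and> x \<le> xr Y"
proof -
  have "bdd_above {x. Complex x Y \<in> Q}" "bdd_below {x. Complex x Y \<in> Q}"
    by (intro bounded_imp_bdd_above bounded_imp_bdd_below compact_imp_bounded slice_compact)+
  then show "Complex x Y \<in> Q \<Longrightarrow> xl Y \<le> x \<and> x \<le> xr Y"
    unfolding xr_def xl_def by (auto intro: cInf_lower cSup_upper)
qed

lemma slice_eq: assumes "Y \<in> {ylo..yhi}" shows "Complex x Y \<in> Q \<longleftrightarrow> x \<in> {xl Y..xr Y}"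
proof
  show "Complex x Y \<in> Q \<Longrightarrow> x \<in> {xl Y..xr Y}" using slice_bounds by auto
  assume x: "x \<in> {xl Y..xr Y}"
  show "Complex x Y \<in> Q"
  proof (cases "xl Y = xr Y")
    case True
    then show ?thesis using x xr_mem[OF assms] by simp
  next
    case False
    then have lt: "xl Y < xr Y" using x by auto
    define t where "t = (x - xl Y) / (xr Y - xl Y)"
    have t: "0 \<le> t" "t \<le> 1" using x lt by (auto simp: t_def divide_le_eq)
    have "(1 - t) *\<^sub>R Complex (xl Y) Y + t *\<^sub>R Complex (xr Y) Y \<in> Q"
      using convexD_alt[OF convQ xl_mem[OF assms] xr_mem[OF assms]] t by simp
    moreover have "t * (xr Y - xl Y) = x - xl Y" using lt by (simp add: t_def)
    then have "(1 - t) *\<^sub>R Complex (xl Y) Y + t *\<^sub>R Complex (xr Y) Y = Complex x Y"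
      by (simp add: complex_eq_iff algebra_simps)
    ultimately show ?thesis by simp
  qed
qed

lemma x_bounded: obtains B where "B > 0" "\<And>Y. Y \<in> {ylo..yhi} \<Longrightarrow> \<bar>xr Y\<bar> \<le> B" "\<And>Y. Y \<in> {ylo..yhi} \<Longrightarrow> \<bar>xl Y\<bar> \<le> B"
proof -
  obtain B where B: "B > 0" "\<And>z. z \<in> Q \<Longrightarrow> norm z \<le> B" using compact_imp_bounded[OF compQ] by (meson bounded_pos)
  show ?thesis
  proof (rule that[OF B(1)])
    fix Y assume Y: "Y \<in> {ylo..yhi}"
    show "\<bar>xr Y\<bar> \<le> B" using B(2)[OF xr_mem[OF Y]] abs_Re_le_cmod[of "Complex (xr Y) Y"] by simp
    show "\<bar>xl Y\<bar> \<le> B" using B(2)[OF xl_mem[OF Y]] abs_Re_le_cmod[of "Complex (xl Y) Y"] by simp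
  qed
qed

text \<open>Concavity of the right arc and convexity of the left arc, multiplied out so that the
  inequality also covers p = t.\<close>

lemma three_point:
  assumes "ylo \<le> p" "p \<le> s" "s \<le> t" "t \<le> yhi"
  shows "(t - s) * xr p + (s - p) * xr t \<le> (t - p) * xr s"
    and "(t - p) * xl s \<le> (t - s) * xl p + (s - p) * xl t"
proof -
  have *: "(t - p) * xl s \<le> (t - s) * x1 + (s - p) * x2 \<and> (t - s) * x1 + (s - p) * x2 \<le> (t - p) * xr s"
    if x: "Complex x1 p \<in> Q" "Complex x2 t \<in> Q" for x1 x2
  proof (cases "p = t")
    case True
    then show ?thesis using assms by simp
  next
    case False
    then have tp: "t - p > 0" using assms by simp
    define r where "r = (s - p) / (t - p)"
    have r: "0 \<le> r" "r \<le> 1" using assms tp by (auto simp: r_def)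
    have rr: "r * (t - p) = s - p" using tp by (simp add: r_def)
    have "(1 - r) *\<^sub>R Complex x1 p + r *\<^sub>R Complex x2 t \<in> Q"
      using convexD_alt[OF convQ x] r by simp
    moreover have "(1 - r) *\<^sub>R Complex x1 p + r *\<^sub>R Complex x2 t = Complex ((1 - r) * x1 + r * x2) s"
      using rr by (simp add: complex_eq_iff algebra_simps)
    ultimately have b: "xl s \<le> (1 - r) * x1 + r * x2" "(1 - r) * x1 + r * x2 \<le> xr s" using slice_bounds by auto
    have e: "(t - p) * ((1 - r) * x1 + r * x2) = (t - s) * x1 + (s - p) * x2"
    proof -
      have "(t - p) * ((1 - r) * x1 + r * x2) = (t - p - r * (t - p)) * x1 + r * (t - p) * x2"
        by (simp add: algebra_simps)
      then show ?thesis unfolding rr by simp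
    qed
    show ?thesis using mult_left_mono[OF b(1), of "t - p"] mult_left_mono[OF b(2), of "t - p"] tp e by auto
  qed
  show "(t - s) * xr p + (s - p) * xr t \<le> (t - p) * xr s"
    using *[OF xr_mem xr_mem] assms by auto
  show "(t - p) * xl s \<le> (t - s) * xl p + (s - p) * xl t"
    using *[OF xl_mem xl_mem] assms by auto
qed

end

text \<open>Slopes of a concave function between interior points lie between slopes to the ends of
  the interval. The ends are at distance at least \<open>e\<close>, so 2 B / e bounds them.\<close>

lemma concave_locally_lipschitz:
  fixes f :: "real \<Rightarrow> real"
  assumes tp: "\<And>p s t. lo \<le> p \<Longrightarrow> p \<le> s \<Longrightarrow> s \<le> t \<Longrightarrow> t \<le> hi \<Longrightarrow> (t - s) * f p + (s - p) * f t \<le> (t - p) * f s"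
    and B: "\<And>s. s \<in> {lo..hi} \<Longrightarrow> \<bar>f s\<bar> \<le> B" and m: "lo < m1" "m1 \<le> m2" "m2 < hi"
  obtains K where "K-lipschitz_on {m1..m2} f"
proof -
  define e where "e = min (m1 - lo) (hi - m2)"
  have e: "e > 0" "m1 - lo \<ge> e" "hi - m2 \<ge> e" using m by (auto simp: e_def)
  have B0: "0 \<le> B" using B[of m1] m by force
  have le: "\<bar>f t - f s\<bar> \<le> 2 * B / e * (t - s)" if st: "s \<in> {m1..m2}" "t \<in> {m1..m2}" "s \<le> t" for s t
  proof -
    have "(t - s) * f lo + (s - lo) * f t \<le> (t - lo) * f s" using tp[of lo s t] st m by auto
    then have 1: "(s - lo) * (f t - f s) \<le> (t - s) * (f s - f lo)" by (simp add: algebra_simps)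
    have "(hi - t) * f s + (t - s) * f hi \<le> (hi - s) * f t" using tp[of s t hi] st m by auto
    then have 2: "(hi - t) * (f s - f t) \<le> (t - s) * (f t - f hi)" by (simp add: algebra_simps)
    have b: "f s - f lo \<le> 2 * B" "f t - f hi \<le> 2 * B"
      using B[of s] B[of lo] B[of t] B[of hi] st m by auto
    have "e * (f t - f s) \<le> (t - s) * (2 * B)"
    proof (cases "f t - f s \<ge> 0")
      case True
      have "e * (f t - f s) \<le> (s - lo) * (f t - f s)" using True e st by (intro mult_right_mono) auto
      also have "\<dots> \<le> (t - s) * (2 * B)" using 1 mult_left_mono[OF b(1), of "t - s"] st by linarith
      finally show ?thesis .
    next
      case False
      then have "e * (f t - f s) \<le> 0" using e by (simp add: mult_le_0_iff)
      also have "0 \<le> (t - s) * (2 * B)" using st B0 by simp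
      finally show ?thesis .
    qed
    moreover have "e * (f s - f t) \<le> (t - s) * (2 * B)"
    proof (cases "f s - f t \<ge> 0")
      case True
      have "e * (f s - f t) \<le> (hi - t) * (f s - f t)" using True e st by (intro mult_right_mono) auto
      also have "\<dots> \<le> (t - s) * (2 * B)" using 2 mult_left_mono[OF b(2), of "t - s"] st by linarith
      finally show ?thesis .
    next
      case False
      then have "e * (f s - f t) \<le> 0" using e by (simp add: mult_le_0_iff)
      also have "0 \<le> (t - s) * (2 * B)" using st B0 by simp
      finally show ?thesis .
    qed
    ultimately have "e * \<bar>f t - f s\<bar> \<le> (t - s) * (2 * B)" by (auto simp: abs_if)
    then show ?thesis using e(1) by (simp add: field_simps)
  qed
  have "(2 * B / e)-lipschitz_on {m1..m2} f"
  proof (rule lipschitz_on_leI)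
    show "0 \<le> 2 * B / e" using B0 e by simp
    fix s t assume "s \<in> {m1..m2}" "t \<in> {m1..m2}" "s \<le> t"
    from le[OF this] \<open>s \<le> t\<close> show "dist (f s) (f t) \<le> 2 * B / e * dist s t"
      by (simp add: dist_real_def abs_minus_commute)
  qed
  then show ?thesis by (rule that)
qed

context body
begin

lemma xr_lipschitz: assumes "ylo < m1" "m1 \<le> m2" "m2 < yhi" obtains K where "K-lipschitz_on {m1..m2} xr"
proof -
  obtain B where B: "\<And>Y. Y \<in> {ylo..yhi} \<Longrightarrow> \<bar>xr Y\<bar> \<le> B" using x_bounded by metis
  show ?thesis by (rule concave_locally_lipschitz[OF three_point(1) B assms]) (use that in auto)
qed

lemma xl_lipschitz: assumes "ylo < m1" "m1 \<le> m2" "m2 < yhi" obtains K where "K-lipschitz_on {m1..m2} xl"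
proof -
  obtain B where B: "\<And>Y. Y \<in> {ylo..yhi} \<Longrightarrow> \<bar>xl Y\<bar> \<le> B" using x_bounded by metis
  have B': "\<bar>- xl Y\<bar> \<le> B" if "Y \<in> {ylo..yhi}" for Y using B[OF that] by simp
  have tp: "(t - s) * (- xl p) + (s - p) * (- xl t) \<le> (t - p) * (- xl s)"
    if "ylo \<le> p" "p \<le> s" "s \<le> t" "t \<le> yhi" for p s t
    using three_point(2)[OF that] by simp
  have "\<exists>K. K-lipschitz_on {m1..m2} (\<lambda>Y. - xl Y)"
    by (rule concave_locally_lipschitz[OF tp B' assms]) auto
  then obtain K where "K-lipschitz_on {m1..m2} (\<lambda>Y. - xl Y)" ..
  then have "K-lipschitz_on {m1..m2} xl" by (simp add: lipschitz_on_def dist_minus)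
  then show ?thesis by (rule that)
qed

lemma continuous_on_xr: "continuous_on {ylo<..<yhi} xr"
  and continuous_on_xl: "continuous_on {ylo<..<yhi} xl"
proof -
  have *: "continuous_on {ylo<..<yhi} f"
    if lipf: "\<And>m1 m2. ylo < m1 \<Longrightarrow> m1 \<le> m2 \<Longrightarrow> m2 < yhi \<Longrightarrow> \<exists>K. K-lipschitz_on {m1..m2} f" for f :: "real \<Rightarrow> real"
  proof (rule continuous_at_imp_continuous_on, rule ballI)
    fix Y assume Y: "Y \<in> {ylo<..<yhi}"
    define m1 m2 where "m1 = (ylo + Y) / 2" and "m2 = (Y + yhi) / 2"
    have m: "ylo < m1" "m1 < Y" "Y < m2" "m2 < yhi" using Y by (auto simp: m1_def m2_def)
    then obtain K where Kf: "K-lipschitz_on {m1..m2} f" using lipf[of m1 m2] by auto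
    have "continuous_on {m1<..<m2} f"
      by (rule continuous_on_subset[OF lipschitz_on_continuous_on[OF Kf]]) auto
    then show "isCont f Y" using m by (simp add: continuous_on_eq_continuous_at)
  qed
  show "continuous_on {ylo<..<yhi} xr" by (rule *) (use xr_lipschitz in metis)
  show "continuous_on {ylo<..<yhi} xl" by (rule *) (use xl_lipschitz in metis)
qed

text \<open>The width is concave and nonnegative, and positive at height 0 because \<open>Q\<close>
  contains a disc about 0; hence it is positive at every height strictly between the
  extremes.\<close>

lemma xl_less_xr: assumes "ylo < Y" "Y < yhi" shows "xl Y < xr Y"
proof -
  obtain e where e: "e > 0" "ball 0 e \<subseteq> Q" using zeroQ by (meson mem_interior)
  then have "Complex (e / 2) 0 \<in> Q" "Complex (- e / 2) 0 \<in> Q" by (auto simp: subset_eq cmod_def)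
  then have l0: "xr 0 - xl 0 > 0" using slice_bounds[of "e / 2" 0] slice_bounds[of "- e / 2" 0] e(1) by auto
  have nn: "xr s - xl s \<ge> 0" if "s \<in> {ylo..yhi}" for s
    using slice_bounds[OF xr_mem[OF that]] by auto
  have tp: "(t - s) * (xr p - xl p) + (s - p) * (xr t - xl t) \<le> (t - p) * (xr s - xl s)"
    if "ylo \<le> p" "p \<le> s" "s \<le> t" "t \<le> yhi" for p s t
    using three_point[OF that] by (simp add: algebra_simps)
  show ?thesis
  proof (cases "Y \<le> 0")
    case True
    have "(0 - Y) * (xr ylo - xl ylo) + (Y - ylo) * (xr 0 - xl 0) \<le> (0 - ylo) * (xr Y - xl Y)"
      using tp[of ylo Y 0] assms True ylo_yhi by auto
    moreover have "(0 - Y) * (xr ylo - xl ylo) \<ge> 0" using nn[of ylo] True ylo_yhi by (intro mult_nonneg_nonneg) auto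
    moreover have "(Y - ylo) * (xr 0 - xl 0) > 0" using l0 assms by simp
    ultimately have "(0 - ylo) * (xr Y - xl Y) > 0" by linarith
    then show ?thesis using ylo_yhi by (simp add: mult_less_0_iff)
  next
    case False
    have "(yhi - Y) * (xr 0 - xl 0) + (Y - 0) * (xr yhi - xl yhi) \<le> (yhi - 0) * (xr Y - xl Y)"
      using tp[of 0 Y yhi] assms False ylo_yhi by auto
    moreover have "(Y - 0) * (xr yhi - xl yhi) \<ge> 0" using nn[of yhi] False ylo_yhi by (intro mult_nonneg_nonneg) auto
    moreover have "(yhi - Y) * (xr 0 - xl 0) > 0" using l0 assms by simp
    ultimately have "(yhi - 0) * (xr Y - xl Y) > 0" by linarith
    then show ?thesis using ylo_yhi by (simp add: zero_less_mult_iff)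
  qed
qed

lemma frontier_if_extreme:
  assumes z: "z \<in> Q" and "Im z = ylo \<or> Im z = yhi \<or> Re z = xr (Im z) \<or> Re z = xl (Im z)"
  shows "z \<in> frontier Q"
proof -
  have "z \<notin> interior Q"
  proof
    assume "z \<in> interior Q"
    then obtain e where e: "e > 0" "ball z e \<subseteq> Q" by (meson mem_interior)
    have m: "Complex (Re z + p) (Im z + q) \<in> Q" if "\<bar>p\<bar> + \<bar>q\<bar> < e" for p q
    proof -
      have "Complex (Re z + p) (Im z + q) - z = Complex p q" by (simp add: complex_eq_iff)
      then have "dist (Complex (Re z + p) (Im z + q)) z \<le> \<bar>p\<bar> + \<bar>q\<bar>"
        using cmod_le[of "Complex p q"] by (simp add: dist_norm)
      then show ?thesis using e that by (auto simp: subset_eq dist_commute)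
    qed
    have "Im z > ylo" "Im z < yhi" using Im_range[OF m[of 0 "-e/2"]] Im_range[OF m[of 0 "e/2"]] e(1) by auto
    moreover have "Re z < xr (Im z)" "xl (Im z) < Re z"
      using slice_bounds[of "Re z + e/2" "Im z"] slice_bounds[of "Re z - e/2" "Im z"] m[of "e/2" 0] m[of "-e/2" 0] e(1) by auto
    ultimately show False using assms(2) by auto
  qed
  then show ?thesis using z closure_subset by (auto simp: frontier_def)
qed

text \<open>\<open>areaF\<close> is the area in the half-plane of \<open>Q\<close> raised by
  \<Lambda>. \<open>areaC\<close> is the remainder in the calibration bound after \<Lambda> times
  the area.\<close>

definition areaC :: "real \<Rightarrow> real" where "areaC \<Lambda> = integral Q (\<lambda>z. 1 / (\<Lambda> + Im z))"
definition areaF :: "real \<Rightarrow> real" where "areaF \<Lambda> = integral Q (\<lambda>z. 1 / (\<Lambda> + Im z)\<^sup>2)"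

lemma slice_integral:
  assumes cg: "continuous_on {ylo..yhi} g"
  shows "(\<lambda>z. g (Im z)) integrable_on Q"
    and "((\<lambda>Y. (xr Y - xl Y) * g Y) has_integral integral Q (\<lambda>z. g (Im z))) {ylo..yhi}"
proof -
  have le: "ylo \<le> yhi" using ylo_yhi by simp
  define gg where "gg s = g (clamp1 ylo yhi s)" for s
  have "continuous_on UNIV gg" unfolding gg_def
    by (rule continuous_on_compose2[OF cg]) (use clamp1_mem[OF le] in \<open>auto simp: clamp1_def intro!: continuous_intros\<close>)
  then have ggm: "gg \<in> borel_measurable borel" by (rule borel_measurable_continuous_onI)
  have "bounded (g ` {ylo..yhi})" by (intro compact_imp_bounded compact_continuous_image cg) simp
  then obtain B where "\<forall>x\<in>g ` {ylo..yhi}. norm x \<le> B" unfolding bounded_iff by blast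
  then have B: "\<bar>gg s\<bar> \<le> B" for s using clamp1_mem[OF le, of s] by (auto simp: gg_def)
  define h where "h z = indicator Q z * gg (Im z)" for z
  have Qb: "Q \<in> sets borel" using compQ by (simp add: borel_compact)
  have hm: "h \<in> borel_measurable borel" unfolding h_def
    using measurable_compose[of Im borel borel gg borel] ggm Qb
    by (intro borel_measurable_times borel_measurable_indicator) auto
  have hint: "integrable lborel h"
  proof (rule Bochner_Integration.integrable_bound)
    have "emeasure lborel Q < \<infinity>" using compact_imp_bounded[OF compQ] by (rule emeasure_bounded_finite)
    then show "integrable lborel (\<lambda>z. indicator Q z * B)"
      using Qb by (intro integrable_mult_left integrable_real_indicator) auto
    show "AE z in lborel. norm (h z) \<le> norm (indicator Q z * B)"
      using B by (auto intro!: AE_I2 simp: h_def indicator_def intro: order_trans[OF _ abs_ge_self])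
  qed (use hm in simp)
  have "(h has_integral integral\<^sup>L lborel h) UNIV" by (rule has_integral_integral_lborel[OF hint])
  then have "((\<lambda>z. if z \<in> Q then g (Im z) else 0) has_integral integral\<^sup>L lborel h) UNIV"
    by (rule has_integral_eq[rotated]) (use Im_range in \<open>auto simp: h_def gg_def\<close>)
  then have hQ: "((\<lambda>z. g (Im z)) has_integral integral\<^sup>L lborel h) Q" by (simp only: has_integral_restrict_UNIV)
  then show "(\<lambda>z. g (Im z)) integrable_on Q" by blast
  let ?T = "\<lambda>w::real\<times>real. Complex (snd w) (fst w)"
  have Tm: "?T \<in> borel_measurable lborel"
  proof -
    have "continuous_on UNIV ?T" unfolding Complex_eq by (intro continuous_intros)
    then show ?thesis using borel_measurable_continuous_onI by simp
  qed
  have hi2: "integrable lborel (\<lambda>w. h (?T w))"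
  proof -
    have "integrable (distr lborel borel ?T) h" unfolding lborel_complex_eq_distr by (rule hint)
    then show ?thesis using Tm hm by (subst (asm) integrable_distr_eq) auto
  qed
  then have hi3: "integrable (lborel \<Otimes>\<^sub>M lborel) (\<lambda>w. h (?T w))" by (simp add: lborel_prod)
  have val: "integral\<^sup>L lborel h = (\<integral>Y. (\<integral>\<xi>. h (Complex \<xi> Y) \<partial>lborel) \<partial>lborel)"
  proof -
    have "integral\<^sup>L lborel h = integral\<^sup>L (distr lborel borel ?T) h" unfolding lborel_complex_eq_distr ..
    also have "\<dots> = (\<integral>w. h (?T w) \<partial>lborel)" by (rule integral_distr) (use Tm hm in auto)
    also have "\<dots> = (\<integral>Y. (\<integral>\<xi>. h (Complex \<xi> Y) \<partial>lborel) \<partial>lborel)"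
      using lborel_pair.integral_fst'[OF hi3] by (simp add: lborel_prod)
    finally show ?thesis .
  qed
  have inner: "(\<integral>\<xi>. h (Complex \<xi> Y) \<partial>lborel) = indicator {ylo..yhi} Y * ((xr Y - xl Y) * gg Y)" for Y
  proof (cases "Y \<in> {ylo..yhi}")
    case True
    have le: "xl Y \<le> xr Y" using slice_bounds[OF xr_mem[OF True]] by auto
    have "(\<integral>\<xi>. h (Complex \<xi> Y) \<partial>lborel) = (\<integral>\<xi>. indicator {xl Y..xr Y} \<xi> * gg Y \<partial>lborel)"
      by (rule Bochner_Integration.integral_cong) (use slice_eq[OF True] in \<open>auto simp: h_def indicator_def\<close>)
    also have "\<dots> = measure lborel {xl Y..xr Y} * gg Y" by simp
    finally show ?thesis using True le by simp
  next
    case False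
    then have "h (Complex \<xi> Y) = 0" for \<xi> using Im_range[of "Complex \<xi> Y"] by (auto simp: h_def indicator_def)
    then show ?thesis using False by simp
  qed
  have "integrable lborel (\<lambda>Y. indicator {ylo..yhi} Y * ((xr Y - xl Y) * gg Y))"
    using lborel_pair.integrable_fst'[OF hi3] by (simp add: inner)
  from has_integral_integral_lborel[OF this]
  have "((\<lambda>Y. indicator {ylo..yhi} Y * ((xr Y - xl Y) * gg Y)) has_integral integral\<^sup>L lborel h) UNIV"
    unfolding val inner .
  then have "((\<lambda>Y. if Y \<in> {ylo..yhi} then (xr Y - xl Y) * g Y else 0) has_integral integral\<^sup>L lborel h) UNIV"
    by (rule has_integral_eq[rotated]) (auto simp: gg_def)
  then have "((\<lambda>Y. (xr Y - xl Y) * g Y) has_integral integral\<^sup>L lborel h) {ylo..yhi}"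
    by (simp only: has_integral_restrict_UNIV)
  moreover have "integral Q (\<lambda>z. g (Im z)) = integral\<^sup>L lborel h" by (rule integral_unique[OF hQ])
  ultimately show "((\<lambda>Y. (xr Y - xl Y) * g Y) has_integral integral Q (\<lambda>z. g (Im z))) {ylo..yhi}" by simp
qed

lemma continuous_recip: "0 < \<Lambda> + ylo \<Longrightarrow> continuous_on {ylo..yhi} (\<lambda>Y. 1 / (\<Lambda> + Y))"
  "0 < \<Lambda> + ylo \<Longrightarrow> continuous_on {ylo..yhi} (\<lambda>Y. 1 / (\<Lambda> + Y)\<^sup>2)"
  by (auto intro!: continuous_intros)

text \<open>The tangent inequality for the reciprocal; the gap between the two sides is (q - p)^2 /
  (q p^2).\<close>

lemma recip_convex:
  fixes s l l' :: real
  assumes "0 < l + s" "0 < l' + s"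
  shows "1 / (l + s) - (l' - l) * (1 / (l + s)\<^sup>2) \<le> 1 / (l' + s)"
    and "l' \<noteq> l \<Longrightarrow> 1 / (l + s) - (l' - l) * (1 / (l + s)\<^sup>2) < 1 / (l' + s)"
proof -
  define p q where "p = l + s" and "q = l' + s"
  have pq: "p > 0" "q > 0" "l' - l = q - p" using assms by (auto simp: p_def q_def)
  have e: "1 / q - (1 / p - (q - p) * (1 / p\<^sup>2)) = (q - p)\<^sup>2 / (q * p\<^sup>2)"
    using pq by (simp add: field_simps power2_eq_square)
  have "0 \<le> (q - p)\<^sup>2 / (q * p\<^sup>2)" using pq by simp
  then show "1 / (l + s) - (l' - l) * (1 / (l + s)\<^sup>2) \<le> 1 / (l' + s)"
    using e pq(3) by (simp add: p_def[symmetric] q_def[symmetric])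
  assume "l' \<noteq> l"
  then have "0 < (q - p)\<^sup>2 / (q * p\<^sup>2)" using pq by simp
  then show "1 / (l + s) - (l' - l) * (1 / (l + s)\<^sup>2) < 1 / (l' + s)"
    using e pq(3) by (simp add: p_def[symmetric] q_def[symmetric])
qed

lemma measure_pos: "0 < measure lebesgue Q"
proof -
  obtain e where e: "e > 0" "ball 0 e \<subseteq> Q" using zeroQ by (meson mem_interior)
  have "0 < measure lebesgue (ball (0::complex) e)" using e(1) by (simp add: content_ball_pos)
  also have "\<dots> \<le> measure lebesgue Q"
    using compQ e by (intro measure_mono_fmeasurable) (auto simp: lmeasurable_compact)
  finally show ?thesis .
qed

text \<open>Integrating the tangent inequality of the reciprocal shows that - \<open>areaF\<close>
  is a slope of \<open>areaC\<close>, with no differentiation under the integral. For strictness,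
  the gap has a positive minimum on the compact range of heights and \<open>Q\<close> has positive
  measure.\<close>

lemma areaC_convex:
  assumes l: "0 < \<Lambda> + ylo" and l': "0 < \<Lambda>' + ylo"
  shows "areaC \<Lambda> - (\<Lambda>' - \<Lambda>) * areaF \<Lambda> \<le> areaC \<Lambda>'"
    and "\<Lambda>' \<noteq> \<Lambda> \<Longrightarrow> areaC \<Lambda> - (\<Lambda>' - \<Lambda>) * areaF \<Lambda> < areaC \<Lambda>'"
proof -
  let ?f = "\<lambda>Y. 1 / (\<Lambda>' + Y) - (1 / (\<Lambda> + Y) - (\<Lambda>' - \<Lambda>) * (1 / (\<Lambda> + Y)\<^sup>2))"
  have cf: "continuous_on {ylo..yhi} ?f" using l l' by (auto intro!: continuous_intros)
  have i: "((\<lambda>z. ?f (Im z)) has_integral (areaC \<Lambda>' - (areaC \<Lambda> - (\<Lambda>' - \<Lambda>) * areaF \<Lambda>))) Q"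
    unfolding areaC_def areaF_def
    by (intro has_integral_diff has_integral_mult_right integrable_integral
      slice_integral(1)[OF continuous_recip(1)[OF l']] slice_integral(1)[OF continuous_recip(1)[OF l]] slice_integral(1)[OF continuous_recip(2)[OF l]])
  have pos: "0 < \<Lambda> + Im z" "0 < \<Lambda>' + Im z" if "z \<in> Q" for z using Im_range[OF that] l l' by auto
  have "0 \<le> areaC \<Lambda>' - (areaC \<Lambda> - (\<Lambda>' - \<Lambda>) * areaF \<Lambda>)"
  proof (rule has_integral_nonneg[OF i])
    fix z assume "z \<in> Q"
    then show "0 \<le> ?f (Im z)" using recip_convex(1)[OF pos] by simp
  qed
  then show "areaC \<Lambda> - (\<Lambda>' - \<Lambda>) * areaF \<Lambda> \<le> areaC \<Lambda>'" by simp
  assume ne: "\<Lambda>' \<noteq> \<Lambda>"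
  have "{ylo..yhi} \<noteq> {}" using ylo_yhi by auto
  then obtain Y0 where Y0: "Y0 \<in> {ylo..yhi}" "\<And>Y. Y \<in> {ylo..yhi} \<Longrightarrow> ?f Y0 \<le> ?f Y"
    using continuous_attains_inf[OF compact_Icc _ cf] by blast
  have f0: "?f Y0 > 0" using recip_convex(2)[of \<Lambda> Y0 \<Lambda>'] ne l l' Y0(1) by auto
  have "((\<lambda>z. ?f Y0) has_integral (measure lebesgue Q * ?f Y0)) Q"
  proof -
    have "((\<lambda>z. if z \<in> Q then 1 else 0 :: real) has_integral measure lebesgue Q) UNIV"
      using lmeasurable_compact[OF compQ] unfolding lmeasurable_iff_has_integral
      by (rule has_integral_eq[rotated]) (auto simp: indicator_def)
    then have "((\<lambda>z. 1 :: real) has_integral measure lebesgue Q) Q" by (simp only: has_integral_restrict_UNIV)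
    from has_integral_mult_left[OF this, of "?f Y0"] show ?thesis by simp
  qed
  then have "measure lebesgue Q * ?f Y0 \<le> areaC \<Lambda>' - (areaC \<Lambda> - (\<Lambda>' - \<Lambda>) * areaF \<Lambda>)"
    by (rule has_integral_le[OF _ i]) (use Y0(2) Im_range in blast)
  moreover have "measure lebesgue Q * ?f Y0 > 0" using measure_pos f0 by simp
  ultimately show "areaC \<Lambda> - (\<Lambda>' - \<Lambda>) * areaF \<Lambda> < areaC \<Lambda>'" by linarith
qed

end

section \<open>The calibration inequality and its equality case\<close>

text \<open>Here t1 is the last time at the lower value and t2 the first time at the upper one. The
  rests before and after have to be split off because \<open>Q\<close> may have horizontal
  sides.\<close>

lemma monotone_transit:
  fixes y :: "real \<Rightarrow> real"
  assumes c: "continuous_on {p..r} y" and pr: "p \<le> r" and ends: "y p = lo" "y r = hi" "lo < hi"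
    and mono: "\<And>s t. p \<le> s \<Longrightarrow> s \<le> t \<Longrightarrow> t \<le> r \<Longrightarrow> y s \<le> y t"
  obtains t1 t2 where "p \<le> t1" "t1 < t2" "t2 \<le> r" "\<And>t. t \<in> {p..t1} \<Longrightarrow> y t = lo"
    "\<And>t. t \<in> {t2..r} \<Longrightarrow> y t = hi" "\<And>t. t \<in> {t1<..<t2} \<Longrightarrow> lo < y t \<and> y t < hi"
proof -
  have cl: "compact {t\<in>{p..r}. y t = v}" for v
  proof -
    have "closedin (top_of_set {p..r}) {t\<in>{p..r}. y t = v}" by (rule continuous_closedin_preimage_constant[OF c])
    then show ?thesis by (rule closedin_compact[OF compact_Icc])
  qed
  have "{t\<in>{p..r}. y t = lo} \<noteq> {}" "{t\<in>{p..r}. y t = hi} \<noteq> {}" using ends pr by auto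
  then have ex: "\<exists>s\<in>{t\<in>{p..r}. y t = lo}. \<forall>t\<in>{t\<in>{p..r}. y t = lo}. t \<le> s"
    "\<exists>s\<in>{t\<in>{p..r}. y t = hi}. \<forall>t\<in>{t\<in>{p..r}. y t = hi}. s \<le> t"
    using compact_attains_sup[OF cl[of lo]] compact_attains_inf[OF cl[of hi]] by blast+
  obtain t1 where t1: "t1 \<in> {t\<in>{p..r}. y t = lo}" "\<And>t. t \<in> {t\<in>{p..r}. y t = lo} \<Longrightarrow> t \<le> t1"
    using ex(1) by blast
  obtain t2 where t2: "t2 \<in> {t\<in>{p..r}. y t = hi}" "\<And>t. t \<in> {t\<in>{p..r}. y t = hi} \<Longrightarrow> t2 \<le> t"
    using ex(2) by blast
  have b: "lo \<le> y t \<and> y t \<le> hi" if "t \<in> {p..r}" for t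
    using mono[of p t] mono[of t r] that ends by auto
  show ?thesis
  proof
    show "p \<le> t1" "t2 \<le> r" using t1(1) t2(1) by auto
    show "t1 < t2" using mono[of t2 t1] t1(1) t2(1) ends(3) by force
    show "y t = lo" if "t \<in> {p..t1}" for t using mono[of t t1] b[of t] t1(1) that by force
    show "y t = hi" if "t \<in> {t2..r}" for t using mono[of t2 t] b[of t] t2(1) that by force
    show "lo < y t \<and> y t < hi" if t: "t \<in> {t1<..<t2}" for t
    proof -
      have tr: "t \<in> {p..r}" using t t1(1) t2(1) by auto
      have "y t \<noteq> lo" "y t \<noteq> hi" using t1(2)[of t] t2(2)[of t] tr t by auto
      then show ?thesis using b[OF tr] by auto
    qed
  qed
qed

text \<open>A closed curve \<open>u\<close> whose heights fill exactly the range of heights of \<open>Q\<close>. At height \<open>Y\<close> the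
  boundary points \<open>xr Y\<close> and \<open>xl Y\<close> serve as calibrating covectors while the curve moves up and down.\<close>

locale calib = body +
  fixes u D :: "real \<Rightarrow> complex" and a b \<tau> K \<Lambda> :: real and N :: "real set"
  assumes lip: "K-lipschitz_on {a..b} u" and ord: "a \<le> \<tau>" "\<tau> \<le> b" and loop: "u a = u b"
    and lo: "Im (u a) = ylo" and hi: "Im (u \<tau>) = yhi"
    and rng: "\<And>t. t \<in> {a..b} \<Longrightarrow> Im (u t) \<in> {ylo..yhi}" and \<Lambda>pos: "0 < \<Lambda> + ylo"
    and Dm: "D \<in> borel_measurable borel" and Db: "\<And>t. norm (D t) \<le> K" and negN: "negligible N"
    and Dd: "\<And>t. t \<in> {a<..<b} \<Longrightarrow> t \<notin> N \<Longrightarrow> (u has_vector_derivative D t) (at t)"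
    and Di: "\<And>p q. a \<le> p \<Longrightarrow> p \<le> q \<Longrightarrow> q \<le> b \<Longrightarrow> (D has_integral (u q - u p)) {p..q}"
begin

lemma ab: "a \<le> b" using ord by simp

lemma pos: "t \<in> {a..b} \<Longrightarrow> 0 < \<Lambda> + Im (u t)"
  using rng[of t] \<Lambda>pos by auto

lemma Re_lip: "K-lipschitz_on {a..b} (\<lambda>t. Re (u t))" and Im_lip: "K-lipschitz_on {a..b} (\<lambda>t. Im (u t))"
proof -
  have "\<bar>Re (u s) - Re (u t)\<bar> \<le> K * dist s t \<and> \<bar>Im (u s) - Im (u t)\<bar> \<le> K * dist s t"
    if "s \<in> {a..b}" "t \<in> {a..b}" for s t
    using lipschitz_onD[OF lip that] abs_Re_le_cmod[of "u s - u t"] abs_Im_le_cmod[of "u s - u t"]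
    by (auto simp: dist_norm)
  then show "K-lipschitz_on {a..b} (\<lambda>t. Re (u t))" "K-lipschitz_on {a..b} (\<lambda>t. Im (u t))"
    using lipschitz_on_nonneg[OF lip] by (auto intro!: lipschitz_onI simp: dist_real_def)
qed

lemma Im_der: "t \<in> {a<..<b} \<Longrightarrow> t \<notin> N \<Longrightarrow> ((\<lambda>t. Im (u t)) has_real_derivative Im (D t)) (at t)"
  and Re_der: "t \<in> {a<..<b} \<Longrightarrow> t \<notin> N \<Longrightarrow> ((\<lambda>t. Re (u t)) has_real_derivative Re (D t)) (at t)"
  using bounded_linear.has_vector_derivative[OF bounded_linear_Im Dd]
    bounded_linear.has_vector_derivative[OF bounded_linear_Re Dd]
  by (simp_all add: has_real_derivative_iff_has_vector_derivative)

lemma Im_der_zero: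
  "t \<in> {a<..<b} \<Longrightarrow> t \<notin> N \<Longrightarrow> Im (u t) \<notin> {ylo<..<yhi} \<Longrightarrow> Im (D t) = 0"
  by (rule derivative_zero_at_bounds[OF Im_der _ rng])

definition wr :: "real \<Rightarrow> real" where "wr Y = xr Y / (\<Lambda> + Y)"
definition wl :: "real \<Rightarrow> real" where "wl Y = xl Y / (\<Lambda> + Y)"
text \<open>Contour form of the enclosed area; the dilation and the horizontal translation used for
  normalization leave it unchanged.\<close>

definition circ :: real where "circ = integral {a..b} (\<lambda>t. Re (D t) / (\<Lambda> + Im (u t)))"
definition speed :: "real \<Rightarrow> real" where "speed t = supp Q (D t) / (\<Lambda> + Im (u t))"
text \<open>By \<open>low_alt\<close> this is det2 of the calibrating point and the velocity,
  divided by the height. It is split so that each term can be integrated by itself: a closed term,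
  \<Lambda> times the area density, and a function of the height times Im u'.\<close>

definition low :: "real \<Rightarrow> real" where
  "low t = - Re (D t) + \<Lambda> * (Re (D t) / (\<Lambda> + Im (u t)))
     + (if t \<le> \<tau> then wr (Im (u t)) else wl (Im (u t))) * Im (D t)"

lemma quotient_bounds:
  obtains B where "\<And>Y. Y \<in> {ylo..yhi} \<Longrightarrow> \<bar>wr Y\<bar> \<le> B" "\<And>Y. Y \<in> {ylo..yhi} \<Longrightarrow> \<bar>wl Y\<bar> \<le> B"
proof -
  obtain B where B: "B > 0" "\<And>Y. Y \<in> {ylo..yhi} \<Longrightarrow> \<bar>xr Y\<bar> \<le> B" "\<And>Y. Y \<in> {ylo..yhi} \<Longrightarrow> \<bar>xl Y\<bar> \<le> B"
    by (rule x_bounded) (rule that)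
  show ?thesis
  proof (rule that[of "B / (\<Lambda> + ylo)"])
    fix Y assume Y: "Y \<in> {ylo..yhi}"
    then have p: "0 < \<Lambda> + Y" "\<Lambda> + ylo \<le> \<Lambda> + Y" using \<Lambda>pos by auto
    show "\<bar>wr Y\<bar> \<le> B / (\<Lambda> + ylo)" "\<bar>wl Y\<bar> \<le> B / (\<Lambda> + ylo)"
      using B(2)[OF Y] B(3)[OF Y] p \<Lambda>pos B(1) by (auto simp: wr_def wl_def abs_divide intro!: frac_le)
  qed
qed

lemma w_cont: "continuous_on {ylo<..<yhi} wr" "continuous_on {ylo<..<yhi} wl"
  unfolding wr_def wl_def using \<Lambda>pos
  by (auto intro!: continuous_intros continuous_on_xr continuous_on_xl)

lemma quotient_measurable:
  assumes "f \<in> borel_measurable borel"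
  shows "(\<lambda>t. f t / (\<Lambda> + Im (u (clamp1 a b t)))) \<in> borel_measurable borel"
proof -
  have "continuous_on UNIV (\<lambda>t. u (clamp1 a b t))"
    by (rule lipschitz_on_continuous_on[OF lipschitz_clamp1[OF lip ab]])
  then have "(\<lambda>t. u (clamp1 a b t)) \<in> borel_measurable borel" by (rule borel_measurable_continuous_onI)
  then show ?thesis using assms by measurable
qed

lemma quotient_integrable:
  assumes f: "f \<in> borel_measurable borel" "\<And>t. \<bar>f t\<bar> \<le> B" and pq: "a \<le> p" "q \<le> b"
  shows "(\<lambda>t. f t / (\<Lambda> + Im (u t))) integrable_on {p..q}"
proof -
  have B0: "0 \<le> B" using f(2)[of 0] by linarith
  have "(\<lambda>t. f t / (\<Lambda> + Im (u (clamp1 a b t)))) integrable_on {p..q}"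
  proof (rule bounded_borel_integrable[OF quotient_measurable[OF f(1)]])
    fix t assume t: "t \<in> {p..q}"
    then have t': "t \<in> {a..b}" using pq by auto
    have "\<Lambda> + ylo \<le> \<Lambda> + Im (u t)" using rng[OF t'] by auto
    then have "\<bar>f t\<bar> / (\<Lambda> + Im (u t)) \<le> B / (\<Lambda> + ylo)"
      using f(2)[of t] \<Lambda>pos B0 by (intro frac_le) auto
    then show "\<bar>f t / (\<Lambda> + Im (u (clamp1 a b t)))\<bar> \<le> B / (\<Lambda> + ylo)"
      using t' pos[OF t'] by (simp add: abs_divide)
  qed
  then show ?thesis
    by (rule integrable_eq) (use pq in auto)
qed

lemma circ_integrable: "a \<le> p \<Longrightarrow> q \<le> b \<Longrightarrow> (\<lambda>t. Re (D t) / (\<Lambda> + Im (u t))) integrable_on {p..q}"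
proof (rule quotient_integrable)
  show "(\<lambda>t. Re (D t)) \<in> borel_measurable borel" using Dm by measurable
  show "\<bar>Re (D t)\<bar> \<le> K" for t using abs_Re_le_cmod[of "D t"] Db[of t] by linarith
qed

lemma speed_integrable_ab: "speed integrable_on {a..b}"
proof -
  obtain B where B: "B > 0" "\<And>v. supp Q v \<le> B * norm v" by (rule supp_bound) (rule that)
  show ?thesis unfolding speed_def
  proof (rule quotient_integrable)
    show "(\<lambda>t. supp Q (D t)) \<in> borel_measurable borel" by (rule measurable_compose[OF Dm borel_measurable_supp])
    show "\<bar>supp Q (D t)\<bar> \<le> B * K" for t
      using B(2)[of "D t"] mult_left_mono[OF Db[of t] less_imp_le[OF B(1)]] supp_nonneg[of "D t"] by linarith
  qed auto
qed

lemma areaC_split: "areaC \<Lambda> = integral {ylo..yhi} wr - integral {ylo..yhi} wl"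
proof -
  obtain B where B: "\<And>Y. Y \<in> {ylo..yhi} \<Longrightarrow> \<bar>wr Y\<bar> \<le> B" "\<And>Y. Y \<in> {ylo..yhi} \<Longrightarrow> \<bar>wl Y\<bar> \<le> B"
    by (rule quotient_bounds) (rule that)
  have "((\<lambda>Y. wr Y - wl Y) has_integral integral {ylo..yhi} wr - integral {ylo..yhi} wl) {ylo..yhi}"
    by (intro has_integral_diff integrable_integral bounded_continuous_Ioo_integrable[OF w_cont(1) B(1)]
        bounded_continuous_Ioo_integrable[OF w_cont(2) B(2)])
  moreover have "((\<lambda>Y. wr Y - wl Y) has_integral areaC \<Lambda>) {ylo..yhi}"
    using slice_integral(2)[OF continuous_recip(1)[OF \<Lambda>pos]]
    by (simp add: areaC_def wr_def wl_def diff_divide_distrib)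
  ultimately show ?thesis using has_integral_unique by metis
qed

text \<open>Up to \<tau> the height passes from \<open>ylo\<close> to \<open>yhi\<close> and
  afterwards back, so by \<open>chain_integral\<close> the last terms give the integrals of
  \<open>wr\<close> and - \<open>wl\<close>, which add up to \<open>areaC\<close>. Oscillations of
  the curve cancel.\<close>

lemma low_integral: "(low has_integral (\<Lambda> * circ + areaC \<Lambda>)) {a..b}"
proof -
  obtain B where B: "\<And>Y. Y \<in> {ylo..yhi} \<Longrightarrow> \<bar>wr Y\<bar> \<le> B" "\<And>Y. Y \<in> {ylo..yhi} \<Longrightarrow> \<bar>wl Y\<bar> \<le> B"
    by (rule quotient_bounds) (rule that)
  let ?c = "\<lambda>t. Re (D t) / (\<Lambda> + Im (u t))"
  have Rei: "((\<lambda>t. - Re (D t) + \<Lambda> * ?c t) has_integral (- (Re (u q) - Re (u p)) + \<Lambda> * integral {p..q} ?c)) {p..q}"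
    if "a \<le> p" "p \<le> q" "q \<le> b" for p q
    using has_integral_linear[OF Di[OF that] bounded_linear_Re] that
    by (intro has_integral_add has_integral_neg has_integral_mult_right integrable_integral circ_integrable)
       (simp_all add: o_def)
  have 1: "((\<lambda>t. wr (Im (u t)) * Im (D t)) has_integral (integral {ylo..Im (u \<tau>)} wr - integral {ylo..Im (u a)} wr)) {a..\<tau>}"
    by (rule chain_integral[OF B(1) w_cont(1) lipschitz_on_subset[OF Im_lip] ord(1) rng negN Im_der]) (use ord in auto)
  have 2: "((\<lambda>t. wl (Im (u t)) * Im (D t)) has_integral (integral {ylo..Im (u b)} wl - integral {ylo..Im (u \<tau>)} wl)) {\<tau>..b}"
    by (rule chain_integral[OF B(2) w_cont(2) lipschitz_on_subset[OF Im_lip] ord(2) rng negN Im_der]) (use ord in auto)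
  have l1: "(low has_integral (- (Re (u \<tau>) - Re (u a)) + \<Lambda> * integral {a..\<tau>} ?c + (integral {ylo..yhi} wr - 0))) {a..\<tau>}"
  proof -
    have "((\<lambda>t. - Re (D t) + \<Lambda> * ?c t + wr (Im (u t)) * Im (D t)) has_integral
      (- (Re (u \<tau>) - Re (u a)) + \<Lambda> * integral {a..\<tau>} ?c + (integral {ylo..yhi} wr - 0))) {a..\<tau>}"
      using has_integral_add[OF Rei[of a \<tau>] 1] ord lo hi by simp
    then show ?thesis by (rule has_integral_eq[rotated]) (simp add: low_def)
  qed
  have "((\<lambda>t. - Re (D t) + \<Lambda> * ?c t + wl (Im (u t)) * Im (D t)) has_integral
      (- (Re (u b) - Re (u \<tau>)) + \<Lambda> * integral {\<tau>..b} ?c + (0 - integral {ylo..yhi} wl))) {\<tau>..b}"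
    using has_integral_add[OF Rei[of \<tau> b] 2] ord lo hi loop by simp
  then have l2: "(low has_integral (- (Re (u b) - Re (u \<tau>)) + \<Lambda> * integral {\<tau>..b} ?c + (0 - integral {ylo..yhi} wl))) {\<tau>..b}"
    by (rule has_integral_spike[rotated 2, of _ _ _ "{\<tau>}"]) (auto simp: low_def)
  have c: "integral {a..\<tau>} ?c + integral {\<tau>..b} ?c = circ"
    unfolding circ_def by (rule Henstock_Kurzweil_Integration.integral_combine[OF ord circ_integrable]) auto
  have "- (Re (u \<tau>) - Re (u a)) + \<Lambda> * integral {a..\<tau>} ?c + (integral {ylo..yhi} wr - 0) +
     (- (Re (u b) - Re (u \<tau>)) + \<Lambda> * integral {\<tau>..b} ?c + (0 - integral {ylo..yhi} wl)) = \<Lambda> * circ + areaC \<Lambda>"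
    unfolding areaC_split c[symmetric] using loop by (simp add: algebra_simps)
  then show ?thesis using has_integral_combine[OF ord l1 l2] by simp
qed

lemma low_alt:
  assumes "t \<in> {a..b}"
  shows "low t = det2 (Complex (if t \<le> \<tau> then xr (Im (u t)) else xl (Im (u t))) (Im (u t))) (D t) / (\<Lambda> + Im (u t))"
proof -
  have p: "\<Lambda> + Im (u t) \<noteq> 0" using pos[OF assms] by simp
  have "- r + \<Lambda> * (r / (\<Lambda> + y)) + f / (\<Lambda> + y) * i = (f * i - y * r) / (\<Lambda> + y)"
    if "\<Lambda> + y \<noteq> 0" for r i f y :: real
    using that by (simp add: divide_simps) (simp add: algebra_simps)
  from this[OF p] show ?thesis
    unfolding low_def wr_def wl_def det2_def by (cases "t \<le> \<tau>") simp_all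
qed

lemma low_le_speed: "t \<in> {a..b} \<Longrightarrow> low t \<le> speed t"
  unfolding low_alt speed_def
  using pos[of t] rng[of t] by (intro divide_right_mono supp_ge) (auto intro: xr_mem xl_mem)

theorem calibration_inequality: "\<Lambda> * circ + areaC \<Lambda> \<le> integral {a..b} speed"
  by (rule has_integral_le[OF low_integral integrable_integral[OF speed_integrable_ab] low_le_speed])

end

text \<open>Pointwise equality determines the two arcs only up to separate horizontal translations.
  The area condition ties these translations together.\<close>

locale calib_eq = calib +
  assumes equality: "integral {a..b} speed = \<Lambda> * circ + areaC \<Lambda>" and area: "circ = areaF \<Lambda>"
begin

definition Z :: "real set" where "Z = N \<union> {t\<in>{a..b}. speed t - low t \<noteq> 0} \<union> {a, b, \<tau>}"

lemma negZ: "negligible Z"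
proof -
  have "((\<lambda>t. speed t - low t) has_integral 0) {a..b}"
    using has_integral_diff[OF integrable_integral[OF speed_integrable_ab] low_integral] equality by simp
  then have "negligible {t\<in>{a..b}. speed t - low t \<noteq> 0}"
    by (rule nonneg_has_integral_zero_negligible) (use low_le_speed in auto)
  then show ?thesis using negN by (auto simp: Z_def)
qed

lemma Z_D:
  assumes "t \<in> {a..b}" "t \<notin> Z"
  shows "t \<in> {a<..<b}" "t \<notin> N"
    "t < \<tau> \<Longrightarrow> supp Q (D t) = det2 (Complex (xr (Im (u t))) (Im (u t))) (D t)"
    "t > \<tau> \<Longrightarrow> supp Q (D t) = det2 (Complex (xl (Im (u t))) (Im (u t))) (D t)"
proof -
  show "t \<in> {a<..<b}" "t \<notin> N" using assms by (auto simp: Z_def)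
  have "speed t = low t" using assms by (auto simp: Z_def)
  then have "supp Q (D t) = det2 (Complex (if t \<le> \<tau> then xr (Im (u t)) else xl (Im (u t))) (Im (u t))) (D t)"
    unfolding low_alt[OF assms(1)] speed_def using pos[OF assms(1)] by simp
  then show "t < \<tau> \<Longrightarrow> supp Q (D t) = det2 (Complex (xr (Im (u t))) (Im (u t))) (D t)"
    "t > \<tau> \<Longrightarrow> supp Q (D t) = det2 (Complex (xl (Im (u t))) (Im (u t))) (D t)" by auto
qed

lemma nonneg_increment:
  assumes h: "bounded_linear h" and pq: "a \<le> p" "p \<le> q" "q \<le> b"
    and nn: "\<And>t. t \<in> {p..q} \<Longrightarrow> t \<notin> Z \<Longrightarrow> 0 \<le> h (D t)"
  shows "h (u p) \<le> (h (u q) :: real)"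
proof -
  have "((\<lambda>t. h (D t)) has_integral h (u q - u p)) {p..q}"
    using has_integral_linear[OF Di[OF pq] h] by (simp add: o_def)
  then have "((\<lambda>t. max 0 (h (D t))) has_integral h (u q - u p)) {p..q}"
    by (rule has_integral_spike[OF negZ, rotated]) (use nn in auto)
  then have "0 \<le> h (u q - u p)" by (rule has_integral_nonneg) simp
  then show ?thesis using linear_diff[OF bounded_linear.linear[OF h]] by simp
qed

text \<open>Along the curve the calibrating point \<open>h\<close> stays on the boundary of \<open>Q\<close> and maximizes
  \<open>det2 \<cdot> u'\<close>, so \<open>det2 h' u' = 0\<close>; the heights of \<open>h\<close> and \<open>u\<close> agree, hence so do their velocities.\<close>

lemma rigid_arc:
  assumes pq: "a \<le> p" "p \<le> q" "q \<le> b" and inter: "\<And>t. t \<in> {p..q} \<Longrightarrow> ylo < Im (u t) \<and> Im (u t) < yhi"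
    and fQ: "\<And>Y. Y \<in> {ylo..yhi} \<Longrightarrow> Complex (f Y) Y \<in> Q"
    and flip: "\<And>m1 m2. ylo < m1 \<Longrightarrow> m1 \<le> m2 \<Longrightarrow> m2 < yhi \<Longrightarrow> \<exists>K. K-lipschitz_on {m1..m2} f"
    and eq: "\<And>t. t \<in> {p<..<q} \<Longrightarrow> t \<notin> Z \<Longrightarrow> supp Q (D t) = det2 (Complex (f (Im (u t))) (Im (u t))) (D t)"
  shows "Re (u q) - f (Im (u q)) = Re (u p) - f (Im (u p))"
proof -
  have sub: "{p..q} \<subseteq> {a..b}" using pq by auto
  have ylip: "K-lipschitz_on {p..q} (\<lambda>t. Im (u t))" by (rule lipschitz_on_subset[OF Im_lip sub])
  have yc: "continuous_on {p..q} (\<lambda>t. Im (u t))" by (rule lipschitz_on_continuous_on[OF ylip])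
  have ne: "{p..q} \<noteq> {}" using pq by auto
  obtain s1 where s1: "s1 \<in> {p..q}" "\<And>t. t \<in> {p..q} \<Longrightarrow> Im (u s1) \<le> Im (u t)"
    using continuous_attains_inf[OF compact_Icc ne yc] by blast
  obtain s2 where s2: "s2 \<in> {p..q}" "\<And>t. t \<in> {p..q} \<Longrightarrow> Im (u t) \<le> Im (u s2)"
    using continuous_attains_sup[OF compact_Icc ne yc] by blast
  obtain Kf where Kf: "Kf-lipschitz_on {Im (u s1)..Im (u s2)} f"
    using flip[of "Im (u s1)" "Im (u s2)"] inter[OF s1(1)] inter[OF s2(1)] s1(2)[OF s2(1)] by blast
  define X where "X t = f (Im (u t))" for t
  have fd: "\<bar>X s - X t\<bar> \<le> Kf * \<bar>Im (u s) - Im (u t)\<bar>" if "s \<in> {p..q}" "t \<in> {p..q}" for s t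
    using lipschitz_onD[OF Kf, of "Im (u s)" "Im (u t)"] s1(2) s2(2) that by (auto simp: X_def dist_real_def)
  have Xlip: "(Kf * K)-lipschitz_on {p..q} X"
  proof (rule lipschitz_onI)
    show "0 \<le> Kf * K" using lipschitz_on_nonneg[OF Kf] lipschitz_on_nonneg[OF lip] by simp
    fix s t assume st: "s \<in> {p..q}" "t \<in> {p..q}"
    have "Kf * \<bar>Im (u s) - Im (u t)\<bar> \<le> Kf * (K * dist s t)"
      using lipschitz_onD[OF ylip st] lipschitz_on_nonneg[OF Kf] by (intro mult_left_mono) (auto simp: dist_real_def)
    then show "dist (X s) (X t) \<le> Kf * K * dist s t" using fd[OF st] by (simp add: dist_real_def)
  qed
  obtain DX NX where DX: "DX \<in> borel_measurable borel" "\<And>t. norm (DX t) \<le> Kf * K" "negligible NX"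
    "\<And>t. t \<in> {p<..<q} \<Longrightarrow> t \<notin> NX \<Longrightarrow> (X has_vector_derivative DX t) (at t)"
    by (rule lipschitz_derivative_on[OF Xlip]) (rule that)
  have "(K + Kf * K)-lipschitz_on {p..q} (\<lambda>t. Re (u t) - X t)"
    by (rule lipschitz_on_diff[OF lipschitz_on_subset[OF Re_lip sub] Xlip])
  then have "Re (u q) - X q = Re (u p) - X p"
  proof (rule lipschitz_zero_derivative[OF _ pq(2)])
    show "negligible (Z \<union> NX)" using negZ DX(3) by (rule negligible_Un)
    fix t assume t: "t \<in> {p<..<q}" "t \<notin> Z \<union> NX"
    have tab: "t \<in> {a..b}" "t \<in> {p..q}" using t sub by auto
    note tZ = Z_D[OF tab(1)]
    have t': "t \<in> {a<..<b}" "t \<notin> N" using tZ(1,2) t by auto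
    have dX: "(X has_real_derivative DX t) (at t)"
      using DX(4) t by (simp add: has_real_derivative_iff_has_vector_derivative)
    note dIm = Im_der[OF t'] and dRe = Re_der[OF t']
    have e: "supp Q (D t) = det2 (Complex (X t) (Im (u t))) (D t)" using eq[of t] t by (simp add: X_def)
    have "((\<lambda>s. det2 (Complex (X s) (Im (u s))) (D t)) has_real_derivative DX t * Im (D t) - Im (D t) * Re (D t)) (at t)"
      unfolding det2_def complex.sel by (intro DERIV_diff DERIV_cmult_right dX dIm)
    moreover have "0 < min (t - p) (q - t)" using t by simp
    moreover have "\<forall>s. \<bar>t - s\<bar> < min (t - p) (q - t) \<longrightarrow>
        det2 (Complex (X s) (Im (u s))) (D t) \<le> det2 (Complex (X t) (Im (u t))) (D t)"
    proof (intro allI impI)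
      fix s assume "\<bar>t - s\<bar> < min (t - p) (q - t)"
      then have "s \<in> {p..q}" by (auto simp: abs_if split: if_splits)
      then have "Complex (X s) (Im (u s)) \<in> Q" unfolding X_def using sub rng by (intro fQ) auto
      then show "det2 (Complex (X s) (Im (u s))) (D t) \<le> det2 (Complex (X t) (Im (u t))) (D t)"
        using supp_ge e by metis
    qed
    ultimately have crit: "DX t * Im (D t) - Im (D t) * Re (D t) = 0" by (rule DERIV_local_max)
    have "Re (D t) - DX t = 0"
    proof (cases "Im (D t) = 0")
      case False
      then show ?thesis using crit by (simp add: algebra_simps)
    next
      \<comment> \<open>The critical equation is empty here. With Im u' = 0 the support value is -y
        Re u'; comparison with a lowest and a highest point of \<open>Q\<close>, strictly below and
        above y, forces Re u' = 0.\<close>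
      case True
      obtain zl where zl: "zl \<in> Q" "Im zl = ylo" by (rule ylo_attained) (rule that)
      obtain zh where zh: "zh \<in> Q" "Im zh = yhi" by (rule yhi_attained) (rule that)
      have "- ylo * Re (D t) \<le> - Im (u t) * Re (D t)" "- yhi * Re (D t) \<le> - Im (u t) * Re (D t)"
        using supp_ge[OF zl(1), of "D t"] supp_ge[OF zh(1), of "D t"] zl(2) zh(2) True unfolding e det2_def by auto
      then have "(Im (u t) - ylo) * Re (D t) \<le> 0" "(yhi - Im (u t)) * Re (D t) \<ge> 0"
        by (auto simp: algebra_simps)
      then have R0: "Re (D t) = 0" using inter[OF tab(2)] by (auto simp: mult_le_0_iff zero_le_mult_iff)
      have "(X has_real_derivative 0) (at t)"
      proof (rule derivative_zero_by_comparison)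
        show "((\<lambda>t. Im (u t)) has_real_derivative 0) (at t)" using dIm True by simp
        show "open {p<..<q}" "t \<in> {p<..<q}" using t by auto
        show "\<bar>X s - X t\<bar> \<le> Kf * \<bar>Im (u s) - Im (u t)\<bar>" if "s \<in> {p<..<q}" for s
          using fd[of s t] that tab by auto
      qed
      then have "DX t = 0" using dX DERIV_unique by blast
      then show ?thesis using R0 by simp
    qed
    then show "((\<lambda>t. Re (u t) - X t) has_vector_derivative 0) (at t)"
      using DERIV_diff[OF dRe dX] by (simp add: has_real_derivative_iff_has_vector_derivative)
  qed
  then show ?thesis by (simp add: X_def)
qed

text \<open>On a rest at an extreme height the velocity is horizontal and -y Re u' is maximal over
  \<open>Q\<close>. Testing with a point at the opposite extreme fixes the direction: right at the
  bottom, left at the top.\<close>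

lemma flat_mono:
  assumes pq: "a \<le> p" "p \<le> q" "q \<le> b"
  shows "(\<And>t. t \<in> {p..q} \<Longrightarrow> Im (u t) = ylo) \<Longrightarrow> Re (u p) \<le> Re (u q)"
    and "(\<And>t. t \<in> {p..q} \<Longrightarrow> Im (u t) = yhi) \<Longrightarrow> Re (u q) \<le> Re (u p)"
proof -
  obtain zl where zl: "zl \<in> Q" "Im zl = ylo" by (rule ylo_attained) (rule that)
  obtain zh where zh: "zh \<in> Q" "Im zh = yhi" by (rule yhi_attained) (rule that)
  have key: "Im w * Re (D t) \<ge> Im (u t) * Re (D t)" if t: "t \<in> {p..q}" "t \<notin> Z" and w: "w \<in> Q" and out: "Im (u t) \<notin> {ylo<..<yhi}" for t w
  proof -
    have tab: "t \<in> {a..b}" using t pq by auto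
    note tZ = Z_D[OF tab t(2)]
    have I0: "Im (D t) = 0" by (rule Im_der_zero[OF tZ(1,2) out])
    have "t < \<tau> \<or> t > \<tau>" using t(2) by (auto simp: Z_def)
    then have "supp Q (D t) = - Im (u t) * Re (D t)" using tZ(3,4) I0 by (auto simp: det2_def)
    then show ?thesis using supp_ge[OF w, of "D t"] I0 by (simp add: det2_def)
  qed
  show "Re (u p) \<le> Re (u q)" if fl: "\<And>t. t \<in> {p..q} \<Longrightarrow> Im (u t) = ylo"
  proof (rule nonneg_increment[OF bounded_linear_Re pq])
    fix t assume t: "t \<in> {p..q}" "t \<notin> Z"
    have "(yhi - ylo) * Re (D t) \<ge> 0" using key[OF t zh(1)] fl[OF t(1)] zh(2) by (simp add: algebra_simps)
    then show "0 \<le> Re (D t)" using ylo_yhi by (simp add: zero_le_mult_iff)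
  qed
  show "Re (u q) \<le> Re (u p)" if fl: "\<And>t. t \<in> {p..q} \<Longrightarrow> Im (u t) = yhi"
  proof -
    have "- Re (u p) \<le> - Re (u q)"
    proof (rule nonneg_increment[of "\<lambda>z. - Re z", OF _ pq])
      show "bounded_linear (\<lambda>z. - Re z)" by (intro bounded_linear_minus bounded_linear_Re)
      fix t assume t: "t \<in> {p..q}" "t \<notin> Z"
      have "(yhi - ylo) * (- Re (D t)) \<ge> 0" using key[OF t zl(1)] fl[OF t(1)] zl(2) by (simp add: algebra_simps)
      then show "0 \<le> - Re (D t)" using ylo_yhi by (simp add: mult_le_0_iff)
    qed
    then show ?thesis by simp
  qed
qed

text \<open>In the case of equality the calibrating end of the slice maximizes det2 with the
  velocity. Comparison with the other end of the same slice gives the sign of (xr - xl) Im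
  u'.\<close>

lemma xr_bounds_D:
  assumes t: "t \<in> {a..b}" "t \<notin> Z"
  shows "t < \<tau> \<Longrightarrow> 0 \<le> Im (D t)" and "\<tau> < t \<Longrightarrow> Im (D t) \<le> 0"
proof -
  note tZ = Z_D[OF t]
  have r: "Im (u t) \<in> {ylo..yhi}" by (rule rng[OF t(1)])
  have in1: "0 \<le> (xr (Im (u t)) - xl (Im (u t))) * Im (D t)" if "t < \<tau>"
    using supp_ge[OF xl_mem[OF r], of "D t"] unfolding tZ(3)[OF that] by (simp add: det2_def algebra_simps)
  have in2: "(xr (Im (u t)) - xl (Im (u t))) * Im (D t) \<le> 0" if "\<tau> < t"
    using supp_ge[OF xr_mem[OF r], of "D t"] unfolding tZ(4)[OF that] by (simp add: det2_def algebra_simps)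
  show "0 \<le> Im (D t)" if "t < \<tau>"
  proof (cases "Im (u t) \<in> {ylo<..<yhi}")
    case True
    then show ?thesis using in1[OF that] xl_less_xr[of "Im (u t)"] by (auto simp: zero_le_mult_iff)
  qed (use Im_der_zero[OF tZ(1,2)] in auto)
  show "Im (D t) \<le> 0" if "\<tau> < t"
  proof (cases "Im (u t) \<in> {ylo<..<yhi}")
    case True
    then show ?thesis using in2[OF that] xl_less_xr[of "Im (u t)"] by (auto simp: mult_le_0_iff)
  qed (use Im_der_zero[OF tZ(1,2)] in auto)
qed

text \<open>Equality makes the height rise until \<tau> and then fall. Between the rests, the curve
  is the right arc translated by \<open>cr\<close> and the left arc translated by \<open>cl\<close>;
  the area yields cr = cl, and the rests lie on horizontal sides of \<open>Q\<close> by
  monotonicity.\<close>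

theorem rigidity: "\<exists>cx. \<forall>t\<in>{a..b}. u t - complex_of_real cx \<in> frontier Q"
proof -
  have uc: "continuous_on {a..b} u" by (rule lipschitz_on_continuous_on[OF lip])
  have yc: "continuous_on {p..q} (\<lambda>t. Im (u t))" if "a \<le> p" "q \<le> b" for p q
    by (intro continuous_intros continuous_on_subset[OF uc]) (use that in auto)
  have lohi: "ylo < yhi" using ylo_yhi by simp
  have up: "Im (u s) \<le> Im (u t)" if "a \<le> s" "s \<le> t" "t \<le> \<tau>" for s t
  proof (rule nonneg_increment[OF bounded_linear_Im])
    fix r assume r: "r \<in> {s..t}" "r \<notin> Z"
    then have "r < \<tau>" "r \<in> {a..b}" using that ord by (auto simp: Z_def)
    then show "0 \<le> Im (D r)" using xr_bounds_D(1) r by blast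
  qed (use that ord in auto)
  have down: "- Im (u s) \<le> - Im (u t)" if "\<tau> \<le> s" "s \<le> t" "t \<le> b" for s t
  proof (rule nonneg_increment[of "\<lambda>z. - Im z"])
    show "bounded_linear (\<lambda>z. - Im z)" by (intro bounded_linear_minus bounded_linear_Im)
    fix r assume r: "r \<in> {s..t}" "r \<notin> Z"
    then have "\<tau> < r" "r \<in> {a..b}" using that ord by (auto simp: Z_def)
    then show "0 \<le> - Im (D r)" using xr_bounds_D(2) r by fastforce
  qed (use that ord in auto)
  obtain t1 t2 where T: "a \<le> t1" "t1 < t2" "t2 \<le> \<tau>" "\<And>t. t \<in> {a..t1} \<Longrightarrow> Im (u t) = ylo"
    "\<And>t. t \<in> {t2..\<tau>} \<Longrightarrow> Im (u t) = yhi" "\<And>t. t \<in> {t1<..<t2} \<Longrightarrow> ylo < Im (u t) \<and> Im (u t) < yhi"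
    by (rule monotone_transit[OF yc[OF order_refl ord(2)] ord(1) lo hi lohi up]) (assumption | rule that)+
  have lo': "Im (u b) = ylo" using lo loop by simp
  obtain t3 t4 where T': "\<tau> \<le> t3" "t3 < t4" "t4 \<le> b" "\<And>t. t \<in> {\<tau>..t3} \<Longrightarrow> - Im (u t) = - yhi"
    "\<And>t. t \<in> {t4..b} \<Longrightarrow> - Im (u t) = - ylo" "\<And>t. t \<in> {t3<..<t4} \<Longrightarrow> - yhi < - Im (u t) \<and> - Im (u t) < - ylo"
  proof (rule monotone_transit[of \<tau> b "\<lambda>t. - Im (u t)" "- yhi" "- ylo"])
    show "continuous_on {\<tau>..b} (\<lambda>t. - Im (u t))" by (intro continuous_on_minus yc ord order_refl)
  qed (use ord hi lo' lohi down that in auto)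
  define cr where "cr = Re (u ((t1 + t2) / 2)) - xr (Im (u ((t1 + t2) / 2)))"
  define cl where "cl = Re (u ((t3 + t4) / 2)) - xl (Im (u ((t3 + t4) / 2)))"
  have right: "Re (u t) = xr (Im (u t)) + cr" if t: "t \<in> {t1<..<t2}" for t
  proof -
    have *: "Re (u q) - xr (Im (u q)) = Re (u p) - xr (Im (u p))" if pq: "t1 < p" "p \<le> q" "q < t2" for p q
    proof (rule rigid_arc)
      show "\<exists>K. K-lipschitz_on {m1..m2} xr" if "ylo < m1" "m1 \<le> m2" "m2 < yhi" for m1 m2
        using xr_lipschitz[OF that] by blast
      show "supp Q (D r) = det2 (Complex (xr (Im (u r))) (Im (u r))) (D r)" if "r \<in> {p<..<q}" "r \<notin> Z" for r
        by (rule Z_D(3)) (use that pq T(1-3) ord in auto)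
    qed (use pq T(1-3,6) ord xr_mem in auto)
    show ?thesis using *[of t "(t1+t2)/2"] *[of "(t1+t2)/2" t] t T(2) by (cases "t \<le> (t1+t2)/2") (auto simp: cr_def)
  qed
  have left: "Re (u t) = xl (Im (u t)) + cl" if t: "t \<in> {t3<..<t4}" for t
  proof -
    have *: "Re (u q) - xl (Im (u q)) = Re (u p) - xl (Im (u p))" if pq: "t3 < p" "p \<le> q" "q < t4" for p q
    proof (rule rigid_arc)
      show "\<exists>K. K-lipschitz_on {m1..m2} xl" if "ylo < m1" "m1 \<le> m2" "m2 < yhi" for m1 m2
        using xl_lipschitz[OF that] by blast
      show "supp Q (D r) = det2 (Complex (xl (Im (u r))) (Im (u r))) (D r)" if "r \<in> {p<..<q}" "r \<notin> Z" for r
        by (rule Z_D(4)) (use that pq T'(1-3) ord in auto)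
      show "ylo < Im (u r) \<and> Im (u r) < yhi" if "r \<in> {p..q}" for r using T'(6)[of r] that pq by auto
    qed (use pq T'(1-3) ord xl_mem in auto)
    show ?thesis using *[of t "(t3+t4)/2"] *[of "(t3+t4)/2" t] t T'(2) by (cases "t \<le> (t3+t4)/2") (auto simp: cl_def)
  qed
  define \<phi>r \<phi>l where "\<phi>r Y = (xr Y + cr) * (1 / (\<Lambda> + Y)\<^sup>2)" and "\<phi>l Y = (xl Y + cl) * (1 / (\<Lambda> + Y)\<^sup>2)" for Y
  have "cr = cl"
  proof -
    have b2: "\<exists>B. \<forall>Y\<in>{ylo..yhi}. \<bar>(f Y + c) * (1 / (\<Lambda> + Y)\<^sup>2)\<bar> \<le> B" if "\<forall>Y\<in>{ylo..yhi}. \<bar>f Y\<bar> \<le> B0" for f c B0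
    proof (intro exI ballI)
      fix Y assume Y: "Y \<in> {ylo..yhi}"
      have "\<bar>f Y + c\<bar> \<le> B0 + \<bar>c\<bar>" using that Y by fastforce
      moreover have "1 / (\<Lambda> + Y)\<^sup>2 \<le> 1 / (\<Lambda> + ylo)\<^sup>2"
        using Y \<Lambda>pos by (intro divide_left_mono power_mono) auto
      ultimately show "\<bar>(f Y + c) * (1 / (\<Lambda> + Y)\<^sup>2)\<bar> \<le> (B0 + \<bar>c\<bar>) * (1 / (\<Lambda> + ylo)\<^sup>2)"
        unfolding abs_mult by (intro mult_mono) auto
    qed
    obtain B0 where "\<forall>Y\<in>{ylo..yhi}. \<bar>xr Y\<bar> \<le> B0" "\<forall>Y\<in>{ylo..yhi}. \<bar>xl Y\<bar> \<le> B0" using x_bounded by metis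
    from b2[OF this(1), of cr] b2[OF this(2), of cl]
    obtain Br Bl where Br: "\<And>Y. Y \<in> {ylo..yhi} \<Longrightarrow> \<bar>\<phi>r Y\<bar> \<le> Br" and Bl: "\<And>Y. Y \<in> {ylo..yhi} \<Longrightarrow> \<bar>\<phi>l Y\<bar> \<le> Bl"
      unfolding \<phi>r_def \<phi>l_def by (elim exE) blast
    have cr: "continuous_on {ylo<..<yhi} \<phi>r" and cl: "continuous_on {ylo<..<yhi} \<phi>l"
      unfolding \<phi>r_def \<phi>l_def using \<Lambda>pos by (auto intro!: continuous_intros continuous_on_xr continuous_on_xl)
    have 1: "((\<lambda>t. \<phi>r (Im (u t)) * Im (D t)) has_integral (integral {ylo..Im (u \<tau>)} \<phi>r - integral {ylo..Im (u a)} \<phi>r)) {a..\<tau>}"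
      by (rule chain_integral[OF Br cr lipschitz_on_subset[OF Im_lip] ord(1) rng negN Im_der]) (use ord in auto)
    have 2: "((\<lambda>t. \<phi>l (Im (u t)) * Im (D t)) has_integral (integral {ylo..Im (u b)} \<phi>l - integral {ylo..Im (u \<tau>)} \<phi>l)) {\<tau>..b}"
      by (rule chain_integral[OF Bl cl lipschitz_on_subset[OF Im_lip] ord(2) rng negN Im_der]) (use ord in auto)
    \<comment> \<open>Integration by parts along the closed curve turns the area into the integral
      of this function, in which Re u can be replaced by xr + cr going up and xl + cl coming down.
      The result is \<open>areaF \<Lambda>\<close> plus (cr - cl) J.\<close>
    let ?k = "\<lambda>t. Re (u t) * Im (D t) / (\<Lambda> + Im (u t))\<^sup>2"
    have Dz: "Im (D t) = 0" if "t \<in> {a..b}" "t \<notin> Z" "Im (u t) = ylo \<or> Im (u t) = yhi" for t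
      using Im_der_zero[OF Z_D(1,2)[OF that(1,2)]] that(3) by auto
    have k1: "(?k has_integral (integral {ylo..yhi} \<phi>r - 0)) {a..\<tau>}"
    proof (rule has_integral_spike[OF negZ])
      show "((\<lambda>t. \<phi>r (Im (u t)) * Im (D t)) has_integral (integral {ylo..yhi} \<phi>r - 0)) {a..\<tau>}"
        using 1 hi lo by simp
      fix t assume t: "t \<in> {a..\<tau>} - Z"
      then have tab: "t \<in> {a..b}" using ord by auto
      show "?k t = \<phi>r (Im (u t)) * Im (D t)"
      proof (cases "t \<in> {t1<..<t2}")
        case True
        then show ?thesis using right[OF True] by (simp add: \<phi>r_def)
      next
        case False
        then have "Im (D t) = 0" using T(4)[of t] T(5)[of t] t Dz[OF tab] by force
        then show ?thesis by simp
      qed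
    qed
    have k2: "(?k has_integral (0 - integral {ylo..yhi} \<phi>l)) {\<tau>..b}"
    proof (rule has_integral_spike[OF negZ])
      show "((\<lambda>t. \<phi>l (Im (u t)) * Im (D t)) has_integral (0 - integral {ylo..yhi} \<phi>l)) {\<tau>..b}"
        using 2 hi lo' by simp
      fix t assume t: "t \<in> {\<tau>..b} - Z"
      then have tab: "t \<in> {a..b}" using ord by auto
      show "?k t = \<phi>l (Im (u t)) * Im (D t)"
      proof (cases "t \<in> {t3<..<t4}")
        case True
        then show ?thesis using left[OF True] by (simp add: \<phi>l_def)
      next
        case False
        then have "Im (D t) = 0" using T'(4)[of t] T'(5)[of t] t Dz[OF tab] by force
        then show ?thesis by simp
      qed
    qed
    have kI: "(?k has_integral (integral {ylo..yhi} \<phi>r - integral {ylo..yhi} \<phi>l)) {a..b}"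
      using has_integral_combine[OF ord k1 k2] by simp
    have Jint: "(\<lambda>Y. 1 / (\<Lambda> + Y)\<^sup>2) integrable_on {ylo..yhi}"
      by (rule integrable_continuous_real[OF continuous_recip(2)[OF \<Lambda>pos]])
    define J where "J = integral {ylo..yhi} (\<lambda>Y. 1 / (\<Lambda> + Y)\<^sup>2)"
    have "((\<lambda>Y. (xr Y - xl Y) * (1 / (\<Lambda> + Y)\<^sup>2) + (cr - cl) * (1 / (\<Lambda> + Y)\<^sup>2)) has_integral (areaF \<Lambda> + (cr - cl) * J)) {ylo..yhi}"
      unfolding areaF_def J_def
      by (intro has_integral_add has_integral_mult_right integrable_integral Jint slice_integral(2)[OF continuous_recip(2)[OF \<Lambda>pos]])
    moreover have "((\<lambda>Y. \<phi>r Y - \<phi>l Y) has_integral (integral {ylo..yhi} \<phi>r - integral {ylo..yhi} \<phi>l)) {ylo..yhi}"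
      by (intro has_integral_diff integrable_integral bounded_continuous_Ioo_integrable[OF cr Br] bounded_continuous_Ioo_integrable[OF cl Bl])
    moreover have "(\<lambda>Y. \<phi>r Y - \<phi>l Y) = (\<lambda>Y. (xr Y - xl Y) * (1 / (\<Lambda> + Y)\<^sup>2) + (cr - cl) * (1 / (\<Lambda> + Y)\<^sup>2))"
    proof
      fix Y
      have "(x + c) * k - (x' + c') * k = (x - x') * k + (c - c') * k" for x c k x' c' :: real
        by (simp add: algebra_simps)
      then show "\<phi>r Y - \<phi>l Y = (xr Y - xl Y) * (1 / (\<Lambda> + Y)\<^sup>2) + (cr - cl) * (1 / (\<Lambda> + Y)\<^sup>2)"
        unfolding \<phi>r_def \<phi>l_def .
    qed
    ultimately have val: "integral {ylo..yhi} \<phi>r - integral {ylo..yhi} \<phi>l = areaF \<Lambda> + (cr - cl) * J"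
      using has_integral_unique by metis
    have invlip: "(1 / (\<Lambda> + ylo)\<^sup>2 * K)-lipschitz_on {a..b} (\<lambda>t. inverse (\<Lambda> + Im (u t)))"
    proof (rule lipschitz_on_compose_differentiable[where f = "\<lambda>t. Im (u t)" and h = "\<lambda>s. inverse (\<Lambda> + s)" and C = "{ylo..yhi}" and h' = "\<lambda>s. - (1 / (\<Lambda> + s)\<^sup>2)"])
      show "((\<lambda>s. inverse (\<Lambda> + s)) has_real_derivative - (1 / (\<Lambda> + z)\<^sup>2)) (at z within {ylo..yhi})" if "z \<in> {ylo..yhi}" for z
        using that \<Lambda>pos by (auto intro!: derivative_eq_intros simp: power2_eq_square divide_simps)
      show "norm (- (1 / (\<Lambda> + z)\<^sup>2)) \<le> 1 / (\<Lambda> + ylo)\<^sup>2" if "z \<in> {ylo..yhi}" for z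
        using that \<Lambda>pos by (simp add: power_mono divide_left_mono)
    qed (use Im_lip rng \<Lambda>pos in auto)
    obtain M where M: "M-lipschitz_on {a..b} (\<lambda>t. Re (u t) * inverse (\<Lambda> + Im (u t)))"
      using lipschitz_on_times[OF Re_lip invlip] by blast
    have "((\<lambda>t. Re (D t) / (\<Lambda> + Im (u t)) - ?k t) has_integral
        (Re (u b) * inverse (\<Lambda> + Im (u b)) - Re (u a) * inverse (\<Lambda> + Im (u a)))) {a..b}"
    proof (rule lipschitz_fundamental_theorem[OF M ab negN])
      fix t assume t: "t \<in> {a<..<b}" "t \<notin> N"
      then have p: "\<Lambda> + Im (u t) \<noteq> 0" using pos[of t] by auto
      have "((\<lambda>t. Re (u t) * inverse (\<Lambda> + Im (u t))) has_real_derivative Re (D t) / (\<Lambda> + Im (u t)) - ?k t) (at t)"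
      proof -
        have "((\<lambda>t. \<Lambda> + Im (u t)) has_real_derivative 0 + Im (D t)) (at t)"
          by (intro DERIV_add DERIV_const Im_der[OF t])
        from DERIV_mult[OF Re_der[OF t] DERIV_inverse'[OF this p]] show ?thesis
          by (rule DERIV_cong) (use p in \<open>simp add: field_simps power2_eq_square\<close>)
      qed
      then show "((\<lambda>t. Re (u t) * inverse (\<Lambda> + Im (u t))) has_vector_derivative Re (D t) / (\<Lambda> + Im (u t)) - ?k t) (at t)"
        by (simp add: has_real_derivative_iff_has_vector_derivative)
    qed
    then have "((\<lambda>t. Re (D t) / (\<Lambda> + Im (u t)) - ?k t) has_integral 0) {a..b}" using loop by simp
    moreover have "((\<lambda>t. Re (D t) / (\<Lambda> + Im (u t)) - ?k t) has_integral (circ - (integral {ylo..yhi} \<phi>r - integral {ylo..yhi} \<phi>l))) {a..b}"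
      unfolding circ_def by (rule has_integral_diff[OF integrable_integral[OF circ_integrable] kI]) auto
    ultimately have "0 = circ - (integral {ylo..yhi} \<phi>r - integral {ylo..yhi} \<phi>l)" by (rule has_integral_unique)
    then have "circ = integral {ylo..yhi} \<phi>r - integral {ylo..yhi} \<phi>l" by simp
    then have zero: "(cr - cl) * J = 0" using val area by simp
    \<comment> \<open>J is positive, so (cr - cl) J = 0 gives cr = cl.\<close>
    have "(yhi - ylo) * (1 / (\<Lambda> + yhi)\<^sup>2) \<le> J"
    proof (rule has_integral_le[OF _ integrable_integral[OF Jint, folded J_def]])
      show "((\<lambda>Y. 1 / (\<Lambda> + yhi)\<^sup>2) has_integral (yhi - ylo) * (1 / (\<Lambda> + yhi)\<^sup>2)) {ylo..yhi}"
        using has_integral_const_real[of "1 / (\<Lambda> + yhi)\<^sup>2" ylo yhi] lohi by simp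
      show "1 / (\<Lambda> + yhi)\<^sup>2 \<le> 1 / (\<Lambda> + Y)\<^sup>2" if "Y \<in> {ylo..yhi}" for Y
        using that \<Lambda>pos by (intro divide_left_mono power_mono) auto
    qed
    moreover have "(yhi - ylo) * (1 / (\<Lambda> + yhi)\<^sup>2) > 0" using lohi \<Lambda>pos by simp
    ultimately show ?thesis using zero by simp
  qed
  let ?v = "\<lambda>t. u t - complex_of_real cr"
  have vc: "continuous_on {p..q} ?v" if "a \<le> p" "q \<le> b" for p q
    by (intro continuous_intros continuous_on_subset[OF uc]) (use that in auto)
  have inQ: "?v t \<in> Q" if t: "t \<in> {t1..t2} \<union> {t3..t4}" for t
  proof -
    have "?v ` closure {t1<..<t2} \<subseteq> Q"
    proof (rule image_closure_subset[OF _ compact_imp_closed[OF compQ]])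
      show "continuous_on (closure {t1<..<t2}) ?v" using vc[of t1 t2] T(1-3) ord by simp
      show "?v ` {t1<..<t2} \<subseteq> Q"
      proof
        fix z assume "z \<in> ?v ` {t1<..<t2}"
        then obtain s where s: "s \<in> {t1<..<t2}" "z = ?v s" by blast
        then have "z = Complex (xr (Im (u s))) (Im (u s))" using right[OF s(1)] by (simp add: complex_eq_iff)
        then show "z \<in> Q" using xr_mem[of "Im (u s)"] T(6)[OF s(1)] by auto
      qed
    qed
    moreover have "?v ` closure {t3<..<t4} \<subseteq> Q"
    proof (rule image_closure_subset[OF _ compact_imp_closed[OF compQ]])
      show "continuous_on (closure {t3<..<t4}) ?v" using vc[of t3 t4] T'(1-3) ord by simp
      show "?v ` {t3<..<t4} \<subseteq> Q"
      proof
        fix z assume "z \<in> ?v ` {t3<..<t4}"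
        then obtain s where s: "s \<in> {t3<..<t4}" "z = ?v s" by blast
        then have "z = Complex (xl (Im (u s))) (Im (u s))" using left[OF s(1)] \<open>cr = cl\<close> by (simp add: complex_eq_iff)
        then show "z \<in> Q" using xl_mem[of "Im (u s)"] T'(6)[OF s(1)] by auto
      qed
    qed
    ultimately show ?thesis using t T(2) T'(2) by auto
  qed
  have between: "?v t \<in> Q" if "?v p \<in> Q" "?v q \<in> Q" "Im (u p) = Im (u t)" "Im (u q) = Im (u t)" "Re (u p) \<le> Re (u t)" "Re (u t) \<le> Re (u q)" for p q t
  proof -
    have "Complex (Re (u p) - cr) (Im (u t)) \<in> Q" "Complex (Re (u q) - cr) (Im (u t)) \<in> Q"
      using that(1-4) by (metis complex.collapse minus_complex.sel complex_of_real_def complex.sel diff_zero)+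
    then have "Im (u t) \<in> {ylo..yhi}" "xl (Im (u t)) \<le> Re (u p) - cr" "Re (u q) - cr \<le> xr (Im (u t))"
      using Im_range slice_bounds by force+
    then have "Complex (Re (u t) - cr) (Im (u t)) \<in> Q" using slice_eq[of "Im (u t)" "Re (u t) - cr"] that(5,6) by auto
    moreover have "?v t = Complex (Re (u t) - cr) (Im (u t))" by (simp add: complex_eq_iff)
    ultimately show ?thesis by simp
  qed
  have tt: "a \<le> t1" "t1 \<le> b" "t2 \<le> b" "t3 \<le> b" "a \<le> t2" "a \<le> t3" "a \<le> t4" "t2 \<le> t3" using T(1-3) T'(1-3) ord by auto
  have low1: "Re (u s) \<le> Re (u t)" if "a \<le> s" "s \<le> t" "t \<le> t1" for s t
    using flat_mono(1)[of s t] T(4) that tt by auto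
  have low2: "Re (u s) \<le> Re (u t)" if "t4 \<le> s" "s \<le> t" "t \<le> b" for s t
    using flat_mono(1)[of s t] T'(5) that tt by auto
  have top: "Im (u t) = yhi" if "t \<in> {t2..t3}" for t
    using T(5)[of t] T'(4)[of t] that by (cases "t \<le> \<tau>") auto
  have high: "Re (u t) \<le> Re (u s)" if "t2 \<le> s" "s \<le> t" "t \<le> t3" for s t
    using flat_mono(2)[of s t] top that tt by auto
  have bot: "Im (u t) = ylo" if "t \<in> {a..t1} \<union> {t4..b}" for t using T(4) T'(5) that by auto
  have "?v t \<in> frontier Q" if t: "t \<in> {a..b}" for t
  proof -
    have "t \<in> {t1<..<t2} \<or> t \<in> {t3<..<t4} \<or> t \<in> {t2..t3} \<or> t \<in> {a..t1} \<or> t \<in> {t4..b}"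
      using t unfolding greaterThanLessThan_iff atLeastAtMost_iff by linarith
    then consider "t \<in> {t1<..<t2}" | "t \<in> {t3<..<t4}" | "t \<in> {t2..t3}" | "t \<in> {a..t1}" | "t \<in> {t4..b}" by blast
    then show ?thesis
    proof cases
      case 1
      then show ?thesis using inQ[of t] right[OF 1] by (intro frontier_if_extreme) auto
    next
      case 2
      then show ?thesis using inQ[of t] left[OF 2] \<open>cr = cl\<close> by (intro frontier_if_extreme) auto
    next
      case 3
      have "?v t \<in> Q"
        by (rule between[of t3 t2 t]) (use 3 top high[of t t3] high[of t2 t] inQ[of t2] inQ[of t3] T(2) T'(2) in auto)
      then show ?thesis using top[OF 3] by (intro frontier_if_extreme) auto
    next
      case 4
      \<comment> \<open>The bottom rest is cut by the base point. Since the curve is closed, the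
        piece after t4 and the piece before t1 join to one monotone passage from u t4 to u t1, both
        of which lie in the translated \<open>Q\<close>.\<close>
      have "Re (u t4) \<le> Re (u b)" by (rule low2) (use T' in auto)
      also have "\<dots> \<le> Re (u t)" using low1[of a t] 4 loop by auto
      finally have "?v t \<in> Q"
        by (intro between[of t4 t1 t]) (use 4 bot low1[of t t1] inQ[of t1] inQ[of t4] T(1,2) T'(2,3) in auto)
      then show ?thesis using bot[of t] 4 by (intro frontier_if_extreme) auto
    next
      case 5
      have "Re (u t) \<le> Re (u b)" by (rule low2) (use 5 in auto)
      also have "\<dots> \<le> Re (u t1)" using low1[of a t1] T(1) loop by auto
      finally have "?v t \<in> Q"
        by (intro between[of t4 t1 t]) (use 5 bot low2[of t4 t] inQ[of t1] inQ[of t4] T(1,2) T'(2,3) in auto)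
      then show ?thesis using bot[of t] 5 by (intro frontier_if_extreme) auto
    qed
  qed
  then have "\<forall>t\<in>{a..b}. ?v t \<in> frontier Q" by (rule ballI)
  then show ?thesis by (rule exI)
qed

end

text \<open>By convexity the inside of the curve lies in the interior of \<open>T\<close>. That
  interior is connected and misses the curve, so it cannot also meet the outside; hence it equals
  the inside, and the frontiers agree.\<close>

lemma simple_closed_curve_in_convex_frontier:
  assumes p: "simple_lipschitz_param \<gamma> a b c" and T: "convex T" "compact T" "interior T \<noteq> {}" and sub: "\<gamma> \<subseteq> frontier T"
  shows "\<gamma> = frontier T"
proof -
  let ?p = "unit_path a b c"
  have sp: "simple_path ?p" "pathfinish ?p = pathstart ?p" and img: "path_image ?p = \<gamma>"
    using p unit_path_image[of a b c]
    by (auto simp: simple_lipschitz_param_def pathfinish_def pathstart_def unit_path_def)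
  have J: "inside \<gamma> \<noteq> {}" "open (inside \<gamma>)" "open (outside \<gamma>)" "inside \<gamma> \<union> outside \<gamma> = - \<gamma>" "inside \<gamma> \<inter> outside \<gamma> = {}"
    "frontier (inside \<gamma>) = \<gamma>"
    using Jordan_inside_outside[OF sp] unfolding img by auto
  have clT: "closed T" using T(2) by (rule compact_imp_closed)
  have "\<gamma> \<subseteq> T" using sub frontier_subset_closed[OF clT] by blast
  then have "inside \<gamma> \<subseteq> T" using outside_subset_convex[OF T(1)] J(5) by blast
  then have 1: "inside \<gamma> \<subseteq> interior T" using J(2) by (rule interior_maximal)
  have "interior T \<inter> \<gamma> = {}" using sub by (auto simp: frontier_def)
  then have cov: "interior T \<subseteq> inside \<gamma> \<union> outside \<gamma>" using J(4) by blast
  have "connected (interior T)" using T(1) convex_interior convex_connected by blast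
  then have "inside \<gamma> \<inter> interior T = {} \<or> outside \<gamma> \<inter> interior T = {}"
    using connectedD[OF _ J(2,3) _ cov] J(5) by blast
  then have "interior T \<subseteq> inside \<gamma>" using 1 J(1) cov by blast
  then have "inside \<gamma> = interior T" using 1 by blast
  then have "\<gamma> = frontier (interior T)" using J(6) by simp
  also have "\<dots> = frontier T" using convex_closure_interior[OF T(1,3)] by (simp add: frontier_def)
  finally show ?thesis .
qed

context body
begin

theorem isoperimetric:
  assumes o: "oriented_param Plus \<gamma> a b c" and sub: "\<gamma> \<subseteq> G" and A: "Area (inside \<gamma>) = A" "A > 0"
    and \<Lambda>: "0 < \<Lambda> + ylo" "areaF \<Lambda> = A"
  shows "areaC \<Lambda> + \<Lambda> * A \<le> len Q a b c"
    and "len Q a b c = areaC \<Lambda> + \<Lambda> * A \<Longrightarrow>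
      \<exists>r>0. \<exists>cx. \<gamma> = (\<lambda>z. Complex cx (r * \<Lambda>) + r *\<^sub>R z) ` frontier Q"
proof -
  have "areaC \<Lambda> + \<Lambda> * A \<le> len Q a b c \<and> (len Q a b c = areaC \<Lambda> + \<Lambda> * A \<longrightarrow>
      (\<exists>r>0. \<exists>cx. \<gamma> = (\<lambda>z. Complex cx (r * \<Lambda>) + r *\<^sub>R z) ` frontier Q))"
  proof -
    obtain K0 where ab0: "a < b" and lip0: "K0-lipschitz_on {a..b} c" and im0: "c ` {a..b} = \<gamma>"
      using o by (auto simp: oriented_param_def simple_lipschitz_param_def)
    have "continuous_on {a..b} (\<lambda>t. Im (c t))"
      by (intro continuous_intros lipschitz_on_continuous_on[OF lip0])
    then obtain t0 where t0: "t0 \<in> {a..b}" "\<And>t. t \<in> {a..b} \<Longrightarrow> Im (c t0) \<le> Im (c t)"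
      using continuous_attains_inf[OF compact_Icc, of a b "\<lambda>t. Im (c t)"] ab0 by auto
    \<comment> \<open>Restart the curve at a lowest point: the calibration switches covectors only
      once, at the highest point.\<close>
    define d where "d = (\<lambda>t. if t \<le> b then c t else c (t - (b - a)))"
    define p q where "p = t0" and "q = t0 + (b - a)"
    have od: "oriented_param Plus \<gamma> p q d"
      unfolding d_def p_def q_def by (rule oriented_param_shift[OF o t0(1)])
    have leneq: "len Q a b c = len Q p q d" by (rule len_unique[OF o od sub])
    obtain K where pq: "p < q" and lip: "K-lipschitz_on {p..q} d" and im: "d ` {p..q} = \<gamma>" and loop: "d p = d q"
      using od by (auto simp: oriented_param_def simple_lipschitz_param_def)
    have sp: "simple_lipschitz_param \<gamma> p q d" using od by (simp add: oriented_param_def)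
    define m where "m = Im (d p)"
    have dp: "d p = c t0" using t0(1) by (simp add: d_def p_def)
    have mmin: "m \<le> Im (d t)" if "t \<in> {p..q}" for t
    proof -
      have "d t \<in> c ` {a..b}" using im im0 that by blast
      then show ?thesis using t0(2) dp by (auto simp: m_def)
    qed
    have mpos: "m > 0" using im sub pq by (auto simp: m_def G_def image_subset_iff)
    have "continuous_on {p..q} (\<lambda>t. Im (d t))"
      by (intro continuous_intros lipschitz_on_continuous_on[OF lip])
    then obtain \<tau> where \<tau>: "\<tau> \<in> {p..q}" "\<And>t. t \<in> {p..q} \<Longrightarrow> Im (d t) \<le> Im (d \<tau>)"
      using continuous_attains_sup[OF compact_Icc, of p q "\<lambda>t. Im (d t)"] pq by auto
    define M where "M = Im (d \<tau>)"
    obtain D N where D: "D \<in> borel_measurable borel" "\<And>t. norm (D t) \<le> K" "negligible N"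
      "\<And>t. t \<in> {p<..<q} \<Longrightarrow> t \<notin> N \<Longrightarrow> (d has_vector_derivative D t) (at t)"
      "\<And>u v. p \<le> u \<Longrightarrow> u \<le> v \<Longrightarrow> v \<le> q \<Longrightarrow> (D has_integral (d v - d u)) {u..v}"
      by (rule lipschitz_derivative_on[OF lip]) (rule that)
    have vd: "vector_derivative d (at t) = D t" if "t \<in> {p..q} - (N \<union> {p,q})" for t
      using that by (intro vector_derivative_at D(4)) auto
    have negN': "negligible (N \<union> {p,q})" using D(3) by auto
    have "Area (inside \<gamma>) = integral {p..q} (\<lambda>t. Re (vector_derivative d (at t)) / Im (d t))"
      by (rule Area_eq_contour_integral[OF od sub])
    also have "\<dots> = integral {p..q} (\<lambda>t. Re (D t) / Im (d t))"
      by (rule integral_spike[OF negN']) (simp add: vd)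
    finally have circA: "integral {p..q} (\<lambda>t. Re (D t) / Im (d t)) = A" using A(1) by simp
    have lenD: "len Q p q d = integral {p..q} (\<lambda>t. supp Q (D t) / Im (d t))"
      unfolding len_def by (rule integral_spike[OF negN']) (simp add: vd)
    \<comment> \<open>A closed curve at constant height has area 0, because Re d' integrates to
      0.\<close>
    have mM: "m < M"
    proof (rule ccontr)
      assume "\<not> m < M"
      then have const: "Im (d t) = m" if "t \<in> {p..q}" for t using mmin[OF that] \<tau>(2)[OF that] by (simp add: M_def)
      have "((\<lambda>t. Re (D t)) has_integral 0) {p..q}"
        using has_integral_linear[OF D(5)[of p q] bounded_linear_Re] pq loop by (simp add: o_def)
      then have "((\<lambda>t. Re (D t) / m) has_integral 0 / m) {p..q}" by (rule has_integral_divide)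
      then have "((\<lambda>t. Re (D t) / Im (d t)) has_integral 0 / m) {p..q}"
        by (rule has_integral_eq[rotated]) (simp add: const)
      then show False using circA A(2) by (simp add: integral_unique)
    qed
    \<comment> \<open>R and \<Lambda>' solve R (\<Lambda>' + ylo) = m and R (\<Lambda>' + yhi) = M,
      so that d / R - \<i> \<Lambda>' has the lowest and highest heights of
      \<open>Q\<close>.\<close>
    define R where "R = (M - m) / (yhi - ylo)"
    define \<Lambda>' where "\<Lambda>' = (m * yhi - M * ylo) / (M - m)"
    have hl: "yhi - ylo > 0" using ylo_yhi by simp
    have R: "R > 0" using mM hl by (simp add: R_def)
    have Rl: "R * (\<Lambda>' + ylo) = m" "R * (\<Lambda>' + yhi) = M"
    proof -
      have "\<Lambda>' + ylo = m * (yhi - ylo) / (M - m)" "\<Lambda>' + yhi = M * (yhi - ylo) / (M - m)"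
        using mM by (auto simp: \<Lambda>'_def field_simps)
      then show "R * (\<Lambda>' + ylo) = m" "R * (\<Lambda>' + yhi) = M" using mM hl by (auto simp: R_def)
    qed
    have \<Lambda>'pos: "0 < \<Lambda>' + ylo" using Rl(1) mpos R by (metis zero_less_mult_pos)
    define u where "u t = (1 / R) *\<^sub>R d t - \<i> * of_real \<Lambda>'" for t
    have Imu: "Im (u t) = Im (d t) / R - \<Lambda>'" for t by (simp add: u_def)
    have Lu: "\<Lambda>' + Im (u t) = Im (d t) / R" for t by (simp add: Imu)
    interpret cal: calib Q u "\<lambda>t. (1 / R) *\<^sub>R D t" p q \<tau> "(1 / R) * K" \<Lambda>' N
    proof
      show "((1 / R) * K)-lipschitz_on {p..q} u"
      proof (rule lipschitz_onI)
        show "0 \<le> (1 / R) * K" using R lipschitz_on_nonneg[OF lip] by simp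
        fix s t assume st: "s \<in> {p..q}" "t \<in> {p..q}"
        have "u s - u t = (1 / R) *\<^sub>R (d s - d t)" by (simp add: u_def algebra_simps)
        then have "norm (u s - u t) = (1 / R) * norm (d s - d t)" using R by simp
        then show "dist (u s) (u t) \<le> (1 / R) * K * dist s t"
          using lipschitz_onD[OF lip st] R by (simp add: dist_norm divide_right_mono)
      qed
      show "Im (u p) = ylo" "Im (u \<tau>) = yhi"
        using Rl R by (auto simp: Imu m_def[symmetric] M_def[symmetric] field_simps)
      show "Im (u t) \<in> {ylo..yhi}" if "t \<in> {p..q}" for t
      proof -
        have "\<Lambda>' + ylo \<le> Im (d t) / R" "Im (d t) / R \<le> \<Lambda>' + yhi"
          using mmin[OF that] \<tau>(2)[OF that] R Rl by (simp_all add: pos_le_divide_eq pos_divide_le_eq mult.commute M_def)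
        then show ?thesis unfolding Imu by simp
      qed
      show "(\<lambda>t. (1 / R) *\<^sub>R D t) \<in> borel_measurable borel" using D(1) by simp
      show "norm ((1 / R) *\<^sub>R D t) \<le> (1 / R) * K" for t using D(2)[of t] R by (simp add: divide_right_mono)
      show "(u has_vector_derivative (1 / R) *\<^sub>R D t) (at t)" if "t \<in> {p<..<q}" "t \<notin> N" for t
        unfolding u_def using D(4)[OF that] by (auto intro!: derivative_eq_intros)
      show "((\<lambda>t. (1 / R) *\<^sub>R D t) has_integral (u y - u x)) {x..y}" if "p \<le> x" "x \<le> y" "y \<le> q" for x y
      proof -
        have "u y - u x = (1 / R) *\<^sub>R (d y - d x)" by (simp add: u_def algebra_simps)
        then show ?thesis using has_integral_scaleR_left has_integral_cmul[OF D(5)[OF that], of "1 / R"] by simp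
      qed
    qed (use \<tau>(1) loop \<Lambda>'pos D(3) in \<open>auto simp: u_def\<close>)
    have circ: "cal.circ = A"
      unfolding cal.circ_def Lu circA[symmetric] using R by simp
    have spd: "integral {p..q} cal.speed = len Q p q d"
    proof -
      have "cal.speed t = supp Q (D t) / Im (d t)" for t
        unfolding cal.speed_def Lu using supp_scaleR[of "1 / R" "D t"] R by simp
      then show ?thesis unfolding lenD by presburger
    qed
    have ineq: "\<Lambda>' * A + areaC \<Lambda>' \<le> len Q a b c"
      using cal.calibration_inequality unfolding circ spd leneq .
    \<comment> \<open>The parameter \<Lambda>' comes from the curve. The tangent of
      \<open>areaC\<close> at \<Lambda>, of slope -A, replaces it by the one that belongs to the
      area.\<close>
    have conv: "areaC \<Lambda> - (\<Lambda>' - \<Lambda>) * A \<le> areaC \<Lambda>'"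
      using areaC_convex(1)[OF \<Lambda>(1) \<Lambda>'pos] \<Lambda>(2) by simp
    have main: "areaC \<Lambda> + \<Lambda> * A \<le> len Q a b c" using ineq conv by (simp add: algebra_simps)
    moreover have "\<exists>r>0. \<exists>cx. \<gamma> = (\<lambda>z. Complex cx (r * \<Lambda>) + r *\<^sub>R z) ` frontier Q"
      if eq: "len Q a b c = areaC \<Lambda> + \<Lambda> * A"
    proof -
      have LL: "\<Lambda>' = \<Lambda>"
      proof (rule ccontr)
        assume "\<Lambda>' \<noteq> \<Lambda>"
        then have "areaC \<Lambda> - (\<Lambda>' - \<Lambda>) * A < areaC \<Lambda>'"
          using areaC_convex(2)[OF \<Lambda>(1) \<Lambda>'pos] \<Lambda>(2) by simp
        then show False using ineq eq by (simp add: algebra_simps)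
      qed
      interpret ce: calib_eq Q u "\<lambda>t. (1 / R) *\<^sub>R D t" p q \<tau> "(1 / R) * K" \<Lambda>' N
        by unfold_locales (use eq spd leneq circ LL \<Lambda>(2) in auto)
      obtain cx0 where cx0: "\<And>t. t \<in> {p..q} \<Longrightarrow> u t - of_real cx0 \<in> frontier Q" using ce.rigidity by blast
      let ?f = "\<lambda>z. Complex (R * cx0) (R * \<Lambda>) + R *\<^sub>R z"
      have "\<gamma> \<subseteq> ?f ` frontier Q"
      proof
        fix w assume "w \<in> \<gamma>"
        then obtain t where t: "t \<in> {p..q}" "w = d t" using im by blast
        have "w = ?f (u t - of_real cx0)" using R LL by (simp add: t(2) u_def complex_eq_iff algebra_simps)
        then show "w \<in> ?f ` frontier Q" using cx0[OF t(1)] by blast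
      qed
      \<comment> \<open>Rigidity only places the curve inside the boundary of the convex set; that
        it fills this boundary is a matter of topology.\<close>
      then have sub2: "\<gamma> \<subseteq> frontier (?f ` Q)" using frontier_affine_image[of R "Complex (R * cx0) (R * \<Lambda>)" Q] R by simp
      have "\<gamma> = frontier (?f ` Q)"
      proof (rule simple_closed_curve_in_convex_frontier[OF sp _ _ _ sub2])
        show "convex (?f ` Q)" unfolding affine_image_eq by (intro convex_translation convex_scaling convQ)
        show "compact (?f ` Q)" unfolding affine_image_eq by (intro compact_translation compact_scaling compQ)
        have "interior (?f ` Q) = ?f ` interior Q"
          unfolding affine_image_eq interior_translation
          by (subst interior_injective_linear_image) (use R in \<open>auto simp: inj_on_def linear_scaleR\<close>)
        then show "interior (?f ` Q) \<noteq> {}" using zeroQ by auto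
      qed
      also have "\<dots> = ?f ` frontier Q" using frontier_affine_image[of R "Complex (R * cx0) (R * \<Lambda>)" Q] R by simp
      finally show ?thesis using R by blast
    qed
    ultimately show ?thesis by blast
  qed
  then show "areaC \<Lambda> + \<Lambda> * A \<le> len Q a b c"
    "len Q a b c = areaC \<Lambda> + \<Lambda> * A \<Longrightarrow> \<exists>r>0. \<exists>cx. \<gamma> = (\<lambda>z. Complex cx (r * \<Lambda>) + r *\<^sub>R z) ` frontier Q"
    by blast+
qed

end

section \<open>Convex trigonometry\<close>

text \<open>A positive periodic density has a primitive \<tau> that is a bijection of the line, and
  its inverse \<sigma> solves \<sigma>' = 1 / f(\<sigma>). It is used twice: with the squared
  radius, to parametrize a boundary by swept area, and with 1 / (\<Lambda> + Im w), to obtain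
  natural time.\<close>

lemma clock_exists:
  fixes f :: "real \<Rightarrow> real"
  assumes cont: "continuous_on UNIV f" and m: "0 < m" "\<And>x. m \<le> f x" and per: "\<And>x. f (x + p) = f x"
  obtains \<tau> \<sigma> where "\<And>x. (\<tau> has_real_derivative f x) (at x)" "\<tau> a = 0"
    "\<And>x. \<sigma> (\<tau> x) = x" "\<And>y. \<tau> (\<sigma> y) = y" "strict_mono \<tau>" "strict_mono \<sigma>"
    "\<And>y. (\<sigma> has_real_derivative 1 / f (\<sigma> y)) (at y)" "(1 / m)-lipschitz_on UNIV \<sigma>"
    "\<And>x. \<tau> (x + p) = \<tau> x + \<tau> (a + p)" "\<And>y. \<sigma> (y + \<tau> (a + p)) = \<sigma> y + p"
proof -
  have "isCont f x" for x using cont by (simp add: continuous_on_eq_continuous_at)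
  then obtain T0 where T0: "\<And>x. (T0 has_vector_derivative f x) (at x)"
    using einterval_antiderivative[of "-\<infinity>" "\<infinity>" f] by auto
  define \<tau> where "\<tau> x = T0 x - T0 a" for x
  have der: "(\<tau> has_real_derivative f x) (at x)" for x
    unfolding \<tau>_def has_real_derivative_iff_has_vector_derivative
    by (rule derivative_eq_intros T0 refl)+ simp
  have grow: "m * (y - x) \<le> \<tau> y - \<tau> x" if "x \<le> y" for x y
  proof -
    have "\<tau> x - m * x \<le> \<tau> y - m * y"
    proof (rule DERIV_nonneg_imp_nondecreasing[OF that])
      fix z
      have "((\<lambda>x. \<tau> x - m * x) has_real_derivative f z - m * 1) (at z)"
        by (intro DERIV_diff der DERIV_cmult DERIV_ident)
      then show "\<exists>d. ((\<lambda>x. \<tau> x - m * x) has_real_derivative d) (at z) \<and> 0 \<le> d" using m(2)[of z] by auto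
    qed
    then show ?thesis by (simp add: algebra_simps)
  qed
  have strict: "\<tau> x < \<tau> y" if "x < y" for x y
  proof -
    have "0 < m * (y - x)" using m(1) that by simp
    then show ?thesis using grow[of x y] that by linarith
  qed
  then have mono: "strict_mono \<tau>" by (rule strict_monoI)
  have za: "\<tau> a = 0" by (simp add: \<tau>_def)
  have "\<exists>x. \<tau> x = y" for y
  proof -
    let ?d = "\<bar>y\<bar> / m"
    have d: "0 \<le> ?d" "m * ?d = \<bar>y\<bar>" using m(1) by auto
    have "\<tau> (a - ?d) \<le> y" "y \<le> \<tau> (a + ?d)"
      using grow[of "a - ?d" a] grow[of a "a + ?d"] d za by auto
    moreover have "\<forall>x. a - ?d \<le> x \<and> x \<le> a + ?d \<longrightarrow> isCont \<tau> x" using DERIV_isCont[OF der] by blast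
    ultimately show ?thesis using IVT[of \<tau> "a - ?d" y "a + ?d"] d(1) by auto
  qed
  then have surj: "surj \<tau>" by (metis surjI)
  define \<sigma> where "\<sigma> = inv \<tau>"
  have inv: "\<sigma> (\<tau> x) = x" "\<tau> (\<sigma> y) = y" for x y
    unfolding \<sigma>_def using strict_mono_imp_inj_on[OF mono] surj by (auto simp: surj_f_inv_f)
  have mono': "strict_mono \<sigma>"
    by (rule strict_monoI) (metis inv(2) mono strict_mono_less)
  have lip: "(1 / m)-lipschitz_on UNIV \<sigma>"
  proof (rule lipschitz_onI)
    fix y z
    have "m * \<bar>\<sigma> y - \<sigma> z\<bar> \<le> \<bar>y - z\<bar>"
      using grow[of "\<sigma> y" "\<sigma> z"] grow[of "\<sigma> z" "\<sigma> y"] m(1) unfolding inv by (cases "\<sigma> y \<le> \<sigma> z") auto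
    then show "dist (\<sigma> y) (\<sigma> z) \<le> 1 / m * dist y z" using m(1) by (simp add: dist_real_def field_simps)
  qed (use m in simp)
  have der': "(\<sigma> has_real_derivative 1 / f (\<sigma> y)) (at y)" for y
  proof -
    have "isCont \<sigma> y"
      using lipschitz_on_continuous_on[OF lip] by (simp add: continuous_on_eq_continuous_at)
    then have "(\<sigma> has_real_derivative inverse (f (\<sigma> y))) (at y)"
      using m(1) m(2)[of "\<sigma> y"] by (intro DERIV_inverse_function[OF der, where a = "y - 1" and b = "y + 1"]) (auto simp: inv)
    then show ?thesis by (simp add: inverse_eq_divide)
  qed
  have per': "\<tau> (x + p) = \<tau> x + \<tau> (a + p)" for x
  proof -
    have "((\<lambda>x. \<tau> (x + p) - \<tau> x) has_real_derivative 0) (at z)" for z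
    proof -
      have "((\<lambda>x. \<tau> (x + p)) has_real_derivative f (z + p)) (at z)"
        using der[of "z + p"] by (simp add: DERIV_shift)
      from DERIV_diff[OF this der[of z]] show ?thesis by (simp add: per)
    qed
    then have "\<tau> (x + p) - \<tau> x = \<tau> (a + p) - \<tau> a" using DERIV_isconst_all[of "\<lambda>x. \<tau> (x + p) - \<tau> x" x a] by blast
    then show ?thesis using za by simp
  qed
  have "\<sigma> (y + \<tau> (a + p)) = \<sigma> y + p" for y
    using per'[of "\<sigma> y"] inv(1)[of "\<sigma> y + p"] by (simp add: inv)
  then show ?thesis by (rule that[OF der za inv mono mono' der' lip per'])
qed

lemma oriented_param_if_winding:
  assumes p: "simple_lipschitz_param \<gamma> a b c" and z: "z \<in> inside \<gamma>" "winding_number (unit_path a b c) z = 1"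
  shows "oriented_param Plus \<gamma> a b c"
proof -
  have ab: "a < b" and sp: "simple_path (unit_path a b c)" and im: "c ` {a..b} = \<gamma>"
    using p by (auto simp: simple_lipschitz_param_def)
  have img: "path_image (unit_path a b c) = \<gamma>" using unit_path_image[OF ab] im by simp
  show ?thesis
  proof (rule simple_closed_path_winding_number_inside[OF sp, unfolded img])
    assume "\<And>z. z \<in> inside \<gamma> \<Longrightarrow> winding_number (unit_path a b c) z = 1"
    then show ?thesis using p by (auto simp: oriented_param_def)
  next
    assume "\<And>z. z \<in> inside \<gamma> \<Longrightarrow> winding_number (unit_path a b c) z = - 1"
    then show ?thesis using z by auto
  qed
qed

lemma body_affine_image:
  fixes k v :: complex
  assumes "body K" "k \<noteq> 0"
  shows "frontier ((\<lambda>z. v + k * z) ` K) = (\<lambda>z. v + k * z) ` frontier K"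
    "inside ((\<lambda>z. v + k * z) ` frontier K) = (\<lambda>z. v + k * z) ` interior K"
proof -
  interpret body K by fact
  have lin: "linear ((*) k)" "inj ((*) k)" using assms(2) by (auto intro: linear_cmult simp: inj_on_def)
  have eq: "(\<lambda>z. v + k * z) ` T = (+) v ` (*) k ` T" for T by (simp add: image_image)
  show 1: "frontier ((\<lambda>z. v + k * z) ` K) = (\<lambda>z. v + k * z) ` frontier K"
    unfolding eq frontier_translation frontier_linear_image[OF lin] ..
  have "inside (frontier ((\<lambda>z. v + k * z) ` K)) = interior ((\<lambda>z. v + k * z) ` K)"
    unfolding eq
    by (intro inside_frontier_eq_interior bounded_translation convex_translation convex_linear_image lin convQ
        bounded_linear_image compact_imp_bounded compQ linear_conv_bounded_linear[THEN iffD1])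
  also have "\<dots> = (\<lambda>z. v + k * z) ` interior K"
    unfolding eq interior_translation interior_injective_linear_image[OF lin] ..
  finally show "inside ((\<lambda>z. v + k * z) ` frontier K) = (\<lambda>z. v + k * z) ` interior K" unfolding 1 .
qed

lemma oriented_param_affine:
  fixes k v :: complex
  assumes K: "body K" and o: "oriented_param Plus (frontier K) a b w" and k: "k \<noteq> 0"
  shows "oriented_param Plus ((\<lambda>z. v + k * z) ` frontier K) a b (\<lambda>t. v + k * w t)"
proof -
  interpret body K by fact
  have sp: "simple_lipschitz_param (frontier K) a b w" using o by (simp add: oriented_param_def)
  obtain C where ab: "a < b" and lip: "C-lipschitz_on {a..b} w" and im: "w ` {a..b} = frontier K"
    using sp by (auto simp: simple_lipschitz_param_def)
  have "(norm k * C)-lipschitz_on {a..b} (\<lambda>t. v + k * w t)"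
  proof (rule lipschitz_onI)
    show "0 \<le> norm k * C" using lipschitz_on_nonneg[OF lip] by simp
    fix s t assume "s \<in> {a..b}" "t \<in> {a..b}"
    then have "norm k * dist (w s) (w t) \<le> norm k * (C * dist s t)"
      by (intro mult_left_mono lipschitz_onD[OF lip]) auto
    moreover have "dist (v + k * w s) (v + k * w t) = norm k * dist (w s) (w t)"
      by (simp add: dist_norm norm_mult[symmetric] right_diff_distrib)
    ultimately show "dist (v + k * w s) (v + k * w t) \<le> norm k * C * dist s t" by simp
  qed
  then have p: "simple_lipschitz_param ((\<lambda>z. v + k * z) ` frontier K) a b (\<lambda>t. v + k * w t)"
    using sp k unfolding simple_lipschitz_param_iff im[symmetric] image_image by auto
  have "0 \<in> inside (frontier K)"
    using inside_frontier_eq_interior[OF compact_imp_bounded[OF compQ] convQ] zeroQ by simp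
  then have wn: "winding_number (unit_path a b w) 0 = 1" and nz: "0 \<notin> w ` {a..b}"
    using o inside_not_mem by (auto simp: oriented_param_def im)
  obtain q where q: "continuous_on {a..b} q" "\<And>t. t \<in> {a..b} \<Longrightarrow> w t = 0 + exp (q t)"
    by (rule continuous_log_on_interval[OF lipschitz_on_continuous_on[OF lip] nz]) (rule that)
  \<comment> \<open>A logarithm along k w is Ln k plus one along w, and the constant cancels in the
    increment.\<close>
  have "winding_number (unit_path a b (\<lambda>t. v + k * w t)) v = ((Ln k + q b) - (Ln k + q a)) / (2 * of_real pi * \<i>)"
    by (rule winding_of_log[OF ab]) (use q k in \<open>auto intro!: continuous_intros simp: exp_add\<close>)
  also have "\<dots> = 1" using winding_of_log[OF ab q] wn by simp
  finally have "winding_number (unit_path a b (\<lambda>t. v + k * w t)) v = 1" .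
  moreover have "v \<in> inside ((\<lambda>z. v + k * z) ` frontier K)"
    unfolding body_affine_image(2)[OF K k] using zeroQ by (intro image_eqI[of _ _ 0]) auto
  ultimately show ?thesis by (rule oriented_param_if_winding[OF p, rotated])
qed

text \<open>The parameter is twice the swept area. The notion is separated from the normalized
  functions of \<open>is_convex_trig\<close> because the proof needs it for the turned polar, where
  the turned curve does not start on the positive x-axis.\<close>

locale area_curve = body Q for Q +
  fixes w :: "real \<Rightarrow> complex" and P C :: real and N :: "real set"
  assumes w_lip: "C-lipschitz_on UNIV w"
    and w_orient: "oriented_param Plus (frontier Q) 0 P w"
    and w_period: "\<And>\<theta>. w (\<theta> + P) = w \<theta>"
    and N: "negligible N"
    and w_der: "\<And>\<theta>. \<theta> \<notin> N \<Longrightarrow> (w has_vector_derivative vector_derivative w (at \<theta>)) (at \<theta>)"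
    and w_det: "\<And>\<theta>. \<theta> \<notin> N \<Longrightarrow> det2 (w \<theta>) (vector_derivative w (at \<theta>)) = 1"
begin

abbreviation D :: "real \<Rightarrow> complex" where "D \<theta> \<equiv> vector_derivative w (at \<theta>)"

lemma P_pos: "0 < P"
  using w_orient by (auto simp: oriented_param_def simple_lipschitz_param_def)

lemma w_image: "w ` {0..P} = frontier Q"
  using w_orient by (auto simp: oriented_param_def simple_lipschitz_param_def)

lemma w_loop: "w P = w 0" using w_period[of 0] by simp

lemma w_period_int: "w (\<theta> + of_int n * P) = w \<theta>"
proof -
  have *: "w (\<theta> + of_nat n * P) = w \<theta>" for \<theta> n
    using w_period[of "\<theta> + of_nat n * P" for n] by (induction n) (simp_all add: algebra_simps)
  show ?thesis
    using *[of \<theta> "nat n"] *[of "\<theta> + of_int n * P" "nat (- n)"] by (cases "0 \<le> n") auto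
qed

lemma reduce_period: obtains n :: int where "\<theta> + of_int n * P \<in> {0..<P}"
proof -
  let ?n = "- \<lfloor>\<theta> / P\<rfloor>"
  have "\<theta> + of_int ?n * P \<in> {0..<P}"
    using floor_divide_lower[OF P_pos, of \<theta>] floor_divide_upper[OF P_pos, of \<theta>] by (auto simp: algebra_simps)
  then show ?thesis by (rule that)
qed

lemma w_frontier: "w \<theta> \<in> frontier Q"
  by (rule reduce_period[of \<theta>]) (metis w_image w_period_int atLeastAtMost_iff atLeastLessThan_iff imageI less_imp_le)

lemma w_surj: assumes "z \<in> frontier Q" obtains \<theta> where "\<theta> \<in> {0..<P}" "w \<theta> = z"
proof -
  obtain t where "t \<in> {0..P}" "w t = z" using assms unfolding w_image[symmetric] by blast
  then show ?thesis using that[of t] that[of 0] P_pos w_loop by (cases "t = P") auto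
qed

lemma w_in: "w \<theta> \<in> Q"
  using w_frontier compQ by (meson compact_imp_closed frontier_subset_closed subset_iff)

lemma Im_w: "Im (w \<theta>) \<in> {ylo..yhi}" using Im_range[OF w_in] .

lemma der_parts:
  assumes "\<theta> \<notin> N"
  shows "((\<lambda>t. Re (w t)) has_real_derivative Re (D \<theta>)) (at \<theta>)" "((\<lambda>t. Im (w t)) has_real_derivative Im (D \<theta>)) (at \<theta>)"
  unfolding has_real_derivative_iff_has_vector_derivative
  using bounded_linear.has_vector_derivative[OF bounded_linear_Re w_der[OF assms]]
    bounded_linear.has_vector_derivative[OF bounded_linear_Im w_der[OF assms]] by auto

lemma lip_parts: "C-lipschitz_on T (\<lambda>t. Re (w t))" "C-lipschitz_on T (\<lambda>t. Im (w t))"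
proof -
  have "\<bar>Re (w s - w t)\<bar> \<le> C * dist s t" "\<bar>Im (w s - w t)\<bar> \<le> C * dist s t" for s t
    using abs_Re_le_cmod[of "w s - w t"] abs_Im_le_cmod[of "w s - w t"] lipschitz_onD[OF w_lip, of s t]
    by (auto simp: dist_norm)
  then show "C-lipschitz_on T (\<lambda>t. Re (w t))" "C-lipschitz_on T (\<lambda>t. Im (w t))"
    using lipschitz_on_nonneg[OF w_lip] by (auto intro!: lipschitz_onI simp: dist_real_def)
qed

lemma parts_integral:
  assumes h: "\<And>y. y \<in> {ylo..yhi} \<Longrightarrow> (h has_real_derivative h' y) (at y)"
    and B: "\<And>y. y \<in> {ylo..yhi} \<Longrightarrow> \<bar>h' y\<bar> \<le> B"
  shows "((\<lambda>\<theta>. h (Im (w \<theta>)) * Re (D \<theta>) + Re (w \<theta>) * (h' (Im (w \<theta>)) * Im (D \<theta>))) has_integral 0) {0..P}"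
proof -
  have "0 \<le> B" using B[of ylo] ylo_yhi by fastforce
  then have "(B * C)-lipschitz_on {0..P} (\<lambda>\<theta>. h (Im (w \<theta>)))"
    using Im_w B
    by (intro lipschitz_on_compose_differentiable[OF lip_parts(2), where C = "{ylo..yhi}" and h' = h'])
       (auto intro: has_field_derivative_at_within[OF h])
  then obtain M where M: "M-lipschitz_on {0..P} (\<lambda>\<theta>. h (Im (w \<theta>)) * Re (w \<theta>))"
    using lipschitz_on_times[OF _ lip_parts(1)] by blast
  have "((\<lambda>\<theta>. h (Im (w \<theta>)) * Re (D \<theta>) + Re (w \<theta>) * (h' (Im (w \<theta>)) * Im (D \<theta>))) has_integral
      h (Im (w P)) * Re (w P) - h (Im (w 0)) * Re (w 0)) {0..P}"
  proof (rule lipschitz_fundamental_theorem[OF M less_imp_le[OF P_pos] N])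
    fix \<theta> assume "\<theta> \<notin> N"
    note d = der_parts[OF this]
    have "((\<lambda>\<theta>. h (Im (w \<theta>))) has_real_derivative h' (Im (w \<theta>)) * Im (D \<theta>)) (at \<theta>)"
      by (rule DERIV_chain2[OF h[OF Im_w] d(2)])
    from DERIV_mult[OF this d(1)]
    show "((\<lambda>\<theta>. h (Im (w \<theta>)) * Re (w \<theta>)) has_vector_derivative
        h (Im (w \<theta>)) * Re (D \<theta>) + Re (w \<theta>) * (h' (Im (w \<theta>)) * Im (D \<theta>))) (at \<theta>)"
      unfolding has_real_derivative_iff_has_vector_derivative[symmetric] by (rule DERIV_cong) simp
  qed
  then show ?thesis by (simp add: w_loop)
qed

lemma green_frontier:
  assumes e: "0 < e" and g: "continuous_on {ylo - e..yhi + e} g"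
    and G0: "\<And>s. s \<in> {ylo - e..yhi + e} \<Longrightarrow> (G0 has_real_derivative g s) (at s)"
  shows "((\<lambda>z. g (Im z)) has_integral (- integral {0..P} (\<lambda>\<theta>. G0 (Im (w \<theta>)) * Re (D \<theta>)))) Q"
proof -
  have i: "inside (frontier Q) = interior Q"
    by (rule inside_frontier_eq_interior[OF compact_imp_bounded[OF compQ] convQ])
  have "((\<lambda>z. g (Im z)) has_integral (- integral {0..P} (\<lambda>\<theta>. G0 (Im (w \<theta>)) * Re (D \<theta>)))) (interior Q)"
    unfolding i[symmetric]
  proof (rule green_formula[OF w_orient g])
    show "ylo - e < Im (w \<theta>) \<and> Im (w \<theta>) < yhi + e" for \<theta> using Im_w[of \<theta>] e by simp
  qed (rule has_field_derivative_at_within[OF G0])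
  moreover have n: "negligible {x \<in> interior Q - Q. g (Im x) \<noteq> 0}" "negligible {x \<in> Q - interior Q. g (Im x) \<noteq> 0}"
    using interior_subset[of Q] closure_subset[of Q]
    by (auto simp: frontier_def intro!: negligible_subset[OF negligible_convex_frontier[OF convQ]])
  ultimately show ?thesis unfolding has_integral_spike_set_eq[OF n] by blast
qed

text \<open>The integral of det2 w w' over a period is P. By Green's formula with weight 1 and
  integration by parts it is also twice the area.\<close>

lemma period_eq: "P = 2 * S Q"
proof -
  have "((\<lambda>\<theta>. Im (w \<theta>) * Re (D \<theta>) + Re (w \<theta>) * (1 * Im (D \<theta>))) has_integral 0) {0..P}"
    by (rule parts_integral[of "\<lambda>y. y" "\<lambda>_. 1" 1]) auto
  moreover have "((\<lambda>\<theta>. det2 (w \<theta>) (D \<theta>)) has_integral P) {0..P}"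
  proof (rule has_integral_spike[OF N])
    show "((\<lambda>\<theta>. 1::real) has_integral P) {0..P}" using has_integral_const_real[of "1::real" 0 P] P_pos by simp
  qed (use w_det in auto)
  ultimately have "((\<lambda>\<theta>. (Im (w \<theta>) * Re (D \<theta>) + Re (w \<theta>) * (1 * Im (D \<theta>)) - det2 (w \<theta>) (D \<theta>)) / 2) has_integral (0 - P) / 2) {0..P}"
    by (intro has_integral_divide has_integral_diff)
  then have "((\<lambda>\<theta>. Im (w \<theta>) * Re (D \<theta>)) has_integral - P / 2) {0..P}" by (simp add: det2_def)
  then have "((\<lambda>z. 1::real) has_integral - (- P / 2)) Q"
    using green_frontier[of 1 "\<lambda>_. 1" "\<lambda>y. y"] by (simp add: integral_unique)
  then have "integral Q (\<lambda>z. 1::real) = P / 2" by (simp add: integral_unique)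
  then show ?thesis unfolding S_def using lmeasure_integral[OF lmeasurable_compact[OF compQ]] by simp
qed

end

lemma AE_lebesgue_iff_negligible: "(AE t in lebesgue. R (t::real)) \<longleftrightarrow> negligible {t. \<not> R t}"
  using AE_lebesgue_on_iff_negligible[of "UNIV :: real set" R, unfolded lebesgue_on_UNIV_eq] by simp

lemma (in area_curve) is_convex_trig_w:
  assumes "Im (w 0) = 0" "0 < Re (w 0)"
  shows "is_convex_trig Q (\<lambda>\<theta>. Re (w \<theta>)) (\<lambda>\<theta>. Im (w \<theta>))"
  unfolding is_convex_trig_def period_eq[symmetric] complex.collapse
proof (intro conjI exI allI)
  have "{\<theta>. \<not> ((\<lambda>\<theta>. Re (w \<theta>)) differentiable (at \<theta>) \<and> (\<lambda>\<theta>. Im (w \<theta>)) differentiable (at \<theta>) \<and>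
      Re (w \<theta>) * deriv (\<lambda>\<theta>. Im (w \<theta>)) \<theta> - Im (w \<theta>) * deriv (\<lambda>\<theta>. Re (w \<theta>)) \<theta> = 1)} \<subseteq> N"
  proof (rule subsetI, rule ccontr)
    fix \<theta> assume c: "\<theta> \<in> {\<theta>. \<not> ((\<lambda>\<theta>. Re (w \<theta>)) differentiable (at \<theta>) \<and> (\<lambda>\<theta>. Im (w \<theta>)) differentiable (at \<theta>) \<and>
      Re (w \<theta>) * deriv (\<lambda>\<theta>. Im (w \<theta>)) \<theta> - Im (w \<theta>) * deriv (\<lambda>\<theta>. Re (w \<theta>)) \<theta> = 1)}" and "\<theta> \<notin> N"
    note d = der_parts[OF this(2)]
    have "(\<lambda>\<theta>. Re (w \<theta>)) differentiable (at \<theta>)" "(\<lambda>\<theta>. Im (w \<theta>)) differentiable (at \<theta>)"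
      using d real_differentiable_def by blast+
    then show False using c w_det[OF \<open>\<theta> \<notin> N\<close>] by (simp add: det2_def DERIV_imp_deriv[OF d(1)] DERIV_imp_deriv[OF d(2)])
  qed
  then show "AE \<theta> in lebesgue. (\<lambda>\<theta>. Re (w \<theta>)) differentiable (at \<theta>) \<and> (\<lambda>\<theta>. Im (w \<theta>)) differentiable (at \<theta>) \<and>
      Re (w \<theta>) * deriv (\<lambda>\<theta>. Im (w \<theta>)) \<theta> - Im (w \<theta>) * deriv (\<lambda>\<theta>. Re (w \<theta>)) \<theta> = 1"
    unfolding AE_lebesgue_iff_negligible by (rule negligible_subset[OF N])
qed (use lip_parts w_period w_orient assms in auto)

lemma is_convex_trig_curve:
  assumes K: "body K" and t: "is_convex_trig K c s"
  obtains C N where "area_curve K (\<lambda>\<theta>. Complex (c \<theta>) (s \<theta>)) (2 * S K) C N"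
proof -
  let ?w = "\<lambda>\<theta>. Complex (c \<theta>) (s \<theta>)"
  let ?R = "\<lambda>\<theta>. c differentiable (at \<theta>) \<and> s differentiable (at \<theta>) \<and> c \<theta> * deriv s \<theta> - s \<theta> * deriv c \<theta> = 1"
  obtain C1 C2 where l: "C1-lipschitz_on UNIV c" "C2-lipschitz_on UNIV s" using t by (auto simp: is_convex_trig_def)
  have "(C1 + C2)-lipschitz_on UNIV ?w"
  proof (rule lipschitz_onI)
    show "0 \<le> C1 + C2" using l lipschitz_on_nonneg by (metis add_nonneg_nonneg)
    fix x y
    have "dist (?w x) (?w y) \<le> \<bar>c x - c y\<bar> + \<bar>s x - s y\<bar>"
      using cmod_le[of "?w x - ?w y"] by (simp add: dist_norm)
    then show "dist (?w x) (?w y) \<le> (C1 + C2) * dist x y"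
      using lipschitz_onD[OF l(1), of x y] lipschitz_onD[OF l(2), of x y] by (simp add: dist_real_def algebra_simps)
  qed
  moreover have "AE \<theta> in lebesgue. ?R \<theta>" using t by (simp add: is_convex_trig_def)
  then have "negligible {\<theta>. \<not> ?R \<theta>}" unfolding AE_lebesgue_iff_negligible .
  moreover have "(?w has_vector_derivative Complex (deriv c \<theta>) (deriv s \<theta>)) (at \<theta>)" if "?R \<theta>" for \<theta>
    using that by (simp add: has_vector_derivative_complex_iff DERIV_deriv_iff_real_differentiable)
  then have "(?w has_vector_derivative vector_derivative ?w (at \<theta>)) (at \<theta>) \<and> det2 (?w \<theta>) (vector_derivative ?w (at \<theta>)) = 1"
    if "?R \<theta>" for \<theta>
  proof -
    have d: "(?w has_vector_derivative Complex (deriv c \<theta>) (deriv s \<theta>)) (at \<theta>)"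
      by (rule \<open>\<And>\<theta>. ?R \<theta> \<Longrightarrow> (?w has_vector_derivative Complex (deriv c \<theta>) (deriv s \<theta>)) (at \<theta>)\<close>[OF that])
    show ?thesis unfolding vector_derivative_at[OF d] using d that by (simp add: det2_def)
  qed
  ultimately have "area_curve K ?w (2 * S K) (C1 + C2) {\<theta>. \<not> ?R \<theta>}"
    using K t by (intro area_curve.intro area_curve_axioms.intro) (auto simp: is_convex_trig_def)
  then show ?thesis by (rule that)
qed

text \<open>Distance from 0 to the boundary in the direction of the angle x.\<close>

definition radial :: "complex set \<Rightarrow> real \<Rightarrow> real" where
  "radial K x = 1 / minkowski K (cis x)"

lemma norm_cis_diff_le: "norm (cis x - cis y) \<le> \<bar>x - y\<bar>"
proof (rule power2_le_imp_le)
  have "(norm (cis x - cis y))\<^sup>2 = (cos x - cos y)\<^sup>2 + (sin x - sin y)\<^sup>2" by (simp add: cmod_power2)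
  also have "\<dots> = ((cos x)\<^sup>2 + (sin x)\<^sup>2) + ((cos y)\<^sup>2 + (sin y)\<^sup>2) - 2 * cos (x - y)"
    unfolding cos_diff by (simp add: power2_eq_square algebra_simps)
  also have "\<dots> = 4 * (sin ((x - y) / 2))\<^sup>2"
  proof -
    have "2 * ((x - y) / 2) = x - y" by simp
    from cos_double_sin[of "(x - y) / 2", unfolded this] show ?thesis by simp
  qed
  also have "\<dots> \<le> 4 * \<bar>(x - y) / 2\<bar>\<^sup>2"
    using power_mono[OF abs_sin_x_le_abs_x[of "(x - y) / 2"], of 2] by simp
  finally show "(norm (cis x - cis y))\<^sup>2 \<le> \<bar>x - y\<bar>\<^sup>2" by (simp add: power_divide)
qed simp

lemma radial_props:
  assumes K: "body K"
  shows "0 \<le> r \<Longrightarrow> r *\<^sub>R cis x \<in> frontier K \<longleftrightarrow> r = radial K x"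
    and "\<exists>m M B. 0 < m \<and> (\<forall>x. m \<le> radial K x \<and> radial K x \<le> M) \<and> B-lipschitz_on UNIV (radial K)"
proof -
  interpret P: body "polar K" by (rule body_polar[OF K])
  interpret Q: body "(\<lambda>w. - \<i> * w) ` polar K" by (rule body_rotate[OF P.body_axioms]) auto
  note meq = minkowski_eq_supp[OF K]
  let ?n = "supp ((\<lambda>w. - \<i> * w) ` polar K)"
  have r: "radial K x = 1 / ?n (cis x)" for x by (simp add: radial_def meq)
  have pos: "0 < ?n (cis x)" for x by (rule Q.supp_pos) simp
  show "r *\<^sub>R cis x \<in> frontier K \<longleftrightarrow> r = radial K x" if "0 \<le> r"
    using pos[of x] unfolding frontier_eq_minkowski[OF K] meq r mem_Collect_eq Q.supp_scaleR[OF that] by (simp add: field_simps)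
  obtain B where B: "B > 0" "\<And>v. ?n v \<le> B * norm v" by (rule Q.supp_bound) (rule that)
  obtain L where L: "L-lipschitz_on UNIV ?n" by (rule Q.supp_lipschitz) (rule that)
  have "sphere (0::complex) 1 \<noteq> {}" using norm_cis[of 0] by (metis empty_iff mem_sphere_0)
  then obtain z where z: "norm z = 1" "\<And>y. norm y = 1 \<Longrightarrow> ?n z \<le> ?n y"
    using continuous_attains_inf[OF compact_sphere _ continuous_on_subset[OF Q.continuous_on_supp subset_UNIV]]
    by (metis mem_sphere_0)
  define k where "k = ?n z"
  have k: "0 < k" "\<And>x. k \<le> ?n (cis x)" using z Q.supp_pos[of z] norm_zero[where 'a = complex] unfolding k_def by (metis zero_neq_one, metis norm_cis)
  have "(L / k\<^sup>2)-lipschitz_on UNIV (radial K)"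
  proof (rule lipschitz_onI)
    show "0 \<le> L / k\<^sup>2" using lipschitz_on_nonneg[OF L] by simp
    fix x y
    have "radial K x - radial K y = (?n (cis y) - ?n (cis x)) / (?n (cis x) * ?n (cis y))"
      using pos[of x] pos[of y] unfolding r by (simp add: field_simps)
    then have "dist (radial K x) (radial K y) = \<bar>?n (cis y) - ?n (cis x)\<bar> / (?n (cis x) * ?n (cis y))"
      using pos[of x] pos[of y] by (simp add: dist_real_def abs_mult)
    also have "\<dots> \<le> L * \<bar>y - x\<bar> / (k * k)"
    proof (rule frac_le)
      show "\<bar>?n (cis y) - ?n (cis x)\<bar> \<le> L * \<bar>y - x\<bar>"
        using lipschitz_onD[OF L, of "cis y" "cis x"] mult_left_mono[OF norm_cis_diff_le[of y x] lipschitz_on_nonneg[OF L]]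
        by (simp add: dist_norm)
      show "k * k \<le> ?n (cis x) * ?n (cis y)" using k pos by (intro mult_mono) (auto intro: less_imp_le)
    qed (use k lipschitz_on_nonneg[OF L] in auto)
    finally show "dist (radial K x) (radial K y) \<le> L / k\<^sup>2 * dist x y"
      by (simp add: dist_real_def power2_eq_square abs_minus_commute)
  qed
  moreover have "1 / B \<le> radial K x \<and> radial K x \<le> 1 / k" for x
    using B(2)[of "cis x"] k pos[of x] unfolding r by (auto intro: frac_le)
  ultimately show "\<exists>m M B. 0 < m \<and> (\<forall>x. m \<le> radial K x \<and> radial K x \<le> M) \<and> B-lipschitz_on UNIV (radial K)"
    using B(1) by (intro exI[of _ "1 / B"] exI[of _ "1 / k"] exI[of _ "L / k\<^sup>2"]) auto
qed

text \<open>The polar angle as a function of twice the swept area is the inverse of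
  \<open>x \<mapsto> \<integral>\<^sub>0\<^sup>x radial\<^sup>2\<close>.\<close>

lemma convex_trig_structure:
  assumes K: "body K"
  obtains \<sigma> where "strict_mono \<sigma>" "\<And>\<theta>. \<sigma> (\<theta> + 2 * S K) = \<sigma> \<theta> + 2 * pi" "\<exists>c s. is_convex_trig K c s"
    "\<And>c s \<theta>. is_convex_trig K c s \<Longrightarrow> Complex (c \<theta>) (s \<theta>) = radial K (\<sigma> \<theta>) *\<^sub>R cis (\<sigma> \<theta>)"
proof -
  interpret body K by fact
  obtain m M B where m: "0 < m" "\<And>x. m \<le> radial K x" "\<And>x. radial K x \<le> M" and B: "B-lipschitz_on UNIV (radial K)"
    using radial_props(2)[OF K] by blast
  have rpos: "0 < radial K x" for x using m(1) m(2)[of x] by simp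
  have per: "radial K (x + 2 * pi) = radial K x" for x by (simp add: radial_def cis.code)
  have rc: "continuous_on UNIV (\<lambda>x. (radial K x)\<^sup>2)" by (intro continuous_intros lipschitz_on_continuous_on[OF B])
  have m2: "0 < m\<^sup>2" "\<And>x. m\<^sup>2 \<le> (radial K x)\<^sup>2" using m(1) power_mono[OF m(2) less_imp_le[OF m(1)]] by auto
  have per2: "(radial K (x + 2 * pi))\<^sup>2 = (radial K x)\<^sup>2" for x by (simp only: per)
  obtain \<tau> \<sigma> where \<tau>: "\<And>x. (\<tau> has_real_derivative (radial K x)\<^sup>2) (at x)" "\<tau> 0 = 0"
    and inv: "\<And>x. \<sigma> (\<tau> x) = x" "\<And>y. \<tau> (\<sigma> y) = y" and mono: "strict_mono \<tau>" "strict_mono \<sigma>"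
    and \<sigma>: "\<And>y. (\<sigma> has_real_derivative 1 / (radial K (\<sigma> y))\<^sup>2) (at y)" "(1 / m\<^sup>2)-lipschitz_on UNIV \<sigma>"
    and shift: "\<And>x. \<tau> (x + 2 * pi) = \<tau> x + \<tau> (0 + 2 * pi)" "\<And>y. \<sigma> (y + \<tau> (0 + 2 * pi)) = \<sigma> y + 2 * pi"
    by (rule clock_exists[OF rc m2 per2, where a = 0]) (rule that)
  define p where "p = \<tau> (2 * pi)"
  have sp: "\<sigma> (y + p) = \<sigma> y + 2 * pi" for y using shift(2) by (simp add: p_def)
  have s0: "\<sigma> 0 = 0" using inv(1)[of 0] \<tau>(2) by simp
  then have s1: "\<sigma> p = 2 * pi" using sp[of 0] by simp
  have p: "0 < p" using s0 s1 strict_mono_less[OF mono(2), of 0 p] by simp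
  define W where "W \<theta> = radial K (\<sigma> \<theta>) *\<^sub>R cis (\<sigma> \<theta>)" for \<theta>
  have "(B + M)-lipschitz_on UNIV (\<lambda>x. radial K x *\<^sub>R cis x)"
  proof (rule lipschitz_onI)
    show "0 \<le> B + M" using lipschitz_on_nonneg[OF B] rpos[of 0] m(3)[of 0] by simp
    fix x y
    have "radial K x *\<^sub>R cis x - radial K y *\<^sub>R cis y = (radial K x - radial K y) *\<^sub>R cis x + radial K y *\<^sub>R (cis x - cis y)"
      by (simp add: algebra_simps)
    then have "norm (radial K x *\<^sub>R cis x - radial K y *\<^sub>R cis y) \<le> \<bar>radial K x - radial K y\<bar> + radial K y * norm (cis x - cis y)"
      using norm_triangle_ineq[of "(radial K x - radial K y) *\<^sub>R cis x" "radial K y *\<^sub>R (cis x - cis y)"] rpos[of y] by simp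
    also have "\<dots> \<le> B * \<bar>x - y\<bar> + M * \<bar>x - y\<bar>"
      using lipschitz_onD[OF B, of x y] m(3)[of y] rpos[of y] norm_cis_diff_le[of x y]
      by (intro add_mono mult_mono) (auto simp: dist_real_def)
    finally show "dist (radial K x *\<^sub>R cis x) (radial K y *\<^sub>R cis y) \<le> (B + M) * dist x y"
      by (simp add: dist_norm dist_real_def algebra_simps)
  qed
  then have Wlip: "((B + M) * (1 / m\<^sup>2))-lipschitz_on UNIV W"
    unfolding W_def by (intro lipschitz_on_compose2[OF \<sigma>(2)]) (rule lipschitz_on_subset, auto)
  have Wf: "W \<theta> \<in> frontier K" for \<theta>
    unfolding W_def using radial_props(1)[OF K, of "radial K (\<sigma> \<theta>)" "\<sigma> \<theta>"] rpos[of "\<sigma> \<theta>"] by simp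
  have Wper: "W (\<theta> + p) = W \<theta>" for \<theta> unfolding W_def sp per by (simp add: cis.code)
  have Wparam: "simple_lipschitz_param (frontier K) 0 p W"
    unfolding simple_lipschitz_param_iff
  proof (intro conjI ballI impI)
    show "\<exists>C. C-lipschitz_on {0..p} W" using lipschitz_on_subset[OF Wlip] by blast
    show "W 0 = W p" using Wper[of 0] by simp
    fix s t assume st: "s \<in> {0..p}" "t \<in> {0..p}" "W s = W t"
    have "norm (W \<theta>) = radial K (\<sigma> \<theta>)" for \<theta> using rpos[of "\<sigma> \<theta>"] by (simp add: W_def)
    then have "radial K (\<sigma> s) = radial K (\<sigma> t)" using st(3) by metis
    then have "cis (\<sigma> s) = cis (\<sigma> t)" using st(3) rpos[of "\<sigma> t"] by (simp add: W_def)
    then obtain n :: int where n: "\<sigma> s = \<sigma> t + 2 * pi * n"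
      using sin_cos_eq_iff[of "\<sigma> s" "\<sigma> t"] by (auto simp: complex_eq_iff)
    have le: "0 \<le> \<sigma> x" "\<sigma> x \<le> 2 * pi" if "x \<in> {0..p}" for x
      using that strict_mono_less_eq[OF mono(2)] s0 s1 by (metis atLeastAtMost_iff)+
    consider "n = 0" | "1 \<le> n" | "n \<le> - 1" by linarith
    then show "s = t \<or> s = 0 \<and> t = p \<or> s = p \<and> t = 0"
    proof cases
      case 1
      then show ?thesis using n strict_mono_eq[OF mono(2)] by simp
    next
      case 2
      then have "2 * pi * 1 \<le> 2 * pi * n" by (intro mult_left_mono) auto
      then have "\<sigma> s = \<sigma> p" "\<sigma> t = \<sigma> 0" unfolding s0 s1 using n le[OF st(1)] le[OF st(2)] by linarith+
      then show ?thesis using strict_mono_eq[OF mono(2)] by simp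
    next
      case 3
      then have "2 * pi * n \<le> 2 * pi * (- 1)" by (intro mult_left_mono) auto
      then have "\<sigma> s = \<sigma> 0" "\<sigma> t = \<sigma> p" unfolding s0 s1 using n le[OF st(1)] le[OF st(2)] by linarith+
      then show ?thesis using strict_mono_eq[OF mono(2)] by simp
    qed
  next
    show "W ` {0..p} = frontier K"
    proof
      show "frontier K \<subseteq> W ` {0..p}"
      proof
        fix z assume z: "z \<in> frontier K"
        have zz: "z = norm z *\<^sub>R cis (Arg2pi z)" using Arg2pi_eq[of z] by (simp add: cis_conv_exp scaleR_conv_of_real)
        then have "norm z = radial K (Arg2pi z)" using z radial_props(1)[OF K, of "norm z" "Arg2pi z"] by simp
        then have "W (\<tau> (Arg2pi z)) = z" using zz by (simp add: W_def inv)
        moreover have "\<tau> (Arg2pi z) \<in> {0..p}"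
          using Arg2pi[of z] strict_mono_less_eq[OF mono(1)] \<tau>(2) unfolding p_def
          by (metis atLeastAtMost_iff less_imp_le)
        ultimately show "z \<in> W ` {0..p}" by (metis imageI)
      qed
    qed (use Wf in auto)
  qed (rule p)
  have "W \<theta> = 0 + exp (Complex (ln (radial K (\<sigma> \<theta>))) (\<sigma> \<theta>))" for \<theta>
    using rpos by (simp add: W_def exp_eq_polar scaleR_conv_of_real flip: exp_of_real)
  moreover have "continuous_on {0..p} (\<lambda>\<theta>. Complex (ln (radial K (\<sigma> \<theta>))) (\<sigma> \<theta>))"
  proof -
    have "continuous_on {0..p} \<sigma>" using lipschitz_on_continuous_on[OF \<sigma>(2)] continuous_on_subset by blast
    then show ?thesis using rpos
      by (intro continuous_on_Complex continuous_on_ln continuous_on_compose2[OF lipschitz_on_continuous_on[OF B]])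
         (auto simp: less_imp_neq[symmetric])
  qed
  ultimately have "winding_number (unit_path 0 p W) 0 =
      (Complex (ln (radial K (\<sigma> p))) (\<sigma> p) - Complex (ln (radial K (\<sigma> 0))) (\<sigma> 0)) / (2 * of_real pi * \<i>)"
    by (intro winding_of_log[OF p])
  also have "Complex (ln (radial K (\<sigma> p))) (\<sigma> p) - Complex (ln (radial K (\<sigma> 0))) (\<sigma> 0) = 2 * of_real pi * \<i>"
    using per[of 0] by (simp add: s0 s1 complex_eq_iff)
  finally have "winding_number (unit_path 0 p W) 0 = 1" by simp
  moreover have "0 \<in> inside (frontier K)"
    using inside_frontier_eq_interior[OF compact_imp_bounded[OF compQ] convQ] zeroQ by simp
  ultimately have Worient: "oriented_param Plus (frontier K) 0 p W"
    by (intro oriented_param_if_winding[OF Wparam])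
  obtain D where D: "negligible {t. \<not> (W has_vector_derivative D t) (at t)}" by (rule lipschitz_derivative[OF Wlip]) (rule that)
  let ?N = "{t. \<not> (W has_vector_derivative D t) (at t)}"
  have Wdet: "det2 (W \<theta>) (D \<theta>) = 1" if "\<theta> \<notin> ?N" for \<theta>
  proof -
    let ?r = "radial K (\<sigma> \<theta>)"
    have d: "((\<lambda>t. Re (W t)) has_real_derivative Re (D \<theta>)) (at \<theta>)" "((\<lambda>t. Im (W t)) has_real_derivative Im (D \<theta>)) (at \<theta>)"
      using that by (auto simp: has_vector_derivative_complex_iff)
    \<comment> \<open>The radius is only Lipschitz, so its derivative is avoided: the identity Im W
      cos \<sigma> - Re W sin \<sigma> = 0 is differentiated instead, and it yields the determinant
      directly.\<close>
    have "((\<lambda>t. Im (W t) * cos (\<sigma> t) - Re (W t) * sin (\<sigma> t)) has_real_derivative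
        (Im (D \<theta>) * cos (\<sigma> \<theta>) + - sin (\<sigma> \<theta>) * (1 / ?r\<^sup>2) * Im (W \<theta>) -
        (Re (D \<theta>) * sin (\<sigma> \<theta>) + cos (\<sigma> \<theta>) * (1 / ?r\<^sup>2) * Re (W \<theta>)))) (at \<theta>)"
      by (intro DERIV_diff DERIV_mult d DERIV_chain2[OF DERIV_cos] DERIV_chain2[OF DERIV_sin] \<sigma>(1))
    moreover have "(\<lambda>t. Im (W t) * cos (\<sigma> t) - Re (W t) * sin (\<sigma> t)) = (\<lambda>t. 0)"
      by (simp add: W_def fun_eq_iff)
    ultimately have "Im (D \<theta>) * cos (\<sigma> \<theta>) + - sin (\<sigma> \<theta>) * (1 / ?r\<^sup>2) * Im (W \<theta>) -
        (Re (D \<theta>) * sin (\<sigma> \<theta>) + cos (\<sigma> \<theta>) * (1 / ?r\<^sup>2) * Re (W \<theta>)) = 0"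
      by (simp only: DERIV_unique[OF _ DERIV_const])
    moreover have "sin (\<sigma> \<theta>) * (1 / ?r\<^sup>2) * Im (W \<theta>) + cos (\<sigma> \<theta>) * (1 / ?r\<^sup>2) * Re (W \<theta>) = 1 / ?r"
    proof -
      have "sin (\<sigma> \<theta>) * (1 / ?r\<^sup>2) * Im (W \<theta>) + cos (\<sigma> \<theta>) * (1 / ?r\<^sup>2) * Re (W \<theta>)
          = (1 / ?r) * ((sin (\<sigma> \<theta>))\<^sup>2 + (cos (\<sigma> \<theta>))\<^sup>2)"
        using rpos[of "\<sigma> \<theta>"] by (simp add: W_def field_simps power2_eq_square)
      then show ?thesis by simp
    qed
    ultimately have "Im (D \<theta>) * cos (\<sigma> \<theta>) - Re (D \<theta>) * sin (\<sigma> \<theta>) = 1 / ?r" by linarith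
    moreover have "det2 (W \<theta>) (D \<theta>) = ?r * (Im (D \<theta>) * cos (\<sigma> \<theta>) - Re (D \<theta>) * sin (\<sigma> \<theta>))"
      by (simp add: det2_def W_def algebra_simps)
    ultimately show ?thesis using rpos[of "\<sigma> \<theta>"] by simp
  qed
  interpret W: area_curve K W p "(B + M) * (1 / m\<^sup>2)" ?N
    by unfold_locales (use Wlip Worient Wper D Wdet in \<open>auto simp: vector_derivative_at\<close>)
  have ex: "\<exists>c s. is_convex_trig K c s"
    using W.is_convex_trig_w rpos[of 0] by (auto simp: W_def s0)
  \<comment> \<open>For uniqueness the given curve is written as the exponential of a Lipschitz
    logarithm, with angle \<open>ang\<close> normalized to 0 at the start. The area condition says
    radial^2 ang' = 1, that is, \<tau> composed with \<open>ang\<close> has derivative 1; so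
    \<open>ang\<close> is \<sigma>.\<close>
  have "Complex (c \<theta>) (s \<theta>) = W \<theta>" if t: "is_convex_trig K c s" for c s \<theta>
  proof -
    obtain C N where "area_curve K (\<lambda>\<theta>. Complex (c \<theta>) (s \<theta>)) (2 * S K) C N"
      by (rule is_convex_trig_curve[OF K t]) (rule that)
    then interpret A: area_curve K "\<lambda>\<theta>. Complex (c \<theta>) (s \<theta>)" p C N unfolding W.period_eq[symmetric] .
    define w where "w \<theta> = Complex (c \<theta>) (s \<theta>)" for \<theta>
    have wf: "w t \<in> frontier K" for t unfolding w_def by (rule A.w_frontier)
    then have nz: "0 \<notin> w ` {0..p}" using zeroQ by (metis DiffD2 frontier_def imageE)
    have wl: "C-lipschitz_on {0..p} w" unfolding w_def by (rule lipschitz_on_subset[OF A.w_lip]) simp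
    obtain q Mq where q: "Mq-lipschitz_on {0..p} q" "\<And>t. t \<in> {0..p} \<Longrightarrow> w t = 0 + exp (q t)"
      by (rule lipschitz_log[OF wl p nz]) (rule that)
    define ang where "ang t = Im (q t) - Im (q 0)" for t
    have "exp (q 0) = of_real (c 0)" "c 0 > 0"
      using q(2)[of 0] p t by (auto simp: w_def is_convex_trig_def complex_eq_iff)
    then have "sin (Im (q 0)) = 0" "0 < exp (Re (q 0)) * cos (Im (q 0))"
      by (auto simp: complex_eq_iff Re_exp Im_exp)
    then have "sin (Im (q 0)) = 0" "cos (Im (q 0)) > 0" using exp_gt_zero zero_less_mult_pos by blast+
    then have c0: "cos (Im (q 0)) = 1" "sin (Im (q 0)) = 0"
      using sin_cos_squared_add[of "Im (q 0)"] by (auto simp: power2_eq_1_iff)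
    have wa: "w t = exp (Re (q t)) *\<^sub>R cis (ang t)" if "t \<in> {0..p}" for t
      using q(2)[OF that] c0 by (simp add: ang_def complex_eq_iff Re_exp Im_exp cos_diff sin_diff)
    then have ra: "exp (Re (q t)) = radial K (ang t)" if "t \<in> {0..p}" for t
      using that wf[of t] radial_props(1)[OF K, of "exp (Re (q t))" "ang t"] by simp
    have "\<tau> (ang t) = t" if t: "t \<in> {0..p}" for t
    proof -
      have t': "0 \<le> t" "{0..t} \<subseteq> {0..p}" "{0<..<t} \<subseteq> {0<..<p}" using t by auto
      obtain Dq Nq where Dq: "negligible Nq" "\<And>t. t \<in> {0<..<p} \<Longrightarrow> t \<notin> Nq \<Longrightarrow> (q has_vector_derivative Dq t) (at t)"
        by (rule lipschitz_derivative_on[OF q(1)]) (rule that)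
      have "Mq-lipschitz_on {0..t} ang"
      proof (rule lipschitz_onI)
        fix x y assume "x \<in> {0..t}" "y \<in> {0..t}"
        then have "dist (q x) (q y) \<le> Mq * dist x y" using t'(2) by (intro lipschitz_onD[OF q(1)]) auto
        then show "dist (ang x) (ang y) \<le> Mq * dist x y"
          using abs_Im_le_cmod[of "q x - q y"] by (simp add: ang_def dist_norm)
      qed (rule lipschitz_on_nonneg[OF q(1)])
      then have "(M\<^sup>2 * Mq)-lipschitz_on {0..t} (\<lambda>t. \<tau> (ang t))"
        by (rule lipschitz_on_compose_differentiable[where C = UNIV and h' = "\<lambda>x. (radial K x)\<^sup>2"])
           (use \<tau>(1) power_mono[OF m(3) less_imp_le[OF rpos]] in auto)
      then have "((\<lambda>t. 1) has_integral (\<tau> (ang t) - \<tau> (ang 0))) {0..t}"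
      proof (rule lipschitz_fundamental_theorem[OF _ t'(1)])
        show "negligible (N \<union> Nq)" using A.N Dq(1) by simp
        fix x assume x: "x \<in> {0<..<t}" "x \<notin> N \<union> Nq"
        then have xp: "x \<in> {0<..<p}" and xp': "x \<in> {0..p}" using t' by auto
        have "((\<lambda>t. exp (q t)) has_vector_derivative Dq x * exp (q x)) (at x)"
          using field_vector_diff_chain_at[OF Dq(2)[OF xp] DERIV_exp] x by (simp add: o_def)
        then have "(w has_vector_derivative Dq x * w x) (at x)"
          using has_vector_derivative_cong_open[of "{0<..<p}" x w "\<lambda>t. exp (q t)"] xp xp' q(2) by auto
        moreover have "(w has_vector_derivative vector_derivative w (at x)) (at x)" "det2 (w x) (vector_derivative w (at x)) = 1"
          using x A.w_der[of x] A.w_det[of x] unfolding w_def[abs_def] by auto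
        ultimately have "det2 (w x) (Dq x * w x) = 1" using vector_derivative_unique_at by metis
        moreover have "det2 (w x) (Dq x * w x) = ((Re (w x))\<^sup>2 + (Im (w x))\<^sup>2) * Im (Dq x)"
          by (simp add: det2_def power2_eq_square algebra_simps)
        moreover have "(Re (w x))\<^sup>2 + (Im (w x))\<^sup>2 = (radial K (ang x))\<^sup>2"
          unfolding wa[OF xp'] cmod_power2[symmetric] using ra[OF xp'] by simp
        ultimately have one: "(radial K (ang x))\<^sup>2 * Im (Dq x) = 1" by simp
        have "(ang has_real_derivative Im (Dq x) - 0) (at x)"
          unfolding ang_def using Dq(2)[OF xp] x
          by (intro DERIV_diff DERIV_const) (auto simp: has_vector_derivative_complex_iff)
        then have "((\<lambda>t. \<tau> (ang t)) has_real_derivative 1) (at x)"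
          using DERIV_chain2[OF \<tau>(1)] one by fastforce
        then show "((\<lambda>t. \<tau> (ang t)) has_vector_derivative 1) (at x)"
          by (simp add: has_real_derivative_iff_has_vector_derivative)
      qed
      moreover have "((\<lambda>t. 1::real) has_integral t) {0..t}" using has_integral_const_real[of "1::real" 0 t] t'(1) by simp
      ultimately have "\<tau> (ang t) - \<tau> (ang 0) = t" by (rule has_integral_unique)
      then show ?thesis by (simp add: ang_def \<tau>(2))
    qed
    then have "ang t = \<sigma> t" if "t \<in> {0..p}" for t using inv(1)[of "ang t"] that by simp
    then have eq: "w t = W t" if "t \<in> {0..p}" for t unfolding W_def using wa[OF that] ra[OF that] that by simp
    obtain n :: int where "\<theta> + of_int n * p \<in> {0..<p}" by (rule A.reduce_period) (rule that)
    then have "w (\<theta> + of_int n * p) = W (\<theta> + of_int n * p)" using eq by simp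
    then show ?thesis unfolding w_def A.w_period_int W.w_period_int .
  qed
  then show ?thesis using that[OF mono(2) _ ex] sp unfolding W.period_eq W_def by blast
qed

definition trig :: "complex set \<Rightarrow> real \<Rightarrow> complex" where
  "trig K \<theta> = Complex (cosK K \<theta>) (sinK K \<theta>)"

lemma trig_sel [simp]: "Re (trig K \<theta>) = cosK K \<theta>" "Im (trig K \<theta>) = sinK K \<theta>"
  by (simp_all add: trig_def)

lemma convex_trig_spec: assumes "body K" shows "is_convex_trig K (cosK K) (sinK K)"
proof -
  obtain c s where "is_convex_trig K c s" by (rule convex_trig_structure[OF assms]) blast
  then have "\<exists>p. is_convex_trig K (fst p) (snd p)" by (intro exI[of _ "(c, s)"]) simp
  then show ?thesis unfolding cosK_def sinK_def convex_trig_def by (rule someI_ex)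
qed

lemma trig_curve: assumes "body K" obtains C N where "area_curve K (trig K) (2 * S K) C N"
proof -
  obtain C N where "area_curve K (\<lambda>\<theta>. Complex (cosK K \<theta>) (sinK K \<theta>)) (2 * S K) C N"
    by (rule is_convex_trig_curve[OF assms convex_trig_spec[OF assms]]) (rule that)
  then show ?thesis by (rule that[unfolded trig_def[abs_def]])
qed

section \<open>Corresponding angles of a body and its polar\<close>

lemma trig_angle:
  assumes "body K"
  obtains \<sigma> where "strict_mono \<sigma>" "\<And>\<theta> n. \<sigma> (\<theta> + of_int n * (2 * S K)) = \<sigma> \<theta> + 2 * pi * of_int n"
    "\<And>\<theta>. \<exists>r>0. trig K \<theta> = r *\<^sub>R cis (\<sigma> \<theta>)"
proof -
  obtain \<sigma> where \<sigma>: "strict_mono \<sigma>" "\<And>\<theta>. \<sigma> (\<theta> + 2 * S K) = \<sigma> \<theta> + 2 * pi"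
    "\<And>\<theta>. trig K \<theta> = radial K (\<sigma> \<theta>) *\<^sub>R cis (\<sigma> \<theta>)"
    unfolding trig_def by (rule convex_trig_structure[OF assms]) (use convex_trig_spec[OF assms] that in blast)
  have *: "\<sigma> (\<theta> + of_nat n * (2 * S K)) = \<sigma> \<theta> + 2 * pi * of_nat n" for \<theta> n
    using \<sigma>(2)[of "\<theta> + of_nat n * (2 * S K)" for n] by (induction n) (simp_all add: algebra_simps)
  have "\<sigma> (\<theta> + of_int n * (2 * S K)) = \<sigma> \<theta> + 2 * pi * of_int n" for \<theta> n
    using *[of \<theta> "nat n"] *[of "\<theta> + of_int n * (2 * S K)" "nat (- n)"] by (cases "0 \<le> n") auto
  moreover have "0 < radial K x" for x using radial_props(2)[OF assms] by (meson less_le_trans)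
  ultimately show ?thesis using that[OF \<sigma>(1)] \<sigma>(3) by blast
qed

lemma cos_pos_near_period:
  assumes "0 < cos x" obtains n :: int where "\<bar>x + 2 * pi * of_int n\<bar> < pi / 2"
proof -
  let ?n = "- \<lfloor>(x + pi) / (2 * pi)\<rfloor>" let ?y = "x + 2 * pi * of_int ?n"
  have y: "- pi \<le> ?y" "?y < pi"
    using floor_divide_lower[of "2 * pi" "x + pi"] floor_divide_upper[of "2 * pi" "x + pi"] by (auto simp: algebra_simps)
  have "cos ?y = cos x" using sin_cos_eq_iff[of ?y x] by blast
  then have c: "0 < cos \<bar>?y\<bar>" using assms by simp
  have "\<bar>?y\<bar> < pi / 2"
  proof (rule ccontr)
    assume "\<not> \<bar>?y\<bar> < pi / 2"
    then have "cos \<bar>?y\<bar> \<le> cos (pi / 2)" using y by (intro cos_monotone_0_pi_le) auto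
    then show False using c by simp
  qed
  then show ?thesis by (rule that)
qed

lemma inner_cis: "(r *\<^sub>R cis a) \<bullet> (q *\<^sub>R cis b) = r * q * cos (a - b)"
  by (simp add: inner_complex_def cos_diff algebra_simps)

lemma corresponding_inner: "corresponding \<Omega> \<theta> \<phi> \<longleftrightarrow> trig \<Omega> \<theta> \<bullet> trig (polar \<Omega>) \<phi> = 1"
  by (simp add: corresponding_def inner_complex_def)

text \<open>The choice in \<open>corr_angle\<close> needs a monotone selection to exist. A normal of
  the polar at a boundary point, turned by a right angle, is a corresponding point by the bipolar
  theorem; choosing its lift nearest in angle makes the selection monotone.\<close>

lemma corr_angle_spec:
  assumes \<Omega>: "body \<Omega>"
  shows "mono (corr_angle \<Omega>)" "corresponding \<Omega> (corr_angle \<Omega> \<phi>) \<phi>"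
proof -
  have P: "body (polar \<Omega>)" by (rule body_polar[OF \<Omega>])
  interpret Po: body "polar \<Omega>" by fact
  obtain C N where "area_curve \<Omega> (trig \<Omega>) (2 * S \<Omega>) C N" by (rule trig_curve[OF \<Omega>]) (rule that)
  then interpret O: area_curve \<Omega> "trig \<Omega>" "2 * S \<Omega>" C N .
  obtain C' N' where "area_curve (polar \<Omega>) (trig (polar \<Omega>)) (2 * S (polar \<Omega>)) C' N'" by (rule trig_curve[OF P]) (rule that)
  then interpret P: area_curve "polar \<Omega>" "trig (polar \<Omega>)" "2 * S (polar \<Omega>)" C' N' .
  obtain \<beta> where \<beta>: "strict_mono \<beta>" "\<And>\<theta> n. \<beta> (\<theta> + of_int n * (2 * S \<Omega>)) = \<beta> \<theta> + 2 * pi * of_int n"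
    "\<And>\<theta>. \<exists>r>0. trig \<Omega> \<theta> = r *\<^sub>R cis (\<beta> \<theta>)" by (rule trig_angle[OF \<Omega>]) (rule that)
  obtain \<alpha> where \<alpha>: "strict_mono \<alpha>" "\<And>\<theta>. \<exists>r>0. trig (polar \<Omega>) \<theta> = r *\<^sub>R cis (\<alpha> \<theta>)"
    by (rule trig_angle[OF P]) (rule that)
  have le1: "trig \<Omega> \<theta> \<bullet> trig (polar \<Omega>) \<phi> \<le> 1" for \<theta> \<phi>
    using P.w_in[of \<phi>] O.w_in[of \<theta>] by (auto simp: polar_eq inner_commute)
  \<comment> \<open>Corresponding vectors have inner product 1 and so form an acute angle. Requiring
    the lifted angles to differ by less than \<pi>/2 fixes the period of \<theta>.\<close>
  define C where "C \<theta> \<phi> \<longleftrightarrow> corresponding \<Omega> \<theta> \<phi> \<and> \<bar>\<beta> \<theta> - \<alpha> \<phi>\<bar> < pi / 2" for \<theta> \<phi>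
  have "\<exists>\<theta>. C \<theta> \<phi>" for \<phi>
  proof -
    let ?k = "trig (polar \<Omega>) \<phi>"
    obtain v where v: "det2 ?k v = 1" "\<And>w. w \<in> polar \<Omega> \<Longrightarrow> det2 w v \<le> 1" by (rule Po.support_normal[OF P.w_frontier]) (rule that)
    let ?z = "Complex (Im v) (- Re v)"
    have z: "?z \<bullet> w = det2 w v" for w by (simp add: inner_complex_def det2_def)
    have "?z \<in> polar (polar \<Omega>)" using v(2) by (simp only: polar_eq[of "polar \<Omega>"] z mem_Collect_eq) blast
    then have zO: "?z \<in> \<Omega>" unfolding polar_polar[OF \<Omega>] .
    have i: "det2 w (\<i> * ?k) = w \<bullet> ?k" for w by (simp add: inner_complex_def det2_def)
    have "?z \<in> frontier \<Omega>"
    proof (rule O.maximizer_in_frontier[OF zO])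
      show "\<i> * ?k \<noteq> 0" using v(1) by (auto simp: det2_simps)
      show "det2 w (\<i> * ?k) \<le> det2 ?z (\<i> * ?k)" if "w \<in> \<Omega>" for w
        unfolding i z v(1) using P.w_in[of \<phi>] that by (auto simp: polar_eq inner_commute)
    qed
    then obtain \<theta> where \<theta>: "trig \<Omega> \<theta> = ?z" by (rule O.w_surj) (rule that)
    have one: "trig \<Omega> \<theta> \<bullet> ?k = 1" unfolding \<theta> z by (rule v(1))
    obtain r q where rq: "0 < r" "trig \<Omega> \<theta> = r *\<^sub>R cis (\<beta> \<theta>)" "0 < q" "?k = q *\<^sub>R cis (\<alpha> \<phi>)" using \<beta>(3) \<alpha>(2) by metis
    then have "0 < cos (\<beta> \<theta> - \<alpha> \<phi>)"
      using one unfolding rq(2,4) inner_cis by (metis mult_pos_pos zero_less_mult_pos zero_less_one)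
    then obtain n :: int where "\<bar>\<beta> \<theta> - \<alpha> \<phi> + 2 * pi * of_int n\<bar> < pi / 2" by (rule cos_pos_near_period) (rule that)
    then have "C (\<theta> + of_int n * (2 * S \<Omega>)) \<phi>"
      unfolding C_def corresponding_inner \<beta>(2) O.w_period_int using one by (simp add: algebra_simps)
    then show ?thesis by blast
  qed
  then have C: "C (SOME \<theta>. C \<theta> \<phi>) \<phi>" for \<phi> by (rule someI_ex)
  have "mono (\<lambda>\<phi>. SOME \<theta>. C \<theta> \<phi>)"
  proof (rule monoI, rule ccontr)
    fix \<phi>1 \<phi>2 :: real
    define \<theta>1 \<theta>2 where "\<theta>1 = (SOME \<theta>. C \<theta> \<phi>1)" and "\<theta>2 = (SOME \<theta>. C \<theta> \<phi>2)"
    have c: "C \<theta>1 \<phi>1" "C \<theta>2 \<phi>2" unfolding \<theta>1_def \<theta>2_def by (rule C)+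
    assume "\<phi>1 \<le> \<phi>2" "\<not> (SOME \<theta>. C \<theta> \<phi>1) \<le> (SOME \<theta>. C \<theta> \<phi>2)"
    then have "\<theta>2 < \<theta>1" "\<phi>1 < \<phi>2" unfolding \<theta>1_def \<theta>2_def by (auto simp: less_le)
    then have b: "\<beta> \<theta>2 < \<beta> \<theta>1" and a: "\<alpha> \<phi>1 < \<alpha> \<phi>2" using \<alpha>(1) \<beta>(1) by (auto simp: strict_mono_less)
    have near: "\<bar>\<beta> \<theta>1 - \<alpha> \<phi>1\<bar> < pi / 2" "\<bar>\<beta> \<theta>2 - \<alpha> \<phi>2\<bar> < pi / 2"
      and one: "trig \<Omega> \<theta>1 \<bullet> trig (polar \<Omega>) \<phi>1 = 1" "trig \<Omega> \<theta>2 \<bullet> trig (polar \<Omega>) \<phi>2 = 1"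
      using c by (auto simp: C_def corresponding_inner)
    obtain r1 r2 q1 q2 where r: "0 < r1" "trig \<Omega> \<theta>1 = r1 *\<^sub>R cis (\<beta> \<theta>1)" "0 < r2" "trig \<Omega> \<theta>2 = r2 *\<^sub>R cis (\<beta> \<theta>2)"
      and q: "0 < q1" "trig (polar \<Omega>) \<phi>1 = q1 *\<^sub>R cis (\<alpha> \<phi>1)" "0 < q2" "trig (polar \<Omega>) \<phi>2 = q2 *\<^sub>R cis (\<alpha> \<phi>2)"
      using \<beta>(3) \<alpha>(2) by metis
    define u v where "u = trig \<Omega> \<theta>1 \<bullet> trig (polar \<Omega>) \<phi>2" and "v = trig \<Omega> \<theta>2 \<bullet> trig (polar \<Omega>) \<phi>1"
    \<comment> \<open>Lagrange's identity for two pairs of plane vectors. If the order were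
      reversed, the determinants would have opposite signs, so u v > 1; as neither factor exceeds 1,
      u would be negative, although its angle is acute.\<close>
    have "det2 (trig \<Omega> \<theta>1) (trig \<Omega> \<theta>2) * det2 (trig (polar \<Omega>) \<phi>1) (trig (polar \<Omega>) \<phi>2) =
        (trig \<Omega> \<theta>1 \<bullet> trig (polar \<Omega>) \<phi>1) * (trig \<Omega> \<theta>2 \<bullet> trig (polar \<Omega>) \<phi>2) - u * v"
      unfolding u_def v_def by (simp add: det2_def inner_complex_def algebra_simps)
    moreover have "det2 (trig \<Omega> \<theta>1) (trig \<Omega> \<theta>2) = r1 * r2 * sin (\<beta> \<theta>2 - \<beta> \<theta>1)"
      "det2 (trig (polar \<Omega>) \<phi>1) (trig (polar \<Omega>) \<phi>2) = q1 * q2 * sin (\<alpha> \<phi>2 - \<alpha> \<phi>1)"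
      unfolding r(2,4) q(2,4) by (simp_all add: det2_def sin_diff algebra_simps)
    moreover have "0 < sin (\<beta> \<theta>1 - \<beta> \<theta>2)" "0 < sin (\<alpha> \<phi>2 - \<alpha> \<phi>1)" using near a b by (intro sin_gt_zero; linarith)+
    then have "r1 * r2 * sin (\<beta> \<theta>2 - \<beta> \<theta>1) < 0" "0 < q1 * q2 * sin (\<alpha> \<phi>2 - \<alpha> \<phi>1)"
      using r q sin_minus[of "\<beta> \<theta>1 - \<beta> \<theta>2"] by (auto simp: mult_pos_neg)
    ultimately have "1 < u * v" unfolding one by (metis mult_neg_pos diff_less_0_iff_less mult_1)
    moreover have "u \<le> 1" "v \<le> 1" unfolding u_def v_def by (rule le1)+
    ultimately have "u < 0" by (smt (verit) mult_le_one mult_nonneg_nonpos)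
    moreover have "u = r1 * q2 * cos (\<beta> \<theta>1 - \<alpha> \<phi>2)" unfolding u_def r(2) q(4) by (rule inner_cis)
    moreover have "0 < cos (\<beta> \<theta>1 - \<alpha> \<phi>2)" using near a b by (intro cos_gt_zero_pi; linarith)
    ultimately show False using r(1) q(3) by (simp add: mult_less_0_iff)
  qed
  then have "\<exists>f. mono f \<and> (\<forall>\<phi>. corresponding \<Omega> (f \<phi>) \<phi>)" using C unfolding C_def by blast
  from someI_ex[OF this] show "mono (corr_angle \<Omega>)" "corresponding \<Omega> (corr_angle \<Omega> \<phi>) \<phi>"
    unfolding corr_angle_def by blast+
qed

text \<open>The corresponding point has inner product at most 1 with the polar curve and equality at
  \<phi>, so it is orthogonal to the velocity there. With det2 k k' = 1 this determines its abscissa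
  as Im k', whichever selection was made.\<close>

lemma cos_corr_angle:
  assumes \<Omega>: "body \<Omega>" and d: "(trig (polar \<Omega>) has_vector_derivative D) (at \<phi>)" and one: "det2 (trig (polar \<Omega>) \<phi>) D = 1"
  shows "cosK \<Omega> (corr_angle \<Omega> \<phi>) = Im D"
proof -
  let ?k = "trig (polar \<Omega>)" let ?w = "trig \<Omega> (corr_angle \<Omega> \<phi>)"
  obtain C N where "area_curve \<Omega> (trig \<Omega>) (2 * S \<Omega>) C N" by (rule trig_curve[OF \<Omega>]) (rule that)
  then interpret O: area_curve \<Omega> "trig \<Omega>" "2 * S \<Omega>" C N .
  obtain C' N' where "area_curve (polar \<Omega>) ?k (2 * S (polar \<Omega>)) C' N'" by (rule trig_curve[OF body_polar[OF \<Omega>]]) (rule that)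
  then interpret P: area_curve "polar \<Omega>" ?k "2 * S (polar \<Omega>)" C' N' .
  have le1: "?w \<bullet> ?k x \<le> 1" for x using P.w_in[of x] O.w_in by (auto simp: polar_eq inner_commute)
  have eq: "?w \<bullet> ?k \<phi> = 1" using corr_angle_spec(2)[OF \<Omega>] by (simp add: corresponding_inner)
  have "((\<lambda>x. ?w \<bullet> ?k x) has_real_derivative ?w \<bullet> D) (at \<phi>)"
    using bounded_linear.has_vector_derivative[OF bounded_linear_inner_right d]
    by (simp add: has_real_derivative_iff_has_vector_derivative)
  then have "?w \<bullet> D = 0" by (rule DERIV_local_max[where d = 1]) (use le1 eq in auto)
  moreover have "cosK \<Omega> (corr_angle \<Omega> \<phi>) * det2 (?k \<phi>) D = Im D * (?w \<bullet> ?k \<phi>) - Im (?k \<phi>) * (?w \<bullet> D)"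
    by (simp add: det2_def inner_complex_def algebra_simps)
  ultimately show ?thesis using one eq by simp
qed

section \<open>Area and length of the isoperimetric contours\<close>

context body
begin

lemma areaF_integrable: "0 < \<Lambda> + ylo \<Longrightarrow> (\<lambda>z. 1 / (\<Lambda> + Im z)\<^sup>2) integrable_on Q"
  by (rule slice_integral(1)[OF continuous_recip(2)])

text \<open>Adding the tangent inequalities of \<open>areaC\<close> at the two points cancels
  \<open>areaC\<close>.\<close>

lemma areaF_strict_anti:
  assumes "0 < \<Lambda> + ylo" "\<Lambda> < \<Lambda>'" shows "areaF \<Lambda>' < areaF \<Lambda>"
proof -
  have l': "0 < \<Lambda>' + ylo" using assms by simp
  have "areaC \<Lambda> - (\<Lambda>' - \<Lambda>) * areaF \<Lambda> < areaC \<Lambda>'" "areaC \<Lambda>' - (\<Lambda> - \<Lambda>') * areaF \<Lambda>' < areaC \<Lambda>"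
    using areaC_convex(2)[OF assms(1) l'] areaC_convex(2)[OF l' assms(1)] assms(2) by auto
  then have "(\<Lambda>' - \<Lambda>) * areaF \<Lambda>' < (\<Lambda>' - \<Lambda>) * areaF \<Lambda>" by (simp add: algebra_simps)
  then show ?thesis using assms(2) by simp
qed

lemma areaF_inj: "0 < \<Lambda> + ylo \<Longrightarrow> 0 < \<Lambda>' + ylo \<Longrightarrow> areaF \<Lambda> = areaF \<Lambda>' \<Longrightarrow> \<Lambda> = \<Lambda>'"
  using areaF_strict_anti by (metis less_irrefl linorder_neqE_linordered_idom)

lemma areaF_nonneg: "0 < \<Lambda> + ylo \<Longrightarrow> 0 \<le> areaF \<Lambda>"
  unfolding areaF_def by (intro Henstock_Kurzweil_Integration.integral_nonneg areaF_integrable) auto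

lemma areaF_pos: assumes "0 < \<Lambda> + ylo" shows "0 < areaF \<Lambda>"
  using areaF_strict_anti[OF assms, of "\<Lambda> + 1"] areaF_nonneg[of "\<Lambda> + 1"] assms by simp

text \<open>The ratio of the two weights is largest at the lowest height, where it is (q/p)^2. So
  both integrals differ at most by this factor; continuity is what the intermediate value theorem
  asks for.\<close>

lemma areaF_lipschitz:
  assumes "0 < \<Lambda>0 + ylo"
  shows "\<exists>K. K-lipschitz_on {\<Lambda>0..\<Lambda>1} areaF"
proof (intro exI lipschitz_on_leI)
  let ?K = "2 * (\<Lambda>1 + ylo) / (\<Lambda>0 + ylo)\<^sup>2 * areaF \<Lambda>0"
  show "0 \<le> max 0 ?K" by simp
  fix x y assume xy: "x \<in> {\<Lambda>0..\<Lambda>1}" "y \<in> {\<Lambda>0..\<Lambda>1}" "x \<le> y"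
  define p q where "p = x + ylo" and "q = y + ylo"
  have pq: "0 < \<Lambda>0 + ylo" "\<Lambda>0 + ylo \<le> p" "p \<le> q" "q \<le> \<Lambda>1 + ylo" "q - p = y - x"
    using xy assms by (auto simp: p_def q_def)
  have "areaF x \<le> (q / p)\<^sup>2 * areaF y"
    unfolding areaF_def Henstock_Kurzweil_Integration.integral_mult_right[symmetric]
  proof (rule integral_le)
    show "(\<lambda>z. 1 / (x + Im z)\<^sup>2) integrable_on Q" using pq by (intro areaF_integrable) (simp add: p_def)
    show "(\<lambda>z. (q / p)\<^sup>2 * (1 / (y + Im z)\<^sup>2)) integrable_on Q"
      using pq by (intro integrable_on_mult_right areaF_integrable) (simp add: q_def)
    fix z assume "z \<in> Q"
    then have z: "ylo \<le> Im z" using Im_range by auto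
    have pos: "0 < x + Im z" "0 < y + Im z" using z pq by (auto simp: p_def q_def)
    have "0 \<le> (y - x) * (Im z - ylo)" using z xy by simp
    then have "(y + Im z) * p \<le> q * (x + Im z)" by (simp add: p_def q_def algebra_simps)
    then have "1 \<le> q * (x + Im z) / (p * (y + Im z))"
      using pos pq by (subst le_divide_eq_1_pos) (auto simp: mult.commute)
    then have "1 / (x + Im z) \<le> q * (x + Im z) / (p * (y + Im z)) / (x + Im z)"
      using pos by (intro divide_right_mono) auto
    then have "1 / (x + Im z) \<le> (q / p) * (1 / (y + Im z))" using pos by simp
    then have "(1 / (x + Im z))\<^sup>2 \<le> ((q / p) * (1 / (y + Im z)))\<^sup>2" using pos by (intro power_mono) auto
    then show "1 / (x + Im z)\<^sup>2 \<le> (q / p)\<^sup>2 * (1 / (y + Im z)\<^sup>2)"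
      by (simp add: power_mult_distrib power_divide)
  qed
  then have "areaF x - areaF y \<le> ((q / p)\<^sup>2 - 1) * areaF y" by (simp add: algebra_simps)
  also have "(q / p)\<^sup>2 - 1 = (q - p) * (q + p) / p\<^sup>2" using pq by (simp add: field_simps power2_eq_square)
  also have "\<dots> * areaF y \<le> ((q - p) * (2 * (\<Lambda>1 + ylo)) / (\<Lambda>0 + ylo)\<^sup>2) * areaF \<Lambda>0"
  proof (rule mult_mono)
    show "(q - p) * (q + p) / p\<^sup>2 \<le> (q - p) * (2 * (\<Lambda>1 + ylo)) / (\<Lambda>0 + ylo)\<^sup>2"
      using pq by (intro frac_le mult_left_mono power_mono) auto
    show "areaF y \<le> areaF \<Lambda>0" using areaF_strict_anti[OF assms, of y] xy by (cases "y = \<Lambda>0") auto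
    show "0 \<le> areaF y" using pq by (intro areaF_nonneg) (simp add: q_def)
  qed (use pq in auto)
  also have "\<dots> = ?K * (y - x)" using pq(5) by simp
  finally have "areaF x - areaF y \<le> max 0 ?K * (y - x)" using xy(3) by (smt (verit) mult_right_mono)
  moreover have "areaF y \<le> areaF x" using areaF_strict_anti[of x y] xy pq by (cases "x = y") (auto simp: p_def)
  ultimately show "dist (areaF x) (areaF y) \<le> max 0 ?K * dist x y" using xy(3) by (simp add: dist_real_def)
qed

lemma areaF_large: assumes "0 < A" obtains \<Lambda> where "0 < \<Lambda> + ylo" "areaF \<Lambda> \<le> A" "\<Lambda>0 \<le> \<Lambda>"
proof -
  define L0 where "L0 = max \<Lambda>0 (1 - ylo)"
  have l0: "0 < L0 + ylo" by (simp add: L0_def)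
  have C: "0 \<le> areaC L" if "0 < L + ylo" for L
    unfolding areaC_def using Im_range that
    by (intro Henstock_Kurzweil_Integration.integral_nonneg slice_integral(1)[OF continuous_recip(1)]) fastforce+
  \<comment> \<open>The tangent inequality at L0 + d, evaluated at L0, bounds d * areaF (L0 + d) by
    areaC L0, because \<open>areaC\<close> is nonnegative. The first summand makes areaC L0 \<le> d
    A, the second keeps d positive.\<close>
  define d where "d = areaC L0 / A + 1"
  have d: "0 < d" "areaC L0 \<le> d * A" using C[OF l0] assms by (auto simp: d_def field_simps add_pos_nonneg)
  have l: "0 < (L0 + d) + ylo" using l0 d by simp
  have "d * areaF (L0 + d) \<le> areaC L0" using areaC_convex(1)[OF l l0] C[OF l] by simp
  then have "d * areaF (L0 + d) \<le> d * A" using d by linarith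
  then show ?thesis using that[OF l] d(1) by (simp add: L0_def)
qed

text \<open>Near its lowest point \<open>Q\<close> contains a cone, so the weight \<open>(\<Lambda> + y)\<^sup>-\<^sup>2\<close> becomes non-integrable
  as \<open>\<Lambda> \<rightarrow> -ylo\<close>.\<close>

lemma areaF_small: obtains \<Lambda> where "0 < \<Lambda> + ylo" "A \<le> areaF \<Lambda>"
proof -
  define h where "h = - ylo"
  have h: "0 < h" using ylo_yhi by (simp add: h_def)
  define \<kappa> where "\<kappa> = (xr 0 - xl 0) / h"
  have \<kappa>: "0 < \<kappa>" using xl_less_xr[of 0] ylo_yhi h by (simp add: \<kappa>_def)
  have cone: "\<kappa> * (Y - ylo) \<le> xr Y - xl Y" if Y: "Y \<in> {ylo..0}" for Y
  proof -
    obtain z where z: "z \<in> Q" "Im z = ylo" by (rule ylo_attained)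
    define s where "s = (Y - ylo) / h"
    have "Y - ylo \<le> h" using Y by (simp add: h_def)
    then have s: "0 \<le> s" "s \<le> 1" "s * h = Y - ylo" using Y h by (auto simp: s_def)
    have "0 \<in> {ylo..yhi}" using ylo_yhi by auto
    then have "(1 - s) *\<^sub>R z + s *\<^sub>R Complex (xr 0) 0 \<in> Q" "(1 - s) *\<^sub>R z + s *\<^sub>R Complex (xl 0) 0 \<in> Q"
      using convexD_alt[OF convQ z(1)] xr_mem xl_mem s by auto
    moreover have "(1 - s) * ylo = Y" using s(3) by (simp add: h_def algebra_simps)
    then have "(1 - s) *\<^sub>R z + s *\<^sub>R Complex x 0 = Complex ((1 - s) * Re z + s * x) Y" for x
      using z(2) by (simp add: complex_eq_iff)
    ultimately have "(1 - s) * Re z + s * xr 0 \<le> xr Y" "xl Y \<le> (1 - s) * Re z + s * xl 0"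
      using slice_bounds by auto
    moreover have "\<kappa> * (Y - ylo) = s * (xr 0 - xl 0)" using h by (simp add: \<kappa>_def s_def)
    ultimately show ?thesis by (simp add: algebra_simps)
  qed
  \<comment> \<open>The exponent is chosen so that \<kappa> (ln h - ln e - 1), a lower bound for the
    integral over the cone, equals |A|.\<close>
  define e where "e = h * exp (- (\<bar>A\<bar> / \<kappa> + 1))"
  define \<Lambda> where "\<Lambda> = e + h"
  have e: "0 < e" using h by (simp add: e_def)
  have l: "0 < \<Lambda> + ylo" using e by (simp add: \<Lambda>_def h_def)
  have le: "ylo \<le> 0" "0 \<le> yhi" using ylo_yhi by auto
  let ?f = "\<lambda>Y. (xr Y - xl Y) * (1 / (\<Lambda> + Y)\<^sup>2)"
  have I: "(?f has_integral areaF \<Lambda>) {ylo..yhi}"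
    using slice_integral(2)[OF continuous_recip(2)[OF l]] by (simp add: areaF_def)
  have I0: "((\<lambda>Y. \<kappa> * (Y - ylo) / (\<Lambda> + Y)\<^sup>2) has_integral
      (\<kappa> * (ln (\<Lambda> + 0) + e / (\<Lambda> + 0)) - \<kappa> * (ln (\<Lambda> + ylo) + e / (\<Lambda> + ylo)))) {ylo..0}"
  proof (rule fundamental_theorem_of_calculus[OF le(1)])
    fix Y assume Y: "Y \<in> {ylo..0}"
    then have p: "0 < \<Lambda> + Y" using l by auto
    have "((\<lambda>Y. \<kappa> * (ln (\<Lambda> + Y) + e / (\<Lambda> + Y))) has_real_derivative \<kappa> * (1 / (\<Lambda> + Y) - e / (\<Lambda> + Y)\<^sup>2)) (at Y)"
      using p by (auto intro!: derivative_eq_intros simp: power2_eq_square)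
    moreover have "\<kappa> * (1 / (\<Lambda> + Y) - e / (\<Lambda> + Y)\<^sup>2) = \<kappa> * (Y - ylo) / (\<Lambda> + Y)\<^sup>2"
    proof -
      have "1 / (\<Lambda> + Y) - e / (\<Lambda> + Y)\<^sup>2 = ((\<Lambda> + Y) - e) / (\<Lambda> + Y)\<^sup>2"
        using p by (simp add: diff_divide_distrib power2_eq_square)
      moreover have "(\<Lambda> + Y) - e = Y - ylo" by (simp add: \<Lambda>_def h_def)
      ultimately show ?thesis by simp
    qed
    ultimately show "((\<lambda>Y. \<kappa> * (ln (\<Lambda> + Y) + e / (\<Lambda> + Y))) has_vector_derivative \<kappa> * (Y - ylo) / (\<Lambda> + Y)\<^sup>2) (at Y within {ylo..0})"
      by (metis has_field_derivative_at_within has_real_derivative_iff_has_vector_derivative)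
  qed
  have int: "?f integrable_on {ylo..yhi}" using I by blast
  then have int0: "?f integrable_on {ylo..0}" by (rule integrable_subinterval_real) (use le in auto)
  have "\<kappa> * (ln (\<Lambda> + 0) + e / (\<Lambda> + 0)) - \<kappa> * (ln (\<Lambda> + ylo) + e / (\<Lambda> + ylo)) \<le> integral {ylo..0} ?f"
  proof (rule has_integral_le[OF I0 integrable_integral[OF int0]])
    fix Y assume "Y \<in> {ylo..0}"
    then show "\<kappa> * (Y - ylo) / (\<Lambda> + Y)\<^sup>2 \<le> (xr Y - xl Y) * (1 / (\<Lambda> + Y)\<^sup>2)"
      using divide_right_mono[OF cone, of Y "(\<Lambda> + Y)\<^sup>2"] by simp
  qed
  also have "\<dots> \<le> integral {ylo..yhi} ?f"
  proof (rule integral_subset_le[OF _ int0 int])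
    have "xl Y \<le> xr Y" if "Y \<in> {ylo..yhi}" for Y using xr_mem[OF that] slice_bounds by blast
    then show "\<forall>Y\<in>{ylo..yhi}. 0 \<le> (xr Y - xl Y) * (1 / (\<Lambda> + Y)\<^sup>2)" by simp
  qed (use le in auto)
  also have "\<dots> = areaF \<Lambda>" using I by (rule integral_unique)
  finally have "\<kappa> * (ln (\<Lambda> + 0) + e / (\<Lambda> + 0)) - \<kappa> * (ln (\<Lambda> + ylo) + e / (\<Lambda> + ylo)) \<le> areaF \<Lambda>" .
  moreover have "\<kappa> * (ln h - ln e - 1) \<le> \<kappa> * (ln (\<Lambda> + 0) + e / (\<Lambda> + 0)) - \<kappa> * (ln (\<Lambda> + ylo) + e / (\<Lambda> + ylo))"
  proof -
    have "ln h \<le> ln (\<Lambda> + 0)" "0 \<le> e / (\<Lambda> + 0)" using h e by (auto simp: \<Lambda>_def)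
    moreover have "\<Lambda> + ylo = e" by (simp add: \<Lambda>_def h_def)
    ultimately have "\<kappa> * (ln h - ln e - 1) \<le> \<kappa> * ((ln (\<Lambda> + 0) + e / (\<Lambda> + 0)) - (ln (\<Lambda> + ylo) + e / (\<Lambda> + ylo)))"
      using \<kappa> e by (intro mult_left_mono) auto
    then show ?thesis by (simp add: algebra_simps)
  qed
  moreover have "\<kappa> * (ln h - ln e - 1) = \<bar>A\<bar>" using h \<kappa> by (simp add: e_def ln_mult field_simps)
  ultimately show ?thesis using that[OF l] by linarith
qed

lemma areaF_surj: assumes "0 < A" obtains \<Lambda> where "0 < \<Lambda> + ylo" "areaF \<Lambda> = A"
proof -
  obtain a where a: "0 < a + ylo" "A \<le> areaF a" by (rule areaF_small)
  obtain b where b: "0 < b + ylo" "areaF b \<le> A" "a \<le> b" by (rule areaF_large[OF assms])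
  obtain K where "K-lipschitz_on {a..b} areaF" using areaF_lipschitz[OF a(1)] by blast
  then obtain l where "a \<le> l" "l \<le> b" "areaF l = A"
    using IVT2'[OF b(2) a(2) b(3)] lipschitz_on_continuous_on by blast
  then show ?thesis using that[of l] a(1) by simp
qed

end

lemma oriented_param_reparam:
  assumes o: "oriented_param s \<gamma> a b c" and ab: "a' < b'" and lip: "K-lipschitz_on {a'..b'} \<phi>"
    and inj: "inj_on \<phi> {a'..b'}" and im: "\<phi> ` {a'..b'} = {a..b}" and e: "\<phi> a' = a" "\<phi> b' = b"
    and c': "\<And>t. t \<in> {a'..b'} \<Longrightarrow> c' t = c (\<phi> t)"
  shows "oriented_param s \<gamma> a' b' c'"
proof -
  have p: "simple_lipschitz_param \<gamma> a b c" using o by (simp add: oriented_param_def)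
  then obtain C where ab0: "a < b" and l: "C-lipschitz_on {a..b} c" and loop: "c a = c b" and img: "c ` {a..b} = \<gamma>"
    and inj0: "\<And>s t. s \<in> {a..b} \<Longrightarrow> t \<in> {a..b} \<Longrightarrow> c s = c t \<Longrightarrow> s = t \<or> s = a \<and> t = b \<or> s = b \<and> t = a"
    unfolding simple_lipschitz_param_iff by metis
  have mem: "\<phi> t \<in> {a..b}" if "t \<in> {a'..b'}" for t using im that by blast
  have "(C * K)-lipschitz_on {a'..b'} (\<lambda>t. c (\<phi> t))"
    by (rule lipschitz_on_compose2[OF lip]) (simp add: im l)
  then have l': "(C * K)-lipschitz_on {a'..b'} c'" by (rule lipschitz_on_transform) (simp add: c')
  have p': "simple_lipschitz_param \<gamma> a' b' c'"
    unfolding simple_lipschitz_param_iff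
  proof (intro conjI ballI impI)
    show "\<exists>C. C-lipschitz_on {a'..b'} c'" using l' by blast
    show "c' a' = c' b'" using ab c' e loop by simp
    show "c' ` {a'..b'} = \<gamma>" unfolding img[symmetric] im[symmetric] image_image using c' by simp
    fix s t assume st: "s \<in> {a'..b'}" "t \<in> {a'..b'}" "c' s = c' t"
    then have "\<phi> s = \<phi> t \<or> \<phi> s = \<phi> a' \<and> \<phi> t = \<phi> b' \<or> \<phi> s = \<phi> b' \<and> \<phi> t = \<phi> a'"
      unfolding e using inj0[OF mem mem] c' by simp
    then show "s = t \<or> s = a' \<and> t = b' \<or> s = b' \<and> t = a'" using inj st(1,2) ab by (auto dest: inj_onD)
  qed (rule ab)
  have "winding_number (unit_path a' b' c') z = of_real (sign_val s)" if z: "z \<in> inside \<gamma>" for z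
  proof -
    have nz: "z \<notin> c ` {a..b}" using inside_not_mem[OF z] img by simp
    obtain q where q: "continuous_on {a..b} q" "\<And>t. t \<in> {a..b} \<Longrightarrow> c t = z + exp (q t)"
      by (rule continuous_log_on_interval[OF lipschitz_on_continuous_on[OF l] nz]) (rule that)
    have "winding_number (unit_path a' b' c') z = (q (\<phi> b') - q (\<phi> a')) / (2 * of_real pi * \<i>)"
    proof (rule winding_of_log[OF ab])
      show "continuous_on {a'..b'} (\<lambda>t. q (\<phi> t))"
        by (rule continuous_on_compose2[OF q(1) lipschitz_on_continuous_on[OF lip]]) (simp add: im)
    qed (use q(2)[OF mem] c' in simp)
    also have "\<dots> = winding_number (unit_path a b c) z" unfolding e by (rule winding_of_log[OF ab0 q, symmetric])
    finally show ?thesis using o z by (simp add: oriented_param_def)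
  qed
  then show ?thesis using p' by (simp add: oriented_param_def)
qed

lemma oriented_param_cong:
  assumes "oriented_param s \<gamma> a b c" "\<And>t. t \<in> {a..b} \<Longrightarrow> c' t = c t"
  shows "oriented_param s \<gamma> a b c'"
proof (rule oriented_param_reparam[OF assms(1), where \<phi> = "\<lambda>t. t"])
  show "a < b" using assms(1) by (simp add: oriented_param_def simple_lipschitz_param_def)
qed (use assms(2) in \<open>auto intro: lipschitz_intros\<close>)

section \<open>Length, area and natural time of the boundary curve\<close>

context area_curve
begin

text \<open>The velocity is itself the normalized supporting covector v at the boundary point: det2
  (w') v = 0 by maximality, and the linear relation between three plane vectors then gives v = w'.
  Hence the boundary is traversed with support value 1.\<close>

lemma supp_D: assumes \<theta>: "\<theta> \<notin> N" shows "supp Q (D \<theta>) = 1"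
proof -
  obtain v where v: "det2 (w \<theta>) v = 1" "\<And>z. z \<in> Q \<Longrightarrow> det2 z v \<le> 1"
    by (rule support_normal[OF w_frontier]) (rule that)
  have "((\<lambda>t. det2 (w t) v) has_real_derivative det2 (D \<theta>) v) (at \<theta>)"
    unfolding det2_def by (intro DERIV_diff DERIV_cmult_right der_parts[OF \<theta>])
  then have 0: "det2 (D \<theta>) v = 0"
    by (rule DERIV_local_max[where d = 1]) (use v w_in in auto)
  have "det2 v (D \<theta>) *\<^sub>R w \<theta> + det2 (D \<theta>) (w \<theta>) *\<^sub>R v + det2 (w \<theta>) v *\<^sub>R D \<theta> = 0"
    by (simp add: det2_def complex_eq_iff algebra_simps)
  moreover have "det2 v (D \<theta>) = 0" "det2 (D \<theta>) (w \<theta>) = - 1" using 0 w_det[OF \<theta>] by (auto simp: det2_def algebra_simps)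
  ultimately have "v = D \<theta>" using v(1) by simp
  then show ?thesis using supp_ge[OF w_in[of \<theta>], of "D \<theta>"] supp_le[of "D \<theta>" 1] v by fastforce
qed

text \<open>Common length of all contours with parameter \<Lambda> by
  \<open>contour.\<gamma>_len\<close>, and the time \<open>L\<close> of the theorem by
  \<open>L_ell\<close>.\<close>

definition ell :: "real \<Rightarrow> real" where
  "ell \<Lambda> = integral {0..P} (\<lambda>\<theta>. 1 / (\<Lambda> + Im (w \<theta>)))"

lemma pos_w: "0 < \<Lambda> + ylo \<Longrightarrow> 0 < \<Lambda> + Im (w \<theta>)" using Im_w[of \<theta>] by auto

lemma continuous_w: "continuous_on T w" using lipschitz_on_continuous_on[OF w_lip] continuous_on_subset by blast

lemma recip_w: assumes "0 < \<Lambda> + ylo" shows "continuous_on T (\<lambda>\<theta>. 1 / (\<Lambda> + Im (w \<theta>)))"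
  using less_imp_neq[OF pos_w[OF assms]] by (intro continuous_intros continuous_w) auto

lemma areaF_integral:
  assumes l: "0 < \<Lambda> + ylo"
  shows "((\<lambda>\<theta>. Re (D \<theta>) / (\<Lambda> + Im (w \<theta>))) has_integral areaF \<Lambda>) {0..P}"
proof -
  let ?e = "(\<Lambda> + ylo) / 2"
  have p: "0 < \<Lambda> + s" if "s \<in> {ylo - ?e..yhi + ?e}" for s using that l by (auto simp: field_simps)
  have "((\<lambda>z. 1 / (\<Lambda> + Im z)\<^sup>2) has_integral (- integral {0..P} (\<lambda>\<theta>. - (1 / (\<Lambda> + Im (w \<theta>))) * Re (D \<theta>)))) Q"
  proof (rule green_frontier[where e = ?e and ?G0.0 = "\<lambda>y. - (1 / (\<Lambda> + y))" and g = "\<lambda>y. 1 / (\<Lambda> + y)\<^sup>2"])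
    show "continuous_on {ylo - ?e..yhi + ?e} (\<lambda>y. 1 / (\<Lambda> + y)\<^sup>2)"
      using less_imp_neq[OF p] by (intro continuous_intros) auto
    show "((\<lambda>y. - (1 / (\<Lambda> + y))) has_real_derivative 1 / (\<Lambda> + s)\<^sup>2) (at s)" if "s \<in> {ylo - ?e..yhi + ?e}" for s
      using p[OF that] by (auto intro!: derivative_eq_intros simp: power2_eq_square)
  qed (use l in simp)
  then have eq: "areaF \<Lambda> = integral {0..P} (\<lambda>\<theta>. Re (D \<theta>) / (\<Lambda> + Im (w \<theta>)))"
    by (simp add: areaF_def integral_unique)
  \<comment> \<open>The integral of a non-integrable function is 0 by default, so a positive value
    proves integrability.\<close>
  moreover have "(\<lambda>\<theta>. Re (D \<theta>) / (\<Lambda> + Im (w \<theta>))) integrable_on {0..P}"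
    using areaF_pos[OF l] not_integrable_integral unfolding eq by (metis less_irrefl)
  ultimately show ?thesis by (simp add: has_integral_integral)
qed

text \<open>The calibration bound is attained. Dividing 1 = Re w Im w' - Im w Re w' by \<Lambda> +
  Im w gives \<Lambda> Re w' / (\<Lambda> + Im w) - Re w' + Re w Im w' / (\<Lambda> + Im w); the
  first term integrates to \<Lambda> \<open>areaF\<close>, the second to 0, and the third, by parts
  and Green's formula with primitive ln, to \<open>areaC\<close>.\<close>

lemma ell_eq:
  assumes l: "0 < \<Lambda> + ylo"
  shows "ell \<Lambda> = areaC \<Lambda> + \<Lambda> * areaF \<Lambda>"
proof -
  let ?e = "(\<Lambda> + ylo) / 2"
  have p: "0 < \<Lambda> + s" if "s \<in> {ylo - ?e..yhi + ?e}" for s using that l by (auto simp: field_simps)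
  have "((\<lambda>z. 1 / (\<Lambda> + Im z)) has_integral (- integral {0..P} (\<lambda>\<theta>. ln (\<Lambda> + Im (w \<theta>)) * Re (D \<theta>)))) Q"
  proof (rule green_frontier[where e = ?e and ?G0.0 = "\<lambda>y. ln (\<Lambda> + y)" and g = "\<lambda>y. 1 / (\<Lambda> + y)"])
    show "continuous_on {ylo - ?e..yhi + ?e} (\<lambda>y. 1 / (\<Lambda> + y))"
      using less_imp_neq[OF p] by (intro continuous_intros) auto
    show "((\<lambda>y. ln (\<Lambda> + y)) has_real_derivative 1 / (\<Lambda> + s)) (at s)" if "s \<in> {ylo - ?e..yhi + ?e}" for s
      using p[OF that] by (auto intro!: derivative_eq_intros)
  qed (use l in simp)
  then have C: "areaC \<Lambda> = - integral {0..P} (\<lambda>\<theta>. ln (\<Lambda> + Im (w \<theta>)) * Re (D \<theta>))"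
    by (simp add: areaC_def integral_unique)
  have 1: "((\<lambda>\<theta>. 1 * Re (D \<theta>) + Re (w \<theta>) * (0 * Im (D \<theta>))) has_integral 0) {0..P}"
    by (rule parts_integral[of "\<lambda>_. 1" "\<lambda>_. 0" 0]) auto
  have 2: "((\<lambda>\<theta>. ln (\<Lambda> + Im (w \<theta>)) * Re (D \<theta>) + Re (w \<theta>) * (1 / (\<Lambda> + Im (w \<theta>)) * Im (D \<theta>))) has_integral 0) {0..P}"
  proof (rule parts_integral[of "\<lambda>y. ln (\<Lambda> + y)" "\<lambda>y. 1 / (\<Lambda> + y)" "1 / (\<Lambda> + ylo)"])
    show "((\<lambda>y. ln (\<Lambda> + y)) has_real_derivative 1 / (\<Lambda> + y)) (at y)" if "y \<in> {ylo..yhi}" for y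
      using that l by (auto intro!: derivative_eq_intros)
    show "\<bar>1 / (\<Lambda> + y)\<bar> \<le> 1 / (\<Lambda> + ylo)" if "y \<in> {ylo..yhi}" for y
      using that l by (auto intro!: divide_left_mono)
  qed
  have 3: "((\<lambda>\<theta>. 1 / (\<Lambda> + Im (w \<theta>))) has_integral ell \<Lambda>) {0..P}"
    unfolding ell_def by (intro integrable_integral integrable_continuous_real recip_w[OF l])
  have "((\<lambda>\<theta>. (ln (\<Lambda> + Im (w \<theta>)) * Re (D \<theta>) + Re (w \<theta>) * (1 / (\<Lambda> + Im (w \<theta>)) * Im (D \<theta>)))
      - (1 * Re (D \<theta>) + Re (w \<theta>) * (0 * Im (D \<theta>))) + \<Lambda> * (Re (D \<theta>) / (\<Lambda> + Im (w \<theta>))) - 1 / (\<Lambda> + Im (w \<theta>)))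
      has_integral 0 - 0 + \<Lambda> * areaF \<Lambda> - ell \<Lambda>) {0..P}"
    by (intro has_integral_add has_integral_diff has_integral_mult_right 1 2 3 areaF_integral[OF l])
  then have "((\<lambda>\<theta>. ln (\<Lambda> + Im (w \<theta>)) * Re (D \<theta>)) has_integral 0 - 0 + \<Lambda> * areaF \<Lambda> - ell \<Lambda>) {0..P}"
  proof (rule has_integral_spike[OF N, rotated])
    fix \<theta> assume "\<theta> \<in> {0..P} - N"
    then have one: "Re (w \<theta>) * Im (D \<theta>) = 1 + Im (w \<theta>) * Re (D \<theta>)" using w_det[of \<theta>] by (simp add: det2_def)
    have "0 < \<Lambda> + Im (w \<theta>)" by (rule pos_w[OF l])
    then have "Re (w \<theta>) * (1 / (\<Lambda> + Im (w \<theta>)) * Im (D \<theta>)) - Re (D \<theta>) + \<Lambda> * (Re (D \<theta>) / (\<Lambda> + Im (w \<theta>))) - 1 / (\<Lambda> + Im (w \<theta>)) = 0"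
      using one by (simp add: field_simps)
    then show "ln (\<Lambda> + Im (w \<theta>)) * Re (D \<theta>) = (ln (\<Lambda> + Im (w \<theta>)) * Re (D \<theta>) + Re (w \<theta>) * (1 / (\<Lambda> + Im (w \<theta>)) * Im (D \<theta>)))
      - (1 * Re (D \<theta>) + Re (w \<theta>) * (0 * Im (D \<theta>))) + \<Lambda> * (Re (D \<theta>) / (\<Lambda> + Im (w \<theta>))) - 1 / (\<Lambda> + Im (w \<theta>))"
      by simp
  qed
  then show ?thesis unfolding C by (simp add: integral_unique)
qed

text \<open>The length element of the contour is d\<theta> / (\<Lambda> + Im w). So \<tau> is
  natural time as a function of the angle, and \<sigma> solves the angle equation up to the sign of
  the problem.\<close>

lemma time_change:
  assumes l: "0 < \<Lambda> + ylo"
  obtains \<tau> \<sigma> where "\<And>x. (\<tau> has_real_derivative 1 / (\<Lambda> + Im (w x))) (at x)" "\<And>x. \<sigma> (\<tau> x) = x" "\<And>t. \<tau> (\<sigma> t) = t"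
    "strict_mono \<sigma>" "\<And>t. (\<sigma> has_real_derivative \<Lambda> + Im (w (\<sigma> t))) (at t)" "(\<Lambda> + yhi)-lipschitz_on UNIV \<sigma>"
    "\<sigma> 0 = \<alpha>" "\<And>t. \<sigma> (t + ell \<Lambda>) = \<sigma> t + P"
proof -
  have hi: "0 < \<Lambda> + yhi" using l ylo_yhi by simp
  have m: "0 < 1 / (\<Lambda> + yhi)" "\<And>x. 1 / (\<Lambda> + yhi) \<le> 1 / (\<Lambda> + Im (w x))"
    using hi pos_w[OF l] Im_w by (auto intro!: divide_left_mono mult_pos_pos)
  have per: "1 / (\<Lambda> + Im (w (x + P))) = 1 / (\<Lambda> + Im (w x))" for x by (simp only: w_period)
  obtain \<tau> \<sigma> where \<tau>: "\<And>x. (\<tau> has_real_derivative 1 / (\<Lambda> + Im (w x))) (at x)" "\<tau> \<alpha> = 0"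
    "\<And>x. \<sigma> (\<tau> x) = x" "\<And>y. \<tau> (\<sigma> y) = y" "strict_mono \<tau>" "strict_mono \<sigma>"
    "\<And>y. (\<sigma> has_real_derivative 1 / (1 / (\<Lambda> + Im (w (\<sigma> y))))) (at y)" "(1 / (1 / (\<Lambda> + yhi)))-lipschitz_on UNIV \<sigma>"
    "\<And>x. \<tau> (x + P) = \<tau> x + \<tau> (\<alpha> + P)" "\<And>y. \<sigma> (y + \<tau> (\<alpha> + P)) = \<sigma> y + P"
    by (rule clock_exists[OF recip_w[OF l] m per, where a = \<alpha>]) (rule that)
  have "((\<lambda>\<theta>. 1 / (\<Lambda> + Im (w \<theta>))) has_integral (\<tau> P - \<tau> 0)) {0..P}"
    by (rule fundamental_theorem_of_calculus[OF less_imp_le[OF P_pos]])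
       (metis \<tau>(1) has_field_derivative_at_within has_real_derivative_iff_has_vector_derivative)
  then have e: "\<tau> (\<alpha> + P) = ell \<Lambda>" using \<tau>(9)[of 0] by (simp add: ell_def integral_unique)
  have "\<sigma> 0 = \<alpha>" using \<tau>(3)[of \<alpha>] \<tau>(2) by simp
  then show ?thesis using that[OF \<tau>(1,3,4,6)] \<tau>(7,8,10) unfolding e by simp
qed

lemma ell_pos: assumes l: "0 < \<Lambda> + ylo" shows "0 < ell \<Lambda>"
proof -
  obtain \<sigma> :: "real \<Rightarrow> real" where s: "strict_mono \<sigma>" "\<And>t. \<sigma> (t + ell \<Lambda>) = \<sigma> t + P"
    by (rule time_change[OF l]) (rule that)
  then have "\<sigma> 0 < \<sigma> (0 + ell \<Lambda>)" using s(2)[of 0] P_pos by simp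
  then show ?thesis using strict_mono_less[OF s(1)] by simp
qed

end

section \<open>The isoperimetric problems\<close>

lemma natural_param_cong:
  assumes nat: "natural_param \<Omega> a b c" and eq: "\<And>t. t \<in> {a..b} \<Longrightarrow> c' t = c t"
  shows "natural_param \<Omega> a b c'"
proof -
  let ?B = "\<lambda>c. {t\<in>{a..b}. \<not> (c differentiable (at t) \<and> finsler \<Omega> (c t) (vector_derivative c (at t)) = 1)}"
  have I: "{a..b} \<in> sets lebesgue" by simp
  have "?B c' \<subseteq> ?B c \<union> {a, b}"
  proof
    fix t assume t: "t \<in> ?B c'"
    show "t \<in> ?B c \<union> {a, b}"
    proof (cases "t \<in> {a<..<b}")
      case True
      have "(c' has_vector_derivative v) (at t) \<longleftrightarrow> (c has_vector_derivative v) (at t)" for v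
        by (rule has_vector_derivative_cong_open[OF _ True]) (use eq in auto)
      then have "vector_derivative c' (at t) = vector_derivative c (at t)" "c' differentiable (at t) \<longleftrightarrow> c differentiable (at t)"
        unfolding vector_derivative_works by (auto simp: vector_derivative_def)
      then show ?thesis using t eq[of t] by auto
    qed (use t in auto)
  qed
  moreover have "negligible (?B c \<union> {a, b})"
    using nat unfolding natural_param_def AE_lebesgue_on_iff_negligible[OF I] by simp
  ultimately show ?thesis
    unfolding natural_param_def AE_lebesgue_on_iff_negligible[OF I] by (rule negligible_subset[rotated])
qed

lemma (in area_curve) rotate:
  assumes u: "norm u = 1"
  shows "area_curve ((\<lambda>z. u * z) ` Q) (\<lambda>\<theta>. u * w \<theta>) P C N"
proof -
  have u0: "u \<noteq> 0" using u by auto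
  interpret R: body "(\<lambda>z. u * z) ` Q" by (rule body_rotate[OF body_axioms u0])
  have d: "((\<lambda>\<theta>. u * w \<theta>) has_vector_derivative u * D \<theta>) (at \<theta>)" if "\<theta> \<notin> N" for \<theta>
    by (rule has_vector_derivative_mult_right[OF w_der[OF that]])
  show ?thesis
  proof unfold_locales
    show "C-lipschitz_on UNIV (\<lambda>\<theta>. u * w \<theta>)"
      using w_lip u unfolding lipschitz_on_def by (simp add: dist_norm norm_mult flip: right_diff_distrib)
    show "oriented_param Plus (frontier ((\<lambda>z. u * z) ` Q)) 0 P (\<lambda>\<theta>. u * w \<theta>)"
      using oriented_param_affine[OF body_axioms w_orient u0, of 0] body_affine_image(1)[OF body_axioms u0, of 0] by simp
    show "negligible N" by (rule N)
    show "u * w (\<theta> + P) = u * w \<theta>" for \<theta> by (simp add: w_period)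
    fix \<theta> assume \<theta>: "\<theta> \<notin> N"
    show "((\<lambda>\<theta>. u * w \<theta>) has_vector_derivative vector_derivative (\<lambda>\<theta>. u * w \<theta>) (at \<theta>)) (at \<theta>)"
      "det2 (u * w \<theta>) (vector_derivative (\<lambda>\<theta>. u * w \<theta>) (at \<theta>)) = 1"
      unfolding vector_derivative_at[OF d[OF \<theta>]] using d[OF \<theta>] det2_rotate[OF u] w_det[OF \<theta>] by auto
  qed
qed

text \<open>The condition on \<open>v\<close> says that the contour is a horizontal translate of the
  boundary of \<open>Q\<close>, raised by \<Lambda> and then dilated by r.\<close>

locale contour = area_curve Q w P C N for Q w P C N +
  fixes \<Lambda> r :: real and v :: complex
  assumes \<Lambda>: "0 < \<Lambda> + ylo" and r: "0 < r" and v: "Im v = r * \<Lambda>"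
begin

definition \<gamma> :: "complex set" where "\<gamma> = (\<lambda>z. v + r *\<^sub>R z) ` frontier Q"

abbreviation c :: "real \<Rightarrow> complex" where "c \<theta> \<equiv> v + r *\<^sub>R w \<theta>"

lemma Im_c: "Im (c \<theta>) = r * (\<Lambda> + Im (w \<theta>))" "0 < Im (c \<theta>)"
proof -
  show "Im (c \<theta>) = r * (\<Lambda> + Im (w \<theta>))" using v by (simp add: distrib_left)
  then show "0 < Im (c \<theta>)" using mult_pos_pos[OF r pos_w[OF \<Lambda>, of \<theta>]] by simp
qed

lemma \<gamma>_range: "\<gamma> = range c"
proof -
  have "frontier Q = range w" using w_frontier w_image by blast
  then show ?thesis by (simp add: \<gamma>_def image_image)
qed

lemma \<gamma>_G: "\<gamma> \<subseteq> G" unfolding \<gamma>_range G_def using Im_c(2) by auto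

lemma c_der:
  assumes "\<theta> \<notin> N"
  shows "(c has_vector_derivative r *\<^sub>R D \<theta>) (at \<theta>)" "vector_derivative c (at \<theta>) = r *\<^sub>R D \<theta>"
proof -
  show d: "(c has_vector_derivative r *\<^sub>R D \<theta>) (at \<theta>)"
    using w_der[OF assms] by (auto intro!: derivative_eq_intros)
  show "vector_derivative c (at \<theta>) = r *\<^sub>R D \<theta>" by (rule vector_derivative_at[OF d])
qed

lemma c_orient: "oriented_param Plus \<gamma> x (x + P) c"
proof -
  have o: "oriented_param Plus \<gamma> 0 P c"
    using oriented_param_affine[OF body_axioms w_orient, of "of_real r" v] r
    by (simp add: \<gamma>_def scaleR_conv_of_real)
  obtain n :: int where n: "x + of_int n * P \<in> {0..<P}" by (rule reduce_period)
  let ?x = "x + of_int n * P"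
  have xP: "?x \<in> {0..P}" using n by simp
  show ?thesis
  proof (rule oriented_param_reparam[OF oriented_param_shift[OF o xP], where \<phi> = "\<lambda>t. t + of_int n * P"])
    show "1-lipschitz_on {x..x + P} (\<lambda>t. t + of_int n * P)" by (rule lipschitz_onI) (auto simp: dist_real_def)
    show "(\<lambda>t. t + of_int n * P) ` {x..x + P} = {?x..?x + (P - 0)}"
      by (simp add: image_add_atLeastAtMost' algebra_simps)
    fix t
    have "w (t + of_int n * P - P) = w t" using w_period_int[of t "n - 1"] by (simp add: algebra_simps)
    then show "c t = (if t + of_int n * P \<le> P then c (t + of_int n * P) else c (t + of_int n * P - (P - 0)))"
      by (simp add: w_period_int)
  qed (use P_pos in \<open>auto simp: inj_on_def\<close>)
qed

lemma \<gamma>_contour: "simple_lipschitz_contour \<gamma>"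
  using c_orient[of 0] by (auto simp: oriented_param_def simple_lipschitz_contour_def)

lemma \<gamma>_area: "Area (inside \<gamma>) = areaF \<Lambda>"
proof -
  have "Area (inside \<gamma>) = integral {0..P} (\<lambda>t. Re (vector_derivative c (at t)) / Im (c t))"
    using Area_eq_contour_integral[OF c_orient[of 0] \<gamma>_G] by simp
  also have "\<dots> = integral {0..P} (\<lambda>t. Re (D t) / (\<Lambda> + Im (w t)))"
    by (rule integral_spike[OF N]) (use r in \<open>simp add: c_der(2) Im_c(1) del: plus_complex.sel\<close>)
  also have "\<dots> = areaF \<Lambda>" using areaF_integral[OF \<Lambda>] by (rule integral_unique)
  finally show ?thesis .
qed

lemma \<gamma>_len: "len Q 0 (0 + P) c = ell \<Lambda>"
proof -
  have "integral {0..P} (\<lambda>t. supp Q (vector_derivative c (at t)) / Im (c t)) = integral {0..P} (\<lambda>t. 1 / (\<Lambda> + Im (w t)))"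
    by (rule integral_spike[OF N])
       (use r supp_D in \<open>simp add: c_der(2) Im_c(1) supp_scaleR del: plus_complex.sel\<close>)
  then show ?thesis by (simp add: len_def ell_def)
qed

end

text \<open>Both problems are reduced to one body turned by the sign. The multiplier of the theorem
  is \<open>sg\<close> times the \<Lambda> used here, and its R is \<open>sg\<close> times a
  positive radius, so that only \<Lambda> + ylo > 0 has to be treated.\<close>

locale gp = area_curve Q w P C N for Q w P C N +
  fixes \<Omega> :: "complex set" and s :: sign
  assumes \<Omega>: "body \<Omega>"
    and Q_eq: "Q = (\<lambda>z. cis (- sign_val s * (pi / 2)) * z) ` polar \<Omega>"
    and w_eq: "\<And>\<theta>. w \<theta> = cis (- sign_val s * (pi / 2)) * trig (polar \<Omega>) \<theta>"
    and P_eq: "P = 2 * S (polar \<Omega>)"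

lemma gp_exists:
  assumes \<Omega>: "body \<Omega>"
  obtains Q w C N where "gp Q w (2 * S (polar \<Omega>)) C N \<Omega> s"
proof -
  obtain C N where "area_curve (polar \<Omega>) (trig (polar \<Omega>)) (2 * S (polar \<Omega>)) C N"
    by (rule trig_curve[OF body_polar[OF \<Omega>]]) (rule that)
  then interpret A: area_curve "polar \<Omega>" "trig (polar \<Omega>)" "2 * S (polar \<Omega>)" C N .
  show ?thesis
    by (rule that, rule gp.intro[OF A.rotate[of "cis (- sign_val s * (pi / 2))"]])
       (use \<Omega> in \<open>auto intro!: gp_axioms.intro\<close>)
qed

context gp
begin

abbreviation sg :: real where "sg \<equiv> sign_val s"

lemma sg_sq: "sg * sg = 1" "sg * (sg * x) = x" "sg \<noteq> 0"
  by (cases s; simp)+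

lemma rot: "cis (- sg * (pi / 2)) = - (of_real sg * \<i>)"
  by (cases s) (auto simp: complex_eq_iff)

lemma w_sel: "Re (w \<theta>) = sg * sinK (polar \<Omega>) \<theta>" "Im (w \<theta>) = - (sg * cosK (polar \<Omega>) \<theta>)"
  unfolding w_eq rot by simp_all

lemma minkowski_supp: "minkowski \<Omega> (sg *\<^sub>R x) = supp Q x"
  using minkowski_eq_supp[OF \<Omega>] minkowski_uminus_eq_supp[OF \<Omega>] unfolding Q_eq rot by (cases s) auto

lemma Len_len:
  assumes "oriented_param Plus \<gamma> a b c" "\<gamma> \<subseteq> G" shows "Len \<Omega> s \<gamma> = len Q a b c"
proof (cases s)
  case Plus
  then show ?thesis using Len_eq[OF \<Omega> assms] curve_length_eq_len[OF \<Omega>] unfolding Q_eq rot by simp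
next
  case Minus
  then show ?thesis using Len_Minus_eq[OF \<Omega> assms] unfolding Q_eq rot by simp
qed

lemma ylo_w: obtains \<theta> where "Im (w \<theta>) = ylo"
proof -
  obtain z where z: "z \<in> Q" "Im z = ylo" by (rule ylo_attained)
  have "z \<in> frontier Q" by (rule frontier_if_extreme[OF z(1)]) (use z in auto)
  then obtain \<theta> where "w \<theta> = z" by (rule w_surj) (rule that)
  then show ?thesis using that z(2) by blast
qed

lemma lambda_range_iff: "l \<in> lambda_range \<Omega> s \<longleftrightarrow> 0 < sg * l + ylo"
proof -
  obtain \<theta>0 where \<theta>0: "Im (w \<theta>0) = ylo" by (rule ylo_w)
  have le: "ylo \<le> Im (w \<theta>)" for \<theta> using Im_w[of \<theta>] by simp
  show ?thesis
  proof (cases s)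
    case Plus
    have "M_plus \<Omega> = - ylo" unfolding M_plus_def
    proof (rule cSup_eq_maximum)
      show "- ylo \<in> range (cosK (polar \<Omega>))" using \<theta>0 w_sel(2)[of \<theta>0] Plus by (intro image_eqI[of _ _ \<theta>0]) auto
      show "x \<le> - ylo" if x: "x \<in> range (cosK (polar \<Omega>))" for x
      proof -
        obtain \<theta> where "x = cosK (polar \<Omega>) \<theta>" using x by blast
        then show ?thesis using le[of \<theta>] w_sel(2)[of \<theta>] Plus by simp
      qed
    qed
    then show ?thesis using Plus by auto
  next
    case Minus
    have "(INF \<phi>. cosK (polar \<Omega>) \<phi>) = ylo"
    proof (rule cInf_eq_minimum)
      show "ylo \<in> range (cosK (polar \<Omega>))" using \<theta>0 w_sel(2)[of \<theta>0] Minus by (intro image_eqI[of _ _ \<theta>0]) auto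
      show "ylo \<le> x" if "x \<in> range (cosK (polar \<Omega>))" for x using that le w_sel(2) Minus by fastforce
    qed
    then show ?thesis using Minus by (auto simp: M_minus_def)
  qed
qed

lemma L_ell: "L \<Omega> s l = ell (sg * l)"
  unfolding ell_def unfolding P_eq by (cases s) (simp_all add: w_sel)

text \<open>By \<open>cos_corr_angle\<close> the numerator is almost everywhere the derivative of
  \<open>sinK (polar \<Omega>)\<close>, which is \<open>sg\<close> times Re w'. This turns the
  integral of the theorem into the contour form of \<open>areaF\<close>.\<close>

lemma F_areaF: assumes l: "0 < sg * l + ylo" shows "F \<Omega> s l = sg * areaF (sg * l)"
proof -
  have tr: "trig (polar \<Omega>) = (\<lambda>\<theta>. (of_real sg * \<i>) * w \<theta>)"
    by (rule ext) (simp add: complex_eq_iff w_sel sg_sq)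
  have cos: "cosK \<Omega> (corr_angle \<Omega> \<theta>) = sg * Re (D \<theta>)" if "\<theta> \<notin> N" for \<theta>
  proof -
    have "(trig (polar \<Omega>) has_vector_derivative (of_real sg * \<i>) * D \<theta>) (at \<theta>)"
      unfolding tr by (rule has_vector_derivative_mult_right[OF w_der[OF that]])
    moreover have "norm (of_real sg * \<i> :: complex) = 1" by (cases s) (auto simp: norm_mult)
    then have "det2 (trig (polar \<Omega>) \<theta>) ((of_real sg * \<i>) * D \<theta>) = 1"
      unfolding tr using det2_rotate w_det[OF that] by metis
    ultimately show ?thesis using cos_corr_angle[OF \<Omega>] by fastforce
  qed
  have "((\<lambda>\<theta>. sg * (Re (D \<theta>) / (sg * l + Im (w \<theta>)))) has_integral sg * areaF (sg * l)) {0..P}"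
    by (rule has_integral_mult_right[OF areaF_integral[OF l]])
  then have "((\<lambda>\<theta>. cosK \<Omega> (corr_angle \<Omega> \<theta>) / (sg * l + Im (w \<theta>))) has_integral sg * areaF (sg * l)) {0..P}"
    by (rule has_integral_spike[OF N, rotated]) (simp add: cos)
  then show ?thesis by (cases s) (simp_all add: P_eq w_sel integral_unique)
qed

lemma polar_contour_eq: "polar_contour \<Omega> s r v = (\<lambda>z. v + r *\<^sub>R z) ` frontier Q"
proof -
  have "cis (- sg * (pi / 2)) \<noteq> 0" by simp
  from body_affine_image(1)[OF body_polar[OF \<Omega>] this, of 0] show ?thesis
    unfolding polar_contour_def Q_eq by (simp add: image_image)
qed

text \<open>\<open>radius\<close> and \<open>centre\<close> solve g = centre + radius w \<alpha>
  with Im centre = radius \<Lambda>: the contour through g on which g has the angle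
  \<alpha>.\<close>

definition radius :: "real \<Rightarrow> complex \<Rightarrow> real \<Rightarrow> real" where
  "radius \<Lambda> g \<alpha> = Im g / (\<Lambda> + Im (w \<alpha>))"

definition centre :: "real \<Rightarrow> complex \<Rightarrow> real \<Rightarrow> complex" where
  "centre \<Lambda> g \<alpha> = g - radius \<Lambda> g \<alpha> *\<^sub>R w \<alpha>"

lemma contour_locale:
  assumes \<Lambda>: "0 < \<Lambda> + ylo" and g: "g \<in> G"
  shows "contour Q w P C N \<Lambda> (radius \<Lambda> g \<alpha>) (centre \<Lambda> g \<alpha>)"
proof unfold_locales
  have p: "0 < \<Lambda> + Im (w \<alpha>)" by (rule pos_w[OF \<Lambda>])
  then show "0 < radius \<Lambda> g \<alpha>" using g by (simp add: radius_def G_def)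
  have "radius \<Lambda> g \<alpha> * (\<Lambda> + Im (w \<alpha>)) = Im g" using p by (simp add: radius_def)
  then show "Im (centre \<Lambda> g \<alpha>) = radius \<Lambda> g \<alpha> * \<Lambda>" by (simp add: centre_def algebra_simps)
qed (rule \<Lambda>)

lemma GP_constants_iff:
  assumes \<Lambda>: "0 < \<Lambda> + ylo" "areaF \<Lambda> = A" and g: "g \<in> G"
  shows "GP_constants \<Omega> s g A \<alpha> l R cx cy \<longleftrightarrow>
    l = sg * \<Lambda> \<and> R = sg * radius \<Lambda> g \<alpha> \<and> cx = Re (centre \<Lambda> g \<alpha>) \<and> cy = Im (centre \<Lambda> g \<alpha>)"
proof -
  have "l \<in> lambda_range \<Omega> s \<and> F \<Omega> s l = sg * A \<longleftrightarrow> l = sg * \<Lambda>"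
  proof
    assume "l \<in> lambda_range \<Omega> s \<and> F \<Omega> s l = sg * A"
    then have "0 < sg * l + ylo" "areaF (sg * l) = areaF \<Lambda>"
      using F_areaF[of l] sg_sq(3) by (auto simp: lambda_range_iff \<Lambda>(2))
    then have "sg * l = \<Lambda>" using areaF_inj \<Lambda>(1) by blast
    then show "l = sg * \<Lambda>" using sg_sq(2)[of l] by simp
  next
    assume "l = sg * \<Lambda>"
    then show "l \<in> lambda_range \<Omega> s \<and> F \<Omega> s l = sg * A"
      using F_areaF[of l] \<Lambda> by (simp add: lambda_range_iff sg_sq)
  qed
  moreover have "sg * \<Lambda> - cosK (polar \<Omega>) \<alpha> = sg * (\<Lambda> + Im (w \<alpha>))"
    by (cases s) (simp_all add: w_sel)
  then have "Im g / (sg * \<Lambda> - cosK (polar \<Omega>) \<alpha>) = sg * radius \<Lambda> g \<alpha>"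
  proof -
    have "y / (sg * x) = sg * (y / x)" for x y by (cases s) simp_all
    then show ?thesis using \<open>sg * \<Lambda> - cosK (polar \<Omega>) \<alpha> = sg * (\<Lambda> + Im (w \<alpha>))\<close> by (simp only: radius_def)
  qed
  moreover have "Re g - sg * radius \<Lambda> g \<alpha> * sinK (polar \<Omega>) \<alpha> = Re (centre \<Lambda> g \<alpha>)"
    by (simp add: centre_def w_sel)
  moreover have "sg * radius \<Lambda> g \<alpha> * (sg * \<Lambda>) = Im (centre \<Lambda> g \<alpha>)"
    using contour.v[OF contour_locale[OF \<Lambda>(1) g]] by (cases s) auto
  ultimately show ?thesis unfolding GP_constants_def by metis
qed

text \<open>The argument \<open>sg * t\<close> makes the lower-sign contour run backwards from
  \<alpha>. The velocity is \<open>sg\<close> times the height times w', whose gauge is the height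
  because \<open>supp Q\<close> is 1 on w'.\<close>

lemma natural_curve:
  assumes "contour Q w P C N \<Lambda> r v"
    and \<tau>: "\<And>x. (\<tau> has_real_derivative 1 / (\<Lambda> + Im (w x))) (at x)" "\<And>x. \<sigma> (\<tau> x) = x" "\<And>t. \<tau> (\<sigma> t) = t"
    and \<sigma>: "strict_mono \<sigma>" "\<And>t. (\<sigma> has_real_derivative \<Lambda> + Im (w (\<sigma> t))) (at t)" "K-lipschitz_on UNIV \<sigma>"
    "\<sigma> 0 = \<alpha>" "\<And>t. \<sigma> (t + ell \<Lambda>) = \<sigma> t + P"
  defines "\<beta> \<equiv> \<lambda>t. v + r *\<^sub>R w (\<sigma> (sg * t))"
  shows "oriented_param s (contour.\<gamma> Q r v) 0 (ell \<Lambda>) \<beta>" "natural_param \<Omega> 0 (ell \<Lambda>) \<beta>"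
proof -
  interpret contour Q w P C N \<Lambda> r v by fact
  have e: "0 < ell \<Lambda>" by (rule ell_pos[OF \<Lambda>])
  have im: "\<sigma> ` {a..b} = {\<sigma> a..\<sigma> b}" for a b
  proof
    show "{\<sigma> a..\<sigma> b} \<subseteq> \<sigma> ` {a..b}"
    proof
      fix y assume "y \<in> {\<sigma> a..\<sigma> b}"
      then have "\<sigma> a \<le> \<sigma> (\<tau> y)" "\<sigma> (\<tau> y) \<le> \<sigma> b" by (auto simp: \<tau>(2))
      then have "\<tau> y \<in> {a..b}" using strict_mono_less_eq[OF \<sigma>(1)] by simp
      then show "y \<in> \<sigma> ` {a..b}" using \<tau>(2)[of y] by (metis imageI)
    qed
  qed (use strict_mono_less_eq[OF \<sigma>(1)] in auto)
  have o: "oriented_param Plus \<gamma> a b (\<lambda>t. c (\<sigma> t))" if "a < b" "\<sigma> b = \<sigma> a + P" for a b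
    by (rule oriented_param_reparam[OF c_orient[of "\<sigma> a"] that(1), where \<phi> = \<sigma>])
       (use that(2) im[of a b] strict_mono_imp_inj_on[OF \<sigma>(1)] inj_on_subset in \<open>auto intro: lipschitz_on_subset[OF \<sigma>(3)]\<close>)
  show "oriented_param s \<gamma> 0 (ell \<Lambda>) \<beta>"
  proof (cases s)
    case Plus
    then show ?thesis using o[OF e] \<sigma>(5)[of 0] by (simp add: \<beta>_def)
  next
    case Minus
    have "oriented_param Plus \<gamma> (- ell \<Lambda>) 0 (\<lambda>t. c (\<sigma> t))" using e \<sigma>(5)[of "- ell \<Lambda>"] by (intro o) auto
    from oriented_param_reverse[OF this, of Minus] show ?thesis using Minus by (simp add: \<beta>_def)
  qed
  have der: "(\<beta> has_vector_derivative sg *\<^sub>R (Im (\<beta> t) *\<^sub>R D (\<sigma> (sg * t)))) (at t)" if "\<sigma> (sg * t) \<notin> N" for t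
  proof -
    have "((\<lambda>t. \<sigma> (sg * t)) has_real_derivative (\<Lambda> + Im (w (\<sigma> (sg * t)))) * sg) (at t)"
      by (rule DERIV_chain2[OF \<sigma>(2)]) (auto intro!: derivative_eq_intros)
    then have "((\<lambda>t. \<sigma> (sg * t)) has_vector_derivative (\<Lambda> + Im (w (\<sigma> (sg * t)))) * sg) (at t)"
      by (simp add: has_real_derivative_iff_has_vector_derivative)
    from vector_diff_chain_at[OF this c_der(1)[OF that]]
    show ?thesis by (simp add: o_def \<beta>_def Im_c(1) mult_ac del: plus_complex.sel)
  qed
  have good: "\<beta> differentiable (at t) \<and> finsler \<Omega> (\<beta> t) (vector_derivative \<beta> (at t)) = 1" if "\<sigma> (sg * t) \<notin> N" for t
  proof
    show "\<beta> differentiable (at t)" using der[OF that] by (rule differentiableI_vector)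
    have p: "0 < Im (\<beta> t)" unfolding \<beta>_def by (rule Im_c(2))
    then have "minkowski \<Omega> (sg *\<^sub>R (Im (\<beta> t) *\<^sub>R D (\<sigma> (sg * t)))) = Im (\<beta> t)"
      unfolding minkowski_supp using supp_scaleR[of "Im (\<beta> t)"] supp_D[OF that] by simp
    then show "finsler \<Omega> (\<beta> t) (vector_derivative \<beta> (at t)) = 1"
      unfolding finsler_def vector_derivative_at[OF der[OF that]] using p by simp
  qed
  \<comment> \<open>Exceptional times are images of exceptional angles under the differentiable
    clock \<tau>.\<close>
  have "negligible ((\<lambda>x. sg * \<tau> x) ` N)"
  proof (rule negligible_differentiable_image_negligible[OF _ N])
    show "(\<lambda>x. sg * \<tau> x) differentiable_on N"
      using DERIV_cmult[OF \<tau>(1), of sg] real_differentiable_def by (intro differentiable_at_imp_differentiable_on) blast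
  qed simp
  moreover have "{t \<in> {0..ell \<Lambda>}. \<not> (\<beta> differentiable (at t) \<and> finsler \<Omega> (\<beta> t) (vector_derivative \<beta> (at t)) = 1)} \<subseteq> (\<lambda>x. sg * \<tau> x) ` N"
  proof
    fix t assume "t \<in> {t \<in> {0..ell \<Lambda>}. \<not> (\<beta> differentiable (at t) \<and> finsler \<Omega> (\<beta> t) (vector_derivative \<beta> (at t)) = 1)}"
    then have "\<sigma> (sg * t) \<in> N" using good by blast
    moreover have "t = sg * \<tau> (\<sigma> (sg * t))" by (simp add: \<tau>(3) sg_sq)
    ultimately show "t \<in> (\<lambda>x. sg * \<tau> x) ` N" by blast
  qed
  ultimately show "natural_param \<Omega> 0 (ell \<Lambda>) \<beta>"
    unfolding natural_param_def using negligible_subset by (subst AE_lebesgue_on_iff_negligible) auto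
qed

text \<open>Separation of variables: along any solution, \<tau> composed with \<theta> has
  derivative \<open>sg\<close>, hence is \<open>sg * t\<close>, and applying \<sigma> recovers
  \<theta>.\<close>

lemma angle_solution_iff:
  assumes \<Lambda>: "0 < \<Lambda> + ylo"
    and \<tau>: "\<And>x. (\<tau> has_real_derivative 1 / (\<Lambda> + Im (w x))) (at x)" "\<And>x. \<sigma> (\<tau> x) = x" "\<And>t. \<tau> (\<sigma> t) = t"
    and \<sigma>: "\<And>t. (\<sigma> has_real_derivative \<Lambda> + Im (w (\<sigma> t))) (at t)" "\<sigma> 0 = \<alpha>"
  shows "angle_solution \<Omega> s \<alpha> (sg * \<Lambda>) (\<lambda>t. \<sigma> (sg * t))"
    and "angle_solution \<Omega> s \<alpha> (sg * \<Lambda>) \<theta> \<Longrightarrow> t \<in> {0..ell \<Lambda>} \<Longrightarrow> \<theta> t = \<sigma> (sg * t)"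
proof -
  have rhs: "sg * \<Lambda> - cosK (polar \<Omega>) x = sg * (\<Lambda> + Im (w x))" for x by (cases s) (simp_all add: w_sel)
  have LL: "L \<Omega> s (sg * \<Lambda>) = ell \<Lambda>" by (simp add: L_ell sg_sq)
  have "((\<lambda>t. \<sigma> (sg * t)) has_real_derivative (\<Lambda> + Im (w (\<sigma> (sg * t)))) * sg) (at t)" for t
    by (rule DERIV_chain2[OF \<sigma>(1)]) (auto intro!: derivative_eq_intros)
  then have "((\<lambda>t. \<sigma> (sg * t)) has_real_derivative sg * (\<Lambda> + Im (w (\<sigma> (sg * t))))) (at t within T)" for t T
    unfolding mult.commute[of sg "\<Lambda> + Im (w (\<sigma> (sg * t)))"] by (rule has_field_derivative_at_within)
  then show "angle_solution \<Omega> s \<alpha> (sg * \<Lambda>) (\<lambda>t. \<sigma> (sg * t))"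
    unfolding angle_solution_def rhs mult_zero_right \<sigma>(2) by blast
  assume sol: "angle_solution \<Omega> s \<alpha> (sg * \<Lambda>) \<theta>" and t: "t \<in> {0..ell \<Lambda>}"
  have "((\<lambda>t. \<tau> (\<theta> t) - sg * t) has_real_derivative 0) (at x within {0..ell \<Lambda>})" if x: "x \<in> {0..ell \<Lambda>}" for x
  proof -
    have "(\<theta> has_real_derivative sg * (\<Lambda> + Im (w (\<theta> x)))) (at x within {0..ell \<Lambda>})"
      using sol x unfolding angle_solution_def rhs LL by blast
    from DERIV_chain2[OF \<tau>(1) this]
    have "((\<lambda>t. \<tau> (\<theta> t)) has_real_derivative 1 / (\<Lambda> + Im (w (\<theta> x))) * (sg * (\<Lambda> + Im (w (\<theta> x))))) (at x within {0..ell \<Lambda>})" .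
    then have "((\<lambda>t. \<tau> (\<theta> t)) has_real_derivative sg) (at x within {0..ell \<Lambda>})"
      using pos_w[OF \<Lambda>, of "\<theta> x"] by (auto elim!: DERIV_cong)
    from DERIV_diff[OF this DERIV_cmult_Id[of sg]] show ?thesis by simp
  qed
  then obtain k where k: "\<And>x. x \<in> {0..ell \<Lambda>} \<Longrightarrow> \<tau> (\<theta> x) - sg * x = k"
    using has_field_derivative_zero_constant[of "{0..ell \<Lambda>}" "\<lambda>t. \<tau> (\<theta> t) - sg * t"] by auto
  have "\<tau> (\<theta> 0) = 0" using sol \<tau>(3)[of 0] \<sigma>(2) by (simp add: angle_solution_def)
  then have "k = 0" using k[of 0] ell_pos[OF \<Lambda>] by simp
  then show "\<theta> t = \<sigma> (sg * t)" using k[OF t] \<tau>(2)[of "\<theta> t"] by simp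
qed

text \<open>A competitor of least length is r times the raised boundary up to a horizontal
  translation. Since g lies on it, \<alpha> is the angle at which g is met, and r and the centre
  follow from g and \<alpha>.\<close>

lemma GP_solution_iff:
  assumes \<Lambda>: "0 < \<Lambda> + ylo" "areaF \<Lambda> = A" and g: "g \<in> G"
  shows "GP_solution \<Omega> s g A \<gamma> \<longleftrightarrow> (\<exists>\<alpha>\<in>{0..<P}. \<gamma> = contour.\<gamma> Q (radius \<Lambda> g \<alpha>) (centre \<Lambda> g \<alpha>))"
proof -
  have A: "0 < A" using areaF_pos[OF \<Lambda>(1)] \<Lambda>(2) by simp
  have lower: "ell \<Lambda> \<le> Len \<Omega> s \<gamma>'" and rigid: "Len \<Omega> s \<gamma>' = ell \<Lambda> \<Longrightarrow> \<exists>\<alpha>\<in>{0..<P}. \<gamma>' = contour.\<gamma> Q (radius \<Lambda> g \<alpha>) (centre \<Lambda> g \<alpha>)"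
    if adm: "GP_admissible g A \<gamma>'" for \<gamma>'
  proof -
    have a: "simple_lipschitz_contour \<gamma>'" "\<gamma>' \<subseteq> G" "g \<in> \<gamma>'" "Area (inside \<gamma>') = A"
      using adm by (auto simp: GP_admissible_def)
    obtain a b c where o: "oriented_param Plus \<gamma>' a b c" by (rule oriented_param_exists[OF a(1)]) (rule that)
    note iso = isoperimetric[OF o a(2,4) A \<Lambda>]
    have e: "ell \<Lambda> = areaC \<Lambda> + \<Lambda> * A" unfolding ell_eq[OF \<Lambda>(1)] \<Lambda>(2) ..
    show "ell \<Lambda> \<le> Len \<Omega> s \<gamma>'" unfolding e Len_len[OF o a(2)] by (rule iso(1))
    assume "Len \<Omega> s \<gamma>' = ell \<Lambda>"
    then obtain r cx where r: "r > 0" "\<gamma>' = (\<lambda>z. Complex cx (r * \<Lambda>) + r *\<^sub>R z) ` frontier Q"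
      using iso(2) unfolding e Len_len[OF o a(2)] by blast
    then obtain z where z: "z \<in> frontier Q" "g = Complex cx (r * \<Lambda>) + r *\<^sub>R z" using a(3) by blast
    obtain \<alpha> where \<alpha>: "\<alpha> \<in> {0..<P}" "w \<alpha> = z" by (rule w_surj[OF z(1)]) (rule that)
    have "Im g = r * (\<Lambda> + Im (w \<alpha>))" using z(2) \<alpha>(2) by (simp add: distrib_left)
    then have rr: "radius \<Lambda> g \<alpha> = r" using pos_w[OF \<Lambda>(1), of \<alpha>] by (simp add: radius_def)
    have "centre \<Lambda> g \<alpha> = g - r *\<^sub>R z" unfolding centre_def rr \<alpha>(2) ..
    then have "centre \<Lambda> g \<alpha> = Complex cx (r * \<Lambda>)" using z(2) by simp
    then have "\<gamma>' = contour.\<gamma> Q (radius \<Lambda> g \<alpha>) (centre \<Lambda> g \<alpha>)"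
      using contour.\<gamma>_def[OF contour_locale[OF \<Lambda>(1) g, of \<alpha>]] r(2) rr by simp
    then show "\<exists>\<alpha>\<in>{0..<P}. \<gamma>' = contour.\<gamma> Q (radius \<Lambda> g \<alpha>) (centre \<Lambda> g \<alpha>)" using \<alpha>(1) by blast
  qed
  have adm: "GP_admissible g A (contour.\<gamma> Q (radius \<Lambda> g \<alpha>) (centre \<Lambda> g \<alpha>)) \<and>
      Len \<Omega> s (contour.\<gamma> Q (radius \<Lambda> g \<alpha>) (centre \<Lambda> g \<alpha>)) = ell \<Lambda>" for \<alpha>
  proof -
    interpret c: contour Q w P C N \<Lambda> "radius \<Lambda> g \<alpha>" "centre \<Lambda> g \<alpha>" by (rule contour_locale[OF \<Lambda>(1) g])
    have "g \<in> c.\<gamma>" unfolding c.\<gamma>_range by (rule range_eqI[of _ _ \<alpha>]) (simp add: centre_def)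
    then show ?thesis
      using c.\<gamma>_contour c.\<gamma>_G c.\<gamma>_area \<Lambda>(2) Len_len[OF c.c_orient[of 0] c.\<gamma>_G] c.\<gamma>_len by (simp add: GP_admissible_def)
  qed
  show ?thesis
  proof
    assume sol: "GP_solution \<Omega> s g A \<gamma>"
    then have "GP_admissible g A \<gamma>" "Len \<Omega> s \<gamma> \<le> ell \<Lambda>" using adm[of 0] by (auto simp: GP_solution_def)
    then show "\<exists>\<alpha>\<in>{0..<P}. \<gamma> = contour.\<gamma> Q (radius \<Lambda> g \<alpha>) (centre \<Lambda> g \<alpha>)"
      using lower rigid by (meson order_antisym)
  next
    assume "\<exists>\<alpha>\<in>{0..<P}. \<gamma> = contour.\<gamma> Q (radius \<Lambda> g \<alpha>) (centre \<Lambda> g \<alpha>)"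
    then show "GP_solution \<Omega> s g A \<gamma>" using adm lower by (auto simp: GP_solution_def)
  qed
qed

end

text \<open>Built from the system of the theorem itself; the description is proper because
  \<open>GP_contour_eq\<close> shows that the system has exactly one solution.\<close>

definition GP_contour :: "complex set \<Rightarrow> sign \<Rightarrow> complex \<Rightarrow> real \<Rightarrow> real \<Rightarrow> complex set" where
  "GP_contour \<Omega> s g A \<alpha> =
     (case (THE k. case k of (\<Lambda>, R, cx, cy) \<Rightarrow> GP_constants \<Omega> s g A \<alpha> \<Lambda> R cx cy) of
       (\<Lambda>, R, cx, cy) \<Rightarrow> polar_contour \<Omega> s \<bar>R\<bar> (Complex cx cy))"

context gp
begin

lemma GP_contour_eq:
  assumes \<Lambda>: "0 < \<Lambda> + ylo" "areaF \<Lambda> = A" and g: "g \<in> G"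
  shows "\<exists>!k. case k of (l, R, cx, cy) \<Rightarrow> GP_constants \<Omega> s g A \<alpha> l R cx cy"
    and "GP_contour \<Omega> s g A \<alpha> = contour.\<gamma> Q (radius \<Lambda> g \<alpha>) (centre \<Lambda> g \<alpha>)"
    and "GP_constants \<Omega> s g A \<alpha> l R cx cy \<Longrightarrow> GP_contour \<Omega> s g A \<alpha> = polar_contour \<Omega> s \<bar>R\<bar> (Complex cx cy)"
proof -
  interpret c: contour Q w P C N \<Lambda> "radius \<Lambda> g \<alpha>" "centre \<Lambda> g \<alpha>" by (rule contour_locale[OF \<Lambda>(1) g])
  let ?k = "(sg * \<Lambda>, sg * radius \<Lambda> g \<alpha>, Re (centre \<Lambda> g \<alpha>), Im (centre \<Lambda> g \<alpha>))"
  have k: "(case k of (l, R, cx, cy) \<Rightarrow> GP_constants \<Omega> s g A \<alpha> l R cx cy) \<longleftrightarrow> k = ?k" for k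
    by (cases k) (simp add: GP_constants_iff[OF \<Lambda> g])
  show "\<exists>!k. case k of (l, R, cx, cy) \<Rightarrow> GP_constants \<Omega> s g A \<alpha> l R cx cy" unfolding k by blast
  have "\<bar>sg * radius \<Lambda> g \<alpha>\<bar> = radius \<Lambda> g \<alpha>" using c.r by (cases s) auto
  then show 2: "GP_contour \<Omega> s g A \<alpha> = c.\<gamma>"
    unfolding GP_contour_def k the_eq_trivial by (simp add: polar_contour_eq c.\<gamma>_def)
  show "GP_constants \<Omega> s g A \<alpha> l R cx cy \<Longrightarrow> GP_contour \<Omega> s g A \<alpha> = polar_contour \<Omega> s \<bar>R\<bar> (Complex cx cy)"
    using \<open>\<bar>sg * radius \<Lambda> g \<alpha>\<bar> = radius \<Lambda> g \<alpha>\<close> unfolding GP_constants_iff[OF \<Lambda> g] 2 by (simp add: polar_contour_eq c.\<gamma>_def)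
qed

lemma GP_param_iff:
  assumes \<Lambda>: "0 < \<Lambda> + ylo" "areaF \<Lambda> = A" and g: "g \<in> G" and k: "GP_constants \<Omega> s g A \<alpha> l R cx cy"
  shows "\<exists>\<theta>. angle_solution \<Omega> s \<alpha> l \<theta>"
    and "angle_solution \<Omega> s \<alpha> l \<theta> \<Longrightarrow>
      oriented_param s (GP_contour \<Omega> s g A \<alpha>) 0 T c \<and> natural_param \<Omega> 0 T c \<and> c 0 = g \<longleftrightarrow>
      T = L \<Omega> s l \<and> (\<forall>t\<in>{0..T}. c t = Complex (R * sinK (polar \<Omega>) (\<theta> t) + cx) (- R * cosK (polar \<Omega>) (\<theta> t) + cy))"
proof -
  interpret c: contour Q w P C N \<Lambda> "radius \<Lambda> g \<alpha>" "centre \<Lambda> g \<alpha>" by (rule contour_locale[OF \<Lambda>(1) g])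
  have kk: "l = sg * \<Lambda>" "R = sg * radius \<Lambda> g \<alpha>" "cx = Re (centre \<Lambda> g \<alpha>)" "cy = Im (centre \<Lambda> g \<alpha>)"
    using k unfolding GP_constants_iff[OF \<Lambda> g] by auto
  have LL: "L \<Omega> s l = ell \<Lambda>" by (simp add: L_ell kk sg_sq)
  obtain \<tau> \<sigma> where \<tau>: "\<And>x. (\<tau> has_real_derivative 1 / (\<Lambda> + Im (w x))) (at x)" "\<And>x. \<sigma> (\<tau> x) = x" "\<And>t. \<tau> (\<sigma> t) = t"
    and \<sigma>: "strict_mono \<sigma>" "\<And>t. (\<sigma> has_real_derivative \<Lambda> + Im (w (\<sigma> t))) (at t)" "(\<Lambda> + yhi)-lipschitz_on UNIV \<sigma>"
    "\<sigma> 0 = \<alpha>" "\<And>t. \<sigma> (t + ell \<Lambda>) = \<sigma> t + P"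
    by (rule time_change[OF \<Lambda>(1)]) (rule that)
  note ode = angle_solution_iff[OF \<Lambda>(1) \<tau> \<sigma>(2,4)]
  show "\<exists>\<theta>. angle_solution \<Omega> s \<alpha> l \<theta>" using ode(1) kk(1) by blast
  define \<beta> where "\<beta> = (\<lambda>t. centre \<Lambda> g \<alpha> + radius \<Lambda> g \<alpha> *\<^sub>R w (\<sigma> (sg * t)))"
  note nat = natural_curve[OF contour_locale[OF \<Lambda>(1) g, of \<alpha>] \<tau> \<sigma>, folded \<beta>_def]
  have \<gamma>: "GP_contour \<Omega> s g A \<alpha> = c.\<gamma>" by (rule GP_contour_eq(2)[OF \<Lambda> g])
  have \<beta>0: "\<beta> 0 = g" by (simp add: \<beta>_def \<sigma>(4) centre_def)
  assume sol: "angle_solution \<Omega> s \<alpha> l \<theta>"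
  have \<beta>: "Complex (R * sinK (polar \<Omega>) (\<theta> t) + cx) (- R * cosK (polar \<Omega>) (\<theta> t) + cy) = \<beta> t" if "t \<in> {0..ell \<Lambda>}" for t
    using ode(2)[OF sol[unfolded kk(1)] that] by (simp add: \<beta>_def complex_eq_iff kk w_sel)
  show "oriented_param s (GP_contour \<Omega> s g A \<alpha>) 0 T c \<and> natural_param \<Omega> 0 T c \<and> c 0 = g \<longleftrightarrow>
      T = L \<Omega> s l \<and> (\<forall>t\<in>{0..T}. c t = Complex (R * sinK (polar \<Omega>) (\<theta> t) + cx) (- R * cosK (polar \<Omega>) (\<theta> t) + cy))"
    unfolding \<gamma> LL
  proof
    assume a: "oriented_param s c.\<gamma> 0 T c \<and> natural_param \<Omega> 0 T c \<and> c 0 = g"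
    then have a': "oriented_param s c.\<gamma> 0 T c" "natural_param \<Omega> 0 T c" "c 0 = \<beta> 0" using \<beta>0 by auto
    have "T = ell \<Lambda> \<and> (\<forall>t\<in>{0..T}. c t = \<beta> t)"
      by (rule natural_param_unique[OF \<Omega> a'(1) nat(1) a'(2) nat(2) a'(3) c.\<gamma>_G])
    then show "T = ell \<Lambda> \<and> (\<forall>t\<in>{0..T}. c t = Complex (R * sinK (polar \<Omega>) (\<theta> t) + cx) (- R * cosK (polar \<Omega>) (\<theta> t) + cy))"
      using \<beta> by simp
  next
    assume a: "T = ell \<Lambda> \<and> (\<forall>t\<in>{0..T}. c t = Complex (R * sinK (polar \<Omega>) (\<theta> t) + cx) (- R * cosK (polar \<Omega>) (\<theta> t) + cy))"
    then have eq: "c t = \<beta> t" if "t \<in> {0..ell \<Lambda>}" for t using \<beta>[OF that] that by simp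
    have "natural_param \<Omega> 0 (ell \<Lambda>) c" by (rule natural_param_cong[OF nat(2) eq])
    then show "oriented_param s c.\<gamma> 0 T c \<and> natural_param \<Omega> 0 T c \<and> c 0 = g"
      using a oriented_param_cong[OF nat(1) eq] eq[of 0] \<beta>0 ell_pos[OF \<Lambda>(1)] by simp
  qed
qed

text \<open>For a given contour \<Lambda> is read off as the height of its centre over its radius,
  and lying in the half-plane means exactly \<Lambda> + ylo > 0. Its area is then
  \<open>areaF \<Lambda>\<close>, so it is a member of the family for that area.\<close>

lemma polar_contour_isoperimetric:
  assumes r: "0 < r" and sub: "polar_contour \<Omega> s r v \<subseteq> G" and g: "g \<in> polar_contour \<Omega> s r v"
  shows "\<exists>\<alpha>\<in>{0..<P}. polar_contour \<Omega> s r v = GP_contour \<Omega> s g (Area (inside (polar_contour \<Omega> s r v))) \<alpha>"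
proof -
  define \<Lambda> where "\<Lambda> = Im v / r"
  have v: "Im v = r * \<Lambda>" using r by (simp add: \<Lambda>_def)
  obtain \<theta>0 where \<theta>0: "Im (w \<theta>0) = ylo" by (rule ylo_w)
  have "v + r *\<^sub>R w \<theta>0 \<in> G" using sub w_frontier unfolding polar_contour_eq by blast
  then have "0 < r * (\<Lambda> + ylo)" using \<theta>0 v by (simp add: G_def distrib_left)
  then have \<Lambda>: "0 < \<Lambda> + ylo" using r by (rule zero_less_mult_pos)
  interpret c: contour Q w P C N \<Lambda> r v by unfold_locales (use \<Lambda> r v in auto)
  have p: "polar_contour \<Omega> s r v = c.\<gamma>" by (simp add: polar_contour_eq c.\<gamma>_def)
  have gG: "g \<in> G" using g sub by blast
  obtain z where z: "z \<in> frontier Q" "g = v + r *\<^sub>R z" using g unfolding polar_contour_eq by blast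
  obtain \<alpha> where \<alpha>: "\<alpha> \<in> {0..<P}" "w \<alpha> = z" by (rule w_surj[OF z(1)]) (rule that)
  have "radius \<Lambda> g \<alpha> = r"
    using c.Im_c(1)[of \<alpha>] pos_w[OF \<Lambda>, of \<alpha>] z(2) \<alpha>(2) by (simp add: radius_def)
  moreover from this have "centre \<Lambda> g \<alpha> = v" unfolding centre_def z(2) \<alpha>(2) by simp
  ultimately have "GP_contour \<Omega> s g (areaF \<Lambda>) \<alpha> = c.\<gamma>" using GP_contour_eq(2)[OF \<Lambda> refl gG, of \<alpha>] by simp
  then show ?thesis unfolding p c.\<gamma>_area using \<alpha>(1) by metis
qed

end

lemma GP_family:
  fixes \<Omega> :: "complex set"
  assumes \<Omega>: "body \<Omega>" and g: "g \<in> G" and A: "0 < A"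
  shows "\<alpha> \<in> {0..<2 * S (polar \<Omega>)} \<Longrightarrow> GP_solution \<Omega> s g A (GP_contour \<Omega> s g A \<alpha>)"
    and "GP_solution \<Omega> s g A \<gamma> \<Longrightarrow> \<exists>\<alpha>\<in>{0..<2 * S (polar \<Omega>)}. \<gamma> = GP_contour \<Omega> s g A \<alpha>"
    and "\<exists>!k. case k of (\<Lambda>, R, cx, cy) \<Rightarrow> GP_constants \<Omega> s g A \<alpha> \<Lambda> R cx cy"
    and "GP_constants \<Omega> s g A \<alpha> \<Lambda> R cx cy \<Longrightarrow> GP_contour \<Omega> s g A \<alpha> = polar_contour \<Omega> s \<bar>R\<bar> (Complex cx cy)"
    and "GP_constants \<Omega> s g A \<alpha> \<Lambda> R cx cy \<Longrightarrow> \<exists>\<theta>. angle_solution \<Omega> s \<alpha> \<Lambda> \<theta>"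
    and "GP_constants \<Omega> s g A \<alpha> \<Lambda> R cx cy \<Longrightarrow> angle_solution \<Omega> s \<alpha> \<Lambda> \<theta> \<Longrightarrow>
      oriented_param s (GP_contour \<Omega> s g A \<alpha>) 0 T c \<and> natural_param \<Omega> 0 T c \<and> c 0 = g \<longleftrightarrow>
      T = L \<Omega> s \<Lambda> \<and> (\<forall>t\<in>{0..T}. c t = Complex (R * sinK (polar \<Omega>) (\<theta> t) + cx) (- R * cosK (polar \<Omega>) (\<theta> t) + cy))"
proof -
  obtain Q w C N where "gp Q w (2 * S (polar \<Omega>)) C N \<Omega> s" by (rule gp_exists[OF \<Omega>]) (rule that)
  then interpret gp Q w "2 * S (polar \<Omega>)" C N \<Omega> s .
  obtain l where l: "0 < l + ylo" "areaF l = A" by (rule areaF_surj[OF A]) (rule that)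
  note eq = GP_contour_eq[OF l g] and sol = GP_solution_iff[OF l g, folded GP_contour_eq(2)[OF l g]]
  show "\<alpha> \<in> {0..<2 * S (polar \<Omega>)} \<Longrightarrow> GP_solution \<Omega> s g A (GP_contour \<Omega> s g A \<alpha>)"
    "GP_solution \<Omega> s g A \<gamma> \<Longrightarrow> \<exists>\<alpha>\<in>{0..<2 * S (polar \<Omega>)}. \<gamma> = GP_contour \<Omega> s g A \<alpha>"
    using sol by blast+
  show "\<exists>!k. case k of (\<Lambda>, R, cx, cy) \<Rightarrow> GP_constants \<Omega> s g A \<alpha> \<Lambda> R cx cy" by (rule eq(1))
  assume k: "GP_constants \<Omega> s g A \<alpha> \<Lambda> R cx cy"
  show "GP_contour \<Omega> s g A \<alpha> = polar_contour \<Omega> s \<bar>R\<bar> (Complex cx cy)" by (rule eq(3)[OF k])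
  show "\<exists>\<theta>. angle_solution \<Omega> s \<alpha> \<Lambda> \<theta>" by (rule GP_param_iff(1)[OF l g k])
  assume "angle_solution \<Omega> s \<alpha> \<Lambda> \<theta>"
  then show "oriented_param s (GP_contour \<Omega> s g A \<alpha>) 0 T c \<and> natural_param \<Omega> 0 T c \<and> c 0 = g \<longleftrightarrow>
      T = L \<Omega> s \<Lambda> \<and> (\<forall>t\<in>{0..T}. c t = Complex (R * sinK (polar \<Omega>) (\<theta> t) + cx) (- R * cosK (polar \<Omega>) (\<theta> t) + cy))"
    by (rule GP_param_iff(2)[OF l g k])
qed

theorem mainTheorem1:
  fixes \<Omega> :: "complex set"
  assumes "convex \<Omega>" and "compact \<Omega>" and "0 \<in> interior \<Omega>"
  shows "\<exists>\<Gamma> :: sign \<Rightarrow> complex \<Rightarrow> real \<Rightarrow> real \<Rightarrow> complex set.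
    (\<forall>s. \<forall>g\<in>G. \<forall>A>0.
       (\<forall>\<alpha>\<in>{0..<2 * S (polar \<Omega>)}. GP_solution \<Omega> s g A (\<Gamma> s g A \<alpha>)) \<and>
       (\<forall>\<gamma>. GP_solution \<Omega> s g A \<gamma> \<longrightarrow> (\<exists>\<alpha>\<in>{0..<2 * S (polar \<Omega>)}. \<gamma> = \<Gamma> s g A \<alpha>)) \<and>
       (\<forall>\<alpha>\<in>{0..<2 * S (polar \<Omega>)}.
          (\<exists>!k. case k of (\<Lambda>, R, cx, cy) \<Rightarrow> GP_constants \<Omega> s g A \<alpha> \<Lambda> R cx cy) \<and>
          (\<forall>\<Lambda> R cx cy. GP_constants \<Omega> s g A \<alpha> \<Lambda> R cx cy \<longrightarrow>
             \<Gamma> s g A \<alpha> = polar_contour \<Omega> s \<bar>R\<bar> (Complex cx cy) \<and>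
             (\<exists>\<theta>. angle_solution \<Omega> s \<alpha> \<Lambda> \<theta>) \<and>
             (\<forall>\<theta>. angle_solution \<Omega> s \<alpha> \<Lambda> \<theta> \<longrightarrow>
                (\<forall>T c. oriented_param s (\<Gamma> s g A \<alpha>) 0 T c \<and> natural_param \<Omega> 0 T c \<and> c 0 = g \<longleftrightarrow>
                   T = L \<Omega> s \<Lambda> \<and>
                   (\<forall>t\<in>{0..T}. c t = Complex (R * sinK (polar \<Omega>) (\<theta> t) + cx)
                                            (- R * cosK (polar \<Omega>) (\<theta> t) + cy))))))) \<and>
    (\<forall>s. \<forall>r>0. \<forall>c. polar_contour \<Omega> s r c \<subseteq> G \<longrightarrow>
       (\<forall>g\<in>polar_contour \<Omega> s r c. \<exists>\<alpha>\<in>{0..<2 * S (polar \<Omega>)}.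
          polar_contour \<Omega> s r c = \<Gamma> s g (Area (inside (polar_contour \<Omega> s r c))) \<alpha>))"
proof -
  have \<Omega>: "body \<Omega>" using assms by (rule body.intro)
  have last: "\<exists>\<alpha>\<in>{0..<2 * S (polar \<Omega>)}. polar_contour \<Omega> s r c = GP_contour \<Omega> s g (Area (inside (polar_contour \<Omega> s r c))) \<alpha>"
    if h: "0 < r" "polar_contour \<Omega> s r c \<subseteq> G" "g \<in> polar_contour \<Omega> s r c" for s r c g
  proof -
    obtain Q w C N where "gp Q w (2 * S (polar \<Omega>)) C N \<Omega> s" by (rule gp_exists[OF \<Omega>]) (rule that)
    then interpret gp Q w "2 * S (polar \<Omega>)" C N \<Omega> s .
    show ?thesis by (rule polar_contour_isoperimetric[OF h])
  qed
  show ?thesis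
    by (intro exI[of _ "GP_contour \<Omega>"] conjI allI ballI impI;
        (rule GP_family[OF \<Omega>] last; assumption))
qed



end
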